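(* Let $p,J,L$ be positive integers, $\mu\in\mathbb R$ (positive or negative), and let $V^j=V(\alpha^j,\beta^j,\infty,\mu)$, $S_l=S(\alpha_l,\beta_l,\eta_0)$, $V_l^j(\eta)=V(\alpha_l^j,\beta_l^j,r_0,\mu|\eta|)$, $j=1,\dots,J$, $l=1,\dots,L$, be a good consistent covering with number $\delta$ (defined in the context). Let $\tilde r_0>r_0$, $\tilde\mu>\mu$ and put $\tilde V_l^j(\eta)=V(\alpha_l^j-2\delta,\beta_l^j+2\delta,\tilde r_0,\tilde\mu|\eta|)$. Suppose there are bounded holomorphic functions $y_l^j(x,\eta)$ defined for $\eta\in S_l$ and $x\in\tilde V_l^j(\eta)$, and constants $A,B,C>0$, such that for all $j,l$ (upper indices mod $J$, lower indices mod $L$) $$|y_{l+1}^j(x,\eta)-y_l^j(x,\eta)|\le C\exp\left(-\frac{A}{|\eta|^p}\right)\quad\text{if }\eta\in S_l\cap S_{l+1},\ x\in\tilde V_l^j(\eta)\cap\tilde V_{l+1}^j(\eta),$$ $$|y_l^{j+1}(x,\eta)-y_l^j(x,\eta)|\le C\exp\left(-B\left|\frac{x}{\eta}\right|^p\right)\quad\text{if }\eta\in S_l,\ x\in\tilde V_l^j(\eta)\cap\tilde V_l^{j+1}(\eta).$$ Then the restrictions of the functions $y_l^j$ to the set of $(x,\eta)$ with $\eta\in S_l$, $x\in V_l^j(\eta)$ admit a combined asymptotic expansion (DAC) of Gevrey order $\frac1p$. More precisely, put $\tilde A=\min(A,Br_0^p)$. There exist a sequence $(a_n)_{n\in\mathbb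 N}$ in $\mathcal H(r_0)$, for each $j$ a sequence $(g_n^j)_{n\in\mathbb N}$ in $\mathcal G(V^j)$, and a constant $\tilde C$ such that for all $j,l$, all $\eta\in S_l$, all $x\in V_l^j(\eta)$ and every integer $N>0$ $$\left|y_l^j(x,\eta)-\sum_{n=0}^{N-1}\left(a_n(x)+g_n^j\left(\frac x\eta\right)\right)\eta^n\right|\le\tilde C\,\tilde A^{-N/p}\,\Gamma\left(\frac Np+1\right)|\eta|^N.$$ Moreover the sequences $(g_n^j)_n$ have compatible Gevrey asymptotic expansions of order $\frac1p$ at infinity of type $(\tilde A^{-1/p},B^{-1/p})$ with coefficients independent of $j$: there exist a double sequence $(g_{nm})$ of complex numbers and a constant $\tilde C$ such that for all $M,n\in\mathbb N$, all $j\in\{1,\dots,J\}$ and all $X\in V^j$ $$|X|^M\left|g_n^j(X)-\sum_{m=1}^{M-1}g_{nm}X^{-m}\right|\le\tilde C\,\tilde A^{-n/p}\,B^{-M/p}\,\Gamma\left(\frac{M+n}p+1\right).$$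
   Context: For $\alpha<\beta\le\alpha+2\pi$, $0<r\le\infty$: $S(\alpha,\beta,r)=\{x\in\mathbb C:0<|x|<r,\ \alpha<\arg x<\beta\}$. Quasi-sectors: for $\mu>0$, $V(\alpha,\beta,r,\mu)=\{x: (|x|<r\text{ and }\alpha<\arg x<\beta)\text{ or }|x|<\mu\}$; for $\mu<0$, $V(\alpha,\beta,r,\mu)=\{x:-\mu<|x|<r,\ \alpha<\arg x<\beta\}$. By convention $V(0,2\pi,\infty,-r)$ denotes the whole annulus $|x|>r$. $\mathcal H(r_0)$: bounded holomorphic functions on the disc $D(0,r_0)$. $\mathcal G(V)$ (for an infinite quasi-sector $V$): bounded holomorphic functions $g$ on $V$ having a Poincaré asymptotic expansion without constant term $g(X)\sim\sum_{m\ge1}g_mX^{-m}$ as $V\ni X\to\infty$. Gevrey DAC. Let $V=V(\alpha,\beta,\infty,\mu)$, $S_*=S(\alpha_2,\beta_2,\eta_0)$, and $\alpha_1<\beta_1$ with $\alpha\le\alpha_1-\beta_2<\beta_1-\alpha_2\le\beta$. A holomorphic function $y(x,\eta)$ defined for $\eta\in S_*$, $x\in V(\alpha_1,\beta_1,r_0,\mu|\eta|)$ admits the DAC $\sum_n(a_n(x)+g_n(x/\eta))\eta^n$ of Gevrey order $\frac1p$ (with $a_n\in\mathcal H(r_0)$, $g_n\in\mathcal G(V)$, $g_n(X)\sim\sum_{m\geq 1} g_{nm}X^{-m}$) if there are constants $C,L_1,L_2>0$ such that for all $n,M,N\in\mathbb N$: $\sup_{|x|<r_0}|a_n(x)|\le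 CL_1^n\Gamma(\frac np+1)$; $|X|^M|g_n(X)-\sum_{m=1}^{M-1}g_{nm}X^{-m}|\le CL_1^nL_2^M\Gamma(\frac{M+n}p+1)$ for $X\in V$; and $|y(x,\eta)-\sum_{n=0}^{N-1}(a_n(x)+g_n(x/\eta))\eta^n|\le CL_1^N\Gamma(\frac Np+1)|\eta|^N$ for all $\eta\in S_*$, $x\in V(\alpha_1,\beta_1,r_0,\mu|\eta|)$. Good consistent covering. Let $C(\sigma,\rho)=\{x\in\mathbb C:\sigma<|x|<\rho\}$ (a disc or $\mathbb C$ if $\sigma<0$). Upper indices are taken mod $J$, lower indices mod $L$. The collection $V^j,S_l,V_l^j(\eta)$ is a good consistent covering with number $\delta>0$ if: (i) $\bigcup_jV^j=C(-\mu,\infty)$ and $V^j\cap V^m$ is bounded whenever $j\notin\{m-1,m,m+1\}$ (i.e. $\alpha^j<\beta^{j-1}<\alpha^{j+1}$); (ii) $\bigcup_lS_l=D(0,\eta_0)\setminus\{0\}$ and $S_l\cap S_m=\emptyset$ whenever $l\notin\{m-1,m,m+1\}$; (iii) $\max_l(\beta_l-\alpha_l)\le\delta<\frac12\min\{\beta^1-\alpha^2,\dots,\beta^{J-1}-\alpha^J,\beta^J-\alpha^1-2\pi\}$; (iv) $V_l^j(\eta)=V(\alpha_l^j,\beta_l^j,r_0,\mu|\eta|)$ with $\alpha_l^j=\alpha^j+\varphi_l+\delta$, $\beta_l^j=\beta^j+\varphi_l-\delta$, $\varphi_l=(\alpha_l+\beta_l)/2$. *)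

theory Defs
  imports "HOL-Analysis.Analysis" "HOL-Library.Landau_Symbols"
begin

section \<open>Sectors and quasi-sectors\<close>

text \<open>The condition \<open>\<alpha> < arg x < \<beta>\<close> means that some determination of the argument of the
  (nonzero) number \<open>x\<close> lies in the open interval. Hence the sets below depend on
  \<open>(\<alpha>, \<beta>)\<close> only up to simultaneous translation by a multiple of \<open>2 * pi\<close>, apart from the
  special convention in the definition of quasi-sectors.\<close>

definition arg_between :: "real \<Rightarrow> real \<Rightarrow> complex \<Rightarrow> bool" where
  "arg_between \<alpha> \<beta> x \<longleftrightarrow>
     x \<noteq> 0 \<and> (\<exists>t. \<alpha> < t \<and> t < \<beta> \<and> x = complex_of_real (cmod x) * cis t)"

definition sector :: "real \<Rightarrow> real \<Rightarrow> ereal \<Rightarrow> complex set" where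
  "sector \<alpha> \<beta> r = {x. 0 < cmod x \<and> ereal (cmod x) < r \<and> arg_between \<alpha> \<beta> x}"

definition annulus :: "real \<Rightarrow> ereal \<Rightarrow> complex set" where
  "annulus \<sigma> \<rho> = {x. \<sigma> < cmod x \<and> ereal (cmod x) < \<rho>}"

text \<open>The first case is the convention that \<open>V(0, 2\<pi>, \<infinity>, -r)\<close> is the full annulus. For
  \<open>\<mu> = 0\<close>, which can occur for the enlarged quasi-sectors, the formulas for positive and for
  negative \<open>\<mu>\<close> both give the sector.\<close>

definition quasi_sector :: "real \<Rightarrow> real \<Rightarrow> ereal \<Rightarrow> real \<Rightarrow> complex set" where
  "quasi_sector \<alpha> \<beta> r \<mu> =
     (if \<alpha> = 0 \<and> \<beta> = 2 * pi \<and> r = \<infinity> \<and> \<mu> < 0 then annulus (- \<mu>) \<infinity>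
      else if \<mu> > 0 then {x. (ereal (cmod x) < r \<and> arg_between \<alpha> \<beta> x) \<or> cmod x < \<mu>}
      else {x. - \<mu> < cmod x \<and> ereal (cmod x) < r \<and> arg_between \<alpha> \<beta> x})"


section \<open>Function spaces\<close>

definition H_space :: "real \<Rightarrow> (complex \<Rightarrow> complex) set" where
  "H_space r = {a. a holomorphic_on ball 0 r \<and> bounded (a ` ball 0 r)}"

definition poincare_expansion ::
  "complex set \<Rightarrow> (complex \<Rightarrow> complex) \<Rightarrow> (nat \<Rightarrow> complex) \<Rightarrow> bool" where
  "poincare_expansion V g c \<longleftrightarrow>
     (\<forall>M. (\<lambda>X. g X - (\<Sum>m = 1..<M. c m / X ^ m))
            \<in> O[inf at_infinity (principal V)](\<lambda>X. 1 / X ^ M))"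

definition G_space :: "complex set \<Rightarrow> (complex \<Rightarrow> complex) set" where
  "G_space V = {g. g holomorphic_on V \<and> bounded (g ` V) \<and> (\<exists>c. poincare_expansion V g c)}"

text \<open>Holomorphy in two variables: complex Frechet differentiability at every point, i.e. the
  derivative exists and is complex linear.\<close>

definition holomorphic2_on :: "(complex \<times> complex \<Rightarrow> complex) \<Rightarrow> (complex \<times> complex) set \<Rightarrow> bool" where
  "holomorphic2_on f U \<longleftrightarrow>
     (\<forall>z\<in>U. \<exists>u v. (f has_derivative (\<lambda>(h, k). u * h + v * k)) (at z within U))"

text \<open>The set of pairs \<open>(x, \<eta>)\<close> with \<open>\<eta> \<in> S(\<alpha>2, \<beta>2, \<eta>0)\<close> and
  \<open>x \<in> V(\<alpha>1, \<beta>1, r0, \<mu> * \<bar>\<eta>\<bar>)\<close>.\<close>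

definition pair_domain ::
  "real \<Rightarrow> real \<Rightarrow> real \<Rightarrow> real \<Rightarrow> real \<Rightarrow> real \<Rightarrow> real \<Rightarrow> (complex \<times> complex) set" where
  "pair_domain \<alpha>1 \<beta>1 r0 \<mu> \<alpha>2 \<beta>2 \<eta>0 =
     {(x, \<eta>). \<eta> \<in> sector \<alpha>2 \<beta>2 (ereal \<eta>0) \<and>
              x \<in> quasi_sector \<alpha>1 \<beta>1 (ereal r0) (\<mu> * cmod \<eta>)}"


section \<open>Combined asymptotic expansions of Gevrey order \<open>1/p\<close>\<close>

text \<open>Here \<open>c n m\<close> is the coefficient of \<open>X^(-m)\<close> in the expansion of \<open>g n\<close>. At \<open>X = 0\<close>, which
  belongs to \<open>V\<close> if \<open>\<mu> > 0\<close>, the product of \<open>\<bar>X\<bar>^M\<close> with the remainder agrees with its continuous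
  extension, in spite of the division by zero.\<close>

definition gevrey_DAC ::
  "nat \<Rightarrow> real \<Rightarrow> real \<Rightarrow> real \<Rightarrow> real \<Rightarrow> real \<Rightarrow> real \<Rightarrow> real \<Rightarrow> real \<Rightarrow> real \<Rightarrow>
   (complex \<Rightarrow> complex \<Rightarrow> complex) \<Rightarrow> (nat \<Rightarrow> complex \<Rightarrow> complex) \<Rightarrow>
   (nat \<Rightarrow> complex \<Rightarrow> complex) \<Rightarrow> (nat \<Rightarrow> nat \<Rightarrow> complex) \<Rightarrow> bool" where
  "gevrey_DAC p \<alpha> \<beta> \<mu> \<alpha>1 \<beta>1 r0 \<alpha>2 \<beta>2 \<eta>0 y a g c \<longleftrightarrow>
     \<alpha>1 < \<beta>1 \<and> \<alpha> \<le> \<alpha>1 - \<beta>2 \<and> \<alpha>1 - \<beta>2 < \<beta>1 - \<alpha>2 \<and> \<beta>1 - \<alpha>2 \<le> \<beta> \<and>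
     holomorphic2_on (\<lambda>(x, \<eta>). y x \<eta>) (pair_domain \<alpha>1 \<beta>1 r0 \<mu> \<alpha>2 \<beta>2 \<eta>0) \<and>
     (\<forall>n. a n \<in> H_space r0) \<and>
     (\<forall>n. g n \<in> G_space (quasi_sector \<alpha> \<beta> \<infinity> \<mu>) \<and>
          poincare_expansion (quasi_sector \<alpha> \<beta> \<infinity> \<mu>) (g n) (c n)) \<and>
     (\<exists>C>0. \<exists>L1>0. \<exists>L2>0.
        (\<forall>n. \<forall>x\<in>ball 0 r0. cmod (a n x) \<le> C * L1 ^ n * Gamma (real n / real p + 1)) \<and>
        (\<forall>n M. \<forall>X\<in>quasi_sector \<alpha> \<beta> \<infinity> \<mu>.
           cmod X ^ M * cmod (g n X - (\<Sum>m = 1..<M. c n m / X ^ m))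
             \<le> C * L1 ^ n * L2 ^ M * Gamma (real (M + n) / real p + 1)) \<and>
        (\<forall>N. \<forall>(x, \<eta>)\<in>pair_domain \<alpha>1 \<beta>1 r0 \<mu> \<alpha>2 \<beta>2 \<eta>0.
           cmod (y x \<eta> - (\<Sum>n<N. (a n x + g n (x / \<eta>)) * \<eta> ^ n))
             \<le> C * L1 ^ N * Gamma (real N / real p + 1) * cmod \<eta> ^ N))"


section \<open>Good consistent coverings\<close>

text \<open>Indices run cyclically through \<open>{1..n}\<close>.\<close>

definition cyc_suc :: "nat \<Rightarrow> nat \<Rightarrow> nat" where
  "cyc_suc n i = Suc (i mod n)"

definition cyc_adjacent :: "nat \<Rightarrow> nat \<Rightarrow> nat \<Rightarrow> bool" where
  "cyc_adjacent n i k \<longleftrightarrow> i = k \<or> i = cyc_suc n k \<or> k = cyc_suc n i"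

text \<open>Angles \<open>\<alpha> 1, \<dots>, \<alpha> J\<close> are continued to all indices \<open>j \<ge> 1\<close> by \<open>\<alpha> (j + J) = \<alpha> j + 2 * pi\<close>,
  as in the term \<open>\<beta> J - \<alpha> 1 - 2 * pi\<close> of the condition on \<open>\<delta>\<close>.\<close>

definition angle_ext :: "nat \<Rightarrow> (nat \<Rightarrow> real) \<Rightarrow> nat \<Rightarrow> real" where
  "angle_ext J \<alpha> j = \<alpha> (Suc ((j - 1) mod J)) + 2 * pi * real ((j - 1) div J)"

text \<open>\<open>\<alpha>V j, \<beta>V j\<close> are the angles of \<open>V\<^sup>j\<close> and \<open>\<alpha>S l, \<beta>S l\<close> those of \<open>S\<^sub>l\<close>. The third conjunct
  of (i) is \<open>\<alpha>\<^sup>j < \<beta>\<^sup>j\<^sup>-\<^sup>1 < \<alpha>\<^sup>j\<^sup>+\<^sup>1\<close> with the index shifted by one; it also fixes the determinations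
  of the angles for which the numbers in (iii) make sense.\<close>

definition good_consistent_covering ::
  "nat \<Rightarrow> nat \<Rightarrow> real \<Rightarrow> real \<Rightarrow> (nat \<Rightarrow> real) \<Rightarrow> (nat \<Rightarrow> real) \<Rightarrow> (nat \<Rightarrow> real) \<Rightarrow> (nat \<Rightarrow> real) \<Rightarrow>
   real \<Rightarrow> bool" where
  "good_consistent_covering J L \<mu> \<eta>0 \<alpha>V \<beta>V \<alpha>S \<beta>S \<delta> \<longleftrightarrow>
     \<delta> > 0 \<and>
     (\<forall>j\<in>{1..J}. \<alpha>V j < \<beta>V j \<and> \<beta>V j \<le> \<alpha>V j + 2 * pi) \<and>
     (\<forall>l\<in>{1..L}. \<alpha>S l < \<beta>S l \<and> \<beta>S l \<le> \<alpha>S l + 2 * pi) \<and>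
     \<comment> \<open>(i)\<close>
     (\<Union>j\<in>{1..J}. quasi_sector (\<alpha>V j) (\<beta>V j) \<infinity> \<mu>) = annulus (- \<mu>) \<infinity> \<and>
     (\<forall>j\<in>{1..J}. \<forall>m\<in>{1..J}. \<not> cyc_adjacent J j m \<longrightarrow>
        bounded (quasi_sector (\<alpha>V j) (\<beta>V j) \<infinity> \<mu> \<inter> quasi_sector (\<alpha>V m) (\<beta>V m) \<infinity> \<mu>)) \<and>
     (\<forall>j\<in>{1..J}. angle_ext J \<alpha>V (j + 1) < \<beta>V j \<and> \<beta>V j < angle_ext J \<alpha>V (j + 2)) \<and>
     \<comment> \<open>(ii)\<close>
     (\<Union>l\<in>{1..L}. sector (\<alpha>S l) (\<beta>S l) (ereal \<eta>0)) = ball 0 \<eta>0 - {0} \<and>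
     (\<forall>l\<in>{1..L}. \<forall>m\<in>{1..L}. \<not> cyc_adjacent L l m \<longrightarrow>
        sector (\<alpha>S l) (\<beta>S l) (ereal \<eta>0) \<inter> sector (\<alpha>S m) (\<beta>S m) (ereal \<eta>0) = {}) \<and>
     \<comment> \<open>(iii)\<close>
     (\<forall>l\<in>{1..L}. \<beta>S l - \<alpha>S l \<le> \<delta>) \<and>
     (\<forall>j\<in>{1..<J}. \<delta> < (\<beta>V j - \<alpha>V (j + 1)) / 2) \<and>
     \<delta> < (\<beta>V J - \<alpha>V 1 - 2 * pi) / 2"

text \<open>The angles \<open>\<alpha>\<^sub>l\<^sup>j\<close> and \<open>\<beta>\<^sub>l\<^sup>j\<close> of (iv).\<close>

definition lower_angle ::
  "(nat \<Rightarrow> real) \<Rightarrow> (nat \<Rightarrow> real) \<Rightarrow> (nat \<Rightarrow> real) \<Rightarrow> real \<Rightarrow> nat \<Rightarrow> nat \<Rightarrow> real" where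
  "lower_angle \<alpha>V \<alpha>S \<beta>S \<delta> j l = \<alpha>V j + (\<alpha>S l + \<beta>S l) / 2 + \<delta>"

definition upper_angle ::
  "(nat \<Rightarrow> real) \<Rightarrow> (nat \<Rightarrow> real) \<Rightarrow> (nat \<Rightarrow> real) \<Rightarrow> real \<Rightarrow> nat \<Rightarrow> nat \<Rightarrow> real" where
  "upper_angle \<beta>V \<alpha>S \<beta>S \<delta> j l = \<beta>V j + (\<alpha>S l + \<beta>S l) / 2 - \<delta>"

end

theory Submission
  imports Defs "HOL-Complex_Analysis.Complex_Analysis"
begin

text \<open>The variable \<open>x\<close> is replaced by \<open>U = x / \<eta>\<close>. For fixed \<open>\<eta>\<close> the functions \<open>U \<mapsto> y\<^sub>l\<^sup>j(U \<eta>, \<eta>)\<close>,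
one for each \<open>j\<close>, are holomorphic on overlapping annular sectors \<open>\<rho> \<le> \<bar>U\<bar> \<le> r1 / \<bar>\<eta>\<bar>\<close> with \<open>r0 < r1\<close>,
and Cauchy's formula on these sectors, summed over one turn, expresses \<open>y\<^sub>l\<^sup>j\<close> by three integrals with
the kernel \<open>1 / (U - X)\<close>: over the arcs of the outer circle \<open>\<bar>x\<bar> = r1\<close>, over the arcs of the inner circle
\<open>\<bar>U\<bar> = \<rho>\<close>, and over the segments that separate neighbouring sectors, where only the differences
\<open>y\<^sub>l\<^sup>j\<^sup>+\<^sup>1 - y\<^sub>l\<^sup>j\<close> enter (\<open>cauchy_formula\<close>).

Each of the three densities is, for a fixed point of its contour, a function of \<open>\<eta>\<close> alone, given on the
sectors of a covering of a punctured disc with exponentially small differences on the overlaps. By the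
Cauchy-Heine representation such a family has one Gevrey expansion in powers of \<open>\<eta>\<close>
(\<open>gevrey_family_expansion\<close>, the theorem of Ramis and Sibuya with explicit bounds). Expanding under the
integral signs gives the combined expansion (\<open>main_remainder\<close>): the outer circle is fixed in the
variable \<open>x\<close> and produces \<open>a\<^sub>n(x)\<close>, while the inner circle and the segments are fixed in the variable
\<open>U\<close> and produce \<open>g\<^sub>n(X)\<close>. On the outer circle \<open>\<bar>x / \<eta>\<bar> = r1 / \<bar>\<eta>\<bar>\<close>, so there the differences in
\<open>j\<close> are as small as those in \<open>l\<close>. This is why the \<open>a\<^sub>n\<close> do not depend on \<open>j\<close>, and it is the origin
of the type \<open>min A (B * r0 ^ p)\<close>.

Sharp types need sharp bounds for the densities on the segments. A family that is bounded by \<open>exp (- b)\<close>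
with jumps bounded by \<open>min (exp (- A / \<bar>\<eta>\<bar>^p)) (exp (- b))\<close> has coefficients bounded by
\<open>A^(- n/p) \<Gamma>(n/p + 1, b)\<close>, an incomplete Gamma function. With \<open>b = B \<bar>U\<bar>^p\<close> the moments of this bound
along a ray can be integrated in closed form (\<open>uGamma_powr_int\<close>), which yields the factors
\<open>A^(- n/p) B^(- M/p) \<Gamma>((M + n)/p + 1)\<close> in the expansion of \<open>g\<^sub>n\<close> at infinity (\<open>fast_expansion\<close>) and
permits the extension of the segments to infinite rays. Expansions of \<open>g\<^sub>n\<^sup>j\<close> and \<open>g\<^sub>n\<^sup>j\<^sup>+\<^sup>1\<close> coincide
because their difference is the exponentially small coefficient of the jump (\<open>fast_diff\<close>).\<close>

section \<open>The incomplete Gamma function\<close>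

text \<open>The upper incomplete Gamma function, usually written \<open>\<Gamma>(k + 1, b)\<close>. The shift by one suits the
weights \<open>\<Gamma>(n/p + 1)\<close> of Gevrey asymptotics.\<close>

definition uGamma :: "real \<Rightarrow> real \<Rightarrow> real" where
  "uGamma k b = integral {b..} (\<lambda>z. z powr k * exp (- z))"

lemma uGamma_has_integral_0:
  fixes k :: real
  assumes "k \<ge> 0"
  shows "((\<lambda>z. z powr k * exp (- z)) has_integral Gamma (k + 1)) {0..}"
  using Gamma_integral_real[of "k + 1"] assms by (simp add: exp_minus divide_inverse)

lemma uGamma_integrable:
  fixes k b :: real
  assumes "k \<ge> 0" "b \<ge> 0"
  shows "(\<lambda>z. z powr k * exp (- z)) integrable_on {b..}"
proof -
  have "(\<lambda>z. z powr k * exp (- z)) absolutely_integrable_on {0..}"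
    using uGamma_has_integral_0[OF assms(1)]
    by (intro nonnegative_absolutely_integrable_1) (auto simp: integrable_on_def)
  then have "(\<lambda>z. z powr k * exp (- z)) absolutely_integrable_on {b..}"
    by (rule set_integrable_subset) (use assms in auto)
  then show ?thesis by (rule set_lebesgue_integral_eq_integral(1))
qed

lemma uGamma_0: "k \<ge> 0 \<Longrightarrow> uGamma k 0 = Gamma (k + 1)"
  unfolding uGamma_def using uGamma_has_integral_0 by (rule integral_unique)

lemma uGamma_nonneg: "k \<ge> 0 \<Longrightarrow> b \<ge> 0 \<Longrightarrow> 0 \<le> uGamma k b"
  unfolding uGamma_def by (rule integral_nonneg[OF uGamma_integrable]) auto

lemma uGamma_le_Gamma: "k \<ge> 0 \<Longrightarrow> b \<ge> 0 \<Longrightarrow> uGamma k b \<le> Gamma (k + 1)"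
  unfolding uGamma_0[symmetric] unfolding uGamma_def
  by (rule integral_subset_le) (auto intro: uGamma_integrable)

lemma uGamma_shift:
  assumes "k \<ge> 0" "m \<ge> 0" "b \<ge> 0"
  shows "b powr m * uGamma k b \<le> uGamma (k + m) b"
proof -
  have "b powr m * uGamma k b = integral {b..} (\<lambda>z. b powr m * (z powr k * exp (- z)))"
    unfolding uGamma_def by simp
  also have "\<dots> \<le> uGamma (k + m) b"
    unfolding uGamma_def
  proof (rule integral_le)
    show "(\<lambda>z. b powr m * (z powr k * exp (- z))) integrable_on {b..}"
      using uGamma_integrable assms by (intro integrable_on_mult_right) auto
    show "(\<lambda>z. z powr (k + m) * exp (- z)) integrable_on {b..}"
      using uGamma_integrable assms by auto
    fix z assume "z \<in> {b..}"
    then have "b powr m \<le> z powr m" using assms by (auto intro: powr_mono2)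
    then have "b powr m * (z powr k * exp (- z)) \<le> z powr m * (z powr k * exp (- z))"
      by (intro mult_right_mono) auto
    then show "b powr m * (z powr k * exp (- z)) \<le> z powr (k + m) * exp (- z)"
      by (simp add: powr_add mult_ac)
  qed
  finally show ?thesis .
qed

lemma uGamma_0_exp: "b \<ge> 0 \<Longrightarrow> uGamma 0 b = exp (- b)"
  unfolding uGamma_def
proof -
  assume b: "b \<ge> 0"
  have "((\<lambda>x. exp (- 1 * x)) has_integral exp (- 1 * b) / 1) {b..}"
    by (rule has_integral_exp_minus_to_infinity) simp
  then have "((\<lambda>x. x powr 0 * exp (- x)) has_integral exp (-b)) {b..}"
    using has_integral_spike_finite[of "{0}" "{b..}" "\<lambda>x. x powr 0 * exp (- x)" "\<lambda>x. exp (- 1 * x)"] by simp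
  then show "integral {b..} (\<lambda>z. z powr 0 * exp (- z)) = exp (- b)" by (rule integral_unique)
qed

lemma uGamma_ge_powr:
  assumes "k \<ge> 0" "b \<ge> 0"
  shows "b powr k * exp (- b) \<le> uGamma k b"
  using uGamma_shift[of 0 k b] uGamma_0_exp[of b] assms by simp

lemma uGamma_eq_diff:
  assumes "k \<ge> 0" "x \<ge> 0"
  shows "uGamma k x = Gamma (k + 1) - integral {0..x} (\<lambda>z. z powr k * exp (- z))"
proof -
  let ?f = "\<lambda>z::real. z powr k * exp (- z)"
  have "(?f has_integral uGamma k x) {x..}"
    unfolding uGamma_def using uGamma_integrable assms by (intro integrable_integral) auto
  moreover have "?f integrable_on {0..x}"
    using integrable_on_subinterval[of ?f "{0..}" 0 x] uGamma_integrable[of k 0] assms by auto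
  then have "(?f has_integral integral {0..x} ?f) {0..x}" by (rule integrable_integral)
  ultimately have "(?f has_integral uGamma k x + integral {0..x} ?f) ({x..} \<union> {0..x})"
    by (rule has_integral_Un) (rule negligible_subset[of "{x}"], auto)
  moreover have "{x..} \<union> {0..x} = {0..}" using assms by auto
  ultimately have "uGamma k x + integral {0..x} ?f = Gamma (k + 1)"
    using has_integral_unique[OF _ uGamma_has_integral_0[OF assms(1)]] by simp
  then show ?thesis by simp
qed

lemma uGamma_cont_on:
  assumes "k \<ge> 0"
  shows "continuous_on {0..x} (uGamma k)"
proof -
  have "(\<lambda>z. z powr k * exp (- z)) integrable_on {0..x}"
    using integrable_on_subinterval[of _ "{0..}" 0 x] uGamma_integrable[of k 0] assms by auto
  then have "continuous_on {0..x} (\<lambda>x. Gamma (k + 1) - integral {0..x} (\<lambda>z. z powr k * exp (- z)))"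
    by (intro continuous_intros indefinite_integral_continuous_1)
  then show ?thesis
    by (rule continuous_on_eq) (use assms uGamma_eq_diff in auto)
qed

lemma uGamma_deriv:
  assumes "k \<ge> 0" "b > 0"
  shows "(uGamma k has_real_derivative - (b powr k * exp (- b))) (at b)"
proof -
  let ?f = "\<lambda>z::real. z powr k * exp (- z)"
  have int: "?f integrable_on {0..b + 1}"
    using integrable_on_subinterval[of ?f "{0..}" 0 "b+1"] uGamma_integrable[of k 0] assms by auto
  have "continuous (at b within {0..b+1}) ?f"
    using assms by (intro continuous_intros) auto
  then have "((\<lambda>u. integral {0..u} ?f) has_vector_derivative ?f b) (at b within {0..b+1})"
    using integral_has_vector_derivative_continuous_at[OF int, of b "{}"] assms by simp
  then have "((\<lambda>u. integral {0..u} ?f) has_real_derivative ?f b) (at b within {0..b+1})"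
    by (simp add: has_real_derivative_iff_has_vector_derivative)
  then have "((\<lambda>u. integral {0..u} ?f) has_real_derivative ?f b) (at b)"
    using at_within_interior[of b "{0..b+1}"] assms by simp
  then have D: "((\<lambda>u. Gamma (k + 1) - integral {0..u} ?f) has_real_derivative - ?f b) (at b)"
    by (auto intro!: derivative_eq_intros)
  show ?thesis
    by (rule has_field_derivative_transform_within_open[OF D, of "{0<..}"])
       (use assms uGamma_eq_diff in auto)
qed

text \<open>The function \<open>b \<mapsto> exp b * uGamma k b\<close> is increasing, because \<open>uGamma_ge_powr\<close> bounds its derivative below by 0.\<close>

lemma uGamma_ge_exp:
  assumes "k \<ge> 0" "b \<ge> 0"
  shows "exp (- b) * Gamma (k + 1) \<le> uGamma k b"
proof -
  have "exp 0 * uGamma k 0 \<le> exp b * uGamma k b"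
  proof (rule DERIV_nonneg_imp_increasing_open[OF assms(2)])
    fix x assume x: "0 < x" "x < b"
    have "((\<lambda>x. exp x * uGamma k x) has_real_derivative
        exp x * uGamma k x + - (x powr k * exp (- x)) * exp x) (at x)"
      by (rule derivative_eq_intros uGamma_deriv refl | use x assms in simp)+
    moreover have "exp x * uGamma k x + - (x powr k * exp (- x)) * exp x \<ge> 0"
      using mult_right_mono[OF uGamma_ge_powr[of k x], of "exp x"] x assms by (simp add: algebra_simps)
    ultimately show "\<exists>y. ((\<lambda>x. exp x * uGamma k x) has_real_derivative y) (at x) \<and> 0 \<le> y" by blast
  next
    show "continuous_on {0..b} (\<lambda>x. exp x * uGamma k x)"
      by (intro continuous_intros uGamma_cont_on assms)
  qed
  then show ?thesis using assms by (simp add: uGamma_0 exp_minus field_simps)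
qed

lemma Gamma_shift_le:
  assumes "k \<ge> 0" "m \<ge> 0" "b \<ge> (0::real)"
  shows "b powr m * Gamma (k + 1) \<le> exp b * Gamma (k + m + 1)"
proof -
  have "exp (- b) * (b powr m * Gamma (k + 1)) \<le> b powr m * uGamma k b"
    using mult_left_mono[OF uGamma_ge_exp[of k b], of "b powr m"] assms by (simp add: mult_ac)
  also have "\<dots> \<le> uGamma (k + m) b" by (rule uGamma_shift) (use assms in auto)
  also have "\<dots> \<le> Gamma (k + m + 1)" using uGamma_le_Gamma[of "k+m" b] assms by simp
  finally show ?thesis by (simp add: exp_minus field_simps)
qed

lemma uGamma_deriv_compose[derivative_intros]:
  assumes "(f has_real_derivative f') (at x)" "k \<ge> 0" "f x > 0"
  shows "((\<lambda>x. uGamma k (f x)) has_real_derivative - (f x powr k * exp (- f x)) * f') (at x)"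
  using DERIV_chain2[OF uGamma_deriv[OF assms(2,3)] assms(1)] .

lemma uGamma_antimono: "k \<ge> 0 \<Longrightarrow> 0 \<le> b \<Longrightarrow> b \<le> b' \<Longrightarrow> uGamma k b' \<le> uGamma k b"
  unfolding uGamma_def by (rule integral_subset_le) (auto intro: uGamma_integrable)

text \<open>The substitution \<open>z = B / v^p\<close> turns the integrand into \<open>uGamma k\<close> times a power; integrating by parts,
with \<open>- (z powr k * exp (- z))\<close> for the derivative of \<open>uGamma k\<close>, leads to the parameter \<open>k + M/p\<close>. Only the
resulting primitive is verified.\<close>

lemma uGamma_powr_int:
  fixes B \<epsilon> R k :: real and p M :: nat
  assumes "k \<ge> 0" "B > 0" "0 < \<epsilon>" "\<epsilon> \<le> R" "p > 0" "M > 0"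
  shows "((\<lambda>v. uGamma k (B / v ^ p) / v ^ (M + 1)) has_integral
           (B powr (- (real M / real p)) * uGamma (k + M / p) (B / R ^ p) - uGamma k (B / R ^ p) / R ^ M) / M
         - (B powr (- (real M / real p)) * uGamma (k + M / p) (B / \<epsilon> ^ p) - uGamma k (B / \<epsilon> ^ p) / \<epsilon> ^ M) / M) {\<epsilon>..R}"
proof (rule fundamental_theorem_of_calculus[OF assms(4)])
  fix v assume v: "v \<in> {\<epsilon>..R}"
  then have v0: "v > 0" using assms by auto
  let ?b = "B / v ^ p"
  have b0: "?b > 0" using assms v0 by simp
  have pw: "B powr (- (real M / real p)) * ?b powr (k + M / p) = ?b powr k / v ^ M"
  proof -
    have "?b powr (M / p) = B powr (M / p) / (v ^ p) powr (M / p)"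
      using assms v0 by (simp add: powr_divide)
    also have "(v ^ p) powr (M / p) = v ^ M"
      using v0 assms by (simp add: powr_realpow[symmetric] powr_powr)
    finally have e: "?b powr (M / p) = B powr (M / p) / v ^ M" .
    have "B powr (- (real M / real p)) * ?b powr (k + M / p)
        = (B powr (- (M / p)) * B powr (M / p)) * (?b powr k / v ^ M)"
      unfolding powr_add e by (simp add: mult_ac)
    then show ?thesis using assms by (simp add: powr_add[symmetric])
  qed
  define b' where "b' = - (B * (real p * v ^ (p - 1))) / (v ^ p * v ^ p)"
  have "((\<lambda>v. v ^ p) has_real_derivative real p * v ^ (p - 1)) (at v)"
    using DERIV_pow[of p v UNIV] by simp
  then have Db: "((\<lambda>v. B / v ^ p) has_real_derivative b') (at v)"
    using DERIV_divide[OF DERIV_const, of "\<lambda>v. v ^ p"] v0 by (fastforce simp: b'_def)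
  have D1: "((\<lambda>v. B powr (- (real M / real p)) * uGamma (k + M / p) (B / v ^ p)) has_real_derivative
      B powr (- (real M / real p)) * (- (?b powr (k + M / p) * exp (- ?b)) * b')) (at v)"
    by (intro DERIV_cmult uGamma_deriv_compose Db) (use assms b0 in auto)
  have Dk: "((\<lambda>v. uGamma k (B / v ^ p)) has_real_derivative - (?b powr k * exp (- ?b)) * b') (at v)"
    by (intro uGamma_deriv_compose Db) (use assms b0 in auto)
  have DM: "((\<lambda>v. v ^ M) has_real_derivative real M * v ^ (M - 1)) (at v)"
    using DERIV_pow[of M v UNIV] by simp
  have D2: "((\<lambda>v. uGamma k (B / v ^ p) / v ^ M) has_real_derivative
     (- (?b powr k * exp (- ?b)) * b' * v ^ M - uGamma k ?b * (real M * v ^ (M - 1))) / (v ^ M * v ^ M)) (at v)"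
    by (rule DERIV_divide[OF Dk DM]) (use v0 in simp)
  have D3: "((\<lambda>v. (B powr (- (real M / real p)) * uGamma (k + M / p) (B / v ^ p) - uGamma k (B / v ^ p) / v ^ M) / M)
     has_real_derivative
     (B powr (- (real M / real p)) * (- (?b powr (k + M / p) * exp (- ?b)) * b')
     - (- (?b powr k * exp (- ?b)) * b' * v ^ M - uGamma k ?b * (real M * v ^ (M - 1))) / (v ^ M * v ^ M)) / M) (at v)"
    by (intro DERIV_cdivide DERIV_diff D1 D2)
  have "v ^ M = v ^ (M - 1) * v" using assms by (metis Suc_diff_1 power_Suc2)
  then have vM: "v ^ (M - 1) / (v ^ M * v ^ M) = 1 / v ^ (M + 1)"
    using v0 by (simp add: field_simps)
  have "(B powr (- (real M / real p)) * (- (?b powr (k + M / p) * exp (- ?b)) * b')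
     - (- (?b powr k * exp (- ?b)) * b' * v ^ M - uGamma k ?b * (real M * v ^ (M - 1))) / (v ^ M * v ^ M)) / M
    = (- (B powr (- (real M / real p)) * ?b powr (k + M / p)) * exp (- ?b) * b'
     + (?b powr k / v ^ M) * exp (- ?b) * b' + real M * uGamma k ?b * (v ^ (M - 1) / (v ^ M * v ^ M))) / M"
    using v0 by (simp add: diff_divide_distrib add_divide_distrib)
  also have "\<dots> = uGamma k ?b / v ^ (M + 1)"
    unfolding pw vM using assms by simp
  finally show "((\<lambda>v. (B powr (- (real M / real p)) * uGamma (k + M / p) (B / v ^ p) - uGamma k (B / v ^ p) / v ^ M) / M)
     has_vector_derivative uGamma k (B / v ^ p) / v ^ (M + 1)) (at v within {\<epsilon>..R})"
    using D3 by (simp only: has_real_derivative_iff_has_vector_derivative has_vector_derivative_at_within)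
qed

lemma powr_scale_uGamma_ge:
  assumes "k \<ge> 0" "B > 0" "0 < (R::real)" "p > 0"
  shows "uGamma k (B / R ^ p) / R ^ M \<le> B powr (- (real M / real p)) * uGamma (k + M / p) (B / R ^ p)"
proof -
  have "(B / R ^ p) powr (M / p) = B powr (M / p) / R ^ M"
    using assms by (simp add: powr_divide powr_realpow[symmetric] powr_powr)
  moreover have "(B / R ^ p) powr (M / p) * uGamma k (B / R ^ p) \<le> uGamma (k + M / p) (B / R ^ p)"
    by (rule uGamma_shift) (use assms in auto)
  ultimately have "B powr (M / p) / R ^ M * uGamma k (B / R ^ p) \<le> uGamma (k + M / p) (B / R ^ p)"
    by simp
  from mult_left_mono[OF this, of "B powr (- (M / p))"]
  have "(B powr (- (M / p)) * B powr (M / p)) * (uGamma k (B / R ^ p) / R ^ M)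
      \<le> B powr (- (M / p)) * uGamma (k + M / p) (B / R ^ p)"
    by (simp add: mult_ac)
  then show ?thesis using assms by (simp add: powr_add[symmetric])
qed

text \<open>The contribution of the lower limit is nonnegative by \<open>powr_scale_uGamma_ge\<close>, so that the bound is
uniform as \<open>\<epsilon>\<close> tends to 0.\<close>

lemma uGamma_powr_int_le:
  fixes B \<epsilon> R k :: real and p M :: nat
  assumes "k \<ge> 0" "B > 0" "0 < \<epsilon>" "\<epsilon> \<le> R" "p > 0" "M > 0"
  shows "integral {\<epsilon>..R} (\<lambda>v. uGamma k (B / v ^ p) / v ^ (M + 1))
        \<le> (B powr (- (real M / real p)) * uGamma (k + M / p) (B / R ^ p) - uGamma k (B / R ^ p) / R ^ M) / M"
  using integral_unique[OF uGamma_powr_int[OF assms]] powr_scale_uGamma_ge[of k B \<epsilon> p M] assms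
  by simp

section \<open>Cauchy's formula on annular sectors\<close>

definition annular_sector :: "real \<Rightarrow> real \<Rightarrow> real \<Rightarrow> real \<Rightarrow> complex set" where
  "annular_sector \<rho> T \<theta> \<theta>' = {of_real t * cis \<phi> |t \<phi>. t \<in> {\<rho>..T} \<and> \<phi> \<in> {\<theta>..\<theta>'}}"

text \<open>The density with respect to \<open>dU / U\<close>, which on a circle is \<open>\<i> d\<theta>\<close> and on a ray \<open>dt / t\<close>.\<close>

definition cauchy_kernel :: "(complex \<Rightarrow> complex) \<Rightarrow> complex \<Rightarrow> complex \<Rightarrow> complex" where
  "cauchy_kernel f X U = f U * U / (U - X)"

lemma in_annular_sectorI:
  "t \<in> {\<rho>..T} \<Longrightarrow> \<phi> \<in> {\<theta>..\<theta>'} \<Longrightarrow> of_real t * cis \<phi> \<in> annular_sector \<rho> T \<theta> \<theta>'"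
  unfolding annular_sector_def by blast

lemma exp_Complex: "exp (Complex a b) = of_real (exp a) * cis b"
  by (simp add: exp_eq_polar)

lemma exp_in_annular_sector:
  assumes "0 < \<rho>" "0 < T" "w \<in> cbox (Complex (ln \<rho>) \<theta>) (Complex (ln T) \<theta>')"
  shows "exp w \<in> annular_sector \<rho> T \<theta> \<theta>'"
proof -
  have "ln \<rho> \<le> Re w" "Re w \<le> ln T" using assms by (auto simp: in_cbox_complex_iff)
  then have "\<rho> \<le> exp (Re w)" "exp (Re w) \<le> T"
    using assms by (metis exp_le_cancel_iff exp_ln)+
  then show ?thesis
    using assms in_annular_sectorI[of "exp (Re w)" \<rho> T "Im w" \<theta> \<theta>']
    by (simp add: exp_eq_polar in_cbox_complex_iff)
qed

text \<open>Contours around a sector are images under \<open>exp\<close> of rectangles. In the logarithmic coordinate sectors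
of any opening up to \<open>2 * pi\<close> are convex, and the measure \<open>dU / U\<close> becomes \<open>dw\<close>.\<close>

lemma contour_integral_linepath_horizontal:
  assumes \<rho>: "0 < \<rho>" "\<rho> < T"
    and cont: "continuous_on {\<rho>..T} (\<lambda>t. \<phi> (of_real t * cis \<theta>))"
  shows "contour_integral (linepath (Complex (ln \<rho>) \<theta>) (Complex (ln T) \<theta>)) (\<lambda>w. \<phi> (exp w))
       = integral {\<rho>..T} (\<lambda>t. \<phi> (of_real t * cis \<theta>) / of_real t)"
proof -
  define c where "c = ln T - ln \<rho>"
  define g where "g = (\<lambda>x. exp (ln \<rho> + x * c))"
  have c: "c > 0" using assms by (simp add: c_def)
  have g01: "g 0 = \<rho>" "g 1 = T" using assms by (auto simp: g_def c_def)
  have gr: "g x \<in> {\<rho>..T}" if "x \<in> {0..1}" for x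
  proof -
    have "ln \<rho> \<le> ln \<rho> + x * c" "ln \<rho> + x * c \<le> ln \<rho> + 1 * c"
      using that c by (auto intro!: mult_right_mono)
    then have "exp (ln \<rho>) \<le> g x" "g x \<le> exp (ln T)"
      unfolding g_def exp_le_cancel_iff by (auto simp: c_def)
    then show ?thesis using assms by simp
  qed
  have "((\<lambda>x. (c * g x) *\<^sub>R ((\<lambda>t. \<phi> (of_real t * cis \<theta>) / of_real t) (g x))) has_integral
        (integral {g 0..g 1} (\<lambda>t. \<phi> (of_real t * cis \<theta>) / of_real t))) {0..1}"
  proof (rule has_integral_substitution)
    show "g ` {0..1} \<subseteq> {\<rho>..T}" using gr by auto
    show "continuous_on {\<rho>..T} (\<lambda>t. \<phi> (of_real t * cis \<theta>) / of_real t)"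
      using assms by (intro continuous_intros cont) auto
    show "(g has_real_derivative c * g x) (at x within {0..1})" for x
      unfolding g_def by (auto intro!: derivative_eq_intros)
  qed (use g01 assms in auto)
  moreover have "(c * g x) *\<^sub>R ((\<lambda>t. \<phi> (of_real t * cis \<theta>) / of_real t) (g x))
      = of_real c * \<phi> (exp (linepath (Complex (ln \<rho>) \<theta>) (Complex (ln T) \<theta>) x))" for x
  proof -
    have "linepath (Complex (ln \<rho>) \<theta>) (Complex (ln T) \<theta>) x = Complex (ln \<rho> + x * c) \<theta>"
      by (simp add: linepath_def complex_eq_iff c_def algebra_simps)
    moreover have "g x \<noteq> 0" by (simp add: g_def)
    ultimately show ?thesis by (simp add: exp_Complex scaleR_conv_of_real g_def)
  qed
  ultimately have "((\<lambda>x. of_real c * \<phi> (exp (linepath (Complex (ln \<rho>) \<theta>) (Complex (ln T) \<theta>) x))) has_integral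
        (integral {\<rho>..T} (\<lambda>t. \<phi> (of_real t * cis \<theta>) / of_real t))) {0..1}"
    by (simp add: g01)
  moreover have "Complex (ln T) \<theta> - Complex (ln \<rho>) \<theta> = of_real c"
    by (simp add: complex_eq_iff c_def)
  ultimately have "((\<lambda>w. \<phi> (exp w)) has_contour_integral (integral {\<rho>..T} (\<lambda>t. \<phi> (of_real t * cis \<theta>) / of_real t)))
      (linepath (Complex (ln \<rho>) \<theta>) (Complex (ln T) \<theta>))"
    by (subst has_contour_integral_linepath) (simp add: mult.commute)
  then show ?thesis by (rule contour_integral_unique)
qed

definition sector_boundary_integral ::
  "real \<Rightarrow> real \<Rightarrow> real \<Rightarrow> real \<Rightarrow> (complex \<Rightarrow> complex) \<Rightarrow> complex" where
  "sector_boundary_integral \<rho> T \<theta> \<theta>' \<phi> =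
     \<i> * integral {\<theta>..\<theta>'} (\<lambda>s. \<phi> (of_real T * cis s)) - \<i> * integral {\<theta>..\<theta>'} (\<lambda>s. \<phi> (of_real \<rho> * cis s))
     + (integral {\<rho>..T} (\<lambda>t. \<phi> (of_real t * cis \<theta>) / of_real t)
      - integral {\<rho>..T} (\<lambda>t. \<phi> (of_real t * cis \<theta>') / of_real t))"

lemma contour_integral_rectpath_exp:
  assumes \<rho>: "0 < \<rho>" "\<rho> < T" "\<theta> < \<theta>'"
    and cont: "continuous_on (exp ` path_image (rectpath (Complex (ln \<rho>) \<theta>) (Complex (ln T) \<theta>'))) \<phi>"
  shows "contour_integral (rectpath (Complex (ln \<rho>) \<theta>) (Complex (ln T) \<theta>')) (\<lambda>w. \<phi> (exp w))
       = sector_boundary_integral \<rho> T \<theta> \<theta>' \<phi>"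
proof -
  let ?a1 = "Complex (ln \<rho>) \<theta>" and ?a2 = "Complex (ln T) \<theta>"
    and ?a3 = "Complex (ln T) \<theta>'" and ?a4 = "Complex (ln \<rho>) \<theta>'"
  let ?P = "path_image (rectpath ?a1 ?a3)" and ?h = "\<lambda>w. \<phi> (exp w)"
  have less: "ln \<rho> < ln T" using \<rho> by simp
  have P: "?P = closed_segment ?a1 ?a2 \<union> closed_segment ?a2 ?a3 \<union> closed_segment ?a3 ?a4 \<union> closed_segment ?a4 ?a1"
    by (simp add: rectpath_def Let_def path_image_join Un_assoc)
  have ch: "continuous_on ?P ?h"
    by (rule continuous_on_compose2[OF cont continuous_on_exp[OF continuous_on_id]]) auto
  have c: "continuous_on (closed_segment ?a1 ?a2) ?h" "continuous_on (closed_segment ?a2 ?a3) ?h"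
     "continuous_on (closed_segment ?a3 ?a4) ?h" "continuous_on (closed_segment ?a4 ?a1) ?h"
    by (rule continuous_on_subset[OF ch]; use P in blast)+
  note ci = c[THEN contour_integrable_continuous_linepath]
  have "contour_integral (rectpath ?a1 ?a3) ?h =
     contour_integral (linepath ?a1 ?a2) ?h + (contour_integral (linepath ?a2 ?a3) ?h +
     (contour_integral (linepath ?a3 ?a4) ?h + contour_integral (linepath ?a4 ?a1) ?h))"
    unfolding rectpath_def Let_def using ci
    by (simp add: contour_integrable_joinI valid_path_join)
  moreover have "contour_integral (linepath ?a3 ?a4) ?h = - contour_integral (linepath ?a4 ?a3) ?h"
    "contour_integral (linepath ?a4 ?a1) ?h = - contour_integral (linepath ?a1 ?a4) ?h"
    using c(3,4) by (simp_all add: contour_integral_reverse_linepath)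
  moreover have "contour_integral (linepath ?a2 ?a3) ?h = \<i> * integral {\<theta>..\<theta>'} (\<lambda>s. \<phi> (of_real T * cis s))"
    "contour_integral (linepath ?a1 ?a4) ?h = \<i> * integral {\<theta>..\<theta>'} (\<lambda>s. \<phi> (of_real \<rho> * cis s))"
    using contour_integral_linepath_same_Re[of ?a2 "ln T" ?a3 \<theta> \<theta>' ?h]
      contour_integral_linepath_same_Re[of ?a1 "ln \<rho>" ?a4 \<theta> \<theta>' ?h] \<rho>
    by (simp_all add: exp_Complex)
  moreover have co: "continuous_on {\<rho>..T} (\<lambda>t. \<phi> (of_real t * cis s))" if "s \<in> {\<theta>, \<theta>'}" for s
  proof (rule continuous_on_compose2[OF cont])
    show "continuous_on {\<rho>..T} (\<lambda>t. of_real t * cis s)" by (intro continuous_intros)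
    show "(\<lambda>t. of_real t * cis s) ` {\<rho>..T} \<subseteq> exp ` ?P"
    proof
      fix x assume "x \<in> (\<lambda>t. of_real t * cis s) ` {\<rho>..T}"
      then obtain t where t: "t \<in> {\<rho>..T}" "x = of_real t * cis s" by auto
      then have "x = exp (Complex (ln t) s)" using \<rho> by (simp add: exp_Complex)
      moreover have "Complex (ln t) s \<in> ?P"
        using t that \<rho> less by (auto simp: path_image_rectpath)
      ultimately show "x \<in> exp ` ?P" by blast
    qed
  qed
  then have "contour_integral (linepath ?a1 ?a2) ?h = integral {\<rho>..T} (\<lambda>t. \<phi> (of_real t * cis \<theta>) / of_real t)"
     "contour_integral (linepath ?a4 ?a3) ?h = integral {\<rho>..T} (\<lambda>t. \<phi> (of_real t * cis \<theta>') / of_real t)"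
    by (intro contour_integral_linepath_horizontal \<rho>; simp)+
  ultimately show ?thesis by (simp add: sector_boundary_integral_def algebra_simps)
qed

text \<open>The integrand is holomorphic on the rectangle in the logarithmic coordinate.\<close>

lemma sector_cauchy_outside:
  assumes \<rho>: "0 < \<rho>" "\<rho> < T" "\<theta> < \<theta>'"
    and hol: "f holomorphic_on annular_sector \<rho> T \<theta> \<theta>'"
    and X: "X \<notin> annular_sector \<rho> T \<theta> \<theta>'"
  shows "sector_boundary_integral \<rho> T \<theta> \<theta>' (cauchy_kernel f X) = 0"
proof -
  let ?R = "cbox (Complex (ln \<rho>) \<theta>) (Complex (ln T) \<theta>')"
  let ?g = "rectpath (Complex (ln \<rho>) \<theta>) (Complex (ln T) \<theta>')"
  have less: "ln \<rho> < ln T" using \<rho> by simp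
  have img: "exp ` ?R \<subseteq> annular_sector \<rho> T \<theta> \<theta>'"
    using exp_in_annular_sector \<rho> by auto
  have sub: "path_image ?g \<subseteq> ?R"
    using less \<rho> by (intro path_image_rectpath_subset_cbox) auto
  have ne: "U - X \<noteq> 0" if "U \<in> annular_sector \<rho> T \<theta> \<theta>'" for U
    using that X by auto
  have holk: "cauchy_kernel f X holomorphic_on annular_sector \<rho> T \<theta> \<theta>'"
    unfolding cauchy_kernel_def by (intro holomorphic_intros hol ne)
  have "(\<lambda>w. cauchy_kernel f X (exp w)) holomorphic_on ?R"
    using holomorphic_on_compose_gen[OF holomorphic_on_exp holk img] by (simp add: o_def)
  then have I: "((\<lambda>w. cauchy_kernel f X (exp w)) has_contour_integral 0) ?g"
    by (rule Cauchy_theorem_convex_simple) (use sub in auto)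
  moreover have "continuous_on (exp ` path_image ?g) (cauchy_kernel f X)"
    by (rule continuous_on_subset[OF holomorphic_on_imp_continuous_on[OF holk]]) (use img sub in blast)
  ultimately show ?thesis
    using contour_integral_rectpath_exp[OF \<rho>, of "cauchy_kernel f X"] contour_integral_unique[OF I] by simp
qed

lemma sector_cauchy_inside:
  assumes \<rho>: "0 < \<rho>" "\<rho> < r" "r < T" "\<theta> < \<tau>" "\<tau> < \<theta>'" "\<theta>' - \<theta> \<le> 2 * pi"
    and hol: "f holomorphic_on annular_sector \<rho> T \<theta> \<theta>'"
    and X: "X = of_real r * cis \<tau>"
  shows "sector_boundary_integral \<rho> T \<theta> \<theta>' (cauchy_kernel f X) = 2 * pi * \<i> * f X"
proof -
  let ?R = "cbox (Complex (ln \<rho>) \<theta>) (Complex (ln T) \<theta>')"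
  let ?g = "rectpath (Complex (ln \<rho>) \<theta>) (Complex (ln T) \<theta>')"
  define w0 where "w0 = Complex (ln r) \<tau>"
  have w0: "exp w0 = X" using X \<rho> by (simp add: w0_def exp_Complex)
  have X0: "X \<noteq> 0" using w0 by auto
  have less: "ln \<rho> < ln T" "ln \<rho> < ln r" "ln r < ln T" using \<rho> by simp_all
  have w0box: "w0 \<in> box (Complex (ln \<rho>) \<theta>) (Complex (ln T) \<theta>')"
    using less \<rho> by (simp add: w0_def in_box_complex_iff)
  have img: "exp ` ?R \<subseteq> annular_sector \<rho> T \<theta> \<theta>'"
    using exp_in_annular_sector \<rho> by auto
  have sub: "path_image ?g \<subseteq> ?R - {w0}"
    using path_image_rectpath_cbox_minus_box[of "Complex (ln \<rho>) \<theta>" "Complex (ln T) \<theta>'"] w0box less \<rho> by auto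
  \<comment> \<open>the rectangle has height at most \<open>2\<pi>\<close>, so it contains only one logarithm of \<open>X\<close>\<close>
  have uniq: "w = w0" if w: "w \<in> ?R" "exp w = X" for w
  proof -
    obtain n :: int where n: "w = w0 + (of_int (2 * n) * pi) * \<i>"
      using w w0 exp_eq[of w w0] by auto
    then have im: "Im w = \<tau> + 2 * n * pi" by (simp add: w0_def)
    have "\<theta> \<le> Im w" "Im w \<le> \<theta>'" using w by (auto simp: in_cbox_complex_iff)
    then have "n * pi < 1 * pi" "(-1) * pi < n * pi" using \<rho>(4-6) im by linarith+
    then have "real_of_int n < 1" "-1 < real_of_int n"
      using mult_less_cancel_right_pos[OF pi_gt_zero] by blast+
    then have "n = 0" by linarith
    then show ?thesis using n by simp
  qed
  define \<psi> where "\<psi> = (\<lambda>w. if w = w0 then deriv exp w0 else (exp w - exp w0) / (w - w0))"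
  have "\<psi> holomorphic_on UNIV"
    unfolding \<psi>_def by (rule pole_lemma_open[OF holomorphic_on_exp open_UNIV])
  then have psi_hol: "\<psi> holomorphic_on ?R" by (rule holomorphic_on_subset) simp
  have dexp: "deriv exp w0 = X"
    unfolding w0[symmetric] by (rule DERIV_imp_deriv[OF DERIV_exp])
  have psi0: "\<psi> w \<noteq> 0" if "w \<in> ?R" for w
  proof (cases "w = w0")
    case True
    then show ?thesis using dexp X0 by (simp add: \<psi>_def)
  next
    case False
    then have "exp w \<noteq> exp w0" using uniq[OF that] w0 by metis
    then show ?thesis using False by (simp add: \<psi>_def)
  qed
  have holf: "(\<lambda>w. f (exp w)) holomorphic_on ?R"
    using holomorphic_on_compose_gen[OF holomorphic_on_exp hol img] by (simp add: o_def)
  define h where "h = (\<lambda>w. f (exp w) * exp w / \<psi> w)"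
  have "h holomorphic_on ?R"
    unfolding h_def by (intro holomorphic_intros holf psi_hol psi0)
  then have "((\<lambda>w. h w / (w - w0)) has_contour_integral (2 * pi * \<i> * winding_number ?g w0 * h w0)) ?g"
    by (intro Cauchy_integral_formula_convex_simple[of ?R]) (use sub w0box in \<open>simp_all add: interior_cbox\<close>)
  moreover have "winding_number ?g w0 = 1" by (rule winding_number_rectpath[OF w0box])
  moreover have "h w0 = f X" using w0 X0 dexp by (simp add: h_def \<psi>_def)
  ultimately have "((\<lambda>w. h w / (w - w0)) has_contour_integral (2 * pi * \<i> * f X)) ?g" by simp
  then have I: "((\<lambda>w. cauchy_kernel f X (exp w)) has_contour_integral (2 * pi * \<i> * f X)) ?g"
  proof (rule has_contour_integral_eq)
    fix w assume "w \<in> path_image ?g"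
    then have w: "w \<in> ?R" "w \<noteq> w0" using sub by auto
    then have "exp w \<noteq> X" using uniq by blast
    then show "h w / (w - w0) = cauchy_kernel f X (exp w)"
      using w w0 by (simp add: h_def \<psi>_def cauchy_kernel_def)
  qed
  have nX: "U - X \<noteq> 0" if U: "U \<in> exp ` path_image ?g" for U
  proof -
    obtain w where "U = exp w" "w \<in> ?R" "w \<noteq> w0" using U sub by blast
    then show ?thesis using uniq[of w] by auto
  qed
  have "continuous_on (exp ` path_image ?g) (cauchy_kernel f X)"
    unfolding cauchy_kernel_def
  proof (intro continuous_intros ballI nX)
    show "continuous_on (exp ` path_image ?g) f"
      by (rule continuous_on_subset[OF holomorphic_on_imp_continuous_on[OF hol]]) (use img sub in blast)
  qed
  then show ?thesis
    using contour_integral_rectpath_exp[of \<rho> T \<theta> \<theta>'] contour_integral_unique[OF I] \<rho> by simp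
qed

lemma of_real_cis_eq_iff:
  assumes "r > 0" "t > 0" "of_real r * cis \<tau> = of_real t * cis \<phi>"
  shows "r = t" "\<exists>n::int. \<phi> = \<tau> + 2 * pi * of_int n"
proof -
  have "cmod (of_real r * cis \<tau>) = cmod (of_real t * cis \<phi>)" using assms by simp
  then show rt: "r = t" using assms(1,2) by (simp add: norm_mult)
  then have "cis \<tau> = cis \<phi>" using assms by simp
  then have "cis (\<phi> - \<tau>) = 1" by (simp flip: cis_divide)
  then have "exp (\<i> * of_real (\<phi> - \<tau>)) = 1" by (simp add: cis_conv_exp)
  then obtain n::int where "\<phi> - \<tau> = of_int (2 * n) * pi" by (auto simp: exp_eq_1)
  then have "\<phi> = \<tau> + 2 * pi * of_int n" by (simp add: algebra_simps)
  then show "\<exists>n::int. \<phi> = \<tau> + 2 * pi * of_int n" by blast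
qed

text \<open>The sum of the boundary integrals of the sectors between consecutive angles \<open>\<theta> i\<close>, with the two
integrals over each common side combined into one: \<open>F (Suc i) - F i\<close> measures the failure of the
functions to glue.\<close>

definition decomposition_sum ::
  "real \<Rightarrow> real \<Rightarrow> nat \<Rightarrow> (nat \<Rightarrow> real) \<Rightarrow> (nat \<Rightarrow> complex \<Rightarrow> complex) \<Rightarrow> complex \<Rightarrow> complex" where
  "decomposition_sum \<rho> T m \<theta> F X =
      (\<Sum>i<m. \<i> * integral {\<theta> i..\<theta> (Suc i)} (\<lambda>s. cauchy_kernel (F i) X (of_real T * cis s)))
    - (\<Sum>i<m. \<i> * integral {\<theta> i..\<theta> (Suc i)} (\<lambda>s. cauchy_kernel (F i) X (of_real \<rho> * cis s)))
    + (\<Sum>i<m. integral {\<rho>..T} (\<lambda>t. cauchy_kernel (\<lambda>U. F (Suc i) U - F i U) X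
                                    (of_real t * cis (\<theta> (Suc i))) / of_real t))"

lemma decomposition_sum_eq:
  fixes \<theta> :: "nat \<Rightarrow> real" and F :: "nat \<Rightarrow> complex \<Rightarrow> complex"
  assumes \<rho>: "0 < \<rho>" "\<rho> < T"
    and inc: "\<And>i. i < m \<Longrightarrow> \<theta> i < \<theta> (Suc i)" and per: "\<theta> m = \<theta> 0 + 2 * pi" "F m = F 0"
    and hol: "\<And>i. i < m \<Longrightarrow> F i holomorphic_on annular_sector \<rho> T (\<theta> i) (\<theta> (Suc i))"
    and X: "\<And>i t. i < m \<Longrightarrow> t \<in> {\<rho>..T} \<Longrightarrow> of_real t * cis (\<theta> (Suc i)) \<noteq> X"
  shows "decomposition_sum \<rho> T m \<theta> F X =
     (\<Sum>i<m. sector_boundary_integral \<rho> T (\<theta> i) (\<theta> (Suc i)) (cauchy_kernel (F i) X))"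
proof -
  define lo where "lo = (\<lambda>j i. integral {\<rho>..T} (\<lambda>t. cauchy_kernel (F j) X (of_real t * cis (\<theta> i)) / of_real t))"
  have lo0m: "lo 0 0 = lo m m"
    using per by (simp add: lo_def cis_mult[symmetric])
  have cont: "continuous_on {\<rho>..T} (\<lambda>t. cauchy_kernel (F j) X (of_real t * cis (\<theta> (Suc i))) / of_real t)"
    if "i < m" "(j = i \<or> j = Suc i)" for i j
  proof -
    have cF: "continuous_on {\<rho>..T} (\<lambda>t. F j (of_real t * cis (\<theta> (Suc i))))"
    proof -
      have 1: "continuous_on {\<rho>..T} (\<lambda>t. F j (of_real t * cis (\<theta> i')))"
        if "j < m" "i' = j \<or> i' = Suc j" for j i'
      proof (rule continuous_on_compose2[OF holomorphic_on_imp_continuous_on[OF hol[OF that(1)]]])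
        show "continuous_on {\<rho>..T} (\<lambda>t. of_real t * cis (\<theta> i'))" by (intro continuous_intros)
        show "(\<lambda>t. of_real t * cis (\<theta> i')) ` {\<rho>..T} \<subseteq> annular_sector \<rho> T (\<theta> j) (\<theta> (Suc j))"
          using inc[of j] that by (auto intro!: in_annular_sectorI)
      qed
      show ?thesis
      proof (cases "j < m")
        case True then show ?thesis using 1[of j "Suc i"] that by auto
      next
        case False
        then have "j = m" "Suc i = m" using that by auto
        then show ?thesis using 1[of 0 0] per that(1)
          by (simp add: cis_mult[symmetric])
      qed
    qed
    show ?thesis unfolding cauchy_kernel_def
      using X[OF that(1)] \<rho> by (intro continuous_intros cF) auto
  qed
  have "(\<Sum>i<m. lo i i) = (\<Sum>i<m. lo (Suc i) (Suc i))"
  proof -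
    have "(\<Sum>i<m. lo (Suc i) (Suc i)) - (\<Sum>i<m. lo i i) = lo m m - lo 0 0"
      using sum_lessThan_telescope[of "\<lambda>i. lo i i" m] by (simp add: sum_subtractf)
    then show ?thesis using lo0m by simp
  qed
  moreover have "integral {\<rho>..T} (\<lambda>t. cauchy_kernel (\<lambda>U. F (Suc i) U - F i U) X
         (of_real t * cis (\<theta> (Suc i))) / of_real t) = lo (Suc i) (Suc i) - lo i (Suc i)" if "i < m" for i
  proof -
    have "cauchy_kernel (\<lambda>U. F (Suc i) U - F i U) X z / w = cauchy_kernel (F (Suc i)) X z / w - cauchy_kernel (F i) X z / w" for z w
      by (simp add: cauchy_kernel_def diff_divide_distrib left_diff_distrib)
    then show ?thesis unfolding lo_def
      using cont[OF that, of i] cont[OF that, of "Suc i"]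
      by (simp add: integral_diff integrable_continuous_interval)
  qed
  ultimately show ?thesis
    unfolding decomposition_sum_def sector_boundary_integral_def
    by (simp add: sum.distrib sum_subtractf lo_def)
qed

text \<open>A point of the open sector number 0 lies outside all the other closed sectors, so only one boundary
integral survives.\<close>

lemma decomposition_sum_inside:
  fixes \<theta> :: "nat \<Rightarrow> real" and F :: "nat \<Rightarrow> complex \<Rightarrow> complex"
  assumes \<rho>: "0 < \<rho>" "\<rho> < r" "r < T" "0 < m"
    and inc: "\<And>i. i < m \<Longrightarrow> \<theta> i < \<theta> (Suc i)" and per: "\<theta> m = \<theta> 0 + 2 * pi" "F m = F 0"
    and hol: "\<And>i. i < m \<Longrightarrow> F i holomorphic_on annular_sector \<rho> T (\<theta> i) (\<theta> (Suc i))"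
    and X: "X = of_real r * cis \<tau>" "\<theta> 0 < \<tau>" "\<tau> < \<theta> 1"
  shows "decomposition_sum \<rho> T m \<theta> F X = 2 * pi * \<i> * F 0 X"
proof -
  have mono: "\<theta> i \<le> \<theta> j" if "i \<le> j" "j \<le> m" for i j
    using that
  proof (induction j)
    case (Suc j)
    then show ?case using inc[of j] by (cases "i = Suc j") auto
  qed simp
  have notin: "X \<noteq> of_real t * cis \<phi>" if t: "t > 0" "\<theta> 1 \<le> \<phi>" "\<phi> \<le> \<theta> 0 + 2 * pi" for t \<phi>
  proof
    assume "X = of_real t * cis \<phi>"
    then obtain n::int where n: "\<phi> = \<tau> + 2 * pi * of_int n"
      using of_real_cis_eq_iff(2)[of r t \<tau> \<phi>] X(1) \<rho>(1,2) t(1) by force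
    then have "0 < 2 * pi * n" "2 * pi * n < 2 * pi * 1" using t X by linarith+
    then have "0 < real_of_int n" "real_of_int n < 1"
      by (simp_all add: zero_less_mult_iff)
    then show False by simp
  qed
  have th1: "\<theta> 1 \<le> \<theta> (Suc i)" "\<theta> (Suc i) \<le> \<theta> 0 + 2 * pi" if "i < m" for i
    using mono[of 1 "Suc i"] mono[of "Suc i" m] that per by auto
  have "decomposition_sum \<rho> T m \<theta> F X =
     (\<Sum>i<m. sector_boundary_integral \<rho> T (\<theta> i) (\<theta> (Suc i)) (cauchy_kernel (F i) X))"
  proof (rule decomposition_sum_eq[OF _ _ inc per hol])
    show "of_real t * cis (\<theta> (Suc i)) \<noteq> X" if "i < m" "t \<in> {\<rho>..T}" for i t
      using notin[of t "\<theta> (Suc i)"] th1[OF that(1)] that \<rho> by auto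
  qed (use \<rho> in auto)
  also have "\<dots> = (\<Sum>i<m. if i = 0 then 2 * pi * \<i> * F 0 X else 0)"
  proof (intro sum.cong refl)
    fix i assume i: "i \<in> {..<m}"
    show "sector_boundary_integral \<rho> T (\<theta> i) (\<theta> (Suc i)) (cauchy_kernel (F i) X)
      = (if i = 0 then 2 * pi * \<i> * F 0 X else 0)"
    proof (cases "i = 0")
      case True
      have "\<theta> 1 - \<theta> 0 \<le> 2 * pi" using th1[of 0] \<rho> by auto
      then have "sector_boundary_integral \<rho> T (\<theta> 0) (\<theta> 1) (cauchy_kernel (F 0) X) = 2 * pi * \<i> * F 0 X"
        using \<rho> X hol[of 0] by (intro sector_cauchy_inside[of _ r _ _ \<tau>]) auto
      then show ?thesis using True by simp
    next
      case False
      have "X \<notin> annular_sector \<rho> T (\<theta> i) (\<theta> (Suc i))"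
      proof
        assume "X \<in> annular_sector \<rho> T (\<theta> i) (\<theta> (Suc i))"
        then obtain t \<phi> where "X = of_real t * cis \<phi>" "t \<in> {\<rho>..T}" "\<phi> \<in> {\<theta> i..\<theta> (Suc i)}"
          unfolding annular_sector_def by blast
        moreover have "\<theta> 1 \<le> \<theta> i" using mono[of 1 i] i False by auto
        ultimately show False using notin[of t \<phi>] th1[of i] i \<rho> by auto
      qed
      then show ?thesis using False i hol[of i] inc[of i] \<rho> by (simp add: sector_cauchy_outside)
    qed
  qed
  also have "\<dots> = 2 * pi * \<i> * F 0 X" using \<rho> by simp
  finally show ?thesis .
qed

lemma decomposition_sum_inner_disc:
  fixes \<theta> :: "nat \<Rightarrow> real" and F :: "nat \<Rightarrow> complex \<Rightarrow> complex"
  assumes \<rho>: "0 < \<rho>" "\<rho> < T"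
    and inc: "\<And>i. i < m \<Longrightarrow> \<theta> i < \<theta> (Suc i)" and per: "\<theta> m = \<theta> 0 + 2 * pi" "F m = F 0"
    and hol: "\<And>i. i < m \<Longrightarrow> F i holomorphic_on annular_sector \<rho> T (\<theta> i) (\<theta> (Suc i))"
    and X: "cmod X < \<rho>"
  shows "decomposition_sum \<rho> T m \<theta> F X = 0"
proof -
  have "decomposition_sum \<rho> T m \<theta> F X =
     (\<Sum>i<m. sector_boundary_integral \<rho> T (\<theta> i) (\<theta> (Suc i)) (cauchy_kernel (F i) X))"
  proof (rule decomposition_sum_eq[OF _ _ inc per hol])
    show "of_real t * cis (\<theta> (Suc i)) \<noteq> X" if "i < m" "t \<in> {\<rho>..T}" for i t
      using X that \<rho> by (auto simp: norm_mult)
  qed (use \<rho> in auto)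
  also have "\<dots> = 0"
  proof (intro sum.neutral ballI sector_cauchy_outside hol inc \<rho>)
    fix i show "X \<notin> annular_sector \<rho> T (\<theta> i) (\<theta> (Suc i))"
      using X \<rho> by (auto simp: annular_sector_def norm_mult)
  qed auto
  finally show ?thesis .
qed

section \<open>Integrals of flat functions, kernels, uniqueness of expansions\<close>

lemma inverse_power_int:
  assumes "0 < \<epsilon>" "\<epsilon> \<le> (R::real)" "n > 0"
  shows "((\<lambda>t. 1 / t ^ (n + 1)) has_integral (1 / \<epsilon> ^ n - 1 / R ^ n) / n) {\<epsilon>..R}"
proof -
  have "((\<lambda>t. 1 / t ^ (n + 1)) has_integral (- (1 / R ^ n) / n - (- (1 / \<epsilon> ^ n) / n))) {\<epsilon>..R}"
  proof (rule fundamental_theorem_of_calculus[OF assms(2)])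
    fix t assume t: "t \<in> {\<epsilon>..R}"
    then have t0: "t > 0" using assms by auto
    have "((\<lambda>t. t ^ n) has_real_derivative real n * t ^ (n - 1)) (at t)"
      using DERIV_pow[of n t UNIV] by simp
    from DERIV_inverse'[OF this] have "((\<lambda>t. inverse (t ^ n)) has_real_derivative - (inverse (t ^ n) * (real n * t ^ (n - 1)) * inverse (t ^ n))) (at t)"
      using t0 by simp
    from DERIV_cdivide[OF DERIV_minus[OF this], of "real n"]
    have "((\<lambda>t. - (1 / t ^ n) / n) has_real_derivative
        - (- (inverse (t ^ n) * (real n * t ^ (n - 1)) * inverse (t ^ n))) / n) (at t)"
      by (simp only: inverse_eq_divide)
    moreover have "- (- (inverse (t ^ n) * (real n * t ^ (n - 1)) * inverse (t ^ n))) / n = 1 / t ^ (n + 1)"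
    proof -
      have "t ^ n = t ^ (n - 1) * t" using assms by (metis Suc_diff_1 power_Suc2)
      then show ?thesis using t0 assms by (simp add: field_simps)
    qed
    ultimately show "((\<lambda>t. - (1 / t ^ n) / n) has_vector_derivative 1 / t ^ (n + 1)) (at t within {\<epsilon>..R})"
      by (simp only: has_real_derivative_iff_has_vector_derivative has_vector_derivative_at_within)
  qed
  then show ?thesis by (simp add: diff_divide_distrib)
qed

lemma min_exp_cont:
  "0 < \<epsilon> \<Longrightarrow> continuous_on {\<epsilon>..R} (\<lambda>t::real. min (exp (- (A / t ^ p))) (exp (- b)) / t ^ n)"
  by (intro continuous_intros) auto

text \<open>The two exponentials agree at \<open>t0\<close> with \<open>A / t0^p = b\<close>. Below \<open>t0\<close> the integral is a moment of
\<open>uGamma 0\<close>; above \<open>t0\<close> it is the constant \<open>exp (- b)\<close> times an elementary integral, and the boundary terms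
at \<open>t0\<close> cancel.\<close>

lemma min_exp_int_le:
  fixes A b \<epsilon> R :: real
  assumes A: "A > 0" and p: "p > 0" and n: "n > 0" and b: "b \<ge> 0" and \<epsilon>: "0 < \<epsilon>" "\<epsilon> \<le> R"
  shows "integral {\<epsilon>..R} (\<lambda>t. min (exp (- (A / t ^ p))) (exp (- b)) / t ^ (n + 1))
       \<le> A powr (- (real n / real p)) * uGamma (n / p) b / n"
proof -
  let ?D = "\<lambda>t. min (exp (- (A / t ^ p))) (exp (- b)) / t ^ (n + 1)"
  let ?U = "A powr (- (real n / real p)) * uGamma (n / p) b"
  have I: "?D integrable_on {x..y}" if "0 < x" for x y
    using min_exp_cont[OF that] by (rule integrable_continuous_interval)
  have low: "integral {x..y} ?D \<le> (?U - exp (- b) / y ^ n) / n"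
    if xy: "0 < x" "x \<le> y" "A / y ^ p = b" for x y
  proof -
    have "integral {x..y} ?D = integral {x..y} (\<lambda>v. uGamma 0 (A / v ^ p) / v ^ (n + 1))"
    proof (rule integral_cong)
      fix v assume v: "v \<in> {x..y}"
      then have "A / v ^ p \<ge> b" using xy A by (auto intro!: divide_left_mono power_mono simp: mult_pos_pos)
      then have "min (exp (- (A / v ^ p))) (exp (- b)) = exp (- (A / v ^ p))" by simp
      then show "?D v = uGamma 0 (A / v ^ p) / v ^ (n + 1)"
        using v xy A by (simp add: uGamma_0_exp)
    qed
    also have "\<dots> \<le> (A powr (- (real n / real p)) * uGamma (0 + n / p) (A / y ^ p) - uGamma 0 (A / y ^ p) / y ^ n) / n"
      by (rule uGamma_powr_int_le) (use xy A p n in auto)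
    finally show ?thesis using xy b by (simp add: uGamma_0_exp)
  qed
  have low': "integral {x..y} ?D \<le> ?U / n" if xy: "0 < x" "x \<le> y" "A / y ^ p \<ge> b" for x y
  proof -
    have "integral {x..y} ?D = integral {x..y} (\<lambda>v. uGamma 0 (A / v ^ p) / v ^ (n + 1))"
    proof (rule integral_cong)
      fix v assume v: "v \<in> {x..y}"
      then have "A / v ^ p \<ge> A / y ^ p" using xy A by (intro divide_left_mono power_mono) auto
      then have "min (exp (- (A / v ^ p))) (exp (- b)) = exp (- (A / v ^ p))" using xy by simp
      then show "?D v = uGamma 0 (A / v ^ p) / v ^ (n + 1)"
        using v xy A by (simp add: uGamma_0_exp)
    qed
    also have "\<dots> \<le> (A powr (- (real n / real p)) * uGamma (0 + n / p) (A / y ^ p) - uGamma 0 (A / y ^ p) / y ^ n) / n"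
      by (rule uGamma_powr_int_le) (use xy A p n in auto)
    also have "\<dots> \<le> (A powr (- (real n / real p)) * uGamma (0 + n / p) (A / y ^ p)) / n"
      using xy A n uGamma_nonneg[of 0 "A / y ^ p"] by (intro divide_right_mono) auto
    also have "\<dots> \<le> ?U / n"
      using xy b by (intro divide_right_mono mult_left_mono) (auto intro: uGamma_antimono)
    finally show ?thesis .
  qed
  have high: "integral {x..y} ?D \<le> exp (- b) / x ^ n / n"
    if xy: "0 < x" "x \<le> y" for x y
  proof -
    have "integral {x..y} ?D \<le> integral {x..y} (\<lambda>t. exp (- b) * (1 / t ^ (n + 1)))"
    proof (rule integral_le[OF I[OF xy(1)]])
      show "(\<lambda>t. exp (- b) * (1 / t ^ (n + 1))) integrable_on {x..y}"
        using inverse_power_int[OF xy n] by (intro integrable_on_mult_right) (auto simp: integrable_on_def)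
      fix t assume t: "t \<in> {x..y}"
      have "?D t \<le> exp (- b) / t ^ (n + 1)"
        using t xy by (intro divide_right_mono) auto
      then show "?D t \<le> exp (- b) * (1 / t ^ (n + 1))" by simp
    qed
    also have "\<dots> = exp (- b) * ((1 / x ^ n - 1 / y ^ n) / n)"
      by (simp only: integral_mult_right integral_unique[OF inverse_power_int[OF xy n]])
    also have "\<dots> \<le> exp (- b) * ((1 / x ^ n) / n)"
      using xy by (intro mult_left_mono divide_right_mono) auto
    finally show ?thesis by simp
  qed
  have pw: "exp (- b) / x ^ n \<le> ?U" if x: "0 < x" "A / x ^ p \<le> b" for x
  proof -
    have "(A / x ^ p) powr (n / p) \<le> b powr (n / p)" using x A by (intro powr_mono2) auto
    moreover have "(A / x ^ p) powr (n / p) = A powr (n / p) / x ^ n"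
      using x A p by (simp add: powr_divide powr_realpow[symmetric] powr_powr)
    ultimately have "A powr (- (n / p)) * (A powr (n / p) / x ^ n) \<le> A powr (- (n / p)) * b powr (n / p)"
      by (intro mult_left_mono) auto
    moreover have "A powr (- (n / p)) * (A powr (n / p) / x ^ n) = 1 / x ^ n"
      using A by (simp add: powr_minus)
    ultimately have "1 / x ^ n \<le> A powr (- (n / p)) * b powr (n / p)" by metis
    then have "exp (- b) * (1 / x ^ n) \<le> exp (- b) * (A powr (- (n / p)) * b powr (n / p))"
      by (rule mult_left_mono) simp
    also have "\<dots> = A powr (- (n / p)) * (b powr (n / p) * exp (- b))" by simp
    also have "\<dots> \<le> ?U" using uGamma_ge_powr[of "n / p" b] b by (intro mult_left_mono) auto
    finally show ?thesis by simp
  qed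
  show ?thesis
  proof (cases "A / R ^ p \<ge> b")
    case True then show ?thesis using low'[of \<epsilon> R] \<epsilon> by simp
  next
    case False
    then have b0: "b > 0" using A \<epsilon> by (smt (verit) divide_pos_pos zero_less_power)
    define x where "x = (A / b) powr (1 / p)"
    have x0: "x > 0" using A b0 by (simp add: x_def)
    have "x ^ p = A / b" using A b0 p by (simp add: x_def powr_realpow[symmetric] powr_powr)
    then have xb: "A / x ^ p = b" using A b0 by simp
    show ?thesis
    proof (cases "A / \<epsilon> ^ p \<le> b")
      case True
      have "integral {\<epsilon>..R} ?D \<le> exp (- b) / \<epsilon> ^ n / n" by (rule high[OF \<epsilon>])
      also have "\<dots> \<le> ?U / n" by (rule divide_right_mono[OF pw[OF \<epsilon>(1) True]]) simp
      finally show ?thesis .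
    next
      case False': False
      have "\<epsilon> < x"
      proof (rule ccontr)
        assume "\<not> \<epsilon> < x"
        then have "x ^ p \<le> \<epsilon> ^ p" using x0 by (intro power_mono) auto
        then have "A / \<epsilon> ^ p \<le> A / x ^ p" using A x0 \<epsilon> by (intro divide_left_mono) auto
        then show False using False' xb by simp
      qed
      moreover have "x < R"
      proof (rule ccontr)
        assume "\<not> x < R"
        then have "R ^ p \<le> x ^ p" using \<epsilon> by (intro power_mono) auto
        then have "A / x ^ p \<le> A / R ^ p" using A x0 \<epsilon> by (intro divide_left_mono) auto
        then show False using False xb by simp
      qed
      ultimately have "integral {\<epsilon>..R} ?D = integral {\<epsilon>..x} ?D + integral {x..R} ?D"
        using I[OF \<epsilon>(1)] by (intro Henstock_Kurzweil_Integration.integral_combine[symmetric]) auto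
      also have "\<dots> \<le> (?U - exp (- b) / x ^ n) / n + exp (- b) / x ^ n / n"
        using \<open>\<epsilon> < x\<close> \<open>x < R\<close> \<epsilon> x0 xb by (intro add_mono low high) auto
      finally show ?thesis by (simp add: diff_divide_distrib)
    qed
  qed
qed

text \<open>Functions that are flat at 0, in the sense that they are bounded by every power, can be integrated against
negative powers up to 0.\<close>

lemma uGamma_flat:
  fixes B R k :: real
  assumes "k \<ge> 0" "B > 0" "p > 0" "R > 0"
  shows "\<exists>K\<ge>0. \<forall>v. 0 < v \<longrightarrow> v \<le> R \<longrightarrow> uGamma k (B / v ^ p) \<le> K * v ^ n"
proof (intro exI conjI allI impI)
  let ?K = "Gamma (k + n + 1) / B ^ n * R ^ ((p - 1) * n)"
  show "0 \<le> ?K" using assms by (auto intro!: mult_nonneg_nonneg divide_nonneg_nonneg Gamma_real_nonneg)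
  fix v assume v: "0 < v" "v \<le> R"
  let ?b = "B / v ^ p"
  have b: "?b > 0" using v assms by simp
  have "?b ^ n * uGamma k ?b \<le> Gamma (k + n + 1)"
    using uGamma_shift[of k n ?b] uGamma_le_Gamma[of "k + n" ?b] b assms
    by (simp add: powr_realpow)
  then have "uGamma k ?b \<le> Gamma (k + n + 1) / ?b ^ n"
    using b by (simp add: pos_le_divide_eq mult.commute)
  also have "\<dots> = Gamma (k + n + 1) / B ^ n * v ^ (p * n)"
    by (simp add: power_divide power_mult)
  also have "p * n = (p - 1) * n + n" using assms by (simp add: algebra_simps)
  also have "Gamma (k + n + 1) / B ^ n * v ^ ((p - 1) * n + n) \<le> Gamma (k + n + 1) / B ^ n * (R ^ ((p - 1) * n) * v ^ n)"
    unfolding power_add using v assms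
    by (intro mult_left_mono mult_right_mono power_mono divide_nonneg_nonneg Gamma_real_nonneg) auto
  finally show "uGamma k ?b \<le> ?K * v ^ n" by simp
qed

lemma exp_flat:
  assumes "A > 0" "p > 0" "(R::real) > 0"
  shows "\<exists>K\<ge>0. \<forall>v. 0 < v \<longrightarrow> v \<le> R \<longrightarrow> exp (- (A / v ^ p)) \<le> K * v ^ n"
  using uGamma_flat[of 0 A p R n] assms by (simp add: uGamma_0_exp)

lemma continuous_on_Icc_flat:
  fixes f :: "real \<Rightarrow> complex"
  assumes "continuous_on {0<..R} f" "f 0 = 0" "\<And>t. 0 < t \<Longrightarrow> t \<le> R \<Longrightarrow> norm (f t) \<le> K * t"
  shows "continuous_on {0..R} f"
  unfolding continuous_on_eq_continuous_within
proof
  fix x assume x: "x \<in> {0..R}"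
  show "continuous (at x within {0..R}) f"
  proof (cases "x = 0")
    case True
    have "(f \<longlongrightarrow> 0) (at 0 within {0..R})"
    proof (rule Lim_null_comparison)
      show "\<forall>\<^sub>F t in at 0 within {0..R}. norm (f t) \<le> K * t"
        unfolding eventually_at_filter using assms(3) by (auto intro!: always_eventually)
      show "((\<lambda>t. K * t) \<longlongrightarrow> 0) (at 0 within {0..R})"
        by (auto intro!: tendsto_eq_intros)
    qed
    then show ?thesis using True assms(2) by (simp add: continuous_within)
  next
    case False
    then have "x \<in> {0<..R}" using x by auto
    then have "continuous (at x within {0<..R}) f"
      using assms(1) continuous_on_eq_continuous_within by blast
    moreover have "at x within {0<..R} = at x within {0..R}"
    proof (rule at_within_nhd[of _ "{0<..}"])
      show "x \<in> {0<..}" using False x by auto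
    qed auto
    ultimately show ?thesis by simp
  qed
qed

lemma tendsto_integral_Icc_0:
  fixes f :: "real \<Rightarrow> complex"
  assumes "continuous_on {0..R} f" "0 < R"
  shows "((\<lambda>\<epsilon>. integral {\<epsilon>..R} f) \<longlongrightarrow> integral {0..R} f) (at_right 0)"
proof -
  have "continuous_on {0..R} (\<lambda>x. integral {x..R} f)"
    by (rule indefinite_integral_continuous_1'[OF integrable_continuous_interval[OF assms(1)]])
  then have "((\<lambda>\<epsilon>. integral {\<epsilon>..R} f) \<longlongrightarrow> integral {0..R} f) (at 0 within {0..R})"
    using assms(2) by (auto simp: continuous_on_def)
  moreover have "at 0 within {0..R} = at_right 0"
    using assms(2) by (simp add: at_within_Icc_at_right)
  ultimately show ?thesis by simp
qed

lemma norm_integral_Icc_0_le: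
  fixes f :: "real \<Rightarrow> complex"
  assumes cont: "continuous_on {0..R} f" and R: "0 < R"
    and le: "\<And>t. 0 < t \<Longrightarrow> t \<le> R \<Longrightarrow> norm (f t) \<le> g t"
    and g: "\<And>\<epsilon>. 0 < \<epsilon> \<Longrightarrow> \<epsilon> \<le> R \<Longrightarrow> g integrable_on {\<epsilon>..R} \<and> integral {\<epsilon>..R} g \<le> I"
  shows "norm (integral {0..R} f) \<le> I"
proof (rule tendsto_upperbound)
  show "((\<lambda>\<epsilon>. norm (integral {\<epsilon>..R} f)) \<longlongrightarrow> norm (integral {0..R} f)) (at_right 0)"
    by (intro tendsto_norm tendsto_integral_Icc_0 cont R)
  show "\<forall>\<^sub>F \<epsilon> in at_right 0. norm (integral {\<epsilon>..R} f) \<le> I"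
    unfolding eventually_at_right_field
  proof (intro exI[of _ R] conjI R allI impI)
    fix \<epsilon> assume \<epsilon>: "0 < \<epsilon>" "\<epsilon> < R"
    have "norm (integral {\<epsilon>..R} f) \<le> integral {\<epsilon>..R} g"
    proof (rule integral_norm_bound_integral)
      show "f integrable_on {\<epsilon>..R}"
        by (rule integrable_continuous_interval, rule continuous_on_subset[OF cont]) (use \<epsilon> in auto)
      show "g integrable_on {\<epsilon>..R}" using g \<epsilon> by auto
      show "norm (f x) \<le> g x" if "x \<in> {\<epsilon>..R}" for x using le[of x] that \<epsilon> by auto
    qed
    then show "norm (integral {\<epsilon>..R} f) \<le> I" using g[of \<epsilon>] \<epsilon> by auto
  qed
qed simp

text \<open>The distance of points on two rays with angle at least \<open>\<kappa>\<close> is bounded below by their moduli, since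
\<open>s\<^sup>2 + r\<^sup>2 - 2 s r cos \<kappa> \<ge> (1 - cos \<kappa>) (s\<^sup>2 + r\<^sup>2)\<close>.\<close>

lemma norm_cis_diff_ge:
  fixes s r \<theta> \<tau> \<kappa> :: real
  assumes "\<kappa> \<le> \<theta> - \<tau>" "\<theta> - \<tau> \<le> 2 * pi - \<kappa>" "0 < \<kappa>" "\<kappa> \<le> pi / 2" "0 \<le> s" "0 \<le> r"
  shows "sqrt (1 - cos \<kappa>) * s \<le> cmod (of_real s * cis \<theta> - of_real r * cis \<tau>)"
    and "sqrt (1 - cos \<kappa>) * r \<le> cmod (of_real s * cis \<theta> - of_real r * cis \<tau>)"
proof -
  have c0: "0 \<le> cos \<kappa>" "cos \<kappa> \<le> 1" using assms by (auto intro!: cos_ge_zero)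
  have cos: "cos (\<theta> - \<tau>) \<le> cos \<kappa>"
  proof (cases "\<theta> - \<tau> \<le> pi")
    case True then show ?thesis using assms by (intro cos_monotone_0_pi_le) auto
  next
    case False
    have "cos (2 * pi - (\<theta> - \<tau>)) \<le> cos \<kappa>" using assms False by (intro cos_monotone_0_pi_le) auto
    then show ?thesis by (simp add: cos_diff)
  qed
  have "(cmod (of_real s * cis \<theta> - of_real r * cis \<tau>))\<^sup>2
      = (s * cos \<theta> - r * cos \<tau>)\<^sup>2 + (s * sin \<theta> - r * sin \<tau>)\<^sup>2"
    by (simp add: cmod_power2)
  also have "\<dots> = s\<^sup>2 * ((cos \<theta>)\<^sup>2 + (sin \<theta>)\<^sup>2) + r\<^sup>2 * ((cos \<tau>)\<^sup>2 + (sin \<tau>)\<^sup>2) - 2 * s * r * cos (\<theta> - \<tau>)"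
    unfolding cos_diff by algebra
  also have "\<dots> = s\<^sup>2 + r\<^sup>2 - 2 * s * r * cos (\<theta> - \<tau>)" by simp
  also have "\<dots> \<ge> s\<^sup>2 + r\<^sup>2 - (2 * s * r) * cos \<kappa>"
    using mult_left_mono[OF cos, of "2 * s * r"] assms by simp
  moreover have "(2 * s * r) * cos \<kappa> \<le> (s\<^sup>2 + r\<^sup>2) * cos \<kappa>"
    using sum_squares_bound[of s r] c0 by (intro mult_right_mono) auto
  ultimately have ge: "(1 - cos \<kappa>) * (s\<^sup>2 + r\<^sup>2) \<le> (cmod (of_real s * cis \<theta> - of_real r * cis \<tau>))\<^sup>2"
    by (simp add: algebra_simps)
  have "(sqrt (1 - cos \<kappa>) * s)\<^sup>2 \<le> (1 - cos \<kappa>) * (s\<^sup>2 + r\<^sup>2)"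
       "(sqrt (1 - cos \<kappa>) * r)\<^sup>2 \<le> (1 - cos \<kappa>) * (s\<^sup>2 + r\<^sup>2)"
    using c0 by (auto simp: power_mult_distrib intro!: mult_left_mono)
  then show "sqrt (1 - cos \<kappa>) * s \<le> cmod (of_real s * cis \<theta> - of_real r * cis \<tau>)"
    "sqrt (1 - cos \<kappa>) * r \<le> cmod (of_real s * cis \<theta> - of_real r * cis \<tau>)"
    using ge by (auto intro: power2_le_imp_le order_trans)
qed

lemma one_minus_cos_pos: "0 < \<kappa> \<Longrightarrow> \<kappa> \<le> pi / 2 \<Longrightarrow> 0 < 1 - cos \<kappa>"
  using cos_monotone_0_pi[of 0 \<kappa>] by simp

lemma kernel_expansion:
  fixes U X :: complex
  assumes "U \<noteq> 0" "U \<noteq> X"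
  shows "U / (U - X) = (\<Sum>n<N. (X / U) ^ n) + (X / U) ^ N * (U / (U - X))"
proof -
  define q where "q = X / U"
  have q: "q \<noteq> 1" using assms by (simp add: q_def)
  then have "(\<Sum>n<N. q ^ n) = (q ^ N - 1) / (q - 1)" by (rule geometric_sum)
  moreover have "U / (U - X) = 1 / (1 - q)" using assms by (simp add: field_simps q_def)
  moreover have "1 / (1 - q) = (q ^ N - 1) / (q - 1) + q ^ N * (1 / (1 - q))"
    using q by (simp add: divide_simps) (simp add: algebra_simps)
  ultimately show ?thesis unfolding q_def by metis
qed

text \<open>A sequence tending to 0 suffices for the uniqueness of asymptotic expansions. This is used to identify
coefficients that were chosen separately for each parameter.\<close>

lemma expansion_unique:
  fixes e :: "nat \<Rightarrow> complex" and \<eta> :: "nat \<Rightarrow> complex"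
  assumes lim: "\<eta> \<longlonglongrightarrow> 0" and nz: "\<And>i. \<eta> i \<noteq> 0"
    and le: "\<And>N. \<exists>K. \<forall>\<^sub>F i in sequentially. cmod (\<Sum>n<Suc N. e n * \<eta> i ^ n) \<le> K * cmod (\<eta> i) ^ Suc N"
  shows "e n = 0"
proof (induction n rule: less_induct)
  case (less n)
  obtain K where K: "\<forall>\<^sub>F i in sequentially. cmod (\<Sum>k<Suc n. e k * \<eta> i ^ k) \<le> K * cmod (\<eta> i) ^ Suc n"
    using le by blast
  have "((\<lambda>i. e n) \<longlongrightarrow> 0) sequentially"
  proof (rule Lim_null_comparison)
    show "\<forall>\<^sub>F i in sequentially. cmod (e n) \<le> K * cmod (\<eta> i)"
      using K
    proof eventually_elim
      case (elim i)
      have "(\<Sum>k<Suc n. e k * \<eta> i ^ k) = e n * \<eta> i ^ n" using less by simp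
      then have "cmod (e n) * cmod (\<eta> i) ^ n \<le> (K * cmod (\<eta> i)) * cmod (\<eta> i) ^ n"
        using elim by (simp add: norm_mult norm_power mult_ac)
      then show ?case using nz[of i] by (simp add: mult_le_cancel_right)
    qed
    show "(\<lambda>i. K * cmod (\<eta> i)) \<longlonglongrightarrow> 0"
      using tendsto_mult_left[OF tendsto_norm[OF lim], of K] by simp
  qed
  then show ?case by (simp add: tendsto_const_iff)
qed

section \<open>The Cauchy-Heine representation with explicit Gevrey bounds\<close>

definition polar_sector :: "real \<Rightarrow> real \<Rightarrow> real \<Rightarrow> complex set" where
  "polar_sector t h R = {of_real r * cis \<tau> |r \<tau>. 0 < r \<and> r \<le> R \<and> \<bar>\<tau> - t\<bar> \<le> h}"

lemma polar_sectorI: "0 < r \<Longrightarrow> r \<le> R \<Longrightarrow> \<bar>\<tau> - t\<bar> \<le> h \<Longrightarrow> of_real r * cis \<tau> \<in> polar_sector t h R"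
  unfolding polar_sector_def by blast

lemma polar_sector_norm: "\<eta> \<in> polar_sector t h R \<Longrightarrow> 0 < cmod \<eta> \<and> cmod \<eta> \<le> R"
  by (auto simp: polar_sector_def norm_mult)

lemma kernel_integral_split:
  fixes w U :: "real \<Rightarrow> complex"
  assumes nz: "\<And>s. s \<in> {a..b} \<Longrightarrow> w s = 0 \<or> (U s \<noteq> 0 \<and> U s \<noteq> \<eta>)"
    and int: "\<And>n. n < N \<Longrightarrow> (\<lambda>s. w s * (1 / U s ^ n)) integrable_on {a..b}"
    and intN: "(\<lambda>s. w s * ((\<eta> / U s) ^ N * (U s / (U s - \<eta>)))) integrable_on {a..b}"
  shows "integral {a..b} (\<lambda>s. w s * (U s / (U s - \<eta>))) =
     (\<Sum>n<N. integral {a..b} (\<lambda>s. w s * (1 / U s ^ n)) * \<eta> ^ n)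
     + integral {a..b} (\<lambda>s. w s * ((\<eta> / U s) ^ N * (U s / (U s - \<eta>))))"
proof -
  have "integral {a..b} (\<lambda>s. w s * (U s / (U s - \<eta>))) =
    integral {a..b} (\<lambda>s. (\<Sum>n<N. w s * (1 / U s ^ n) * \<eta> ^ n) + w s * ((\<eta> / U s) ^ N * (U s / (U s - \<eta>))))"
  proof (rule integral_cong)
    fix s assume "s \<in> {a..b}"
    from nz[OF this] show "w s * (U s / (U s - \<eta>)) =
       (\<Sum>n<N. w s * (1 / U s ^ n) * \<eta> ^ n) + w s * ((\<eta> / U s) ^ N * (U s / (U s - \<eta>)))"
    proof
      assume "U s \<noteq> 0 \<and> U s \<noteq> \<eta>"
      then have "w s * (U s / (U s - \<eta>)) = w s * ((\<Sum>n<N. (\<eta> / U s) ^ n) + (\<eta> / U s) ^ N * (U s / (U s - \<eta>)))"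
        using kernel_expansion[of "U s" \<eta> N] by metis
      also have "\<dots> = (\<Sum>n<N. w s * (\<eta> / U s) ^ n) + w s * ((\<eta> / U s) ^ N * (U s / (U s - \<eta>)))"
        by (simp only: distrib_left sum_distrib_left)
      also have "(\<Sum>n<N. w s * (\<eta> / U s) ^ n) = (\<Sum>n<N. w s * (1 / U s ^ n) * \<eta> ^ n)"
        by (simp add: power_divide)
      finally show ?thesis .
    qed simp
  qed
  also have "\<dots> = integral {a..b} (\<lambda>s. \<Sum>n<N. w s * (1 / U s ^ n) * \<eta> ^ n)
      + integral {a..b} (\<lambda>s. w s * ((\<eta> / U s) ^ N * (U s / (U s - \<eta>))))"
    by (intro integral_add integrable_sum intN integrable_on_mult_left int) auto
  also have "integral {a..b} (\<lambda>s. \<Sum>n<N. w s * (1 / U s ^ n) * \<eta> ^ n)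
      = (\<Sum>n<N. integral {a..b} (\<lambda>s. w s * (1 / U s ^ n) * \<eta> ^ n))"
    by (intro integral_sum integrable_on_mult_left int) auto
  finally show ?thesis by (simp only: integral_mult_left)
qed

text \<open>The functions \<open>G t\<close>, indexed by a direction \<open>t\<close>, live on closed sectors with bisector \<open>t\<close>, half-opening
\<open>pi / m\<close> and radius \<open>R\<close>. Besides the usual flatness \<open>exp (- A / \<bar>\<eta>\<bar>^p)\<close> of the differences an overall
size \<open>exp (- b)\<close> is recorded; it becomes \<open>exp (- B \<bar>U\<bar>^p)\<close> when the family depends on a point \<open>U\<close>.\<close>

locale gevrey_family =
  fixes G :: "real \<Rightarrow> complex \<Rightarrow> complex" and m p :: nat and R C A b :: real
  assumes m: "m > 0" and p: "p > 0" and R: "R > 0" and C: "C \<ge> 0" and A: "A > 0" and b: "b \<ge> 0"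
    and hol: "G t holomorphic_on polar_sector t (pi / m) R"
    and bnd: "\<eta> \<in> polar_sector t (pi / m) R \<Longrightarrow> cmod (G t \<eta>) \<le> C * exp (- b)"
    and diff: "\<eta> \<in> polar_sector t (pi / m) R \<Longrightarrow> \<eta> \<in> polar_sector t' (pi / m) R \<Longrightarrow>
       cmod (G t \<eta> - G t' \<eta>) \<le> C * min (exp (- (A / cmod \<eta> ^ p))) (exp (- b))"
begin

text \<open>Starting from the direction \<open>t\<close>, the \<open>m\<close> functions \<open>branch t i\<close> cover one turn. Neighbouring branches
meet along the ray in the direction \<open>dir t (Suc i)\<close>, where the density of the Cauchy-Heine integral is
\<open>jump t i\<close>. The coefficients are what one gets by expanding the kernel \<open>U / (U - \<eta>)\<close> in powers of \<open>\<eta>\<close>.\<close>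

definition h :: real where "h = pi / m"
definition dir :: "real \<Rightarrow> nat \<Rightarrow> real" where "dir t i = t - h + 2 * h * i"
definition branch :: "real \<Rightarrow> nat \<Rightarrow> complex \<Rightarrow> complex" where
  "branch t i = (if i < m then G (t + 2 * h * i) else G t)"
definition raypt :: "real \<Rightarrow> nat \<Rightarrow> real \<Rightarrow> complex" where "raypt t i s = of_real s * cis (dir t (Suc i))"
definition jump :: "real \<Rightarrow> nat \<Rightarrow> real \<Rightarrow> complex" where
  "jump t i s = (branch t (Suc i) (raypt t i s) - branch t i (raypt t i s)) / of_real s"
definition coef :: "real \<Rightarrow> nat \<Rightarrow> complex" where
  "coef t n = ((\<Sum>i<m. \<i> * integral {dir t i..dir t (Suc i)} (\<lambda>s. branch t i (of_real R * cis s) * (1 / (of_real R * cis s) ^ n)))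
     + (\<Sum>i<m. integral {0..R} (\<lambda>s. jump t i s * (1 / raypt t i s ^ n)))) / (2 * pi * \<i>)"

definition coef_size :: "nat \<Rightarrow> real" where
  "coef_size n = exp (- b) / R ^ n + A powr (- (real n / real p)) * uGamma (n / p) b / n"

lemma h: "h > 0" "h \<le> pi" "m * h = pi"
  using m by (auto simp: h_def field_simps)

lemma dir_m: "dir t m = dir t 0 + 2 * pi"
  using h(3) by (simp add: dir_def algebra_simps)

lemma ray_mem:
  assumes "i < m" "0 < s" "s \<le> R"
  shows "raypt t i s \<in> polar_sector (t + 2 * h * i) h R"
    and "Suc i < m \<Longrightarrow> raypt t i s \<in> polar_sector (t + 2 * h * (Suc i)) h R"
    and "Suc i = m \<Longrightarrow> raypt t i s \<in> polar_sector t h R"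
proof -
  show "raypt t i s \<in> polar_sector (t + 2 * h * i) h R"
    unfolding raypt_def using h assms by (intro polar_sectorI) (auto simp: dir_def algebra_simps)
  show "raypt t i s \<in> polar_sector (t + 2 * h * (Suc i)) h R"
    unfolding raypt_def using h assms by (intro polar_sectorI) (auto simp: dir_def algebra_simps)
  show "raypt t i s \<in> polar_sector t h R" if "Suc i = m"
  proof -
    have "raypt t i s = of_real s * cis (dir t 0)"
      using dir_m[of t] that by (simp add: raypt_def flip: cis_mult)
    also have "\<dots> \<in> polar_sector t h R"
      using h assms by (intro polar_sectorI) (auto simp: dir_def)
    finally show ?thesis .
  qed
qed

lemma ray_diff:
  assumes "i < m" "0 < s" "s \<le> R"
  shows "cmod (jump t i s) \<le> C * min (exp (- (A / s ^ p))) (exp (- b)) / s"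
proof -
  have z: "cmod (raypt t i s) = s" using assms by (simp add: raypt_def norm_mult)
  have "cmod (branch t (Suc i) (raypt t i s) - branch t i (raypt t i s)) \<le> C * min (exp (- (A / s ^ p))) (exp (- b))"
  proof (cases "Suc i < m")
    case True
    then show ?thesis using diff[of "raypt t i s" "t + 2 * h * (Suc i)" "t + 2 * h * i"] ray_mem[OF assms]
      assms z unfolding h_def[symmetric] by (simp add: branch_def)
  next
    case False
    then have "Suc i = m" using assms by simp
    then show ?thesis using diff[of "raypt t i s" t "t + 2 * h * i"] ray_mem[OF assms]
      assms z unfolding h_def[symmetric] by (simp add: branch_def)
  qed
  then show ?thesis using assms by (simp add: jump_def norm_divide divide_right_mono)
qed

lemma jump_0: "jump t i 0 = 0" by (simp add: jump_def)

lemma cont_G: "continuous_on (polar_sector t h R) (G t)"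
  using holomorphic_on_imp_continuous_on[OF hol] by (simp add: h_def)

lemma cont_jump:
  assumes "i < m" shows "continuous_on {0<..R} (jump t i)"
proof -
  have zc: "continuous_on {0<..R} (raypt t i)" unfolding raypt_def by (intro continuous_intros)
  have "continuous_on {0<..R} (\<lambda>s. branch t i (raypt t i s))"
    using ray_mem(1)[OF assms] assms
    by (auto simp: branch_def intro!: continuous_on_compose2[OF cont_G zc])
  moreover have "continuous_on {0<..R} (\<lambda>s. branch t (Suc i) (raypt t i s))"
  proof (cases "Suc i < m")
    case True
    then show ?thesis using ray_mem(2)[OF assms _ _ True]
      by (auto simp: branch_def simp del: of_nat_Suc intro!: continuous_on_compose2[OF cont_G zc])
  next
    case False
    then have "Suc i = m" using assms by simp
    moreover have "branch t (Suc i) = G t" using False by (simp add: branch_def)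
    moreover have "raypt t i ` {0<..R} \<subseteq> polar_sector t h R"
      using ray_mem(3)[OF assms _ _ \<open>Suc i = m\<close>] by (simp add: image_subset_iff)
    ultimately show ?thesis
      using continuous_on_compose2[OF cont_G zc] by simp
  qed
  ultimately show ?thesis unfolding jump_def by (intro continuous_intros) auto
qed

lemma cont_ray:
  assumes i: "i < m" and \<phi>: "continuous_on {0<..R} \<phi>"
    and le: "\<And>s. 0 < s \<Longrightarrow> s \<le> R \<Longrightarrow> cmod (\<phi> s) \<le> K / s ^ n"
  shows "continuous_on {0..R} (\<lambda>s. jump t i s * \<phi> s)"
proof -
  obtain K' where K': "K' \<ge> 0" "\<And>s. 0 < s \<Longrightarrow> s \<le> R \<Longrightarrow> exp (- (A / s ^ p)) \<le> K' * s ^ (n + 2)"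
    using exp_flat[OF A p R, of "n + 2"] by blast
  show ?thesis
  proof (rule continuous_on_Icc_flat)
    show "continuous_on {0<..R} (\<lambda>s. jump t i s * \<phi> s)" by (intro continuous_intros cont_jump i \<phi>)
    fix s assume s: "0 < s" "s \<le> R"
    have "cmod (jump t i s) \<le> C * min (exp (- (A / s ^ p))) (exp (- b)) / s" by (rule ray_diff[OF i s])
    also have "\<dots> \<le> C * (K' * s ^ (n + 2)) / s"
      using s C K'(2)[OF s] by (intro divide_right_mono mult_left_mono) auto
    finally have 1: "cmod (jump t i s) \<le> C * K' * s ^ (n + 1)" using s by simp
    have "cmod (jump t i s * \<phi> s) \<le> (C * K' * s ^ (n + 1)) * (K / s ^ n)"
      unfolding norm_mult by (intro mult_mono 1 le s) (use C K' s in auto)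
    also have "\<dots> = (C * K' * K) * s" using s by simp
    finally show "cmod (jump t i s * \<phi> s) \<le> (C * K' * K) * s" .
  qed (simp add: jump_0)
qed

lemma ray_bound:
  assumes i: "i < m" and \<phi>: "continuous_on {0<..R} \<phi>" and n: "n > 0"
    and le: "\<And>s. 0 < s \<Longrightarrow> s \<le> R \<Longrightarrow> cmod (\<phi> s) \<le> K / s ^ n"
  shows "cmod (integral {0..R} (\<lambda>s. jump t i s * \<phi> s)) \<le> K * (C * (A powr (- (real n / real p)) * uGamma (n / p) b / n))"
proof (rule norm_integral_Icc_0_le[OF cont_ray[OF i \<phi> le] R])
  let ?D = "\<lambda>t. min (exp (- (A / t ^ p))) (exp (- b)) / t ^ (n + 1)"
  have "0 \<le> cmod (\<phi> R)" by simp
  also have "\<dots> \<le> K / R ^ n" by (rule le) (use R in auto)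
  finally have "0 \<le> K / R ^ n * R ^ n" using R by (intro mult_nonneg_nonneg) auto
  then have K: "K \<ge> 0" using R by simp
  fix s assume s: "0 < s" "s \<le> R"
  have "cmod (jump t i s * \<phi> s) \<le> (C * min (exp (- (A / s ^ p))) (exp (- b)) / s) * (K / s ^ n)"
    unfolding norm_mult by (intro mult_mono ray_diff i le s) (use C s in \<open>auto intro!: divide_nonneg_nonneg mult_nonneg_nonneg\<close>)
  then show "cmod (jump t i s * \<phi> s) \<le> (K * C) * ?D s" by (simp add: mult_ac)
next
  let ?D = "\<lambda>t. min (exp (- (A / t ^ p))) (exp (- b)) / t ^ (n + 1)"
  have "0 \<le> cmod (\<phi> R)" by simp
  also have "\<dots> \<le> K / R ^ n" by (rule le) (use R in auto)
  finally have "0 \<le> K / R ^ n * R ^ n" using R by (intro mult_nonneg_nonneg) auto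
  then have K: "K \<ge> 0" using R by simp
  fix \<epsilon> assume \<epsilon>: "0 < \<epsilon>" "\<epsilon> \<le> R"
  have int: "?D integrable_on {\<epsilon>..R}" using min_exp_cont[OF \<epsilon>(1)] by (rule integrable_continuous_interval)
  have "integral {\<epsilon>..R} (\<lambda>s. (K * C) * ?D s) = (K * C) * integral {\<epsilon>..R} ?D" by (rule integral_mult_right)
  also have "\<dots> \<le> (K * C) * (A powr (- (real n / real p)) * uGamma (n / p) b / n)"
    by (intro mult_left_mono min_exp_int_le A p n b \<epsilon>) (use K C in auto)
  also have "\<dots> = K * (C * (A powr (- (real n / real p)) * uGamma (n / p) b / n))" by (rule mult.assoc)
  finally show "(\<lambda>s. (K * C) * ?D s) integrable_on {\<epsilon>..R} \<and>
      integral {\<epsilon>..R} (\<lambda>s. (K * C) * ?D s) \<le> K * (C * (A powr (- (real n / real p)) * uGamma (n / p) b / n))"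
    using integrable_on_mult_right[OF int, of "K * C"] by blast
qed

lemma cont_arc:
  assumes "i < m" shows "continuous_on {dir t i..dir t (Suc i)} (\<lambda>s. branch t i (of_real R * cis s))"
proof -
  have "of_real R * cis s \<in> polar_sector (t + 2 * h * i) h R" if "s \<in> {dir t i..dir t (Suc i)}" for s
    using that h R by (intro polar_sectorI) (auto simp: dir_def algebra_simps abs_le_iff)
  then show ?thesis
    using assms by (auto simp: branch_def intro!: continuous_on_compose2[OF cont_G] continuous_intros)
qed

lemma arc_le:
  assumes "i < m" "s \<in> {dir t i..dir t (Suc i)}" "0 < \<epsilon>" "\<epsilon> \<le> R"
  shows "cmod (branch t i (of_real \<epsilon> * cis s)) \<le> C * exp (- b)"
proof -
  have "of_real \<epsilon> * cis s \<in> polar_sector (t + 2 * h * i) h R"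
    using assms h R by (intro polar_sectorI) (auto simp: dir_def algebra_simps abs_le_iff)
  then show ?thesis using bnd assms by (simp add: branch_def h_def)
qed

lemma dir_Suc: "dir t (Suc i) - dir t i = 2 * h" by (simp add: dir_def algebra_simps)

lemma ray_away:
  assumes i: "i < m" and \<eta>: "\<eta> = of_real r * cis \<tau>" "\<bar>\<tau> - t\<bar> \<le> h / 2" "r > 0" and s: "s \<ge> 0"
  shows "sqrt (1 - cos (h / 2)) * s \<le> cmod (raypt t i s - \<eta>)"
    and "sqrt (1 - cos (h / 2)) * r \<le> cmod (raypt t i s - \<eta>)"
proof -
  have dir: "dir t (Suc i) = t + h + 2 * h * i" by (simp add: dir_def algebra_simps)
  have "h / 2 \<le> dir t (Suc i) - \<tau>"
  proof -
    have "0 \<le> 2 * h * i" using h by simp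
    then show ?thesis using \<eta>(2) h(1) unfolding dir by linarith
  qed
  moreover have "dir t (Suc i) - \<tau> \<le> 2 * pi - h / 2"
  proof -
    have "real (Suc i) * h \<le> m * h" using i h by (intro mult_right_mono) auto
    then have "2 * h * i + 2 * h \<le> 2 * pi" using h(3) by (simp add: algebra_simps)
    then show ?thesis using \<eta>(2) h(1) unfolding dir by linarith
  qed
  ultimately show "sqrt (1 - cos (h / 2)) * s \<le> cmod (raypt t i s - \<eta>)"
    "sqrt (1 - cos (h / 2)) * r \<le> cmod (raypt t i s - \<eta>)"
    unfolding raypt_def \<eta>(1) using h s \<eta> by (intro norm_cis_diff_ge; simp)+
qed

lemma branch_0: "branch t 0 = G t" using m by (simp add: branch_def)
lemma branch_m: "branch t m = branch t 0" using m by (simp add: branch_def)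

lemma raypt_nz: "s > 0 \<Longrightarrow> raypt t i s \<noteq> 0" by (simp add: raypt_def)

lemma cont_raypt: "continuous_on S (raypt t i)" unfolding raypt_def by (intro continuous_intros)

text \<open>Cauchy's formula on \<open>m\<close> annular sectors whose inner radius tends to 0. The branches are bounded and the
kernel \<open>U / (U - \<eta>)\<close> vanishes at \<open>U = 0\<close>, so the inner arcs disappear in the limit.\<close>

lemma cauchy_heine:
  assumes \<eta>: "\<eta> = of_real r * cis \<tau>" "\<bar>\<tau> - t\<bar> \<le> h / 2" "r > 0" "r < R"
  shows "2 * pi * \<i> * G t \<eta> =
    (\<Sum>i<m. \<i> * integral {dir t i..dir t (Suc i)} (\<lambda>s. branch t i (of_real R * cis s) * ((of_real R * cis s) / (of_real R * cis s - \<eta>))))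
    + (\<Sum>i<m. integral {0..R} (\<lambda>s. jump t i s * (raypt t i s / (raypt t i s - \<eta>))))"
    (is "?L = ?Out + ?Ray")
proof -
  define c where "c = sqrt (1 - cos (h / 2))"
  have c0: "c > 0" unfolding c_def using one_minus_cos_pos[of "h/2"] h by simp
  define In where "In = (\<lambda>\<epsilon>. \<Sum>i<m. \<i> * integral {dir t i..dir t (Suc i)} (\<lambda>s. cauchy_kernel (branch t i) \<eta> (of_real \<epsilon> * cis s)))"
  define Ray where "Ray = (\<lambda>\<epsilon>. \<Sum>i<m. integral {\<epsilon>..R} (\<lambda>s. jump t i s * (raypt t i s / (raypt t i s - \<eta>))))"
  have eq: "?L = ?Out - In \<epsilon> + Ray \<epsilon>" if \<epsilon>: "0 < \<epsilon>" "\<epsilon> < r" for \<epsilon>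
  proof -
    have "decomposition_sum \<epsilon> R m (dir t) (branch t) \<eta> = 2 * pi * \<i> * branch t 0 \<eta>"
    proof (rule decomposition_sum_inside[OF \<epsilon> \<eta>(4) m _ dir_m branch_m _ \<eta>(1)])
      show "dir t i < dir t (Suc i)" if "i < m" for i using h by (simp add: dir_def)
      have "dir t 0 = t - h" "dir t 1 = t + h" by (auto simp: dir_def)
      then show "dir t 0 < \<tau>" "\<tau> < dir t 1" using \<eta>(2) h(1) by linarith+
      show "branch t i holomorphic_on annular_sector \<epsilon> R (dir t i) (dir t (Suc i))" if i: "i < m" for i
      proof -
        have "G (t + 2 * h * i) holomorphic_on annular_sector \<epsilon> R (dir t i) (dir t (Suc i))"
        proof (rule holomorphic_on_subset[OF hol])
          show "annular_sector \<epsilon> R (dir t i) (dir t (Suc i)) \<subseteq> polar_sector (t + 2 * h * i) (pi / m) R"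
          proof
            fix x assume "x \<in> annular_sector \<epsilon> R (dir t i) (dir t (Suc i))"
            then obtain s \<phi> where x: "x = of_real s * cis \<phi>" "s \<in> {\<epsilon>..R}" "\<phi> \<in> {dir t i..dir t (Suc i)}"
              unfolding annular_sector_def by blast
            then have "\<bar>\<phi> - (t + 2 * h * i)\<bar> \<le> h"
              by (auto simp: dir_def algebra_simps abs_le_iff)
            then show "x \<in> polar_sector (t + 2 * h * i) (pi / m) R"
              unfolding x(1) h_def[symmetric] using x \<epsilon> by (intro polar_sectorI) auto
          qed
        qed
        then show ?thesis using i by (simp add: branch_def)
      qed
    qed
    moreover have "cauchy_kernel (\<lambda>U. branch t (Suc i) U - branch t i U) \<eta> (of_real s * cis (dir t (Suc i))) / of_real s
        = jump t i s * (raypt t i s / (raypt t i s - \<eta>))" for i s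
      by (simp add: cauchy_kernel_def jump_def raypt_def)
    ultimately show ?thesis
      by (simp add: decomposition_sum_def In_def Ray_def branch_0) (simp add: cauchy_kernel_def)
  qed
  have In0: "(In \<longlongrightarrow> 0) (at_right 0)"
  proof (rule Lim_null_comparison)
    show "\<forall>\<^sub>F \<epsilon> in at_right 0. norm (In \<epsilon>) \<le> (m * (2 * h * (C * exp (- b) / (r / 2)))) * \<epsilon>"
      unfolding eventually_at_right_field
    proof (intro exI[of _ "r / 2"] conjI allI impI)
      fix \<epsilon> assume \<epsilon>: "0 < \<epsilon>" "\<epsilon> < r / 2"
      have "norm (In \<epsilon>) \<le> (\<Sum>i<m. 2 * h * (C * exp (- b) * \<epsilon> / (r / 2)))"
        unfolding In_def
      proof (rule sum_norm_le)
        fix i assume "i \<in> {..<m}"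
        then have i: "i < m" by simp
        have le: "cmod (cauchy_kernel (branch t i) \<eta> (of_real \<epsilon> * cis s)) \<le> C * exp (- b) * \<epsilon> / (r / 2)"
          if "s \<in> {dir t i..dir t (Suc i)}" for s
        proof -
          have "r / 2 \<le> cmod \<eta> - cmod (of_real \<epsilon> * cis s)" using \<epsilon> \<eta> by (simp add: norm_mult)
          also have "\<dots> \<le> cmod (of_real \<epsilon> * cis s - \<eta>)"
            by (metis norm_minus_commute norm_triangle_ineq2)
          finally have d: "r / 2 \<le> cmod (of_real \<epsilon> * cis s - \<eta>)" .
          have "cmod (branch t i (of_real \<epsilon> * cis s)) * \<epsilon> \<le> C * exp (- b) * \<epsilon>"
            using arc_le[OF i that] \<epsilon> \<eta> by (intro mult_right_mono) auto
          then show ?thesis unfolding cauchy_kernel_def norm_divide norm_mult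
            using d \<epsilon> \<eta> C by (intro frac_le) auto
        qed
        have "cmod (integral {dir t i..dir t (Suc i)} (\<lambda>s. cauchy_kernel (branch t i) \<eta> (of_real \<epsilon> * cis s)))
            \<le> (C * exp (- b) * \<epsilon> / (r / 2)) * (dir t (Suc i) - dir t i)"
        proof (rule integral_bound)
          show "continuous_on {dir t i..dir t (Suc i)} (\<lambda>s. cauchy_kernel (branch t i) \<eta> (of_real \<epsilon> * cis s))"
            unfolding cauchy_kernel_def
          proof (intro continuous_intros)
            have "of_real \<epsilon> * cis s \<in> polar_sector (t + 2 * h * i) h R" if "s \<in> {dir t i..dir t (Suc i)}" for s
              using that h R \<epsilon> \<eta> by (intro polar_sectorI) (auto simp: dir_def algebra_simps abs_le_iff)
            then show "continuous_on {dir t i..dir t (Suc i)} (\<lambda>s. branch t i (of_real \<epsilon> * cis s))"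
              using i by (auto simp: branch_def intro!: continuous_on_compose2[OF cont_G] continuous_intros)
            have "cmod (of_real \<epsilon> * cis s) \<noteq> cmod \<eta>" for s using \<epsilon> \<eta> by (simp add: norm_mult)
            then show "\<forall>s\<in>{dir t i..dir t (Suc i)}. of_real \<epsilon> * cis s - \<eta> \<noteq> 0" by force
          qed
          show "dir t i \<le> dir t (Suc i)" using h by (simp add: dir_def)
        qed (use le in auto)
        then show "cmod (\<i> * integral {dir t i..dir t (Suc i)} (\<lambda>s. cauchy_kernel (branch t i) \<eta> (of_real \<epsilon> * cis s)))
           \<le> 2 * h * (C * exp (- b) * \<epsilon> / (r / 2))"
          by (simp add: norm_mult dir_Suc mult_ac)
      qed
      then show "norm (In \<epsilon>) \<le> (m * (2 * h * (C * exp (- b) / (r / 2)))) * \<epsilon>" by (simp add: mult_ac)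
    qed (use \<eta> in simp)
    show "((\<lambda>\<epsilon>. (m * (2 * h * (C * exp (- b) / (r / 2)))) * \<epsilon>) \<longlongrightarrow> 0) (at_right 0)"
      by (rule tendsto_mult_right_zero[OF tendsto_ident_at])
  qed
  have Ray0: "(Ray \<longlongrightarrow> ?Ray) (at_right 0)"
    unfolding Ray_def
  proof (intro tendsto_sum tendsto_integral_Icc_0 R)
    fix i assume "i \<in> {..<m}"
    then have i: "i < m" by simp
    note aw = ray_away[OF i \<eta>(1-3)]
    show "continuous_on {0..R} (\<lambda>s. jump t i s * (raypt t i s / (raypt t i s - \<eta>)))"
    proof (rule cont_ray[OF i, where K = "1 / c" and n = 0])
      have "raypt t i s \<noteq> \<eta>" if "s \<ge> 0" for s
      proof -
        have "c * r \<le> cmod (raypt t i s - \<eta>)" using aw(2)[OF that] by (simp only: c_def)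
        moreover have "0 < c * r" using c0 \<eta> by simp
        ultimately show ?thesis by force
      qed
      then show "continuous_on {0<..R} (\<lambda>s. raypt t i s / (raypt t i s - \<eta>))"
        by (intro continuous_intros cont_raypt) auto
      fix s assume s: "0 < s" "s \<le> R"
      have "cmod (raypt t i s - \<eta>) \<ge> c * s" using aw(1)[of s] s by (simp add: c_def)
      moreover have cs: "0 < c * s" using c0 s by simp
      ultimately have "s / cmod (raypt t i s - \<eta>) \<le> s / (c * s)"
        using s c0 by (intro divide_left_mono mult_pos_pos) linarith+
      then show "cmod (raypt t i s / (raypt t i s - \<eta>)) \<le> 1 / c / s ^ 0"
        using s by (simp add: norm_divide raypt_def norm_mult)
    qed
  qed
  have "((\<lambda>\<epsilon>. ?Out - In \<epsilon> + Ray \<epsilon>) \<longlongrightarrow> ?Out - 0 + ?Ray) (at_right 0)"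
    by (intro tendsto_intros In0 Ray0)
  moreover have "\<forall>\<^sub>F \<epsilon> in at_right 0. ?Out - In \<epsilon> + Ray \<epsilon> = ?L"
    unfolding eventually_at_right_field using eq \<eta>(3) by (intro exI[of _ r]) auto
  ultimately have "((\<lambda>\<epsilon>. ?L) \<longlongrightarrow> ?Out - 0 + ?Ray) (at_right (0::real))"
    by (rule Lim_transform_eventually)
  then have "?L = ?Out - 0 + ?Ray" by (simp add: tendsto_const_iff)
  then show ?thesis by simp
qed

definition rem_const :: "real \<Rightarrow> real" where "rem_const q = 1 / (1 - q) + m / sqrt (1 - cos (h / 2))"

lemma coeff_le:
  assumes n: "n > 0"
  shows "cmod (coef t n) \<le> (1 + m) * C * coef_size n"
proof -
  let ?a = "A powr (- (real n / real p)) * uGamma (n / p) b / n"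
  have a: "?a \<ge> 0" using uGamma_nonneg[of "n/p" b] b by simp
  have 1: "cmod (\<Sum>i<m. \<i> * integral {dir t i..dir t (Suc i)} (\<lambda>s. branch t i (of_real R * cis s) * (1 / (of_real R * cis s) ^ n)))
     \<le> (\<Sum>i<m. (C * exp (- b) / R ^ n) * (2 * h))"
  proof (rule sum_norm_le)
    fix i assume "i \<in> {..<m}"
    then have i: "i < m" by simp
    have "cmod (integral {dir t i..dir t (Suc i)} (\<lambda>s. branch t i (of_real R * cis s) * (1 / (of_real R * cis s) ^ n)))
       \<le> (C * exp (- b) / R ^ n) * (dir t (Suc i) - dir t i)"
    proof (rule integral_bound)
      show "dir t i \<le> dir t (Suc i)" using h by (simp add: dir_def)
      show "continuous_on {dir t i..dir t (Suc i)} (\<lambda>s. branch t i (of_real R * cis s) * (1 / (of_real R * cis s) ^ n))"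
        by (intro continuous_intros cont_arc i) (use R in auto)
      fix s assume "s \<in> {dir t i..dir t (Suc i)}"
      from divide_right_mono[OF arc_le[OF i this R], of "R ^ n"]
      show "cmod (branch t i (of_real R * cis s) * (1 / (of_real R * cis s) ^ n)) \<le> C * exp (- b) / R ^ n"
        using R by (simp add: norm_mult norm_divide norm_power)
    qed
    then show "cmod (\<i> * integral {dir t i..dir t (Suc i)} (\<lambda>s. branch t i (of_real R * cis s) * (1 / (of_real R * cis s) ^ n)))
       \<le> (C * exp (- b) / R ^ n) * (2 * h)" by (simp add: norm_mult dir_Suc)
  qed
  have 2: "cmod (\<Sum>i<m. integral {0..R} (\<lambda>s. jump t i s * (1 / raypt t i s ^ n))) \<le> (\<Sum>i<m. 1 * (C * ?a))"
  proof (rule sum_norm_le)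
    fix i assume "i \<in> {..<m}"
    then have i: "i < m" by simp
    show "cmod (integral {0..R} (\<lambda>s. jump t i s * (1 / raypt t i s ^ n))) \<le> 1 * (C * ?a)"
    proof (rule ray_bound[OF i _ n])
      show "continuous_on {0<..R} (\<lambda>s. 1 / raypt t i s ^ n)"
        by (intro continuous_intros cont_raypt) (use raypt_nz in auto)
    qed (auto simp: norm_divide norm_power raypt_def norm_mult)
  qed
  have "cmod (coef t n) * (2 * pi) = cmod (coef t n * (2 * pi * \<i>))" by (simp add: norm_mult)
  also have "\<dots> = cmod ((\<Sum>i<m. \<i> * integral {dir t i..dir t (Suc i)} (\<lambda>s. branch t i (of_real R * cis s) * (1 / (of_real R * cis s) ^ n)))
     + (\<Sum>i<m. integral {0..R} (\<lambda>s. jump t i s * (1 / raypt t i s ^ n))))"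
    by (simp add: coef_def)
  also have "\<dots> \<le> (\<Sum>i<m. (C * exp (- b) / R ^ n) * (2 * h)) + (\<Sum>i<m. 1 * (C * ?a))"
    by (rule norm_triangle_le[OF add_mono[OF 1 2]])
  also have "\<dots> = (2 * pi) * (C * exp (- b) / R ^ n) + m * (C * ?a)"
    using h(3) by (simp add: mult_ac flip: h(3))
  also have "\<dots> \<le> (2 * pi) * (C * exp (- b) / R ^ n) + (2 * pi) * (m * (C * ?a))"
  proof (rule add_left_mono)
    have "1 * (m * (C * ?a)) \<le> (2 * pi) * (m * (C * ?a))"
      using a C pi_ge_two by (intro mult_right_mono mult_nonneg_nonneg) auto
    then show "m * (C * ?a) \<le> (2 * pi) * (m * (C * ?a))" by simp
  qed
  also have "\<dots> = (C * exp (- b) / R ^ n + m * (C * ?a)) * (2 * pi)" by (simp add: algebra_simps)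
  finally have "cmod (coef t n) \<le> C * exp (- b) / R ^ n + m * (C * ?a)" by simp
  also have "\<dots> = C * (exp (- b) / R ^ n + m * ?a)" by (simp add: algebra_simps)
  also have "\<dots> \<le> C * ((1 + m) * (exp (- b) / R ^ n) + (1 + m) * ?a)"
  proof (intro mult_left_mono add_mono C)
    show "exp (- b) / R ^ n \<le> (1 + m) * (exp (- b) / R ^ n)"
      using mult_right_mono[of 1 "1 + real m" "exp (- b) / R ^ n"] R by simp
    show "m * ?a \<le> (1 + m) * ?a" using mult_right_mono[of m "1 + real m" ?a] a by simp
  qed
  also have "\<dots> = (1 + m) * C * coef_size n" by (simp add: coef_size_def algebra_simps)
  finally show ?thesis .
qed

lemma remainder_le:
  assumes \<eta>: "\<eta> = of_real r * cis \<tau>" "\<bar>\<tau> - t\<bar> \<le> h / 2" "r > 0" "r \<le> q * R" and q: "0 < q" "q < 1" and N: "N > 0"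
  shows "cmod (G t \<eta> - (\<Sum>n<N. coef t n * \<eta> ^ n)) \<le> rem_const q * C * coef_size N * cmod \<eta> ^ N"
proof -
  have qR: "q * R < 1 * R" using q R by (intro mult_strict_right_mono) auto
  then have rR: "r < R" using \<eta> by simp
  define c where "c = sqrt (1 - cos (h / 2))"
  have c0: "c > 0" unfolding c_def using one_minus_cos_pos[of "h/2"] h by simp
  let ?a = "A powr (- (real N / real p)) * uGamma (N / p) b / N"
  have a: "?a \<ge> 0" using uGamma_nonneg[of "N/p" b] b by simp
  have r\<eta>: "cmod \<eta> = r" using \<eta> by (simp add: norm_mult)
  define O1 where "O1 = (\<lambda>i. integral {dir t i..dir t (Suc i)} (\<lambda>s. branch t i (of_real R * cis s) * ((\<eta> / (of_real R * cis s)) ^ N * ((of_real R * cis s) / (of_real R * cis s - \<eta>)))))"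
  define R1 where "R1 = (\<lambda>i. integral {0..R} (\<lambda>s. jump t i s * ((\<eta> / raypt t i s) ^ N * (raypt t i s / (raypt t i s - \<eta>)))))"
  have arc_ne: "of_real R * cis s \<noteq> \<eta>" for s
    using rR R r\<eta> by (metis abs_of_pos less_irrefl mult.right_neutral norm_cis norm_mult norm_of_real)
  have O: "integral {dir t i..dir t (Suc i)} (\<lambda>s. branch t i (of_real R * cis s) * ((of_real R * cis s) / (of_real R * cis s - \<eta>)))
     = (\<Sum>n<N. integral {dir t i..dir t (Suc i)} (\<lambda>s. branch t i (of_real R * cis s) * (1 / (of_real R * cis s) ^ n)) * \<eta> ^ n) + O1 i" if i: "i < m" for i
    unfolding O1_def
    by (rule kernel_integral_split; (intro integrable_continuous_interval continuous_intros cont_arc i)?)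
       (use arc_ne R in auto)
  have O1: "cmod (O1 i) \<le> (C * exp (- b) / R ^ N * r ^ N / (1 - q)) * (2 * h)" if i: "i < m" for i
  proof -
    have "cmod (O1 i) \<le> (C * exp (- b) / R ^ N * r ^ N / (1 - q)) * (dir t (Suc i) - dir t i)"
      unfolding O1_def
    proof (rule integral_bound)
      show "dir t i \<le> dir t (Suc i)" using h by (simp add: dir_def)
      show "continuous_on {dir t i..dir t (Suc i)} (\<lambda>s. branch t i (of_real R * cis s) * ((\<eta> / (of_real R * cis s)) ^ N * ((of_real R * cis s) / (of_real R * cis s - \<eta>))))"
        by (intro continuous_intros cont_arc i) (use R arc_ne in auto)
      fix s assume s: "s \<in> {dir t i..dir t (Suc i)}"
      have "R * (1 - q) \<le> R - r" using \<eta>(4) by (simp add: algebra_simps)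
      also have "\<dots> \<le> cmod (of_real R * cis s - \<eta>)"
        using norm_triangle_ineq2[of "of_real R * cis s" \<eta>] R r\<eta> by (simp add: norm_mult)
      finally have d: "R * (1 - q) \<le> cmod (of_real R * cis s - \<eta>)" .
      then have "R / cmod (of_real R * cis s - \<eta>) \<le> R / (R * (1 - q))"
        using R q arc_ne by (intro divide_left_mono mult_pos_pos) auto
      then have k: "R / cmod (of_real R * cis s - \<eta>) \<le> 1 / (1 - q)" using R by simp
      have "cmod (branch t i (of_real R * cis s) * ((\<eta> / (of_real R * cis s)) ^ N * ((of_real R * cis s) / (of_real R * cis s - \<eta>))))
         = cmod (branch t i (of_real R * cis s)) * ((r / R) ^ N * (R / cmod (of_real R * cis s - \<eta>)))"
        using R r\<eta> by (simp add: norm_mult norm_divide norm_power)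
      also have "\<dots> \<le> (C * exp (- b)) * ((r / R) ^ N * (1 / (1 - q)))"
        by (intro mult_mono arc_le[OF i s R] k order_refl) (use R \<eta> C q in auto)
      finally show "cmod (branch t i (of_real R * cis s) * ((\<eta> / (of_real R * cis s)) ^ N * ((of_real R * cis s) / (of_real R * cis s - \<eta>))))
        \<le> C * exp (- b) / R ^ N * r ^ N / (1 - q)" by (simp add: power_divide)
    qed
    then show ?thesis by (simp add: dir_Suc)
  qed
  have ray_ne: "raypt t i s \<noteq> \<eta>" if "i < m" "s \<ge> 0" for i s
  proof -
    have "c * r \<le> cmod (raypt t i s - \<eta>)" using ray_away(2)[OF that(1) \<eta>(1-3) that(2)] by (simp only: c_def)
    moreover have "0 < c * r" using c0 \<eta> by simp
    ultimately show ?thesis by force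
  qed
  have kray: "cmod (raypt t i s / (raypt t i s - \<eta>)) \<le> 1 / c" if "i < m" "0 < s" for i s
  proof -
    have "cmod (raypt t i s - \<eta>) \<ge> c * s" using ray_away(1)[OF that(1) \<eta>(1-3), of s] that by (simp add: c_def)
    moreover have cs: "0 < c * s" using c0 that by simp
    ultimately have "s / cmod (raypt t i s - \<eta>) \<le> s / (c * s)"
      using that c0 by (intro divide_left_mono mult_pos_pos) linarith+
    then show ?thesis using that by (simp add: norm_divide raypt_def norm_mult)
  qed
  have remc: "continuous_on {0<..R} (\<lambda>s. (\<eta> / raypt t i s) ^ N * (raypt t i s / (raypt t i s - \<eta>)))" if "i < m" for i
    by (intro continuous_intros cont_raypt) (use raypt_nz ray_ne[OF that] in auto)
  have remle: "cmod ((\<eta> / raypt t i s) ^ N * (raypt t i s / (raypt t i s - \<eta>))) \<le> (r ^ N / c) / s ^ N"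
    if "i < m" "0 < s" "s \<le> R" for i s
  proof -
    have "cmod ((\<eta> / raypt t i s) ^ N * (raypt t i s / (raypt t i s - \<eta>))) = (r / s) ^ N * cmod (raypt t i s / (raypt t i s - \<eta>))"
      using that r\<eta> by (simp add: norm_mult norm_divide norm_power raypt_def)
    also have "\<dots> \<le> (r / s) ^ N * (1 / c)" using that \<eta> by (intro mult_left_mono kray) auto
    also have "\<dots> = (r ^ N / c) / s ^ N" by (simp add: power_divide)
    finally show ?thesis .
  qed
  have radius: "integral {0..R} (\<lambda>s. jump t i s * (raypt t i s / (raypt t i s - \<eta>)))
     = (\<Sum>n<N. integral {0..R} (\<lambda>s. jump t i s * (1 / raypt t i s ^ n)) * \<eta> ^ n) + R1 i" if i: "i < m" for i
    unfolding R1_def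
  proof (rule kernel_integral_split)
    show "jump t i s = 0 \<or> raypt t i s \<noteq> 0 \<and> raypt t i s \<noteq> \<eta>" if "s \<in> {0..R}" for s
      using that ray_ne[OF i, of s] jump_0[of t i] raypt_nz[of s t i] by (cases "s = 0") auto
    show "(\<lambda>s. jump t i s * (1 / raypt t i s ^ n)) integrable_on {0..R}" for n
      by (rule integrable_continuous_interval, rule cont_ray[OF i, where K = 1 and n = n])
         (intro continuous_intros cont_raypt, auto simp: raypt_def norm_divide norm_power norm_mult)
    show "(\<lambda>s. jump t i s * ((\<eta> / raypt t i s) ^ N * (raypt t i s / (raypt t i s - \<eta>)))) integrable_on {0..R}"
      by (rule integrable_continuous_interval, rule cont_ray[OF i remc[OF i] remle[OF i]])
  qed
  have R1: "cmod (R1 i) \<le> (r ^ N / c) * (C * ?a)" if i: "i < m" for i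
    unfolding R1_def by (rule ray_bound[OF i remc[OF i] N remle[OF i]])
  have "2 * pi * \<i> * G t \<eta> =
      (\<Sum>i<m. \<i> * ((\<Sum>n<N. integral {dir t i..dir t (Suc i)} (\<lambda>s. branch t i (of_real R * cis s) * (1 / (of_real R * cis s) ^ n)) * \<eta> ^ n) + O1 i))
      + (\<Sum>i<m. (\<Sum>n<N. integral {0..R} (\<lambda>s. jump t i s * (1 / raypt t i s ^ n)) * \<eta> ^ n) + R1 i)"
    unfolding cauchy_heine[OF \<eta>(1-3) rR] using O radius by simp
  also have "\<dots> = (\<Sum>i<m. \<Sum>n<N. \<i> * integral {dir t i..dir t (Suc i)} (\<lambda>s. branch t i (of_real R * cis s) * (1 / (of_real R * cis s) ^ n)) * \<eta> ^ n)
      + (\<Sum>i<m. \<Sum>n<N. integral {0..R} (\<lambda>s. jump t i s * (1 / raypt t i s ^ n)) * \<eta> ^ n)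
      + ((\<Sum>i<m. \<i> * O1 i) + (\<Sum>i<m. R1 i))"
    by (simp add: distrib_left sum.distrib sum_distrib_left mult_ac)
  also have "(\<Sum>i<m. \<Sum>n<N. \<i> * integral {dir t i..dir t (Suc i)} (\<lambda>s. branch t i (of_real R * cis s) * (1 / (of_real R * cis s) ^ n)) * \<eta> ^ n)
      + (\<Sum>i<m. \<Sum>n<N. integral {0..R} (\<lambda>s. jump t i s * (1 / raypt t i s ^ n)) * \<eta> ^ n)
      = (\<Sum>n<N. (2 * pi * \<i>) * coef t n * \<eta> ^ n)"
    apply (subst (1 2) sum.swap)
    apply (subst sum.distrib[symmetric])
    apply (intro sum.cong refl)
    apply (simp add: coef_def sum_distrib_right distrib_right)
    done
  finally have "(2 * pi * \<i>) * (G t \<eta> - (\<Sum>n<N. coef t n * \<eta> ^ n)) = (\<Sum>i<m. \<i> * O1 i) + (\<Sum>i<m. R1 i)"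
    by (simp add: right_diff_distrib sum_distrib_left mult_ac)
  then have "cmod ((2 * pi * \<i>) * (G t \<eta> - (\<Sum>n<N. coef t n * \<eta> ^ n))) = cmod ((\<Sum>i<m. \<i> * O1 i) + (\<Sum>i<m. R1 i))"
    by (rule arg_cong)
  moreover have "cmod ((2 * pi * \<i>) * z) = cmod z * (2 * pi)" for z by (simp add: norm_mult)
  ultimately have "cmod (G t \<eta> - (\<Sum>n<N. coef t n * \<eta> ^ n)) * (2 * pi) = cmod ((\<Sum>i<m. \<i> * O1 i) + (\<Sum>i<m. R1 i))"
    by (simp only:)
  also have "\<dots> \<le> (\<Sum>i<m. (C * exp (- b) / R ^ N * r ^ N / (1 - q)) * (2 * h)) + (\<Sum>i<m. (r ^ N / c) * (C * ?a))"
    by (rule norm_triangle_le, intro add_mono sum_norm_le) (use O1 R1 in \<open>auto simp: norm_mult\<close>)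
  also have "\<dots> = (2 * pi) * (C * exp (- b) / R ^ N * r ^ N / (1 - q)) + m * ((r ^ N / c) * (C * ?a))"
    using h(3) by (simp add: mult_ac flip: h(3))
  also have "\<dots> \<le> (2 * pi) * (C * exp (- b) / R ^ N * r ^ N / (1 - q)) + (2 * pi) * (m * ((r ^ N / c) * (C * ?a)))"
  proof (rule add_left_mono)
    have "1 * (m * ((r ^ N / c) * (C * ?a))) \<le> (2 * pi) * (m * ((r ^ N / c) * (C * ?a)))"
      using a C c0 \<eta> pi_ge_two by (intro mult_right_mono mult_nonneg_nonneg) auto
    then show "m * ((r ^ N / c) * (C * ?a)) \<le> (2 * pi) * (m * ((r ^ N / c) * (C * ?a)))" by simp
  qed
  also have "\<dots> = (C * r ^ N * (1 / (1 - q) * (exp (- b) / R ^ N) + m / c * ?a)) * (2 * pi)" by (simp add: algebra_simps)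
  finally have "cmod (G t \<eta> - (\<Sum>n<N. coef t n * \<eta> ^ n)) \<le> C * r ^ N * (1 / (1 - q) * (exp (- b) / R ^ N) + m / c * ?a)"
    by simp
  also have "\<dots> \<le> C * r ^ N * (rem_const q * (exp (- b) / R ^ N) + rem_const q * ?a)"
    using a C R c0 q \<eta> unfolding rem_const_def c_def[symmetric]
    by (intro mult_left_mono add_mono mult_right_mono) auto
  also have "\<dots> = rem_const q * C * coef_size N * cmod \<eta> ^ N" by (simp add: coef_size_def r\<eta> algebra_simps)
  finally show ?thesis .
qed

lemma coef_size_nonneg: "0 \<le> coef_size n"
  unfolding coef_size_def using R b uGamma_nonneg[of "n/p" b] by (intro add_nonneg_nonneg) auto

lemma rem_const_pos: "0 < q \<Longrightarrow> q < 1 \<Longrightarrow> 0 < rem_const q"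
  unfolding rem_const_def using m h one_minus_cos_pos[of "h/2"] by (intro add_pos_pos) auto

text \<open>Coefficients belonging to close directions expand functions whose difference is flat on a common ray,
hence they coincide by uniqueness. Chains of close directions then connect any two directions.\<close>

lemma coef_eq_near:
  assumes "\<bar>t - t'\<bar> \<le> h"
  shows "coef t n = coef t' n"
proof -
  define \<tau> where "\<tau> = (t + t') / 2"
  have \<tau>: "\<bar>\<tau> - t\<bar> \<le> h / 2" "\<bar>\<tau> - t'\<bar> \<le> h / 2"
    using assms by (auto simp: \<tau>_def abs_if field_simps split: if_splits)
  define r where "r = (\<lambda>i::nat. (1 / 2 * R) * (1 / real (Suc i)))"
  define \<eta> where "\<eta> = (\<lambda>i. of_real (r i) * cis \<tau>)"
  have r: "0 < r i" "r i \<le> 1 / 2 * R" for i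
  proof -
    show "0 < r i" using R by (simp add: r_def)
    have "(1 / 2 * R) * (1 / real (Suc i)) \<le> (1 / 2 * R) * 1"
      using R by (intro mult_left_mono) auto
    then show "r i \<le> 1 / 2 * R" by (simp add: r_def)
  qed
  have "coef t n - coef t' n = 0"
  proof (rule expansion_unique[of \<eta> "\<lambda>n. coef t n - coef t' n"])
    have "r \<longlonglongrightarrow> (1 / 2 * R) * 0"
      unfolding r_def by (intro tendsto_mult_left LIMSEQ_inverse_real_of_nat[unfolded inverse_eq_divide])
    then have "(\<lambda>i. of_real (r i) * cis \<tau>) \<longlonglongrightarrow> of_real 0 * cis \<tau>"
      by (intro tendsto_mult tendsto_of_real tendsto_const) simp
    then show "\<eta> \<longlonglongrightarrow> 0" by (simp add: \<eta>_def)
    show "\<eta> i \<noteq> 0" for i using r(1)[of i] by (simp add: \<eta>_def)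
    fix N
    obtain K' where K': "K' \<ge> 0" "\<And>s. 0 < s \<Longrightarrow> s \<le> R \<Longrightarrow> exp (- (A / s ^ p)) \<le> K' * s ^ (Suc N)"
      using exp_flat[OF A p R, of "Suc N"] by blast
    show "\<exists>K. \<forall>\<^sub>F i in sequentially. cmod (\<Sum>n<Suc N. (coef t n - coef t' n) * \<eta> i ^ n) \<le> K * cmod (\<eta> i) ^ Suc N"
    proof (intro exI always_eventually allI)
      fix i
      have n\<eta>: "cmod (\<eta> i) = r i" using r(1)[of i] by (simp add: \<eta>_def norm_mult)
      let ?S = "\<lambda>t. \<Sum>n<Suc N. coef t n * \<eta> i ^ n"
      have 1: "cmod (G t (\<eta> i) - ?S t) \<le> rem_const (1/2) * C * coef_size (Suc N) * cmod (\<eta> i) ^ Suc N"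
        "cmod (G t' (\<eta> i) - ?S t') \<le> rem_const (1/2) * C * coef_size (Suc N) * cmod (\<eta> i) ^ Suc N"
        using \<tau> r by (intro remainder_le[of "\<eta> i" "r i" \<tau>]; simp add: \<eta>_def)+
      have "\<eta> i \<in> polar_sector t (pi / m) R" "\<eta> i \<in> polar_sector t' (pi / m) R"
        unfolding \<eta>_def h_def[symmetric] using r[of i] \<tau> h R by (intro polar_sectorI; simp)+
      then have "cmod (G t (\<eta> i) - G t' (\<eta> i)) \<le> C * min (exp (- (A / r i ^ p))) (exp (- b))"
        using diff[of "\<eta> i" t t'] n\<eta> by simp
      also have "\<dots> \<le> C * (K' * r i ^ Suc N)"
        using K'(2)[OF r(1)[of i]] r[of i] R C by (intro mult_left_mono) auto
      finally have 2: "cmod (G t (\<eta> i) - G t' (\<eta> i)) \<le> C * K' * cmod (\<eta> i) ^ Suc N" using n\<eta> by simp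
      have "(\<Sum>n<Suc N. (coef t n - coef t' n) * \<eta> i ^ n) = (G t' (\<eta> i) - ?S t') - (G t (\<eta> i) - ?S t) + (G t (\<eta> i) - G t' (\<eta> i))"
        unfolding left_diff_distrib sum_subtractf by simp
      also have "cmod \<dots> \<le> rem_const (1/2) * C * coef_size (Suc N) * cmod (\<eta> i) ^ Suc N + rem_const (1/2) * C * coef_size (Suc N) * cmod (\<eta> i) ^ Suc N + C * K' * cmod (\<eta> i) ^ Suc N"
        by (intro norm_triangle_le add_mono norm_triangle_le_diff 1 2)
      also have "\<dots> = (rem_const (1/2) * C * coef_size (Suc N) + rem_const (1/2) * C * coef_size (Suc N) + C * K') * cmod (\<eta> i) ^ Suc N"
        by (simp only: distrib_right)
      finally show "cmod (\<Sum>n<Suc N. (coef t n - coef t' n) * \<eta> i ^ n)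
         \<le> (rem_const (1/2) * C * coef_size (Suc N) + rem_const (1/2) * C * coef_size (Suc N) + C * K') * cmod (\<eta> i) ^ Suc N" .
    qed
  qed
  then show ?thesis by simp
qed

lemma coef_eq: "coef t n = coef t' n"
proof -
  have *: "\<bar>t - t'\<bar> \<le> real k * h \<Longrightarrow> coef t n = coef t' n" for k t'
  proof (induction k arbitrary: t')
    case (Suc k)
    define t'' where "t'' = (if t' > t then max t (t' - h) else min t (t' + h))"
    have "0 \<le> real k * h" using h by simp
    then have "\<bar>t - t''\<bar> \<le> real k * h" "\<bar>t'' - t'\<bar> \<le> h"
      using Suc.prems h by (auto simp: t''_def algebra_simps min_def max_def split: if_splits)
    then show ?case using Suc.IH coef_eq_near by metis
  qed simp
  obtain k :: nat where "\<bar>t - t'\<bar> / h \<le> k" using real_arch_simple by blast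
  then have "\<bar>t - t'\<bar> \<le> k * h" using h by (simp add: field_simps)
  then show ?thesis by (rule *)
qed

text \<open>The integrals over the rays are estimated by moments, which need \<open>n > 0\<close>. The coefficient number 0 is the
limit of \<open>G t\<close> at 0.\<close>

lemma coeff_0_le: "cmod (coef t 0) \<le> C * exp (- b)"
proof (rule field_le_epsilon)
  fix e :: real assume e: "e > 0"
  let ?K = "rem_const (1/2) * C * coef_size 1"
  have K: "?K \<ge> 0" using rem_const_pos[of "1/2"] C coef_size_nonneg by simp
  define r where "r = min (1 / 2 * R) (e / (?K + 1))"
  have r: "0 < r" using R e K by (simp add: r_def)
  have r2: "r \<le> 1 / 2 * R" unfolding r_def by (rule min.cobounded1)
  note r = r r2
  have "?K * r \<le> (?K + 1) * r" using r by (intro mult_right_mono) auto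
  also have "\<dots> \<le> (?K + 1) * (e / (?K + 1))" using K by (intro mult_left_mono) (auto simp: r_def)
  also have "\<dots> = e" using K by simp
  finally have Kr: "?K * r \<le> e" .
  have "cmod (G t (of_real r * cis t) - (\<Sum>n<1. coef t n * (of_real r * cis t) ^ n)) \<le> ?K * cmod (of_real r * cis t) ^ 1"
    using r h by (intro remainder_le[of _ r t]) auto
  then have 1: "cmod (G t (of_real r * cis t) - coef t 0) \<le> ?K * r" using r by (simp add: norm_mult)
  have "of_real r * cis t \<in> polar_sector t (pi / m) R" using r R by (intro polar_sectorI) auto
  then have 2: "cmod (G t (of_real r * cis t)) \<le> C * exp (- b)" by (rule bnd)
  have "coef t 0 = G t (of_real r * cis t) - (G t (of_real r * cis t) - coef t 0)" by simp
  then have "cmod (coef t 0) \<le> cmod (G t (of_real r * cis t)) + cmod (G t (of_real r * cis t) - coef t 0)"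
    using norm_triangle_ineq4 by metis
  then show "cmod (coef t 0) \<le> C * exp (- b) + e" using 1 2 Kr by linarith
qed

lemma expansion:
  assumes q: "0 < q" "q < 1"
  shows "\<exists>c. cmod (c 0) \<le> C * exp (- b) \<and> (\<forall>n>0. cmod (c n) \<le> (1 + m) * C * coef_size n) \<and>
     (\<forall>t \<tau> r N. 0 < r \<longrightarrow> r \<le> q * R \<longrightarrow> \<bar>\<tau> - t\<bar> \<le> pi / m / 2 \<longrightarrow> 0 < N \<longrightarrow>
        cmod (G t (of_real r * cis \<tau>) - (\<Sum>n<N. c n * (of_real r * cis \<tau>) ^ n)) \<le> rem_const q * C * coef_size N * r ^ N)"
proof (intro exI[of _ "coef 0"] conjI allI impI coeff_0_le coeff_le)
  fix t \<tau> r :: real and N :: nat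
  assume *: "0 < r" "r \<le> q * R" "\<bar>\<tau> - t\<bar> \<le> pi / m / 2" "0 < N"
  have "cmod (G t (of_real r * cis \<tau>) - (\<Sum>n<N. coef t n * (of_real r * cis \<tau>) ^ n)) \<le> rem_const q * C * coef_size N * cmod (of_real r * cis \<tau>) ^ N"
    using * q by (intro remainder_le[of _ r \<tau>]) (auto simp: h_def)
  then show "cmod (G t (of_real r * cis \<tau>) - (\<Sum>n<N. coef 0 n * (of_real r * cis \<tau>) ^ n)) \<le> rem_const q * C * coef_size N * r ^ N"
    using *(1) coef_eq[of t _ 0] by (simp add: norm_mult)
qed

end

lemma power_times_Suc_le:
  assumes "0 < q" "q < (1::real)"
  shows "\<exists>K>0. \<forall>n. q ^ n * (real n + 1) \<le> K"
proof -
  define x where "x = 1 / q - 1"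
  have x: "x > 0" using assms by (simp add: x_def field_simps)
  show ?thesis
  proof (intro exI[of _ "1 + 1 / x"] conjI allI)
    show "0 < 1 + 1 / x" using x by (intro add_pos_pos) auto
    fix n
    have "1 + real n * x \<le> (1 + x) ^ n" using Bernoulli_inequality[of x n] x by simp
    also have "1 + x = 1 / q" by (simp add: x_def)
    finally have B: "1 + real n * x \<le> 1 / q ^ n" by (simp add: power_divide)
    have "real n + 1 \<le> (1 + 1 / x) * (1 + real n * x)" using x by (simp add: field_simps)
    also have "\<dots> \<le> (1 + 1 / x) * (1 / q ^ n)" using B x by (intro mult_left_mono add_nonneg_nonneg) auto
    finally show "q ^ n * (real n + 1) \<le> 1 + 1 / x" using assms by (simp add: field_simps)
  qed
qed

text \<open>The bound for the \<open>n\<close>-th coefficient and for the \<open>n\<close>-th remainder. The denominator \<open>n + 1\<close> is gained in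
\<open>min_exp_int_le\<close> and is spent later in \<open>gevrey_bound_int_ex\<close>.\<close>

definition gevrey_bound :: "real \<Rightarrow> nat \<Rightarrow> nat \<Rightarrow> real \<Rightarrow> real" where
  "gevrey_bound A p n b = A powr (- (real n / real p)) * uGamma (real n / real p) b / (real n + 1)"

lemma gevrey_bound_nonneg: "b \<ge> 0 \<Longrightarrow> 0 \<le> gevrey_bound A p n b"
  unfolding gevrey_bound_def by (intro mult_nonneg_nonneg divide_nonneg_nonneg uGamma_nonneg) auto

lemma gevrey_bound_0: "b \<ge> 0 \<Longrightarrow> A > 0 \<Longrightarrow> gevrey_bound A p 0 b = exp (- b)"
  by (simp add: gevrey_bound_def uGamma_0_exp)

text \<open>The arcs of radius \<open>R\<close> contribute \<open>exp (- b) / R^n\<close> to the coefficients. If \<open>R = r2 / s\<close>, this is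
\<open>exp (- b) (s / r2)^n\<close>, while \<open>A \<le> B r0^p\<close> and \<open>uGamma k b \<ge> b powr k * exp (- b)\<close> give at least
\<open>exp (- b) (s / r0)^n / (n + 1)\<close> on the right. The geometric gain from \<open>r0 < r2\<close> absorbs the denominator. For
the fixed radius \<open>\<eta>1\<close> any geometric growth is dominated by the Gamma function.\<close>

lemma boundary_term_le:
  fixes A B r0 r2 \<eta>1 :: real and p :: nat
  assumes "A > 0" "B > 0" "A \<le> B * r0 ^ p" "0 < r0" "r0 < r2" "0 < \<eta>1" "p > 0"
  shows "\<exists>K>0. \<forall>s R n. s \<ge> 0 \<longrightarrow> (R = \<eta>1 \<or> (R = r2 / s \<and> s > 0)) \<longrightarrow>
     exp (- (B * s ^ p)) / R ^ n \<le> K * gevrey_bound A p n (B * s ^ p)"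
proof -
  obtain K1 where K1: "K1 > 0" "\<And>n. (r0 / r2) ^ n * (real n + 1) \<le> K1"
    using power_times_Suc_le[of "r0 / r2"] assms by auto
  define y where "y = A * (2 / \<eta>1) ^ p"
  have y: "y > 0" using assms by (simp add: y_def)
  show ?thesis
  proof (intro exI[of _ "K1 + exp y"] conjI allI impI)
    show "0 < K1 + exp y" using K1 by (simp add: add_pos_pos)
    fix s R :: real and n :: nat
    assume s: "s \<ge> 0" and R: "R = \<eta>1 \<or> (R = r2 / s \<and> s > 0)"
    define b where "b = B * s ^ p"
    have b: "b \<ge> 0" using s assms by (simp add: b_def)
    define k where "k = real n / real p"
    have k: "k \<ge> 0" by (simp add: k_def)
    have bound_nonneg: "gevrey_bound A p n b \<ge> 0" by (rule gevrey_bound_nonneg[OF b])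
    from R have "exp (- b) / R ^ n \<le> K1 * gevrey_bound A p n b \<or> exp (- b) / R ^ n \<le> exp y * gevrey_bound A p n b"
    proof
      assume R: "R = \<eta>1"
      have "y powr k * Gamma (0 + 1) \<le> exp y * Gamma (0 + k + 1)"
        by (rule Gamma_shift_le) (use y k in auto)
      moreover have "y powr k = A powr k * (2 / \<eta>1) ^ n"
        using assms unfolding y_def k_def
        by (simp add: powr_mult powr_realpow[symmetric] powr_powr)
      ultimately have "A powr k * (2 / \<eta>1) ^ n \<le> exp y * Gamma (k + 1)" by simp
      then have "A powr k * (2 / \<eta>1) ^ n * (A powr (- k) / 2 ^ n) \<le> exp y * Gamma (k + 1) * (A powr (- k) / 2 ^ n)"
        by (rule mult_right_mono) simp
      moreover have "A powr k * (2 / \<eta>1) ^ n * (A powr (- k) / 2 ^ n) = (A powr k * A powr (- k)) * (1 / \<eta>1 ^ n)"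
        by (simp add: power_divide)
      moreover have "A powr k * A powr (- k) = 1" using assms by (simp add: powr_add[symmetric])
      ultimately have "1 / \<eta>1 ^ n \<le> exp y * Gamma (k + 1) * (A powr (- k) / 2 ^ n)" by simp
      also have "\<dots> \<le> exp y * Gamma (k + 1) * (A powr (- k) / (real n + 1))"
      proof (intro mult_left_mono divide_left_mono)
        have "real n + 1 \<le> real (2 ^ n)" using less_exp[of n] by (metis Suc_leI of_nat_Suc of_nat_le_iff add.commute)
        then show "real n + 1 \<le> 2 ^ n" by simp
        show "0 \<le> exp y * Gamma (k + 1)" using k by (intro mult_nonneg_nonneg Gamma_real_nonneg) auto
      qed auto
      finally have "exp (- b) * (1 / \<eta>1 ^ n) \<le> exp (- b) * (exp y * Gamma (k + 1) * (A powr (- k) / (real n + 1)))"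
        by (rule mult_left_mono) simp
      also have "\<dots> = exp y * (A powr (- k) * (exp (- b) * Gamma (k + 1)) / (real n + 1))" by simp
      also have "\<dots> \<le> exp y * (A powr (- k) * uGamma k b / (real n + 1))"
        by (intro mult_left_mono divide_right_mono uGamma_ge_exp k b) auto
      finally show ?thesis using R by (simp add: gevrey_bound_def k_def)
    next
      assume R: "R = r2 / s \<and> s > 0"
      have "b powr k = B powr k * s ^ n"
        using assms R unfolding b_def k_def
        by (simp add: powr_mult powr_realpow[symmetric] powr_powr)
      then have u1: "B powr k * (s ^ n * exp (- b)) \<le> uGamma k b"
        using uGamma_ge_powr[OF k b] by (simp add: mult_ac)
      have "A powr k \<le> B powr k * r0 ^ n"
      proof -
        have "A powr k \<le> (B * r0 ^ p) powr k" using assms k by (intro powr_mono2) auto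
        also have "\<dots> = B powr k * r0 ^ n" using assms unfolding k_def
          by (simp add: powr_mult powr_realpow[symmetric] powr_powr)
        finally show ?thesis .
      qed
      then have "A powr k * (s ^ n * exp (- b)) \<le> (B powr k * r0 ^ n) * (s ^ n * exp (- b))"
        using s by (intro mult_right_mono) auto
      also have "\<dots> = r0 ^ n * (B powr k * (s ^ n * exp (- b)))" by simp
      also have "\<dots> \<le> r0 ^ n * uGamma k b" using u1 assms by (intro mult_left_mono) auto
      finally have "A powr k * (s ^ n * exp (- b)) \<le> r0 ^ n * uGamma k b" .
      then have "A powr (- k) * (A powr k * (s ^ n * exp (- b))) \<le> A powr (- k) * (r0 ^ n * uGamma k b)"
        by (rule mult_left_mono) simp
      moreover have "A powr (- k) * (A powr k * (s ^ n * exp (- b))) = (A powr k * A powr (- k)) * (s ^ n * exp (- b))" by simp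
      moreover have "A powr k * A powr (- k) = 1" using assms by (simp add: powr_add[symmetric])
      ultimately have "s ^ n * exp (- b) \<le> A powr (- k) * (r0 ^ n * uGamma k b)" by simp
      then have "s ^ n * exp (- b) / r2 ^ n \<le> A powr (- k) * (r0 ^ n * uGamma k b) / r2 ^ n"
        using assms by (intro divide_right_mono) auto
      also have "\<dots> = (r0 / r2) ^ n * (real n + 1) * (A powr (- k) * uGamma k b / (real n + 1))"
        by (simp add: power_divide)
      also have "\<dots> \<le> K1 * (A powr (- k) * uGamma k b / (real n + 1))"
        using k b by (intro mult_right_mono K1 divide_nonneg_nonneg mult_nonneg_nonneg uGamma_nonneg) auto
      finally have "s ^ n * exp (- b) / r2 ^ n \<le> K1 * gevrey_bound A p n b" by (simp add: gevrey_bound_def k_def)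
      moreover have "exp (- b) / R ^ n = s ^ n * exp (- b) / r2 ^ n" using R assms by (simp add: power_divide)
      ultimately show ?thesis by simp
    qed
    then have "exp (- b) / R ^ n \<le> (K1 + exp y) * gevrey_bound A p n b"
    proof
      assume "exp (- b) / R ^ n \<le> K1 * gevrey_bound A p n b"
      then show ?thesis using bound_nonneg by (simp add: distrib_right add_increasing2)
    next
      assume "exp (- b) / R ^ n \<le> exp y * gevrey_bound A p n b"
      then show ?thesis using bound_nonneg K1(1) by (simp add: distrib_right add_increasing)
    qed
    then show "exp (- (B * s ^ p)) / R ^ n \<le> (K1 + exp y) * gevrey_bound A p n (B * s ^ p)"
      by (simp add: b_def)
  qed
qed

text \<open>The constant is the same for all families whose parameters are linked by \<open>b = B s^p\<close> and
\<open>R \<in> {\<eta>1, r2 / s}\<close>, in particular for all points of a contour at once.\<close>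

theorem gevrey_family_expansion:
  fixes A B r0 r2 \<eta>1 q :: real and p m :: nat
  assumes AB: "A > 0" "B > 0" "A \<le> B * r0 ^ p" and r: "0 < r0" "r0 < r2" "0 < \<eta>1" and pm: "p > 0" "m > 0"
    and q: "0 < q" "q < 1"
  shows "\<exists>K>0. \<forall>G R C s. gevrey_family G m p R C A (B * s ^ p) \<longrightarrow> s \<ge> 0 \<longrightarrow>
     (R = \<eta>1 \<or> (R = r2 / s \<and> s > 0)) \<longrightarrow>
     (\<exists>c. (\<forall>n. cmod (c n) \<le> K * C * gevrey_bound A p n (B * s ^ p)) \<and>
      (\<forall>t \<tau> r N. 0 < r \<longrightarrow> r \<le> q * R \<longrightarrow> \<bar>\<tau> - t\<bar> \<le> pi / m / 2 \<longrightarrow>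
        cmod (G t (of_real r * cis \<tau>) - (\<Sum>n<N. c n * (of_real r * cis \<tau>) ^ n))
        \<le> K * C * gevrey_bound A p N (B * s ^ p) * r ^ N))"
proof -
  obtain K1 where K1: "K1 > 0" "\<And>s R n. s \<ge> 0 \<Longrightarrow> (R = \<eta>1 \<or> (R = r2 / s \<and> s > 0)) \<Longrightarrow>
     exp (- (B * s ^ p)) / R ^ n \<le> K1 * gevrey_bound A p n (B * s ^ p)"
    using boundary_term_le[OF AB r pm(1)] by blast
  define K0 where "K0 = 1 / (1 - q) + m / sqrt (1 - cos (pi / m / 2))"
  have K0: "K0 > 0"
  proof -
    have "pi / m / 2 > 0" "pi / m / 2 \<le> pi / 2" using pm by (auto simp: field_simps)
    then show ?thesis unfolding K0_def using q pm one_minus_cos_pos[of "pi / m / 2"] by (intro add_pos_pos) auto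
  qed
  define K where "K = (1 + m + K0) * (K1 + 2) + 1"
  have K: "K \<ge> 1" using K0 K1 by (simp add: K_def)
  have K2: "(1 + m) * (K1 + 2) \<le> K" "K0 * (K1 + 2) \<le> K"
    using K0 K1 by (auto simp: K_def algebra_simps add_nonneg_nonneg)
  show ?thesis
  proof (intro exI[of _ K] conjI allI impI)
    show "K > 0" using K by simp
    fix G :: "real \<Rightarrow> complex \<Rightarrow> complex" and R C s :: real
    assume fam: "gevrey_family G m p R C A (B * s ^ p)" and s: "s \<ge> 0" and Rc: "R = \<eta>1 \<or> (R = r2 / s \<and> s > 0)"
    interpret gevrey_family G m p R C A "B * s ^ p" by (rule fam)
    let ?b = "B * s ^ p" and ?gb = "\<lambda>n. gevrey_bound A p n (B * s ^ p)"
    have bound_nonneg: "?gb n \<ge> 0" for n by (rule gevrey_bound_nonneg[OF b])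
    have coef_size_le: "coef_size n \<le> (K1 + 2) * ?gb n" if "n > 0" for n
    proof -
      let ?X = "A powr (- (real n / real p)) * uGamma (real n / real p) ?b"
      have X: "?X \<ge> 0" using uGamma_nonneg[OF _ b] by simp
      have "?X / n \<le> 2 * (?X / (real n + 1))"
      proof -
        have "?X * (real n + 1) \<le> ?X * (2 * real n)" using that X by (intro mult_left_mono) auto
        then show ?thesis using that by (simp add: field_simps)
      qed
      then have "?X / n \<le> 2 * ?gb n" by (simp add: gevrey_bound_def)
      then show ?thesis unfolding coef_size_def using K1(2)[OF s Rc, of n] by (simp add: distrib_right)
    qed
    have KK0: "rem_const q = K0" by (simp add: rem_const_def K0_def h_def)
    obtain c where c0: "cmod (c 0) \<le> C * exp (- ?b)" and c: "\<And>n. n > 0 \<Longrightarrow> cmod (c n) \<le> (1 + m) * C * coef_size n"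
      and rem: "\<And>t \<tau> r N. 0 < r \<Longrightarrow> r \<le> q * R \<Longrightarrow> \<bar>\<tau> - t\<bar> \<le> pi / m / 2 \<Longrightarrow> 0 < N \<Longrightarrow>
        cmod (G t (of_real r * cis \<tau>) - (\<Sum>n<N. c n * (of_real r * cis \<tau>) ^ n)) \<le> rem_const q * C * coef_size N * r ^ N"
      using expansion[OF q] by blast
    have CK: "C * x \<le> K * C * x" if "x \<ge> 0" for x
      using mult_right_mono[OF K, of "C * x"] C that by (simp add: mult_ac)
    show "\<exists>c. (\<forall>n. cmod (c n) \<le> K * C * ?gb n) \<and>
      (\<forall>t \<tau> r N. 0 < r \<longrightarrow> r \<le> q * R \<longrightarrow> \<bar>\<tau> - t\<bar> \<le> pi / m / 2 \<longrightarrow>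
        cmod (G t (of_real r * cis \<tau>) - (\<Sum>n<N. c n * (of_real r * cis \<tau>) ^ n)) \<le> K * C * ?gb N * r ^ N)"
    proof (intro exI[of _ c] conjI allI impI)
      fix n
      show "cmod (c n) \<le> K * C * ?gb n"
      proof (cases "n = 0")
        case True
        then show ?thesis using c0 CK[of "exp (- ?b)"] gevrey_bound_0[OF b A] by simp
      next
        case False
        then have "cmod (c n) \<le> (1 + m) * C * ((K1 + 2) * ?gb n)"
          using c[of n] coef_size_le[of n] C by (smt (verit) mult_left_mono mult_nonneg_nonneg of_nat_0_le_iff gr0I)
        also have "\<dots> = ((1 + m) * (K1 + 2)) * (C * ?gb n)" by (simp add: mult_ac)
        also have "\<dots> \<le> K * (C * ?gb n)" using K2 C bound_nonneg by (intro mult_right_mono) auto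
        finally show ?thesis by (simp add: mult_ac)
      qed
    next
      fix t \<tau> r :: real and N :: nat
      assume *: "0 < r" "r \<le> q * R" "\<bar>\<tau> - t\<bar> \<le> pi / m / 2"
      show "cmod (G t (of_real r * cis \<tau>) - (\<Sum>n<N. c n * (of_real r * cis \<tau>) ^ n)) \<le> K * C * ?gb N * r ^ N"
      proof (cases "N = 0")
        case True
        have "q * R \<le> 1 * R" using q R by (intro mult_right_mono) (use \<open>R > 0\<close> in auto)
        then have "of_real r * cis \<tau> \<in> polar_sector t (pi / m) R"
          using * m by (intro polar_sectorI) (auto simp: abs_le_iff field_simps)
        from bnd[OF this] show ?thesis using True CK[of "exp (- ?b)"] gevrey_bound_0[OF b A] by simp
      next
        case False
        have "cmod (G t (of_real r * cis \<tau>) - (\<Sum>n<N. c n * (of_real r * cis \<tau>) ^ n)) \<le> rem_const q * C * coef_size N * r ^ N"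
          using * False by (intro rem) auto
        also have "\<dots> \<le> rem_const q * C * ((K1 + 2) * ?gb N) * r ^ N"
          using coef_size_le[of N] False K0 C * unfolding KK0 by (intro mult_right_mono mult_left_mono) auto
        also have "\<dots> = (K0 * (K1 + 2)) * (C * ?gb N * r ^ N)" unfolding KK0 by (simp add: mult_ac)
        also have "\<dots> \<le> K * (C * ?gb N * r ^ N)" using K2 C bound_nonneg * by (intro mult_right_mono) auto
        finally show ?thesis by (simp add: mult_ac)
      qed
    qed
  qed
qed

section \<open>Expansions depending on a parameter\<close>

text \<open>Coefficients of an expansion that is uniform in a parameter are uniform limits of difference quotients
of the expanded functions. Hence they inherit continuity and holomorphy in the parameter, whatever way they
were chosen.\<close>

lemma coeff_uniform_limit:
  fixes \<eta> :: "nat \<Rightarrow> complex" and F :: "nat \<Rightarrow> 'a \<Rightarrow> complex" and c :: "nat \<Rightarrow> 'a \<Rightarrow> complex"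
  assumes lim: "\<eta> \<longlonglongrightarrow> 0" and nz: "\<And>i. \<eta> i \<noteq> 0"
    and le: "\<forall>\<^sub>F i in sequentially. \<forall>z\<in>Z. cmod (F i z - (\<Sum>k<Suc n. c k z * \<eta> i ^ k)) \<le> K * cmod (\<eta> i) ^ Suc n"
  shows "uniform_limit Z (\<lambda>i z. (F i z - (\<Sum>k<n. c k z * \<eta> i ^ k)) / \<eta> i ^ n) (c n) sequentially"
proof (rule uniform_limitI)
  fix e :: real assume e: "e > 0"
  have "(\<lambda>i. K * cmod (\<eta> i)) \<longlonglongrightarrow> 0"
    using tendsto_mult_left[OF tendsto_norm[OF lim], of K] by simp
  then have "\<forall>\<^sub>F i in sequentially. K * cmod (\<eta> i) < e" using e by (rule order_tendstoD)
  with le show "\<forall>\<^sub>F i in sequentially. \<forall>z\<in>Z. dist ((F i z - (\<Sum>k<n. c k z * \<eta> i ^ k)) / \<eta> i ^ n) (c n z) < e"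
  proof eventually_elim
    case (elim i)
    show ?case
    proof
      fix z assume z: "z \<in> Z"
      have "(F i z - (\<Sum>k<n. c k z * \<eta> i ^ k)) / \<eta> i ^ n - c n z = (F i z - (\<Sum>k<Suc n. c k z * \<eta> i ^ k)) / \<eta> i ^ n"
        using nz[of i] by (simp add: field_simps)
      then have "dist ((F i z - (\<Sum>k<n. c k z * \<eta> i ^ k)) / \<eta> i ^ n) (c n z)
          = cmod (F i z - (\<Sum>k<Suc n. c k z * \<eta> i ^ k)) / cmod (\<eta> i) ^ n"
        by (simp only: dist_norm norm_divide norm_power)
      also have "\<dots> \<le> (K * cmod (\<eta> i) ^ Suc n) / cmod (\<eta> i) ^ n"
        using elim(1) z by (intro divide_right_mono) auto
      also have "\<dots> = K * cmod (\<eta> i)" using nz[of i] by simp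
      also have "\<dots> < e" by (rule elim(2))
      finally show "dist ((F i z - (\<Sum>k<n. c k z * \<eta> i ^ k)) / \<eta> i ^ n) (c n z) < e" .
    qed
  qed
qed

lemma coeff_continuous:
  fixes \<eta> :: "nat \<Rightarrow> complex" and F :: "nat \<Rightarrow> 'a::metric_space \<Rightarrow> complex" and c :: "nat \<Rightarrow> 'a \<Rightarrow> complex"
  assumes lim: "\<eta> \<longlonglongrightarrow> 0" and nz: "\<And>i. \<eta> i \<noteq> 0"
    and cont: "\<forall>\<^sub>F i in sequentially. continuous_on Z (F i)"
    and le: "\<And>N. \<exists>K. \<forall>\<^sub>F i in sequentially. \<forall>z\<in>Z. cmod (F i z - (\<Sum>k<N. c k z * \<eta> i ^ k)) \<le> K * cmod (\<eta> i) ^ N"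
  shows "continuous_on Z (c n)"
proof (induction n rule: less_induct)
  case (less n)
  obtain K where K: "\<forall>\<^sub>F i in sequentially. \<forall>z\<in>Z. cmod (F i z - (\<Sum>k<Suc n. c k z * \<eta> i ^ k)) \<le> K * cmod (\<eta> i) ^ Suc n"
    using le by blast
  show ?case
  proof (rule uniform_limit_theorem[OF _ coeff_uniform_limit[OF lim nz K]])
    show "\<forall>\<^sub>F i in sequentially. continuous_on Z (\<lambda>z. (F i z - (\<Sum>k<n. c k z * \<eta> i ^ k)) / \<eta> i ^ n)"
      using cont by eventually_elim (auto intro!: continuous_intros less simp: nz)
  qed simp
qed

lemma holomorphic2_slice:
  assumes f: "holomorphic2_on f D" and \<phi>: "\<phi> holomorphic_on Z" and \<psi>: "\<psi> holomorphic_on Z"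
    and D: "\<And>z. z \<in> Z \<Longrightarrow> (\<phi> z, \<psi> z) \<in> D"
  shows "(\<lambda>z. f (\<phi> z, \<psi> z)) holomorphic_on Z"
  unfolding holomorphic_on_def
proof
  fix z assume z: "z \<in> Z"
  obtain \<phi>' \<psi>' where d: "(\<phi> has_field_derivative \<phi>') (at z within Z)" "(\<psi> has_field_derivative \<psi>') (at z within Z)"
    using \<phi> \<psi> z unfolding holomorphic_on_def field_differentiable_def by meson
  have pair: "((\<lambda>z. (\<phi> z, \<psi> z)) has_derivative (\<lambda>h. (\<phi>' * h, \<psi>' * h))) (at z within Z)"
    by (intro has_derivative_Pair d[unfolded has_field_derivative_def])
  obtain u v where "(f has_derivative (\<lambda>(h, k). u * h + v * k)) (at (\<phi> z, \<psi> z) within D)"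
    using f D[OF z] unfolding holomorphic2_on_def by blast
  then have "(f has_derivative (\<lambda>(h, k). u * h + v * k)) (at (\<phi> z, \<psi> z) within (\<lambda>z. (\<phi> z, \<psi> z)) ` Z)"
    by (rule has_derivative_subset) (use D in auto)
  from has_derivative_in_compose[OF pair this]
  have "((\<lambda>z. f (\<phi> z, \<psi> z)) has_derivative (\<lambda>h. u * (\<phi>' * h) + v * (\<psi>' * h))) (at z within Z)"
    by simp
  moreover have "(\<lambda>h. u * (\<phi>' * h) + v * (\<psi>' * h)) = (*) (u * \<phi>' + v * \<psi>')"
    by (auto simp: algebra_simps)
  ultimately have "((\<lambda>z. f (\<phi> z, \<psi> z)) has_field_derivative (u * \<phi>' + v * \<psi>')) (at z within Z)"
    unfolding has_field_derivative_def by metis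
  then show "(\<lambda>z. f (\<phi> z, \<psi> z)) field_differentiable at z within Z"
    unfolding field_differentiable_def by blast
qed

definition gevrey_size :: "real \<Rightarrow> nat \<Rightarrow> nat \<Rightarrow> real" where
  "gevrey_size A p N = A powr (- (real N / real p)) * Gamma (real N / real p + 1)"

lemma gevrey_size_pos: "A > 0 \<Longrightarrow> 0 < gevrey_size A p N"
  unfolding gevrey_size_def by (intro mult_pos_pos Gamma_real_pos add_nonneg_pos) auto

lemma gevrey_bound_le_size: "A > 0 \<Longrightarrow> gevrey_bound A p N 0 \<le> gevrey_size A p N"
proof -
  assume A: "A > 0"
  have "gevrey_size A p N / (real N + 1) \<le> gevrey_size A p N / 1"
    using gevrey_size_pos[OF A, of p N] by (intro divide_left_mono) auto
  then show ?thesis by (simp add: gevrey_bound_def gevrey_size_def uGamma_0)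
qed

lemma exp_le_gevrey_size:
  assumes "A > 0" "p > 0" "(r::real) > 0"
  shows "exp (- (A / r ^ p)) \<le> gevrey_size A p N * r ^ N"
proof -
  let ?k = "real N / real p"
  have "(A / r ^ p) powr ?k * exp (- (A / r ^ p)) \<le> Gamma (?k + 1)"
    using uGamma_ge_powr[of ?k "A / r ^ p"] uGamma_le_Gamma[of ?k "A / r ^ p"] assms by simp
  moreover have "(A / r ^ p) powr ?k = A powr ?k / r ^ N"
    using assms by (simp add: powr_divide powr_realpow[symmetric] powr_powr)
  ultimately have "A powr ?k / r ^ N * exp (- (A / r ^ p)) \<le> Gamma (?k + 1)" by simp
  then have "(A powr (- ?k) * r ^ N) * (A powr ?k / r ^ N * exp (- (A / r ^ p))) \<le> (A powr (- ?k) * r ^ N) * Gamma (?k + 1)"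
    using assms by (intro mult_left_mono) auto
  moreover have "(A powr (- ?k) * r ^ N) * (A powr ?k / r ^ N * exp (- (A / r ^ p))) = (A powr (- ?k) * A powr ?k) * exp (- (A / r ^ p))"
    using assms by simp
  moreover have "A powr (- ?k) * A powr ?k = 1" using assms by (simp add: powr_add[symmetric])
  ultimately show ?thesis by (simp add: gevrey_size_def mult_ac)
qed

section \<open>Three families of functions of \<open>\<eta>\<close>\<close>

text \<open>The situation of the theorem with the cyclic index \<open>j\<close> unrolled to the integers, the angles increasing
by \<open>2 * pi\<close> along a period. The number \<open>A\<close> is already at most \<open>B * r0 ^ p\<close>, and all
differences in the index \<open>l\<close> are flat, not only those of neighbours. A point \<open>U\<close> stands for \<open>x / \<eta>\<close>. The flag
\<open>E\<close> tells whether the quasi-sectors contain a disc about 0, and \<open>\<rho>1\<close> is their inner radius \<open>\<bar>\<mu>\<bar>\<close>. The sets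
\<open>W k\<close> contain the quasi-sectors with room to spare: by the angle \<open>\<kappa>\<close> on each side, and by \<open>\<rho>\<close> instead of \<open>\<rho>1\<close>.
The function \<open>lam\<close> selects for each direction a sector \<open>S l\<close> around it.\<close>

locale sectorial_data =
  fixes p J m :: nat and A B C r0 r1 r2 r0' \<rho> \<rho>1 \<kappa> \<eta>1 :: real and E :: bool
    and \<alpha> \<beta> :: "int \<Rightarrow> real" and Y :: "int \<Rightarrow> 'l \<Rightarrow> complex \<Rightarrow> complex \<Rightarrow> complex"
    and D :: "int \<Rightarrow> 'l \<Rightarrow> (complex \<times> complex) set" and S :: "'l \<Rightarrow> complex set" and lam :: "real \<Rightarrow> 'l"
    and W :: "int \<Rightarrow> complex set"
  defines "W \<equiv> \<lambda>k. {of_real s * cis \<tau> |s \<tau>. \<rho> \<le> s \<and> \<alpha> k - \<kappa> \<le> \<tau> \<and> \<tau> \<le> \<beta> k + \<kappa>} \<union> (if E then cball 0 \<rho> else {})"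
  assumes p: "p > 0" and m: "m > 0" and J: "J \<ge> 2" and A: "A > 0" and B: "B > 0" and C: "C \<ge> 0"
    and AB: "A \<le> B * r0 ^ p"
    and r: "0 < r0" "r0 < r1" "r1 < r2" "r2 < r0'" and \<rho>: "0 < \<rho>" "0 < \<rho>1" "E \<Longrightarrow> \<rho>1 < \<rho>" "\<not> E \<Longrightarrow> \<rho> < \<rho>1"
    and \<kappa>: "0 < \<kappa>" "\<kappa> \<le> 1" "pi / m \<le> \<kappa>" and \<eta>1: "0 < \<eta>1" "\<eta>1 * \<rho> < r1"
    and angles: "\<alpha> (k + 1) + 2 * \<kappa> < \<beta> k" "\<beta> k + 2 * \<kappa> < \<alpha> (k + 2)"
    and period: "\<alpha> (k + int J) = \<alpha> k + 2 * pi" "\<beta> (k + int J) = \<beta> k + 2 * pi" "Y (k + int J) = Y k"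
    and S_lam: "0 < s \<Longrightarrow> s \<le> \<eta>1 \<Longrightarrow> \<bar>\<tau> - t\<bar> \<le> pi / m \<Longrightarrow> of_real s * cis \<tau> \<in> S (lam t)"
    and S_nz: "0 \<notin> S l"
    and dom: "U \<in> W k \<Longrightarrow> \<eta> \<in> S l \<Longrightarrow> cmod U * cmod \<eta> < r0' \<Longrightarrow> (U * \<eta>, \<eta>) \<in> D k l"
    and Y_hol: "holomorphic2_on (\<lambda>(x, \<eta>). Y k l x \<eta>) (D k l)"
    and Y_bnd: "(x, \<eta>) \<in> D k l \<Longrightarrow> cmod (Y k l x \<eta>) \<le> C"
    and Y_A: "(x, \<eta>) \<in> D k l \<Longrightarrow> (x, \<eta>) \<in> D k l' \<Longrightarrow> cmod (Y k l x \<eta> - Y k l' x \<eta>) \<le> C * exp (- (A / cmod \<eta> ^ p))"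
    and Y_B: "(x, \<eta>) \<in> D k l \<Longrightarrow> (x, \<eta>) \<in> D (k + 1) l \<Longrightarrow>
        cmod (Y (k + 1) l x \<eta> - Y k l x \<eta>) \<le> C * exp (- (B * cmod (x / \<eta>) ^ p))"
begin

definition q :: real where "q = r1 / r2"
definition \<epsilon>1 :: real where "\<epsilon>1 = q * \<eta>1"

lemma q: "0 < q" "q < 1" using r by (auto simp: q_def)
lemma \<epsilon>1: "0 < \<epsilon>1" "\<epsilon>1 < \<eta>1"
  using q \<eta>1 by (auto simp: \<epsilon>1_def)

lemma W_polar: "\<rho> \<le> s \<Longrightarrow> \<alpha> k - \<kappa> \<le> \<tau> \<Longrightarrow> \<tau> \<le> \<beta> k + \<kappa> \<Longrightarrow> of_real s * cis \<tau> \<in> W k"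
  unfolding W_def by blast

lemma hol_x:
  assumes "\<eta> \<in> S l" "Z \<subseteq> W k" "\<And>U. U \<in> Z \<Longrightarrow> cmod U * cmod \<eta> < r0'"
  shows "(\<lambda>U. Y k l (U * \<eta>) \<eta>) holomorphic_on Z"
proof -
  have "(\<lambda>U. U * \<eta>) holomorphic_on Z" by (intro holomorphic_intros)
  moreover have "(U * \<eta>, \<eta>) \<in> D k l" if "U \<in> Z" for U
    using dom assms that by blast
  ultimately show ?thesis
    using holomorphic2_slice[OF Y_hol, of "\<lambda>U. U * \<eta>" Z "\<lambda>_. \<eta>" k l] by simp
qed

lemma polar_in_S:
  assumes "\<eta> \<in> polar_sector t (pi / m) R" "R \<le> \<eta>1"
  shows "\<eta> \<in> S (lam t)"
  using assms unfolding polar_sector_def by (auto intro!: S_lam)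

lemma hol_eta:
  assumes "U \<in> W k" "R \<le> \<eta>1" "cmod U * R < r0'"
  shows "(\<lambda>\<eta>. Y k (lam t) (U * \<eta>) \<eta>) holomorphic_on polar_sector t (pi / m) R"
proof -
  have "(U * \<eta>, \<eta>) \<in> D k (lam t)" if \<eta>: "\<eta> \<in> polar_sector t (pi / m) R" for \<eta>
  proof (rule dom[OF assms(1) polar_in_S[OF \<eta> assms(2)]])
    have "cmod U * cmod \<eta> \<le> cmod U * R" using polar_sector_norm[OF \<eta>] by (intro mult_left_mono) auto
    then show "cmod U * cmod \<eta> < r0'" using assms(3) by linarith
  qed
  then show ?thesis
    using holomorphic2_slice[OF Y_hol, of "\<lambda>\<eta>. U * \<eta>" "polar_sector t (pi / m) R" "\<lambda>\<eta>. \<eta>" k "lam t"]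
    by (auto intro: holomorphic_intros)
qed

definition K_family :: real where
  "K_family = (SOME K. K > 0 \<and> (\<forall>G R C s. gevrey_family G m p R C A (B * s ^ p) \<longrightarrow> s \<ge> 0 \<longrightarrow>
     (R = \<eta>1 \<or> (R = r2 / s \<and> s > 0)) \<longrightarrow>
     (\<exists>c. (\<forall>n. cmod (c n) \<le> K * C * gevrey_bound A p n (B * s ^ p)) \<and>
      (\<forall>t \<tau> r N. 0 < r \<longrightarrow> r \<le> q * R \<longrightarrow> \<bar>\<tau> - t\<bar> \<le> pi / m / 2 \<longrightarrow>
        cmod (G t (of_real r * cis \<tau>) - (\<Sum>n<N. c n * (of_real r * cis \<tau>) ^ n))
        \<le> K * C * gevrey_bound A p N (B * s ^ p) * r ^ N))))"

lemma K_family: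
  shows "K_family > 0"
    and "gevrey_family G m p R C' A (B * s ^ p) \<Longrightarrow> s \<ge> 0 \<Longrightarrow> (R = \<eta>1 \<or> (R = r2 / s \<and> s > 0)) \<Longrightarrow>
     (\<exists>c. (\<forall>n. cmod (c n) \<le> K_family * C' * gevrey_bound A p n (B * s ^ p)) \<and>
      (\<forall>t \<tau> r N. 0 < r \<longrightarrow> r \<le> q * R \<longrightarrow> \<bar>\<tau> - t\<bar> \<le> pi / m / 2 \<longrightarrow>
        cmod (G t (of_real r * cis \<tau>) - (\<Sum>n<N. c n * (of_real r * cis \<tau>) ^ n))
        \<le> K_family * C' * gevrey_bound A p N (B * s ^ p) * r ^ N))"
  using someI_ex[OF gevrey_family_expansion[OF A B AB r(1) order_less_trans[OF r(2,3)] \<eta>1(1) p m q]]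
  unfolding K_family_def[symmetric] by blast+

text \<open>The density on the inner circle: \<open>U\<close> is fixed, and the differences come from the change of \<open>l\<close> only.\<close>

lemma inner_family:
  assumes U: "U \<in> W k" "cmod U \<le> \<rho>"
  shows "gevrey_family (\<lambda>t \<eta>. Y k (lam t) (U * \<eta>) \<eta>) m p \<eta>1 C A 0"
proof
  have Ur: "cmod U * cmod \<eta> < r0'" if "cmod \<eta> \<le> \<eta>1" for \<eta>
  proof -
    have "cmod U * cmod \<eta> \<le> \<rho> * \<eta>1" using U that \<eta>1 \<rho> by (intro mult_mono) auto
    then show ?thesis using \<eta>1 r by (simp add: mult.commute)
  qed
  have mem: "(U * \<eta>, \<eta>) \<in> D k (lam t)" if "\<eta> \<in> polar_sector t (pi / m) \<eta>1" for t \<eta>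
    using that Ur polar_sector_norm[OF that] polar_in_S[OF that] by (intro dom U) auto
  show "(\<lambda>\<eta>. Y k (lam t) (U * \<eta>) \<eta>) holomorphic_on polar_sector t (pi / m) \<eta>1" for t
    using Ur[of "of_real \<eta>1"] \<eta>1 by (intro hol_eta U) auto
  fix \<eta> t assume 1: "\<eta> \<in> polar_sector t (pi / m) \<eta>1"
  show "cmod (Y k (lam t) (U * \<eta>) \<eta>) \<le> C * exp (- 0)"
    using Y_bnd[OF mem[OF 1]] by simp
  fix t' assume 2: "\<eta> \<in> polar_sector t' (pi / m) \<eta>1"
  have "exp (- (A / cmod \<eta> ^ p)) \<le> 1" using A by simp
  then show "cmod (Y k (lam t) (U * \<eta>) \<eta> - Y k (lam t') (U * \<eta>) \<eta>) \<le> C * min (exp (- (A / cmod \<eta> ^ p))) (exp (- 0))"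
    using Y_A[OF mem[OF 1] mem[OF 2]] by simp
qed (use m p A C \<eta>1 in auto)

definition inner_coef :: "int \<Rightarrow> complex \<Rightarrow> nat \<Rightarrow> complex" where
  "inner_coef k U = (SOME c. (\<forall>n. cmod (c n) \<le> K_family * C * gevrey_bound A p n 0) \<and>
      (\<forall>t \<tau> r N. 0 < r \<longrightarrow> r \<le> \<epsilon>1 \<longrightarrow> \<bar>\<tau> - t\<bar> \<le> pi / m / 2 \<longrightarrow>
        cmod (Y k (lam t) (U * (of_real r * cis \<tau>)) (of_real r * cis \<tau>) - (\<Sum>n<N. c n * (of_real r * cis \<tau>) ^ n))
        \<le> K_family * C * gevrey_bound A p N 0 * r ^ N))"

lemma inner_coef:
  assumes U: "U \<in> W k" "cmod U \<le> \<rho>"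
  shows "cmod (inner_coef k U n) \<le> K_family * C * gevrey_bound A p n 0"
    and "0 < r \<Longrightarrow> r \<le> \<epsilon>1 \<Longrightarrow> cmod (Y k (lam t) (U * (of_real r * cis t)) (of_real r * cis t) - (\<Sum>n<N. inner_coef k U n * (of_real r * cis t) ^ n))
        \<le> K_family * C * gevrey_bound A p N 0 * r ^ N"
proof -
  have "gevrey_family (\<lambda>t \<eta>. Y k (lam t) (U * \<eta>) \<eta>) m p \<eta>1 C A (B * 0 ^ p)"
    using inner_family[OF U] p by (simp add: power_0_left)
  from K_family(2)[OF this]
  have "\<exists>c. (\<forall>n. cmod (c n) \<le> K_family * C * gevrey_bound A p n 0) \<and>
      (\<forall>t \<tau> r N. 0 < r \<longrightarrow> r \<le> \<epsilon>1 \<longrightarrow> \<bar>\<tau> - t\<bar> \<le> pi / m / 2 \<longrightarrow>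
        cmod (Y k (lam t) (U * (of_real r * cis \<tau>)) (of_real r * cis \<tau>) - (\<Sum>n<N. c n * (of_real r * cis \<tau>) ^ n))
        \<le> K_family * C * gevrey_bound A p N 0 * r ^ N)"
    using p by (simp add: power_0_left \<epsilon>1_def)
  note * = someI_ex[OF this, folded inner_coef_def]
  then show "cmod (inner_coef k U n) \<le> K_family * C * gevrey_bound A p n 0" by blast
  assume "0 < r" "r \<le> \<epsilon>1"
  then show "cmod (Y k (lam t) (U * (of_real r * cis t)) (of_real r * cis t) - (\<Sum>n<N. inner_coef k U n * (of_real r * cis t) ^ n))
        \<le> K_family * C * gevrey_bound A p N 0 * r ^ N"
    using * m by simp
qed

definition radius :: "real \<Rightarrow> real" where "radius s = (if \<eta>1 \<le> r2 / s then \<eta>1 else r2 / s)"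

lemma radius: "s > 0 \<Longrightarrow> 0 < radius s" "radius s \<le> \<eta>1" "s > 0 \<Longrightarrow> s * radius s \<le> r2"
  using \<eta>1 r by (auto simp: radius_def field_simps)

text \<open>The density on the rays. The jump is bounded by \<open>exp (- B \<bar>U\<bar>^p)\<close>, and a difference of two jumps by
\<open>exp (- A / \<bar>\<eta>\<bar>^p)\<close> as well. For large \<open>\<bar>U\<bar>\<close> the variable \<open>\<eta>\<close> is confined by \<open>\<bar>U \<eta>\<bar> \<le> r2\<close>.\<close>

lemma jump_family:
  assumes s: "\<rho> \<le> s" and \<theta>: "\<alpha> (k + 1) - \<kappa> \<le> \<theta>" "\<theta> \<le> \<beta> k + \<kappa>"
  defines "U \<equiv> of_real s * cis \<theta>"
  shows "gevrey_family (\<lambda>t \<eta>. Y (k + 1) (lam t) (U * \<eta>) \<eta> - Y k (lam t) (U * \<eta>) \<eta>) m p (radius s) (2 * C) A (B * s ^ p)"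
proof
  have s0: "s > 0" using s \<rho> by simp
  have "\<alpha> k < \<alpha> (k + 1)" "\<beta> k < \<beta> (k + 1)"
    using angles[of k] angles[of "k - 1"] angles[of "k + 1"] \<kappa> by (simp_all add: algebra_simps)
  then have UW: "U \<in> W k" "U \<in> W (k + 1)" using s \<theta> by (auto simp: U_def intro!: W_polar)
  have nU: "cmod U = s" using s0 by (simp add: U_def norm_mult)
  have Ur: "cmod U * cmod \<eta> < r0'" if "cmod \<eta> \<le> radius s" for \<eta>
  proof -
    have "cmod U * cmod \<eta> \<le> s * radius s" unfolding nU using that s0 by (intro mult_left_mono) auto
    then show ?thesis using radius(3)[OF s0] r by linarith
  qed
  have mem: "(U * \<eta>, \<eta>) \<in> D k (lam t)" "(U * \<eta>, \<eta>) \<in> D (k + 1) (lam t)" if "\<eta> \<in> polar_sector t (pi / m) (radius s)" for t \<eta>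
    using that Ur polar_sector_norm[OF that] polar_in_S[OF that radius(2)] by (auto intro!: dom UW)
  show "(\<lambda>\<eta>. Y (k + 1) (lam t) (U * \<eta>) \<eta> - Y k (lam t) (U * \<eta>) \<eta>) holomorphic_on polar_sector t (pi / m) (radius s)" for t
    using Ur[of "of_real (radius s)"] radius[of s] s0 by (intro holomorphic_intros hol_eta UW) auto
  have b: "cmod (Y (k + 1) (lam t) (U * \<eta>) \<eta> - Y k (lam t) (U * \<eta>) \<eta>) \<le> C * exp (- (B * s ^ p))"
    if 1: "\<eta> \<in> polar_sector t (pi / m) (radius s)" for t \<eta>
  proof -
    have "cmod (U * \<eta> / \<eta>) = s" using polar_sector_norm[OF 1] nU by (auto simp: norm_mult norm_divide)
    then show ?thesis using Y_B[OF mem[OF 1]] by simp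
  qed
  fix \<eta> t assume 1: "\<eta> \<in> polar_sector t (pi / m) (radius s)"
  have "C * exp (- (B * s ^ p)) \<le> 2 * C * exp (- (B * s ^ p))" using C by simp
  then show "cmod (Y (k + 1) (lam t) (U * \<eta>) \<eta> - Y k (lam t) (U * \<eta>) \<eta>) \<le> 2 * C * exp (- (B * s ^ p))"
    using b[OF 1] by linarith
  fix t' assume 2: "\<eta> \<in> polar_sector t' (pi / m) (radius s)"
  let ?d = "Y (k + 1) (lam t) (U * \<eta>) \<eta> - Y k (lam t) (U * \<eta>) \<eta> - (Y (k + 1) (lam t') (U * \<eta>) \<eta> - Y k (lam t') (U * \<eta>) \<eta>)"
  have "cmod ?d \<le> C * exp (- (B * s ^ p)) + C * exp (- (B * s ^ p))"
    by (rule norm_triangle_le_diff[OF add_mono[OF b[OF 1] b[OF 2]]])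
  moreover have "cmod ?d \<le> C * exp (- (A / cmod \<eta> ^ p)) + C * exp (- (A / cmod \<eta> ^ p))"
  proof -
    have "?d = (Y (k + 1) (lam t) (U * \<eta>) \<eta> - Y (k + 1) (lam t') (U * \<eta>) \<eta>) - (Y k (lam t) (U * \<eta>) \<eta> - Y k (lam t') (U * \<eta>) \<eta>)" by simp
    also have "cmod \<dots> \<le> C * exp (- (A / cmod \<eta> ^ p)) + C * exp (- (A / cmod \<eta> ^ p))"
      by (rule norm_triangle_le_diff[OF add_mono[OF Y_A[OF mem(2)[OF 1] mem(2)[OF 2]] Y_A[OF mem(1)[OF 1] mem(1)[OF 2]]]])
    finally show ?thesis .
  qed
  ultimately show "cmod ?d \<le> 2 * C * min (exp (- (A / cmod \<eta> ^ p))) (exp (- (B * s ^ p)))"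
    by (simp add: min_def)
qed (use m p A C B radius s \<rho> in \<open>auto intro!: mult_nonneg_nonneg\<close>)

definition jump_coef :: "int \<Rightarrow> real \<Rightarrow> real \<Rightarrow> nat \<Rightarrow> complex" where
  "jump_coef k \<theta> s = (SOME c. (\<forall>n. cmod (c n) \<le> K_family * (2 * C) * gevrey_bound A p n (B * s ^ p)) \<and>
      (\<forall>t \<tau> r N. 0 < r \<longrightarrow> r \<le> q * radius s \<longrightarrow> \<bar>\<tau> - t\<bar> \<le> pi / m / 2 \<longrightarrow>
        cmod (Y (k + 1) (lam t) (of_real s * cis \<theta> * (of_real r * cis \<tau>)) (of_real r * cis \<tau>)
            - Y k (lam t) (of_real s * cis \<theta> * (of_real r * cis \<tau>)) (of_real r * cis \<tau>)
            - (\<Sum>n<N. c n * (of_real r * cis \<tau>) ^ n))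
        \<le> K_family * (2 * C) * gevrey_bound A p N (B * s ^ p) * r ^ N))"

lemma jump_coef:
  assumes s: "\<rho> \<le> s" and \<theta>: "\<alpha> (k + 1) - \<kappa> \<le> \<theta>" "\<theta> \<le> \<beta> k + \<kappa>"
  shows "cmod (jump_coef k \<theta> s n) \<le> K_family * (2 * C) * gevrey_bound A p n (B * s ^ p)"
    and "0 < r \<Longrightarrow> r \<le> \<epsilon>1 \<Longrightarrow> s * r \<le> r1 \<Longrightarrow>
        cmod (Y (k + 1) (lam t) (of_real s * cis \<theta> * (of_real r * cis t)) (of_real r * cis t)
            - Y k (lam t) (of_real s * cis \<theta> * (of_real r * cis t)) (of_real r * cis t)
            - (\<Sum>n<N. jump_coef k \<theta> s n * (of_real r * cis t) ^ n))
        \<le> K_family * (2 * C) * gevrey_bound A p N (B * s ^ p) * r ^ N"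
proof -
  have s0: "s > 0" using s \<rho> by simp
  have "radius s = \<eta>1 \<or> (radius s = r2 / s \<and> s > 0)" using s0 by (simp add: radius_def)
  note * = someI_ex[OF K_family(2)[OF jump_family[OF assms] _ this], folded jump_coef_def]
  show "cmod (jump_coef k \<theta> s n) \<le> K_family * (2 * C) * gevrey_bound A p n (B * s ^ p)" using * s0 by simp
  assume r': "0 < r" "r \<le> \<epsilon>1" "s * r \<le> r1"
  have "r \<le> q * radius s" using r' s0 r by (auto simp: radius_def \<epsilon>1_def q_def field_simps)
  then show "cmod (Y (k + 1) (lam t) (of_real s * cis \<theta> * (of_real r * cis t)) (of_real r * cis t)
            - Y k (lam t) (of_real s * cis \<theta> * (of_real r * cis t)) (of_real r * cis t)
            - (\<Sum>n<N. jump_coef k \<theta> s n * (of_real r * cis t) ^ n))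
        \<le> K_family * (2 * C) * gevrey_bound A p N (B * s ^ p) * r ^ N"
    using * s0 r' m by simp
qed

definition mid :: "int \<Rightarrow> real" where "mid k = (\<alpha> (k + 1) + \<beta> k) / 2"

lemma mid: "\<alpha> (k + 1) + \<kappa> < mid k" "mid k < \<beta> k - \<kappa>"
  using angles[of k] by (auto simp: mid_def)

lemma mid_less: "mid k < mid (k + 1)"
proof -
  have "mid k < \<alpha> (k + 2)" using mid[of k] angles(2)[of k] \<kappa> by linarith
  moreover have "\<alpha> (k + 2) < mid (k + 1)" using mid(1)[of "k + 1"] \<kappa> by (simp add: add.assoc)
  ultimately show ?thesis by linarith
qed

lemma shift: "\<alpha> (k + z * int J) = \<alpha> k + 2 * pi * of_int z" "\<beta> (k + z * int J) = \<beta> k + 2 * pi * of_int z"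
    "Y (k + z * int J) = Y k"
proof -
  have *: "\<alpha> (k + z * int J) = \<alpha> k + 2 * pi * of_int z \<and> \<beta> (k + z * int J) = \<beta> k + 2 * pi * of_int z \<and> Y (k + z * int J) = Y k"
  proof (induction z rule: int_induct[where k = 0])
    case base then show ?case by simp
  next
    case (step1 i)
    have "k + (i + 1) * int J = (k + i * int J) + int J" by (simp add: algebra_simps)
    then show ?case using step1 period[of "k + i * int J"] by (simp add: algebra_simps)
  next
    case (step2 i)
    have "k + i * int J = (k + (i - 1) * int J) + int J" by (simp add: algebra_simps)
    then show ?case using step2 period[of "k + (i - 1) * int J"] by (simp add: algebra_simps)
  qed
  then show "\<alpha> (k + z * int J) = \<alpha> k + 2 * pi * of_int z" "\<beta> (k + z * int J) = \<beta> k + 2 * pi * of_int z"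
    "Y (k + z * int J) = Y k" by auto
qed

lemma ex_mid: "\<exists>k. mid (k - 1) \<le> \<tau> \<and> \<tau> \<le> mid k"
proof -
  have ms: "mid (z * int J) = mid 0 + 2 * pi * of_int z" for z
    using shift(1)[of 1 z] shift(2)[of 0 z] by (simp add: mid_def add.commute add_divide_distrib)
  obtain z1 :: int where z1: "(mid 0 - \<tau>) / (2 * pi) < z1" using ex_less_of_int by blast
  obtain z2 :: int where z2: "(\<tau> - mid 0) / (2 * pi) < z2" using ex_less_of_int by blast
  define k0 where "k0 = - z1 * int J"
  have k0: "mid k0 < \<tau>" unfolding k0_def ms using z1 by (simp add: field_simps)
  have k1: "\<tau> < mid (z2 * int J)" using z2 by (simp add: ms field_simps)
  have mono: "mid k \<le> mid (k + int i)" for k i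
  proof (induction i)
    case (Suc i)
    then show ?case using mid_less[of "k + int i"] by (simp add: algebra_simps)
  qed simp
  have "k0 < z2 * int J"
  proof (rule ccontr)
    assume "\<not> k0 < z2 * int J"
    then have "mid (z2 * int J) \<le> mid k0" using mono[of "z2 * int J" "nat (k0 - z2 * int J)"] by simp
    then show False using k0 k1 by linarith
  qed
  then have "\<tau> \<le> mid (k0 + int (nat (z2 * int J - k0)))" using k1 by simp
  then have ex: "\<exists>i. \<tau> \<le> mid (k0 + int i)" by blast
  define i where "i = (LEAST i. \<tau> \<le> mid (k0 + int i))"
  have i: "\<tau> \<le> mid (k0 + int i)" unfolding i_def using LeastI_ex[OF ex] .
  have "i \<noteq> 0" using i k0 by (intro notI) simp
  then have "\<not> \<tau> \<le> mid (k0 + int (i - 1))" using not_less_Least[of "i - 1" "\<lambda>i. \<tau> \<le> mid (k0 + int i)"] i_def by simp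
  then have "mid ((k0 + int i) - 1) \<le> \<tau>" using \<open>i \<noteq> 0\<close> by (simp add: of_nat_diff algebra_simps)
  then show ?thesis using i by blast
qed

text \<open>The index of a sector containing the direction \<open>\<tau>\<close> with margin \<open>\<kappa>\<close>.\<close>

definition sector_at :: "real \<Rightarrow> int" where "sector_at \<tau> = (SOME k. mid (k - 1) \<le> \<tau> \<and> \<tau> \<le> mid k)"

lemma sector_at: "\<alpha> (sector_at \<tau>) + \<kappa> \<le> \<tau>" "\<tau> \<le> \<beta> (sector_at \<tau>) - \<kappa>"
proof -
  have "mid (sector_at \<tau> - 1) \<le> \<tau> \<and> \<tau> \<le> mid (sector_at \<tau>)" unfolding sector_at_def by (rule someI_ex[OF ex_mid])
  then show "\<alpha> (sector_at \<tau>) + \<kappa> \<le> \<tau>" "\<tau> \<le> \<beta> (sector_at \<tau>) - \<kappa>" using mid[of "sector_at \<tau>"] mid[of "sector_at \<tau> - 1"] by auto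
qed

lemma \<alpha>_less: "\<alpha> k < \<alpha> (k + 1)"
  using angles(1)[of k] angles(2)[of "k - 1"] angles(1)[of "k - 1"] \<kappa> by (simp add: algebra_simps)

lemma \<alpha>_mono: "k \<le> k' \<Longrightarrow> \<alpha> k \<le> \<alpha> k'"
proof (induction k' rule: int_ge_induct)
  case (step i) then show ?case using \<alpha>_less[of i] by simp
qed simp

lemma adjacent_cases:
  assumes "\<alpha> k - \<kappa> \<le> \<tau>" "\<tau> \<le> \<beta> k + \<kappa>" "\<alpha> k' - \<kappa> \<le> \<tau>" "\<tau> \<le> \<beta> k' + \<kappa>"
  shows "k' = k \<or> k' = k + 1 \<or> k = k' + 1"
proof (rule ccontr)
  assume "\<not> ?thesis"
  then have "k + 2 \<le> k' \<or> k' + 2 \<le> k" by linarith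
  then show False
  proof
    assume "k + 2 \<le> k'"
    then show False using \<alpha>_mono[of "k + 2" k'] angles(2)[of k] assms by linarith
  next
    assume "k' + 2 \<le> k"
    then show False using \<alpha>_mono[of "k' + 2" k] angles(2)[of k'] assms by linarith
  qed
qed

lemma Y_B_adjacent:
  assumes "\<alpha> k - \<kappa> \<le> \<tau>" "\<tau> \<le> \<beta> k + \<kappa>" "\<alpha> k' - \<kappa> \<le> \<tau>" "\<tau> \<le> \<beta> k' + \<kappa>"
    and s: "\<rho> \<le> s" and \<eta>: "\<eta> \<in> S l" "s * cmod \<eta> < r0'"
  defines "x \<equiv> of_real s * cis \<tau> * \<eta>"
  shows "(x, \<eta>) \<in> D k l" "(x, \<eta>) \<in> D k' l" "cmod (Y k l x \<eta> - Y k' l x \<eta>) \<le> C * exp (- (B * s ^ p))"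
proof -
  have s0: "s > 0" using s \<rho> by simp
  have n: "cmod (of_real s * cis \<tau>) = s" using s0 by (simp add: norm_mult)
  show D: "(x, \<eta>) \<in> D k l" "(x, \<eta>) \<in> D k' l"
    unfolding x_def using assms n by (auto intro!: dom W_polar)
  have "\<eta> \<noteq> 0" using S_nz \<eta> by auto
  then have "cmod (x / \<eta>) = s" using s0 by (simp add: x_def norm_mult norm_divide)
  then show "cmod (Y k l x \<eta> - Y k' l x \<eta>) \<le> C * exp (- (B * s ^ p))"
    using adjacent_cases[OF assms(1-4)] Y_B[of x \<eta> k l] Y_B[of x \<eta> k' l] D C
    by (auto simp: norm_minus_commute)
qed

lemma outer_exp_le: "0 < x \<Longrightarrow> exp (- (B * (r1 / x) ^ p)) \<le> exp (- (A / x ^ p))"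
proof -
  assume x: "0 < x"
  have "A \<le> B * r1 ^ p"
    using AB mult_left_mono[OF power_mono[of r0 r1 p], of B] B r by linarith
  then have "A / x ^ p \<le> B * r1 ^ p / x ^ p" using x by (intro divide_right_mono) auto
  then show ?thesis by (simp add: power_divide)
qed

text \<open>The density on the outer circle: \<open>x = r1 cis \<phi>\<close> is fixed, so \<open>x / \<eta>\<close> turns against \<open>\<eta>\<close> and the index \<open>k\<close>
has to follow. The resulting differences are bounded by \<open>exp (- B (r1 / \<bar>\<eta>\<bar>)^p)\<close>, which is at most
\<open>exp (- A / \<bar>\<eta>\<bar>^p)\<close> because of \<open>A \<le> B r0^p\<close>.\<close>

lemma outer_family:
  defines "u \<equiv> \<lambda>\<phi>. of_real r1 * cis \<phi>"
  shows "gevrey_family (\<lambda>t \<eta>. Y (sector_at (\<phi> - t)) (lam t) (u \<phi>) \<eta>) m p \<eta>1 (2 * C) A 0"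
proof
  have U: "\<exists>s \<tau>. u \<phi> = of_real s * cis \<tau> * \<eta> \<and> \<rho> \<le> s \<and> s = r1 / cmod \<eta> \<and> s * cmod \<eta> < r0' \<and>
     \<alpha> (sector_at (\<phi> - t)) \<le> \<tau> \<and> \<tau> \<le> \<beta> (sector_at (\<phi> - t)) \<and> (\<exists>\<sigma>. \<tau> = \<phi> - \<sigma> \<and> \<eta> = of_real (cmod \<eta>) * cis \<sigma>)" if \<eta>: "\<eta> \<in> polar_sector t (pi / m) \<eta>1" for \<eta> t
  proof -
    obtain x \<sigma> where x: "\<eta> = of_real x * cis \<sigma>" "0 < x" "x \<le> \<eta>1" "\<bar>\<sigma> - t\<bar> \<le> pi / m"
      using \<eta> unfolding polar_sector_def by blast
    have nx: "cmod \<eta> = x" using x by (simp add: norm_mult)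
    have "\<rho> * x \<le> \<rho> * \<eta>1" using x \<rho> by (intro mult_left_mono) auto
    then have "\<rho> \<le> r1 / x" using x \<eta>1 by (simp add: field_simps)
    moreover have "u \<phi> = of_real (r1 / x) * cis (\<phi> - \<sigma>) * \<eta>"
    proof -
      have "cis (\<phi> - \<sigma>) * cis \<sigma> = cis \<phi>" by (simp add: cis_mult)
      then show ?thesis using x by (simp add: u_def mult_ac)
    qed
    moreover have "\<alpha> (sector_at (\<phi> - t)) \<le> \<phi> - \<sigma>" "\<phi> - \<sigma> \<le> \<beta> (sector_at (\<phi> - t))"
      using sector_at[of "\<phi> - t"] x \<kappa> by linarith+
    ultimately show ?thesis using nx x r by (intro exI[of _ "r1 / x"] exI[of _ "\<phi> - \<sigma>"]) auto
  qed
  have mem: "(u \<phi>, \<eta>) \<in> D (sector_at (\<phi> - t)) (lam t)" if \<eta>: "\<eta> \<in> polar_sector t (pi / m) \<eta>1" for \<eta> t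
  proof -
    obtain s \<tau> where "u \<phi> = of_real s * cis \<tau> * \<eta>" "\<rho> \<le> s" "s * cmod \<eta> < r0'" "\<alpha> (sector_at (\<phi> - t)) \<le> \<tau>" "\<tau> \<le> \<beta> (sector_at (\<phi> - t))"
      using U[OF \<eta>] by blast
    moreover have "cmod (of_real s * cis \<tau>) = s" using \<open>\<rho> \<le> s\<close> \<rho> by (simp add: norm_mult)
    ultimately show ?thesis using polar_in_S[OF \<eta>] \<kappa> by (auto intro!: dom W_polar)
  qed
  show "(\<lambda>\<eta>. Y (sector_at (\<phi> - t)) (lam t) (u \<phi>) \<eta>) holomorphic_on polar_sector t (pi / m) \<eta>1" for t
    using holomorphic2_slice[OF Y_hol, of "\<lambda>_. u \<phi>" "polar_sector t (pi / m) \<eta>1" "\<lambda>\<eta>. \<eta>"] mem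
    by (auto intro: holomorphic_intros)
  fix \<eta> t assume 1: "\<eta> \<in> polar_sector t (pi / m) \<eta>1"
  show "cmod (Y (sector_at (\<phi> - t)) (lam t) (u \<phi>) \<eta>) \<le> 2 * C * exp (- 0)" using Y_bnd[OF mem[OF 1]] C by simp
  fix t' assume 2: "\<eta> \<in> polar_sector t' (pi / m) \<eta>1"
  let ?k = "sector_at (\<phi> - t)" and ?k' = "sector_at (\<phi> - t')"
  have n0: "0 < cmod \<eta>" using polar_sector_norm[OF 1] by simp
  obtain s \<tau> \<sigma> where a: "u \<phi> = of_real s * cis \<tau> * \<eta>" "\<rho> \<le> s" "s = r1 / cmod \<eta>" "s * cmod \<eta> < r0'" "\<alpha> ?k \<le> \<tau>" "\<tau> \<le> \<beta> ?k"
      "\<tau> = \<phi> - \<sigma>" "\<eta> = of_real (cmod \<eta>) * cis \<sigma>" using U[OF 1] by blast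
  obtain \<tau>' \<sigma>' where a': "\<alpha> ?k' \<le> \<tau>'" "\<tau>' \<le> \<beta> ?k'" "\<tau>' = \<phi> - \<sigma>'" "\<eta> = of_real (cmod \<eta>) * cis \<sigma>'" using U[OF 2] by blast
  obtain z :: int where z: "\<sigma>' = \<sigma> + 2 * pi * of_int z"
    using of_real_cis_eq_iff(2)[OF n0 n0, of \<sigma> \<sigma>'] a(8) a'(4) by metis
  let ?k2 = "?k' + z * int J"
  have k2: "\<alpha> ?k2 \<le> \<tau>" "\<tau> \<le> \<beta> ?k2" using a a' z shift[of ?k' z] by auto
  have YY: "Y ?k' = Y ?k2" using shift(3) by simp
  have S1: "\<eta> \<in> S (lam t)" "\<eta> \<in> S (lam t')" using polar_in_S 1 2 by auto
  have B1: "(u \<phi>, \<eta>) \<in> D ?k2 (lam t)" "cmod (Y ?k (lam t) (u \<phi>) \<eta> - Y ?k2 (lam t) (u \<phi>) \<eta>) \<le> C * exp (- (B * s ^ p))"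
    unfolding a(1) using Y_B_adjacent(2,3)[OF _ _ _ _ a(2) S1(1) a(4), of ?k \<tau> ?k2] a k2 \<kappa> by auto
  have "(u \<phi>, \<eta>) \<in> D ?k2 (lam t')"
    unfolding a(1) using Y_B_adjacent(2)[OF _ _ _ _ a(2) S1(2) a(4), of ?k \<tau> ?k2] a k2 \<kappa> by auto
  from Y_A[OF B1(1) this]
  have A1: "cmod (Y ?k2 (lam t) (u \<phi>) \<eta> - Y ?k2 (lam t') (u \<phi>) \<eta>) \<le> C * exp (- (A / cmod \<eta> ^ p))" .
  have "C * exp (- (B * s ^ p)) \<le> C * exp (- (A / cmod \<eta> ^ p))"
    using outer_exp_le[OF n0] C a(3) by (intro mult_left_mono) auto
  then have "cmod ((Y ?k (lam t) (u \<phi>) \<eta> - Y ?k2 (lam t) (u \<phi>) \<eta>) + (Y ?k2 (lam t) (u \<phi>) \<eta> - Y ?k2 (lam t') (u \<phi>) \<eta>))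
      \<le> C * exp (- (A / cmod \<eta> ^ p)) + C * exp (- (A / cmod \<eta> ^ p))"
    using A1 B1(2) by (intro norm_triangle_le add_mono) auto
  moreover have "exp (- (A / cmod \<eta> ^ p)) \<le> 1" using A by simp
  ultimately show "cmod (Y ?k (lam t) (u \<phi>) \<eta> - Y ?k' (lam t') (u \<phi>) \<eta>) \<le> 2 * C * min (exp (- (A / cmod \<eta> ^ p))) (exp (- 0))"
    unfolding YY by simp
qed (use m p A C \<eta>1 in auto)

definition outer_coef :: "real \<Rightarrow> nat \<Rightarrow> complex" where
  "outer_coef \<phi> = (SOME c. (\<forall>n. cmod (c n) \<le> K_family * (2 * C) * gevrey_bound A p n 0) \<and>
      (\<forall>t \<tau> r N. 0 < r \<longrightarrow> r \<le> \<epsilon>1 \<longrightarrow> \<bar>\<tau> - t\<bar> \<le> pi / m / 2 \<longrightarrow>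
        cmod (Y (sector_at (\<phi> - t)) (lam t) (of_real r1 * cis \<phi>) (of_real r * cis \<tau>) - (\<Sum>n<N. c n * (of_real r * cis \<tau>) ^ n))
        \<le> K_family * (2 * C) * gevrey_bound A p N 0 * r ^ N))"

definition K_outer :: real where "K_outer = K_family * (2 * C) + C"

lemma K_outer: "0 \<le> K_outer" using K_family(1) C by (simp add: K_outer_def)

text \<open>The expansion holds for every \<open>k\<close> whose sector contains the direction \<open>\<phi> - t\<close> of \<open>x / \<eta>\<close>, since two such
functions differ by a flat one. The coefficients do not depend on \<open>k\<close>.\<close>

lemma outer_coef:
  shows "cmod (outer_coef \<phi> n) \<le> K_outer * gevrey_size A p n"
    and "0 < r \<Longrightarrow> r \<le> \<epsilon>1 \<Longrightarrow> \<alpha> k - \<kappa> \<le> \<phi> - t \<Longrightarrow> \<phi> - t \<le> \<beta> k + \<kappa> \<Longrightarrow>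
        cmod (Y k (lam t) (of_real r1 * cis \<phi>) (of_real r * cis t) - (\<Sum>n<N. outer_coef \<phi> n * (of_real r * cis t) ^ n))
        \<le> K_outer * gevrey_size A p N * r ^ N"
proof -
  have "gevrey_family (\<lambda>t \<eta>. Y (sector_at (\<phi> - t)) (lam t) (of_real r1 * cis \<phi>) \<eta>) m p \<eta>1 (2 * C) A (B * 0 ^ p)"
    using outer_family[of \<phi>] p by (simp add: power_0_left)
  from K_family(2)[OF this]
  have "\<exists>c. (\<forall>n. cmod (c n) \<le> K_family * (2 * C) * gevrey_bound A p n 0) \<and>
      (\<forall>t \<tau> r N. 0 < r \<longrightarrow> r \<le> \<epsilon>1 \<longrightarrow> \<bar>\<tau> - t\<bar> \<le> pi / m / 2 \<longrightarrow>
        cmod (Y (sector_at (\<phi> - t)) (lam t) (of_real r1 * cis \<phi>) (of_real r * cis \<tau>) - (\<Sum>n<N. c n * (of_real r * cis \<tau>) ^ n))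
        \<le> K_family * (2 * C) * gevrey_bound A p N 0 * r ^ N)"
    using p by (simp add: power_0_left \<epsilon>1_def)
  note * = someI_ex[OF this, folded outer_coef_def]
  have le: "K_family * (2 * C) * gevrey_bound A p N 0 \<le> K_family * (2 * C) * gevrey_size A p N" for N
    using K_family(1) C gevrey_bound_le_size[OF A] by (intro mult_left_mono) auto
  have size_nonneg: "gevrey_size A p N \<ge> 0" for N using gevrey_size_pos[OF A, of p N] by simp
  show "cmod (outer_coef \<phi> n) \<le> K_outer * gevrey_size A p n"
  proof -
    have "cmod (outer_coef \<phi> n) \<le> K_family * (2 * C) * gevrey_bound A p n 0" using * by blast
    also note le
    also have "K_family * (2 * C) * gevrey_size A p n \<le> K_outer * gevrey_size A p n"
      using C size_nonneg by (intro mult_right_mono) (auto simp: K_outer_def)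
    finally show ?thesis .
  qed
  assume r': "0 < r" "r \<le> \<epsilon>1" and k: "\<alpha> k - \<kappa> \<le> \<phi> - t" "\<phi> - t \<le> \<beta> k + \<kappa>"
  let ?u = "of_real r1 * cis \<phi>" and ?\<eta> = "of_real r * cis t"
  have n\<eta>: "cmod ?\<eta> = r" using r' by (simp add: norm_mult)
  have u: "?u = of_real (r1 / r) * cis (\<phi> - t) * ?\<eta>"
  proof -
    have "cis (\<phi> - t) * cis t = cis \<phi>" by (simp add: cis_mult)
    then show ?thesis using r' by (simp add: mult_ac)
  qed
  have S1: "?\<eta> \<in> S (lam t)" using r' \<epsilon>1 m by (intro S_lam) auto
  have "\<rho> * r \<le> \<rho> * \<eta>1" using r' \<epsilon>1 \<rho> by (intro mult_left_mono) auto
  then have s: "\<rho> \<le> r1 / r" using r' \<eta>1 by (simp add: field_simps)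
  have "cmod (Y k (lam t) ?u ?\<eta> - Y (sector_at (\<phi> - t)) (lam t) ?u ?\<eta>) \<le> C * exp (- (B * (r1 / r) ^ p))"
    unfolding u using sector_at[of "\<phi> - t"] \<kappa> k r' r n\<eta> by (intro Y_B_adjacent(3) s S1) auto
  also have "\<dots> \<le> C * exp (- (A / r ^ p))" using outer_exp_le[OF r'(1)] C by (intro mult_left_mono) auto
  also have "\<dots> \<le> C * (gevrey_size A p N * r ^ N)" using exp_le_gevrey_size[OF A p r'(1)] C by (intro mult_left_mono) auto
  finally have 1: "cmod (Y k (lam t) ?u ?\<eta> - Y (sector_at (\<phi> - t)) (lam t) ?u ?\<eta>) \<le> C * (gevrey_size A p N * r ^ N)" .
  have "cmod (Y (sector_at (\<phi> - t)) (lam t) ?u ?\<eta> - (\<Sum>n<N. outer_coef \<phi> n * ?\<eta> ^ n)) \<le> K_family * (2 * C) * gevrey_bound A p N 0 * r ^ N"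
    using * r' m by simp
  also have "\<dots> \<le> K_family * (2 * C) * gevrey_size A p N * r ^ N" using le r' by (intro mult_right_mono) auto
  finally have 2: "cmod (Y (sector_at (\<phi> - t)) (lam t) ?u ?\<eta> - (\<Sum>n<N. outer_coef \<phi> n * ?\<eta> ^ n)) \<le> K_family * (2 * C) * gevrey_size A p N * r ^ N" .
  have "cmod ((Y k (lam t) ?u ?\<eta> - Y (sector_at (\<phi> - t)) (lam t) ?u ?\<eta>) + (Y (sector_at (\<phi> - t)) (lam t) ?u ?\<eta> - (\<Sum>n<N. outer_coef \<phi> n * ?\<eta> ^ n)))
     \<le> C * (gevrey_size A p N * r ^ N) + K_family * (2 * C) * gevrey_size A p N * r ^ N"
    by (rule norm_triangle_le[OF add_mono[OF 1 2]])
  also have "\<dots> = K_outer * gevrey_size A p N * r ^ N" by (simp add: K_outer_def algebra_simps)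
  finally show "cmod (Y k (lam t) ?u ?\<eta> - (\<Sum>n<N. outer_coef \<phi> n * ?\<eta> ^ n)) \<le> K_outer * gevrey_size A p N * r ^ N" by simp
qed

end

section \<open>The contours\<close>

lemma integral_periodic:
  fixes f :: "real \<Rightarrow> complex"
  assumes cont: "continuous_on UNIV f" and per: "\<And>x. f (x + 2 * pi) = f x"
  shows "integral {a..a + 2 * pi} f = integral {0..2 * pi} f"
proof -
  have cs: "continuous_on S f" for S using cont by (rule continuous_on_subset) simp
  have int: "f integrable_on {x..y}" for x y by (rule integrable_continuous_interval[OF cs])
  have pern: "f (x + of_int n * (2 * pi)) = f x" for x and n :: int
  proof (induction n rule: int_induct[where k = 0])
    case (step1 i)
    then show ?case using per[of "x + of_int i * (2 * pi)"] by (simp add: algebra_simps)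
  next
    case (step2 i)
    then show ?case using per[of "x + of_int (i - 1) * (2 * pi)"] by (simp add: algebra_simps)
  qed simp
  have sh: "integral {x..y} f = integral {x + of_int n * (2 * pi)..y + of_int n * (2 * pi)} f" for x y and n :: int
    using integral_shift[OF cs, where a = x and b = y and c = "of_int n * (2 * pi)"] pern by (simp add: o_def)
  define n where "n = \<lfloor>a / (2 * pi)\<rfloor>"
  define a' where "a' = a - of_int n * (2 * pi)"
  have "of_int n \<le> a / (2 * pi)" "a / (2 * pi) < of_int n + 1" unfolding n_def by linarith+
  then have a': "0 \<le> a'" "a' \<le> 2 * pi" by (auto simp: a'_def field_simps)
  have "integral {a..a + 2 * pi} f = integral {a'..a' + 2 * pi} f"
    using sh[of a' "a' + 2 * pi" n] by (simp add: a'_def)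
  also have "\<dots> = integral {a'..2 * pi} f + integral {2 * pi..a' + 2 * pi} f"
    using a' by (intro Henstock_Kurzweil_Integration.integral_combine[symmetric] int) auto
  also have "integral {2 * pi..a' + 2 * pi} f = integral {0..a'} f"
    using sh[of 0 a' 1] by (simp add: add.commute)
  also have "integral {a'..2 * pi} f + integral {0..a'} f = integral {0..2 * pi} f"
    using Henstock_Kurzweil_Integration.integral_combine[OF a' int] by (metis add.commute)
  finally show ?thesis .
qed

lemma sum_integral_combine:
  fixes \<theta> :: "nat \<Rightarrow> real" and f :: "real \<Rightarrow> complex"
  assumes "\<And>i. i < m \<Longrightarrow> \<theta> i \<le> \<theta> (Suc i)" "continuous_on UNIV f"
  shows "(\<Sum>i<m. integral {\<theta> i..\<theta> (Suc i)} f) = integral {\<theta> 0..\<theta> m} f \<and> \<theta> 0 \<le> \<theta> m"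
  using assms(1)
proof (induction m)
  case (Suc m)
  have int: "f integrable_on {x..y}" for x y
    by (rule integrable_continuous_interval[OF continuous_on_subset[OF assms(2)]]) simp
  have "integral {\<theta> 0..\<theta> m} f + integral {\<theta> m..\<theta> (Suc m)} f = integral {\<theta> 0..\<theta> (Suc m)} f"
    using Suc by (intro Henstock_Kurzweil_Integration.integral_combine int) auto
  moreover have 1: "\<theta> 0 \<le> \<theta> m" "\<theta> m \<le> \<theta> (Suc m)" using Suc by auto
  moreover have "(\<Sum>i<m. integral {\<theta> i..\<theta> (Suc i)} f) = integral {\<theta> 0..\<theta> m} f" using Suc by auto
  ultimately show ?case using order_trans[OF 1] by simp
qed simp

lemma circle_cauchy:
  fixes \<theta> :: "nat \<Rightarrow> real"
  assumes \<theta>: "\<And>i. i < m \<Longrightarrow> \<theta> i \<le> \<theta> (Suc i)" "\<theta> m = \<theta> 0 + 2 * pi" and \<rho>: "\<rho> > 0" "cmod X \<noteq> \<rho>"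
    and f: "f holomorphic_on cball 0 \<rho>"
  shows "(\<Sum>i<m. \<i> * integral {\<theta> i..\<theta> (Suc i)} (\<lambda>s. cauchy_kernel f X (of_real \<rho> * cis s)))
     = (if cmod X < \<rho> then 2 * pi * \<i> * f X else 0)"
proof -
  let ?k = "\<lambda>s. cauchy_kernel f X (of_real \<rho> * cis s)"
  have ne: "of_real \<rho> * cis s \<noteq> X" for s using \<rho> by (auto simp: norm_mult)
  have cont: "continuous_on UNIV ?k" unfolding cauchy_kernel_def
  proof (intro continuous_intros continuous_on_compose2[OF holomorphic_on_imp_continuous_on[OF f]])
    show "range (\<lambda>x. of_real \<rho> * cis x) \<subseteq> cball 0 \<rho>" using \<rho> by (auto simp: norm_mult)
  qed (use ne in auto)
  have "(\<Sum>i<m. \<i> * integral {\<theta> i..\<theta> (Suc i)} ?k) = \<i> * integral {\<theta> 0..\<theta> 0 + 2 * pi} ?k"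
    using sum_integral_combine[of m \<theta> ?k] \<theta> cont by (simp add: sum_distrib_left[symmetric])
  also have "integral {\<theta> 0..\<theta> 0 + 2 * pi} ?k = integral {0..2 * pi} ?k"
    by (rule integral_periodic[OF cont]) (simp flip: cis_mult)
  also have "\<i> * integral {0..2 * pi} ?k = (if cmod X < \<rho> then 2 * pi * \<i> * f X else 0)"
  proof -
    define v where "v = (if cmod X < \<rho> then 2 * pi * \<i> * f X else 0)"
    have "((\<lambda>u. f u / (u - X)) has_contour_integral v) (circlepath 0 \<rho>)"
    proof (cases "cmod X < \<rho>")
      case True
      then show ?thesis using Cauchy_integral_circlepath_simple[OF f, of X] by (simp add: v_def)
    next
      case False
      then have "\<And>u. u \<in> cball 0 \<rho> \<Longrightarrow> u - X \<noteq> 0" using \<rho> by auto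
      then have "(\<lambda>u. f u / (u - X)) holomorphic_on cball 0 \<rho>" by (intro holomorphic_intros f)
      then show ?thesis using False \<rho>(1)
        using Cauchy_theorem_convex_simple[of "\<lambda>u. f u / (u - X)" "cball 0 \<rho>" "circlepath 0 \<rho>"]
        by (simp add: v_def sphere_cball)
    qed
    then have "((\<lambda>t. f (of_real \<rho> * cis t) / (of_real \<rho> * cis t - X) * of_real \<rho> * \<i> * cis t) has_integral v) {0..2 * pi}"
      unfolding circlepath_def by (subst (asm) has_contour_integral_part_circlepath_iff) auto
    moreover have "(\<lambda>t. f (of_real \<rho> * cis t) / (of_real \<rho> * cis t - X) * of_real \<rho> * \<i> * cis t) = (\<lambda>t. \<i> * ?k t)"
      by (auto simp: cauchy_kernel_def)
    ultimately have "((\<lambda>t. \<i> * ?k t) has_integral v) {0..2 * pi}" by metis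
    then have "integral {0..2 * pi} (\<lambda>t. \<i> * ?k t) = v" by (rule integral_unique)
    then show ?thesis unfolding v_def by (simp only: integral_mult_right)
  qed
  finally show ?thesis .
qed

text \<open>The rays are parametrized by \<open>v = 1 / \<bar>U\<bar>\<close>, which makes the infinite rays compact.\<close>

lemma integral_inverse_substitution:
  fixes \<phi> :: "real \<Rightarrow> complex"
  assumes "0 < \<rho>" "\<rho> \<le> T" and cont: "continuous_on {\<rho>..T} \<phi>"
  shows "integral {\<rho>..T} (\<lambda>s. \<phi> s / of_real s) = integral {1 / T..1 / \<rho>} (\<lambda>v. \<phi> (1 / v) / of_real v)"
proof -
  have "((\<lambda>v. (- (1 / v\<^sup>2)) *\<^sub>R ((\<lambda>s. \<phi> s / of_real s) (1 / v))) has_integral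
     (integral {1 / (1 / T)..1 / (1 / \<rho>)} (\<lambda>s. \<phi> s / of_real s) - integral {1 / (1 / \<rho>)..1 / (1 / T)} (\<lambda>s. \<phi> s / of_real s))) {1 / T..1 / \<rho>}"
  proof (rule has_integral_substitution_general[of "{}" _ _ _ \<rho> T])
    show "1 / T \<le> 1 / \<rho>" using assms by (simp add: frac_le)
    show "(/) 1 ` {1 / T..1 / \<rho>} \<subseteq> {\<rho>..T}"
    proof
      fix x assume "x \<in> (/) 1 ` {1 / T..1 / \<rho>}"
      then obtain v where v: "x = 1 / v" "1 / T \<le> v" "v \<le> 1 / \<rho>" by auto
      have "0 < 1 / T" using assms by simp
      then have "0 < v" using v by linarith
      then show "x \<in> {\<rho>..T}" unfolding v(1) using v(2,3) assms(1,2) by (simp add: field_simps)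
    qed
    show "continuous_on {\<rho>..T} (\<lambda>s. \<phi> s / of_real s)"
      using assms by (intro continuous_intros cont) auto
    have pos: "0 < v" if "v \<in> {1 / T..1 / \<rho>}" for v
    proof -
      have "0 < 1 / T" using assms by simp
      moreover have "1 / T \<le> v" using that by simp
      ultimately show ?thesis by linarith
    qed
    have "\<forall>v\<in>{1 / T..1 / \<rho>}. v \<noteq> 0"
    proof
      fix v assume "v \<in> {1 / T..1 / \<rho>}"
      from pos[OF this] show "v \<noteq> 0" by simp
    qed
    then show "continuous_on {1 / T..1 / \<rho>} ((/) 1)" by (intro continuous_intros) auto
    show "((/) 1 has_real_derivative - (1 / x\<^sup>2)) (at x within {1 / T..1 / \<rho>})" if "x \<in> {1 / T..1 / \<rho>} - {}" for x
      using pos[of x] that by (auto intro!: derivative_eq_intros simp: power2_eq_square)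
  qed simp
  moreover have "integral {T..\<rho>} (\<lambda>s. \<phi> s / of_real s) = 0"
    using assms by (cases "T = \<rho>") auto
  ultimately have "((\<lambda>v. (- (1 / v\<^sup>2)) *\<^sub>R (\<phi> (1 / v) / of_real (1 / v))) has_integral (- integral {\<rho>..T} (\<lambda>s. \<phi> s / of_real s))) {1 / T..1 / \<rho>}"
    by simp
  then have "((\<lambda>v. - ((- (1 / v\<^sup>2)) *\<^sub>R (\<phi> (1 / v) / of_real (1 / v)))) has_integral (- (- integral {\<rho>..T} (\<lambda>s. \<phi> s / of_real s)))) {1 / T..1 / \<rho>}"
    by (rule has_integral_neg)
  moreover have "- ((- (1 / v\<^sup>2)) *\<^sub>R (\<phi> (1 / v) / of_real (1 / v))) = \<phi> (1 / v) / of_real v" for v :: real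
    by (cases "v = 0") (simp_all add: scaleR_conv_of_real power2_eq_square divide_inverse)
  ultimately show ?thesis by (simp add: integral_unique)
qed

context sectorial_data
begin

text \<open>A fixed sequence of moduli tending to 0, along which expansions are compared.\<close>

definition eta_seq :: "nat \<Rightarrow> real" where "eta_seq i = \<epsilon>1 * (1 / real (Suc i))"

lemma eta_seq: "0 < eta_seq i" "eta_seq i \<le> \<epsilon>1" "eta_seq \<longlonglongrightarrow> 0"
proof -
  show "0 < eta_seq i" using \<epsilon>1 by (simp add: eta_seq_def)
  have "\<epsilon>1 * (1 / real (Suc i)) \<le> \<epsilon>1 * 1" using \<epsilon>1 by (intro mult_left_mono) auto
  then show "eta_seq i \<le> \<epsilon>1" by (simp add: eta_seq_def)
  have "eta_seq \<longlonglongrightarrow> \<epsilon>1 * 0"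
    unfolding eta_seq_def by (intro tendsto_mult_left LIMSEQ_inverse_real_of_nat[unfolded inverse_eq_divide])
  then show "eta_seq \<longlonglongrightarrow> 0" by simp
qed

lemma eta_seq_cis: "(\<lambda>i. of_real (eta_seq i) * cis t) \<longlonglongrightarrow> 0" "of_real (eta_seq i) * cis t \<noteq> 0" "cmod (of_real (eta_seq i) * cis t) = eta_seq i"
proof -
  have "(\<lambda>i. of_real (eta_seq i) * cis t) \<longlonglongrightarrow> of_real 0 * cis t"
    by (intro tendsto_mult tendsto_of_real tendsto_const eta_seq)
  then show "(\<lambda>i. of_real (eta_seq i) * cis t) \<longlonglongrightarrow> 0" by simp
  show "of_real (eta_seq i) * cis t \<noteq> 0" using eta_seq(1)[of i] by simp
  show "cmod (of_real (eta_seq i) * cis t) = eta_seq i" using eta_seq(1)[of i] by (simp add: norm_mult)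
qed

lemma eta_seq_S: "of_real (eta_seq i) * cis t \<in> S (lam t)"
  using eta_seq(1,2)[of i] \<epsilon>1 m by (intro S_lam) auto

lemma r_S: "0 < r \<Longrightarrow> r \<le> \<epsilon>1 \<Longrightarrow> of_real r * cis t \<in> S (lam t)"
  using \<epsilon>1 m by (intro S_lam) auto

lemma cont_x: "continuous_on {x. (x, \<eta>) \<in> D k l} (\<lambda>x. Y k l x \<eta>)"
proof -
  have "(\<lambda>x. Y k l x \<eta>) holomorphic_on {x. (x, \<eta>) \<in> D k l}"
    using holomorphic2_slice[OF Y_hol holomorphic_on_ident holomorphic_on_const, of "{x. (x, \<eta>) \<in> D k l}" \<eta> k l]
    by simp
  then show ?thesis by (rule holomorphic_on_imp_continuous_on)
qed

lemma size_nonneg: "0 \<le> gevrey_size A p N" using gevrey_size_pos[OF A, of p N] by simp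

lemma outer_mem:
  assumes "0 < r" "r \<le> \<epsilon>1" "\<alpha> k - \<kappa> \<le> \<phi> - t" "\<phi> - t \<le> \<beta> k + \<kappa>"
  shows "(of_real r1 * cis \<phi>, of_real r * cis t) \<in> D k (lam t)"
proof -
  have "cis (\<phi> - t) * cis t = cis \<phi>" by (simp add: cis_mult)
  then have u: "of_real r1 * cis \<phi> = of_real (r1 / r) * cis (\<phi> - t) * (of_real r * cis t)"
    using assms by (simp add: mult_ac)
  have "\<rho> * r \<le> \<rho> * \<eta>1" using assms \<epsilon>1 \<rho> by (intro mult_left_mono) auto
  then have s: "\<rho> \<le> r1 / r" using assms \<eta>1 by (simp add: field_simps)
  show ?thesis unfolding u
    using assms r by (intro dom W_polar s r_S) (auto simp: norm_mult norm_divide)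
qed

text \<open>Although the coefficients are chosen separately for each \<open>\<phi>\<close>, they are continuous in \<open>\<phi>\<close>, because locally
one function of \<open>\<phi>\<close> can be used for all \<open>\<phi>\<close>.\<close>

lemma outer_coef_cont: "continuous_on UNIV (\<lambda>\<phi>. outer_coef \<phi> n)"
proof (rule continuous_at_imp_continuous_on, rule ballI)
  fix \<phi>0 :: real
  let ?Z = "{\<phi>0 - \<kappa>..\<phi>0 + \<kappa>}" and ?k = "sector_at \<phi>0"
  have a: "\<alpha> ?k - \<kappa> \<le> \<phi> - 0" "\<phi> - 0 \<le> \<beta> ?k + \<kappa>" if "\<phi> \<in> ?Z" for \<phi>
    using sector_at[of \<phi>0] that \<kappa> by auto
  have "continuous_on ?Z (\<lambda>\<phi>. outer_coef \<phi> n)"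
  proof (rule coeff_continuous[OF eta_seq_cis(1)[of 0] eta_seq_cis(2), where F = "\<lambda>i \<phi>. Y ?k (lam 0) (of_real r1 * cis \<phi>) (of_real (eta_seq i) * cis 0)"])
    show "\<forall>\<^sub>F i in sequentially. continuous_on ?Z (\<lambda>\<phi>. Y ?k (lam 0) (of_real r1 * cis \<phi>) (of_real (eta_seq i) * cis 0))"
      using outer_mem[OF eta_seq(1,2) a] by (intro always_eventually allI continuous_on_compose2[OF cont_x]) (auto intro!: continuous_intros)
    fix N show "\<exists>K. \<forall>\<^sub>F i in sequentially. \<forall>\<phi>\<in>?Z. cmod (Y ?k (lam 0) (of_real r1 * cis \<phi>) (of_real (eta_seq i) * cis 0) - (\<Sum>k<N. outer_coef \<phi> k * (of_real (eta_seq i) * cis 0) ^ k)) \<le> K * cmod (of_real (eta_seq i) * cis 0) ^ N"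
      using outer_coef(2)[OF eta_seq(1,2) a] by (intro exI[of _ "K_outer * gevrey_size A p N"] always_eventually allI ballI) (simp only: eta_seq_cis(3))
  qed
  then show "isCont (\<lambda>\<phi>. outer_coef \<phi> n) \<phi>0"
    using \<kappa> continuous_on_interior[of ?Z "\<lambda>\<phi>. outer_coef \<phi> n" \<phi>0] by simp
qed

lemma outer_coef_periodic: "outer_coef (\<phi> + 2 * pi) n = outer_coef \<phi> n"
proof -
  let ?k = "sector_at \<phi>"
  let ?e = "\<lambda>i. of_real (eta_seq i) * cis 0"
  have Y: "Y (?k + int J) = Y ?k" by (rule period)
  have "outer_coef (\<phi> + 2 * pi) n - outer_coef \<phi> n = 0"
  proof (rule expansion_unique[OF eta_seq_cis(1)[of 0] eta_seq_cis(2), of "\<lambda>n. outer_coef (\<phi> + 2 * pi) n - outer_coef \<phi> n"])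
    fix N
    show "\<exists>K. \<forall>\<^sub>F i in sequentially. cmod (\<Sum>n<Suc N. (outer_coef (\<phi> + 2 * pi) n - outer_coef \<phi> n) * ?e i ^ n) \<le> K * cmod (?e i) ^ Suc N"
    proof (intro exI always_eventually allI)
      fix i
      let ?y = "Y ?k (lam 0) (of_real r1 * cis \<phi>) (?e i)" and ?S = "\<lambda>\<phi>. \<Sum>n<Suc N. outer_coef \<phi> n * ?e i ^ n"
      have c: "cis (\<phi> + 2 * pi) = cis \<phi>" by (simp flip: cis_mult)
      have 1: "cmod (?y - ?S \<phi>) \<le> K_outer * gevrey_size A p (Suc N) * eta_seq i ^ Suc N"
        using sector_at[of \<phi>] \<kappa> by (intro outer_coef(2) eta_seq) auto
      have 2: "cmod (?y - ?S (\<phi> + 2 * pi)) \<le> K_outer * gevrey_size A p (Suc N) * eta_seq i ^ Suc N"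
        using outer_coef(2)[OF eta_seq(1,2), of "?k + int J" "\<phi> + 2 * pi" 0 i "Suc N"] sector_at[of \<phi>] \<kappa> period[of ?k]
        by (simp only: c Y)
      have "(\<Sum>n<Suc N. (outer_coef (\<phi> + 2 * pi) n - outer_coef \<phi> n) * ?e i ^ n) = (?y - ?S \<phi>) - (?y - ?S (\<phi> + 2 * pi))"
        unfolding left_diff_distrib sum_subtractf by simp
      also have "cmod \<dots> \<le> K_outer * gevrey_size A p (Suc N) * eta_seq i ^ Suc N + K_outer * gevrey_size A p (Suc N) * eta_seq i ^ Suc N"
        by (intro norm_triangle_le_diff add_mono 1 2)
      also have "\<dots> = 2 * K_outer * gevrey_size A p (Suc N) * cmod (?e i) ^ Suc N" unfolding eta_seq_cis(3) by simp
      finally show "cmod (\<Sum>n<Suc N. (outer_coef (\<phi> + 2 * pi) n - outer_coef \<phi> n) * ?e i ^ n) \<le> 2 * K_outer * gevrey_size A p (Suc N) * cmod (?e i) ^ Suc N" .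
    qed
  qed
  then show ?thesis by simp
qed

lemma inner_small: "0 < r \<Longrightarrow> r \<le> \<epsilon>1 \<Longrightarrow> \<rho> * r < r1"
proof -
  assume "0 < r" "r \<le> \<epsilon>1"
  then have "\<rho> * r \<le> \<rho> * \<eta>1" using \<epsilon>1 \<rho> by (intro mult_left_mono) auto
  then show ?thesis using \<eta>1 by (simp add: mult.commute)
qed

lemma inner_coef_cont: "continuous_on (W k \<inter> cball 0 \<rho>) (\<lambda>U. inner_coef k U n)"
proof (rule coeff_continuous[OF eta_seq_cis(1)[of 0] eta_seq_cis(2), where F = "\<lambda>i U. Y k (lam 0) (U * (of_real (eta_seq i) * cis 0)) (of_real (eta_seq i) * cis 0)"])
  let ?Z = "W k \<inter> cball 0 \<rho>"
  have "cmod U * eta_seq i < r0'" if "U \<in> ?Z" for U i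
  proof -
    have "cmod U * eta_seq i \<le> \<rho> * eta_seq i" using that eta_seq(1)[of i] by (intro mult_right_mono) auto
    then show ?thesis using inner_small[OF eta_seq(1,2)[of i]] r by linarith
  qed
  then show "\<forall>\<^sub>F i in sequentially. continuous_on ?Z (\<lambda>U. Y k (lam 0) (U * (of_real (eta_seq i) * cis 0)) (of_real (eta_seq i) * cis 0))"
    by (intro always_eventually allI holomorphic_on_imp_continuous_on hol_x eta_seq_S) (auto simp only: eta_seq_cis(3))
  fix N show "\<exists>K. \<forall>\<^sub>F i in sequentially. \<forall>U\<in>?Z. cmod (Y k (lam 0) (U * (of_real (eta_seq i) * cis 0)) (of_real (eta_seq i) * cis 0) - (\<Sum>n<N. inner_coef k U n * (of_real (eta_seq i) * cis 0) ^ n)) \<le> K * cmod (of_real (eta_seq i) * cis 0) ^ N"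
    using inner_coef(2)[OF _ _ eta_seq(1,2)] by (intro exI[of _ "K_family * C * gevrey_bound A p N 0"] always_eventually allI ballI) (auto simp only: eta_seq_cis(3) Int_iff mem_cball_0)
qed

lemma \<beta>_less: "\<beta> k < \<beta> (k + 1)"
  using angles(2)[of k] angles(1)[of "k + 1"] \<kappa> by (simp add: algebra_simps)

lemma jump_coef_cont:
  assumes \<theta>: "\<alpha> (k + 1) - \<kappa> \<le> \<theta>" "\<theta> \<le> \<beta> k + \<kappa>"
  shows "continuous_on {\<rho>..} (\<lambda>s. jump_coef k \<theta> s n)"
  unfolding continuous_on_eq_continuous_within
proof
  fix s0 assume s0: "s0 \<in> {\<rho>..}"
  let ?Z = "{\<rho>..s0 + 1}"
  let ?e = "\<lambda>i. of_real (eta_seq i) * cis 0"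
  have "(\<lambda>i. eta_seq i * (s0 + 1)) \<longlonglongrightarrow> 0 * (s0 + 1)" by (intro tendsto_mult_right eta_seq)
  then have "\<forall>\<^sub>F i in sequentially. eta_seq i * (s0 + 1) < r1" using r by (intro order_tendstoD(2)[of _ 0]) auto
  then have ev: "\<forall>\<^sub>F i in sequentially. \<forall>s\<in>?Z. s * eta_seq i \<le> r1"
  proof eventually_elim
    case (elim i)
    show ?case
    proof
      fix s assume "s \<in> ?Z"
      then have "s * eta_seq i \<le> (s0 + 1) * eta_seq i" using eta_seq(1)[of i] by (intro mult_right_mono) auto
      then show "s * eta_seq i \<le> r1" using elim by (simp add: mult.commute)
    qed
  qed
  have UW: "of_real s * cis \<theta> \<in> W k" "of_real s * cis \<theta> \<in> W (k + 1)" if "s \<in> ?Z" for s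
    using \<theta> that \<alpha>_less[of k] \<beta>_less[of k] by (auto intro!: W_polar)
  have "continuous_on ?Z (\<lambda>s. jump_coef k \<theta> s n)"
  proof (rule coeff_continuous[OF eta_seq_cis(1)[of 0] eta_seq_cis(2), where F = "\<lambda>i s. Y (k + 1) (lam 0) (of_real s * cis \<theta> * ?e i) (?e i) - Y k (lam 0) (of_real s * cis \<theta> * ?e i) (?e i)"])
    show "\<forall>\<^sub>F i in sequentially. continuous_on ?Z (\<lambda>s. Y (k + 1) (lam 0) (of_real s * cis \<theta> * ?e i) (?e i) - Y k (lam 0) (of_real s * cis \<theta> * ?e i) (?e i))"
      using ev
    proof eventually_elim
      case (elim i)
      have sm: "cmod (of_real s * cis \<theta>) * cmod (?e i) < r0'" if "s \<in> ?Z" for s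
      proof -
        have "cmod (of_real s * cis \<theta>) = s" using that \<rho> by (simp add: norm_mult)
        then have "cmod (of_real s * cis \<theta>) * cmod (?e i) = s * eta_seq i" using eta_seq_cis(3)[of i 0] by (simp only:)
        then show ?thesis using elim that r by fastforce
      qed
      have "(of_real s * cis \<theta> * ?e i, ?e i) \<in> D k (lam 0)" "(of_real s * cis \<theta> * ?e i, ?e i) \<in> D (k + 1) (lam 0)" if "s \<in> ?Z" for s
        using dom[OF UW(1)[OF that] eta_seq_S sm[OF that]] dom[OF UW(2)[OF that] eta_seq_S sm[OF that]] by auto
      then show ?case
        by (intro continuous_on_diff continuous_on_compose2[OF cont_x]) (auto intro!: continuous_intros)
    qed
    fix N
    show "\<exists>K. \<forall>\<^sub>F i in sequentially. \<forall>s\<in>?Z. cmod (Y (k + 1) (lam 0) (of_real s * cis \<theta> * ?e i) (?e i) - Y k (lam 0) (of_real s * cis \<theta> * ?e i) (?e i) - (\<Sum>n<N. jump_coef k \<theta> s n * ?e i ^ n)) \<le> K * cmod (?e i) ^ N"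
    proof (intro exI[of _ "K_family * (2 * C) * (A powr (- (real N / real p)) * Gamma (real N / real p + 1))"], use ev in eventually_elim, intro ballI)
      fix i s assume i: "\<forall>s\<in>?Z. s * eta_seq i \<le> r1" and s: "s \<in> ?Z"
      have b: "0 \<le> B * s ^ p" using s \<rho> B by simp
      have "gevrey_bound A p N (B * s ^ p) \<le> A powr (- (real N / real p)) * Gamma (real N / real p + 1)"
      proof -
        have "A powr (- (real N / real p)) * uGamma (real N / real p) (B * s ^ p) \<le> A powr (- (real N / real p)) * Gamma (real N / real p + 1)"
          using b by (intro mult_left_mono uGamma_le_Gamma) auto
        moreover have "gevrey_bound A p N (B * s ^ p) \<le> A powr (- (real N / real p)) * uGamma (real N / real p) (B * s ^ p) / 1"
          unfolding gevrey_bound_def using b uGamma_nonneg[of "real N / real p" "B * s ^ p"] by (intro divide_left_mono) auto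
        ultimately show ?thesis by simp
      qed
      then have "K_family * (2 * C) * gevrey_bound A p N (B * s ^ p) * eta_seq i ^ N \<le> K_family * (2 * C) * (A powr (- (real N / real p)) * Gamma (real N / real p + 1)) * eta_seq i ^ N"
        using K_family(1) C eta_seq(1)[of i] by (intro mult_right_mono mult_left_mono) auto
      then show "cmod (Y (k + 1) (lam 0) (of_real s * cis \<theta> * ?e i) (?e i) - Y k (lam 0) (of_real s * cis \<theta> * ?e i) (?e i) - (\<Sum>n<N. jump_coef k \<theta> s n * ?e i ^ n))
         \<le> K_family * (2 * C) * (A powr (- (real N / real p)) * Gamma (real N / real p + 1)) * cmod (?e i) ^ N"
        using jump_coef(2)[OF _ \<theta> eta_seq(1,2), of s i 0 N] s i unfolding eta_seq_cis(3) by (meson atLeastAtMost_iff order_trans)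
    qed
  qed
  then have "continuous (at s0 within ?Z) (\<lambda>s. jump_coef k \<theta> s n)" using s0 by (auto simp: continuous_on_eq_continuous_within)
  moreover have "at s0 within ?Z = at s0 within {\<rho>..}"
    by (rule at_within_nhd[of _ "{..<s0 + 1}"]) auto
  ultimately show "continuous (at s0 within {\<rho>..}) (\<lambda>s. jump_coef k \<theta> s n)" by simp
qed

text \<open>The directions of the rays, for a Cauchy formula valid on the quasi-sector number \<open>j\<close>. The sector number 0
is larger than this quasi-sector by \<open>\<kappa>\<close> on both sides, so that all the rays, and all arcs belonging to other
sectors, stay at a positive angle from it.\<close>

definition node :: "int \<Rightarrow> nat \<Rightarrow> real" where
  "node j i = (if i = 0 then \<alpha> j - \<kappa> else if i = J then \<alpha> j - \<kappa> + 2 * pi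
     else if i = 1 then \<beta> j + \<kappa> else mid (j + int i - 1))"

lemma node_0: "node j 0 = \<alpha> j - \<kappa>" and node_J: "node j J = node j 0 + 2 * pi" and node_1: "node j 1 = \<beta> j + \<kappa>"
  using J by (auto simp: node_def)

lemma node_lower: "i \<le> J \<Longrightarrow> \<alpha> (j + int i) - \<kappa> \<le> node j i"
proof -
  assume i: "i \<le> J"
  consider "i = 0" | "i = J" | "i = 1" "i \<noteq> J" | "i \<ge> 2" "i < J" using i by linarith
  then show ?thesis
  proof cases
    case 2 then show ?thesis using period(1)[of j] J by (simp add: node_def)
  next
    case 3 then show ?thesis using angles(1)[of j] \<kappa> by (simp add: node_def)
  next
    case 4 then show ?thesis using mid(1)[of "j + int i - 1"] \<kappa> by (simp add: node_def)
  qed (simp add: node_def)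
qed

lemma node_upper: "i < J \<Longrightarrow> node j (Suc i) \<le> \<beta> (j + int i) + \<kappa>"
proof -
  assume i: "i < J"
  consider "Suc i = J" | "i = 0" "Suc i \<noteq> J" | "i \<ge> 1" "Suc i < J" using i by linarith
  then show ?thesis
  proof cases
    case 1
    then have "\<alpha> j + 2 * pi = \<alpha> (j + int i + 1)" using period(1)[of j] by (simp add: algebra_simps flip: 1)
    then show ?thesis using angles(1)[of "j + int i"] \<kappa> J 1 by (simp add: node_def)
  next
    case 2 then show ?thesis by (simp add: node_def)
  next
    case 3 then show ?thesis using mid(2)[of "j + int i"] \<kappa> by (simp add: node_def)
  qed
qed

lemma node_less: "i < J \<Longrightarrow> node j i < node j (Suc i)"
proof -
  assume i: "i < J"
  have gap: "\<beta> (j + int i - 1) + \<kappa> < \<alpha> (j + int i + 1) - \<kappa>" using angles(2)[of "j + int i - 1"] by (simp add: algebra_simps)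
  consider "i = 0" | "i \<ge> 1" by linarith
  then show ?thesis
  proof cases
    case 1
    have "node j 1 = \<beta> j + \<kappa>" by (rule node_1)
    then show ?thesis using 1 angles(1)[of j] \<alpha>_less[of j] \<kappa> by (simp add: node_0)
  next
    case 2
    have "node j i \<le> \<beta> (j + int (i - 1)) + \<kappa>" using node_upper[of "i - 1" j] 2 i by simp
    also have "\<dots> = \<beta> (j + int i - 1) + \<kappa>" using 2 by (simp add: of_nat_diff algebra_simps)
    also note gap
    also have "\<alpha> (j + int i + 1) - \<kappa> \<le> node j (Suc i)" using node_lower[of "Suc i" j] i by (simp add: add.commute add.left_commute)
    finally show ?thesis .
  qed
qed

lemma node_mono: "i \<le> i' \<Longrightarrow> i' \<le> J \<Longrightarrow> node j i \<le> node j i'"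
proof (induction i')
  case (Suc i')
  then show ?case using node_less[of i' j] by (cases "i = Suc i'") auto
qed simp

lemma node_W: "i < J \<Longrightarrow> \<rho> \<le> s \<Longrightarrow> node j i \<le> \<theta> \<Longrightarrow> \<theta> \<le> node j (Suc i) \<Longrightarrow> of_real s * cis \<theta> \<in> W (j + int i)"
  using node_lower[of i j] node_upper[of i j] by (intro W_polar) auto

lemma node_ray:
  assumes "i < J"
  shows "\<alpha> (j + int i + 1) - \<kappa> \<le> node j (Suc i)" "node j (Suc i) \<le> \<beta> (j + int i) + \<kappa>"
  using node_lower[of "Suc i" j] node_upper[of i j] assms by (auto simp: add.commute add.left_commute)

definition Vsec :: "int \<Rightarrow> complex set" where
  "Vsec j = {of_real s * cis \<tau> |s \<tau>. (if E then 0 < s else \<rho>1 < s) \<and> \<alpha> j < \<tau> \<and> \<tau> < \<beta> j} \<union> (if E then ball 0 \<rho>1 else {})"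

text \<open>A lower bound for \<open>\<bar>U - X\<bar>\<close> relative to \<open>\<bar>U\<bar>\<close> and to \<open>\<bar>X\<bar>\<close>, for \<open>U\<close> on the contour and \<open>X\<close> in the quasi-sector.
It comes from the angle \<open>\<kappa>\<close>, or from the gap between \<open>\<rho>\<close> and \<open>\<rho>1\<close>.\<close>

definition separation :: real where
  "separation = min (sqrt (1 - cos \<kappa>)) (if E then 1 - \<rho>1 / \<rho> else 1 - \<rho> / \<rho>1)"

lemma \<kappa>_pi: "\<kappa> \<le> pi / 2" using \<kappa> pi_ge_two by linarith

lemma separation: "0 < separation" "separation \<le> 1"
proof -
  show "0 < separation" using one_minus_cos_pos[OF \<kappa>(1) \<kappa>_pi] \<rho> by (simp add: separation_def)
  have "(if E then 1 - \<rho>1 / \<rho> else 1 - \<rho> / \<rho>1) \<le> 1" using \<rho> by simp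
  then show "separation \<le> 1" by (simp add: separation_def min_le_iff_disj)
qed

lemma away_of_ge:
  assumes "x \<le> \<sigma> * s" "0 < s" "0 \<le> x" "0 \<le> \<sigma>" "cmod U = s" "cmod X = x" "separation \<le> 1 - \<sigma>" "\<sigma> \<le> 1"
  shows "separation * s \<le> cmod (U - X)" "separation * x \<le> cmod (U - X)"
proof -
  have "(1 - \<sigma>) * s \<le> s - x" using assms by (simp add: algebra_simps)
  also have "\<dots> \<le> cmod (U - X)" using norm_triangle_ineq2[of U X] assms by simp
  finally have 1: "(1 - \<sigma>) * s \<le> cmod (U - X)" .
  have "separation * s \<le> (1 - \<sigma>) * s" using assms by (intro mult_right_mono) auto
  then show "separation * s \<le> cmod (U - X)" using 1 by linarith
  moreover have "x \<le> s" using assms mult_right_mono[of \<sigma> 1 s] by linarith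
  then have "separation * x \<le> separation * s" using separation by (intro mult_left_mono) auto
  ultimately show "separation * x \<le> cmod (U - X)" by linarith
qed

lemma away_ray:
  assumes X: "X \<in> Vsec j" and \<theta>: "node j 1 \<le> \<theta>" "\<theta> \<le> node j J" and s: "\<rho> \<le> s"
  shows "separation * s \<le> cmod (of_real s * cis \<theta> - X)" "separation * cmod X \<le> cmod (of_real s * cis \<theta> - X)"
proof -
  have s0: "0 < s" using s \<rho> by simp
  have "(\<exists>x \<tau>. X = of_real x * cis \<tau> \<and> 0 < x \<and> \<alpha> j < \<tau> \<and> \<tau> < \<beta> j) \<or> (E \<and> cmod X < \<rho>1)"
    using X \<rho> unfolding Vsec_def by (auto split: if_splits) (metis order_less_trans)+
  then have "separation * s \<le> cmod (of_real s * cis \<theta> - X) \<and> separation * cmod X \<le> cmod (of_real s * cis \<theta> - X)"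
  proof
    assume "\<exists>x \<tau>. X = of_real x * cis \<tau> \<and> 0 < x \<and> \<alpha> j < \<tau> \<and> \<tau> < \<beta> j"
    then obtain x \<tau> where x: "X = of_real x * cis \<tau>" "0 < x" "\<alpha> j < \<tau>" "\<tau> < \<beta> j" by blast
    have "\<kappa> \<le> \<theta> - \<tau>" "\<theta> - \<tau> \<le> 2 * pi - \<kappa>" using \<theta> x node_1[of j] node_J[of j] node_0[of j] by linarith+
    from norm_cis_diff_ge[OF this \<kappa>(1) \<kappa>_pi, of s x]
    have 1: "sqrt (1 - cos \<kappa>) * s \<le> cmod (of_real s * cis \<theta> - X)" "sqrt (1 - cos \<kappa>) * x \<le> cmod (of_real s * cis \<theta> - X)"
      using s0 x by auto
    have "separation \<le> sqrt (1 - cos \<kappa>)" by (simp add: separation_def)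
    then have "separation * s \<le> sqrt (1 - cos \<kappa>) * s" "separation * x \<le> sqrt (1 - cos \<kappa>) * x" using s0 x by (auto intro!: mult_right_mono)
    moreover have "cmod X = x" using x by (simp add: norm_mult)
    ultimately show ?thesis using 1 by auto
  next
    assume e: "E \<and> cmod X < \<rho>1"
    have "cmod X \<le> (\<rho>1 / \<rho>) * s"
    proof -
      have "\<rho>1 * 1 \<le> \<rho>1 * (s / \<rho>)" using s \<rho> by (intro mult_left_mono) auto
      then show ?thesis using e by simp
    qed
    moreover have "separation \<le> 1 - \<rho>1 / \<rho>" unfolding separation_def using e by simp
    moreover have "\<rho>1 / \<rho> \<le> 1" "0 \<le> \<rho>1 / \<rho>" using e \<rho> by auto
    moreover have "cmod (of_real s * cis \<theta>) = s" using s0 by (simp add: norm_mult)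
    ultimately show ?thesis
      using away_of_ge[of "cmod X" "\<rho>1 / \<rho>" s "of_real s * cis \<theta>" X] s0 by simp
  qed
  then show "separation * s \<le> cmod (of_real s * cis \<theta> - X)" "separation * cmod X \<le> cmod (of_real s * cis \<theta> - X)" by auto
qed

lemma away_arc:
  assumes X: "X \<in> Vsec j" and E: "\<not> E"
  shows "separation * \<rho> \<le> cmod (of_real \<rho> * cis \<theta> - X)" "separation * cmod X \<le> cmod (of_real \<rho> * cis \<theta> - X)"
proof -
  have "\<rho>1 < cmod X" using X E \<rho> unfolding Vsec_def by (auto simp: norm_mult)
  then have "\<rho> \<le> (\<rho> / \<rho>1) * cmod X"
    using \<rho> by (simp add: field_simps)
  moreover have "separation \<le> 1 - \<rho> / \<rho>1" unfolding separation_def using E by simp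
  moreover have "0 < cmod X" using \<open>\<rho>1 < cmod X\<close> \<rho> by linarith
  ultimately have "separation * cmod X \<le> cmod (X - of_real \<rho> * cis \<theta>)" "separation * \<rho> \<le> cmod (X - of_real \<rho> * cis \<theta>)"
    using away_of_ge[of \<rho> "\<rho> / \<rho>1" "cmod X" X "of_real \<rho> * cis \<theta>"] \<rho> E by (auto simp: norm_mult)
  then show "separation * \<rho> \<le> cmod (of_real \<rho> * cis \<theta> - X)" "separation * cmod X \<le> cmod (of_real \<rho> * cis \<theta> - X)"
    by (auto simp: norm_minus_commute)
qed

end

section \<open>Cauchy's formula in the variable \<open>x / \<eta>\<close>\<close>

lemma continuous_on_kernel_param:
  fixes w U :: "real \<Rightarrow> complex" and X :: "'a::topological_space \<Rightarrow> complex"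
  assumes "continuous_on {a..b} w" "continuous_on {a..b} U" "continuous_on Z X"
    and "\<And>s t. s \<in> Z \<Longrightarrow> t \<in> {a..b} \<Longrightarrow> U t \<noteq> X s"
  shows "continuous_on Z (\<lambda>s. integral {a..b} (\<lambda>t. w t * U t / (U t - X s)))"
proof -
  have "continuous_on (Z \<times> {a..b}) (\<lambda>x. w (snd x))"
    by (rule continuous_on_compose2[OF assms(1) continuous_on_snd[OF continuous_on_id]]) auto
  moreover have "continuous_on (Z \<times> {a..b}) (\<lambda>x. U (snd x))"
    by (rule continuous_on_compose2[OF assms(2) continuous_on_snd[OF continuous_on_id]]) auto
  moreover have "continuous_on (Z \<times> {a..b}) (\<lambda>x. X (fst x))"
    by (rule continuous_on_compose2[OF assms(3) continuous_on_fst[OF continuous_on_id]]) auto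
  ultimately have "continuous_on (Z \<times> cbox a b) (\<lambda>(s, t). w t * U t / (U t - X s))"
    unfolding split_beta cbox_interval by (intro continuous_intros) (use assms(4) in auto)
  from integral_continuous_on_param[OF this] show ?thesis by (simp add: cbox_interval)
qed

lemma integral_expansion_diff:
  fixes a k :: "real \<Rightarrow> complex"
  assumes "(\<lambda>s. a s * k s) integrable_on I" "\<And>n. n < N \<Longrightarrow> (\<lambda>s. c n s * k s) integrable_on I"
  shows "integral I (\<lambda>s. a s * k s) - (\<Sum>n<N. integral I (\<lambda>s. c n s * k s) * \<eta> ^ n)
     = integral I (\<lambda>s. (a s - (\<Sum>n<N. c n s * \<eta> ^ n)) * k s)"
proof -
  have "(\<Sum>n<N. integral I (\<lambda>s. c n s * k s) * \<eta> ^ n) = integral I (\<lambda>s. \<Sum>n<N. c n s * k s * \<eta> ^ n)"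
    by (subst integral_sum) (auto intro!: integrable_on_mult_left assms)
  moreover have "(\<lambda>s. \<Sum>n<N. c n s * k s * \<eta> ^ n) integrable_on I"
    by (intro integrable_sum integrable_on_mult_left assms) auto
  ultimately have "integral I (\<lambda>s. a s * k s) - (\<Sum>n<N. integral I (\<lambda>s. c n s * k s) * \<eta> ^ n)
     = integral I (\<lambda>s. a s * k s - (\<Sum>n<N. c n s * k s * \<eta> ^ n))"
    using assms(1) by (simp add: integral_diff)
  also have "\<dots> = integral I (\<lambda>s. (a s - (\<Sum>n<N. c n s * \<eta> ^ n)) * k s)"
    by (intro integral_cong) (simp only: left_diff_distrib sum_distrib_right, simp add: mult_ac)
  finally show ?thesis .
qed

definition double_size :: "real \<Rightarrow> real \<Rightarrow> nat \<Rightarrow> nat \<Rightarrow> nat \<Rightarrow> real" where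
  "double_size A B p n M = A powr (- (real n / real p)) * B powr (- (real M / real p)) * Gamma (real (M + n) / real p + 1)"

lemma double_size_pos: "A > 0 \<Longrightarrow> B > 0 \<Longrightarrow> 0 < double_size A B p n M"
  unfolding double_size_def by (intro mult_pos_pos Gamma_real_pos add_nonneg_pos) auto

lemma double_size_0: "B > 0 \<Longrightarrow> double_size A B p n 0 = gevrey_size A p n"
  by (simp add: double_size_def gevrey_size_def)

lemma gevrey_bound_cont:
  assumes "B > 0" "0 < \<epsilon>"
  shows "continuous_on {\<epsilon>..R} (\<lambda>v. gevrey_bound A p n (B / v ^ p) / v ^ M)"
  unfolding gevrey_bound_def
proof (intro continuous_intros)
  show "continuous_on {\<epsilon>..R} (\<lambda>v. uGamma (real n / real p) (B / v ^ p))"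
  proof (rule continuous_on_compose2[where g = "uGamma (real n / real p)"])
    show "continuous_on {0..B / \<epsilon> ^ p} (uGamma (real n / real p))" by (rule uGamma_cont_on) simp
    show "(\<lambda>v. B / v ^ p) ` {\<epsilon>..R} \<subseteq> {0..B / \<epsilon> ^ p}"
      using assms by (auto intro!: divide_left_mono power_mono mult_pos_pos divide_nonneg_nonneg)
    show "continuous_on {\<epsilon>..R} (\<lambda>v. B / v ^ p)" using assms by (intro continuous_intros) auto
  qed
qed (use assms in auto)

lemma gevrey_bound_int:
  assumes "A > 0" "B > 0" "p > 0" "M > 0" "0 < \<epsilon>" "\<epsilon> \<le> R"
  shows "integral {\<epsilon>..R} (\<lambda>v. gevrey_bound A p n (B / v ^ p) / v ^ (M + 1)) \<le> double_size A B p n M / (real n + 1)"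
proof -
  let ?k = "real n / real p"
  have "integral {\<epsilon>..R} (\<lambda>v. gevrey_bound A p n (B / v ^ p) / v ^ (M + 1))
      = integral {\<epsilon>..R} (\<lambda>v. (A powr (- ?k) / (real n + 1)) * (uGamma ?k (B / v ^ p) / v ^ (M + 1)))"
    by (simp add: gevrey_bound_def mult_ac)
  also have "\<dots> = (A powr (- ?k) / (real n + 1)) * integral {\<epsilon>..R} (\<lambda>v. uGamma ?k (B / v ^ p) / v ^ (M + 1))"
    by (rule integral_mult_right)
  also have "\<dots> \<le> (A powr (- ?k) / (real n + 1)) * (B powr (- (real M / real p)) * Gamma (?k + M / p + 1))"
  proof (rule mult_left_mono)
    have b: "0 \<le> B / R ^ p" using assms by simp
    have "integral {\<epsilon>..R} (\<lambda>v. uGamma ?k (B / v ^ p) / v ^ (M + 1))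
        \<le> (B powr (- (real M / real p)) * uGamma (?k + M / p) (B / R ^ p) - uGamma ?k (B / R ^ p) / R ^ M) / M"
      by (rule uGamma_powr_int_le) (use assms in auto)
    also have "\<dots> \<le> (B powr (- (real M / real p)) * uGamma (?k + M / p) (B / R ^ p)) / M"
      using assms uGamma_nonneg[of ?k "B / R ^ p"] b by (intro divide_right_mono) auto
    also have "\<dots> \<le> (B powr (- (real M / real p)) * uGamma (?k + M / p) (B / R ^ p)) / 1"
      using assms uGamma_nonneg[of "?k + M / p" "B / R ^ p"] b by (intro divide_left_mono) auto
    also have "\<dots> \<le> B powr (- (real M / real p)) * Gamma (?k + M / p + 1)"
      using uGamma_le_Gamma[of "?k + M / p" "B / R ^ p"] b by (simp add: mult_left_mono)
    finally show "integral {\<epsilon>..R} (\<lambda>v. uGamma ?k (B / v ^ p) / v ^ (M + 1)) \<le> B powr (- (real M / real p)) * Gamma (?k + M / p + 1)" .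
  qed simp
  also have "\<dots> = double_size A B p n M / (real n + 1)"
    by (simp add: double_size_def add_divide_distrib add.commute)
  finally show ?thesis .
qed

text \<open>For \<open>M > 0\<close> this is \<open>gevrey_bound_int\<close>. For \<open>M = 0\<close> one power of \<open>1 / v\<close> is lost by comparison with
\<open>M = 1\<close>, so that \<open>\<Gamma>((n + 1)/p + 1)\<close> appears instead of \<open>\<Gamma>(n/p + 1)\<close>; the denominator \<open>n + 1\<close> in
\<open>gevrey_bound\<close> compensates the quotient.\<close>

lemma gevrey_bound_int_ex:
  assumes AB: "A > 0" "B > 0" and p: "p > 0" and R0: "R0 > 0"
  shows "\<exists>K\<ge>1. \<forall>n M \<epsilon> R. 0 < \<epsilon> \<longrightarrow> \<epsilon> \<le> R \<longrightarrow> R \<le> R0 \<longrightarrow>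
     integral {\<epsilon>..R} (\<lambda>v. gevrey_bound A p n (B / v ^ p) / v ^ (M + 1)) \<le> K * double_size A B p n M"
proof (intro exI conjI allI impI)
  let ?K = "1 + R0 * (B powr (- (1 / real p)) * exp 1)"
  show "1 \<le> ?K" using R0 AB by simp
  fix n M :: nat and \<epsilon> R assume e: "0 < \<epsilon>" "\<epsilon> \<le> R" "R \<le> R0"
  have ds: "0 < double_size A B p n M" for n M by (rule double_size_pos[OF AB])
  have Kds: "double_size A B p n M \<le> ?K * double_size A B p n M"
    using mult_right_mono[of 1 ?K "double_size A B p n M"] ds[of n M] R0 AB by simp
  show "integral {\<epsilon>..R} (\<lambda>v. gevrey_bound A p n (B / v ^ p) / v ^ (M + 1)) \<le> ?K * double_size A B p n M"
  proof (cases "M > 0")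
    case True
    have "integral {\<epsilon>..R} (\<lambda>v. gevrey_bound A p n (B / v ^ p) / v ^ (M + 1)) \<le> double_size A B p n M / (real n + 1)"
      by (rule gevrey_bound_int[OF AB p True e(1,2)])
    also have "\<dots> \<le> double_size A B p n M / 1" using ds[of n M] by (intro divide_left_mono) auto
    finally show ?thesis using Kds by simp
  next
    case False
    then have M: "M = 0" by simp
    have "integral {\<epsilon>..R} (\<lambda>v. gevrey_bound A p n (B / v ^ p) / v ^ (M + 1))
       \<le> integral {\<epsilon>..R} (\<lambda>v. R0 * (gevrey_bound A p n (B / v ^ p) / v ^ (1 + 1)))"
    proof (rule integral_le)
      show "(\<lambda>v. gevrey_bound A p n (B / v ^ p) / v ^ (M + 1)) integrable_on {\<epsilon>..R}"
        using gevrey_bound_cont[OF AB(2) e(1)] by (rule integrable_continuous_interval)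
      show "(\<lambda>v. R0 * (gevrey_bound A p n (B / v ^ p) / v ^ (1 + 1))) integrable_on {\<epsilon>..R}"
        using gevrey_bound_cont[OF AB(2) e(1)] by (intro integrable_on_mult_right integrable_continuous_interval)
      fix v assume v: "v \<in> {\<epsilon>..R}"
      then have g: "0 \<le> gevrey_bound A p n (B / v ^ p)" using AB e by (intro gevrey_bound_nonneg) auto
      have "gevrey_bound A p n (B / v ^ p) / v = v * (gevrey_bound A p n (B / v ^ p) / v ^ 2)"
        using v e by (simp add: power2_eq_square)
      also have "\<dots> \<le> R0 * (gevrey_bound A p n (B / v ^ p) / v ^ 2)"
        using v e g by (intro mult_right_mono) auto
      finally show "gevrey_bound A p n (B / v ^ p) / v ^ (M + 1) \<le> R0 * (gevrey_bound A p n (B / v ^ p) / v ^ (1 + 1))"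
        using M by (simp add: power2_eq_square)
    qed
    also have "\<dots> = R0 * integral {\<epsilon>..R} (\<lambda>v. gevrey_bound A p n (B / v ^ p) / v ^ (1 + 1))" by (rule integral_mult_right)
    also have "\<dots> \<le> R0 * (double_size A B p n 1 / (real n + 1))"
      using R0 gevrey_bound_int[OF AB p _ e(1,2), of 1 n] by (intro mult_left_mono) auto
    also have "\<dots> \<le> R0 * (B powr (- (1 / real p)) * exp 1 * double_size A B p n 0)"
    proof (rule mult_left_mono)
      let ?k = "real n / real p"
      have "1 powr (1 - 1 / real p) * Gamma ((?k + 1 / p) + 1) \<le> exp 1 * Gamma ((?k + 1 / p) + (1 - 1 / real p) + 1)"
        using p by (intro Gamma_shift_le) auto
      then have "Gamma (?k + 1 / p + 1) \<le> exp 1 * Gamma ((?k + 1) + 1)" by simp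
      also have "Gamma ((?k + 1) + 1) = (?k + 1) * Gamma (?k + 1)"
      proof (rule Gamma_plus1)
        have k0: "0 \<le> ?k" by simp
        show "?k + 1 \<notin> \<int>\<^sub>\<le>\<^sub>0"
        proof
          assume "?k + 1 \<in> \<int>\<^sub>\<le>\<^sub>0"
          then obtain z :: int where "?k + 1 = of_int z" "z \<le> 0" by (elim nonpos_Ints_cases)
          then have "?k + 1 \<le> 0" by simp
          then show False using k0 by linarith
        qed
      qed
      also have "exp 1 * ((?k + 1) * Gamma (?k + 1)) \<le> exp 1 * ((real n + 1) * Gamma (?k + 1))"
      proof (intro mult_left_mono mult_right_mono)
        have "real n / real p \<le> real n / 1" using p by (intro divide_left_mono) auto
        then show "?k + 1 \<le> real n + 1" by simp
        show "0 \<le> Gamma (?k + 1)" by (intro Gamma_real_nonneg add_nonneg_pos) auto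
      qed simp
      finally have G: "Gamma (?k + 1 / p + 1) \<le> exp 1 * ((real n + 1) * Gamma (?k + 1))" .
      have "double_size A B p n 1 = A powr (- ?k) * B powr (- (1 / real p)) * Gamma (?k + 1 / p + 1)"
        by (simp add: double_size_def add_divide_distrib add.commute)
      also have "\<dots> \<le> A powr (- ?k) * B powr (- (1 / real p)) * (exp 1 * ((real n + 1) * Gamma (?k + 1)))"
        using G by (intro mult_left_mono) auto
      also have "\<dots> = (B powr (- (1 / real p)) * exp 1 * double_size A B p n 0) * (real n + 1)"
        using AB by (simp add: double_size_def mult_ac)
      finally show "double_size A B p n 1 / (real n + 1) \<le> B powr (- (1 / real p)) * exp 1 * double_size A B p n 0"
        by (simp add: pos_divide_le_eq)
    qed (use R0 in simp)
    also have "\<dots> = (R0 * (B powr (- (1 / real p)) * exp 1)) * double_size A B p n M" using M by simp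
    also have "\<dots> \<le> ?K * double_size A B p n M" using ds[of n M] by (intro mult_right_mono) auto
    finally show ?thesis .
  qed
qed

context sectorial_data
begin

definition ray_point :: "int \<Rightarrow> nat \<Rightarrow> real \<Rightarrow> complex" where "ray_point j i v = of_real (1 / v) * cis (node j (Suc i))"
definition ray_weight :: "int \<Rightarrow> nat \<Rightarrow> nat \<Rightarrow> real \<Rightarrow> complex" where
  "ray_weight j i n v = jump_coef (j + int i) (node j (Suc i)) (1 / v) n / of_real v"
definition K_jump :: real where "K_jump = K_family * (2 * C)"
text \<open>The coefficients of the density on the inner arcs. If the quasi-sectors contain a disc, then the integral of
the function number \<open>j\<close> over the whole inner circle is known, and subtracting it removes the arc of sector
0, which is the only one that can be close to \<open>X\<close>.\<close>

definition arc_weight :: "int \<Rightarrow> nat \<Rightarrow> nat \<Rightarrow> real \<Rightarrow> complex" where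
  "arc_weight j i n \<theta> = (if E then inner_coef j (of_real \<rho> * cis \<theta>) n - inner_coef (j + int i) (of_real \<rho> * cis \<theta>) n
                 else - inner_coef (j + int i) (of_real \<rho> * cis \<theta>) n)"

lemma K_jump: "0 \<le> K_jump" using K_family(1) C by (simp add: K_jump_def)

lemma bound_nonneg: "0 < v \<Longrightarrow> 0 \<le> gevrey_bound A p n (B / v ^ p)"
  using B by (intro gevrey_bound_nonneg) auto

lemma inv_\<rho>: "0 < v \<Longrightarrow> v \<le> 1 / \<rho> \<Longrightarrow> \<rho> \<le> 1 / v"
  using \<rho> by (simp add: field_simps)

lemma ray_weight_le:
  assumes "i < J" "0 < v" "v \<le> 1 / \<rho>"
  shows "cmod (ray_weight j i n v) \<le> K_jump * gevrey_bound A p n (B / v ^ p) / v"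
  using jump_coef(1)[OF inv_\<rho>[OF assms(2,3)] node_ray[OF assms(1), of j], of n] assms
  by (simp add: ray_weight_def K_jump_def norm_divide power_divide divide_right_mono)

lemma ray_weight_cont: "i < J \<Longrightarrow> continuous_on {0<..1 / \<rho>} (ray_weight j i n)"
  unfolding ray_weight_def
proof (intro continuous_intros)
  assume i: "i < J"
  show "continuous_on {0<..1 / \<rho>} (\<lambda>v. jump_coef (j + int i) (node j (Suc i)) (1 / v) n)"
  proof (rule continuous_on_compose2[OF jump_coef_cont[OF node_ray[OF i]]])
    show "continuous_on {0<..1 / \<rho>} (\<lambda>v. 1 / v)" by (intro continuous_intros) auto
    show "(\<lambda>v. 1 / v) ` {0<..1 / \<rho>} \<subseteq> {\<rho>..}" using inv_\<rho> by auto
  qed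
qed auto

lemma ray_weight_0: "ray_weight j i n 0 = 0" by (simp add: ray_weight_def)

lemma ray_weight_times_cont:
  assumes i: "i < J" and R: "0 < R" "R \<le> 1 / \<rho>" and \<phi>: "continuous_on {0<..R} \<phi>"
    and le: "\<And>v. 0 < v \<Longrightarrow> v \<le> R \<Longrightarrow> cmod (\<phi> v) \<le> K / v ^ M"
  shows "continuous_on {0..R} (\<lambda>v. ray_weight j i n v * \<phi> v)"
proof -
  obtain K' where K': "K' \<ge> 0" "\<And>v. 0 < v \<Longrightarrow> v \<le> R \<Longrightarrow> uGamma (real n / real p) (B / v ^ p) \<le> K' * v ^ (M + 2)"
    using uGamma_flat[of "real n / real p" B p R "M + 2"] B p R by auto
  show ?thesis
  proof (rule continuous_on_Icc_flat)
    have "continuous_on {0<..R} (ray_weight j i n)"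
      by (rule continuous_on_subset[OF ray_weight_cont[OF i]]) (use R in auto)
    then show "continuous_on {0<..R} (\<lambda>v. ray_weight j i n v * \<phi> v)" by (intro continuous_intros \<phi>)
    fix v assume v: "0 < v" "v \<le> R"
    let ?a = "K_jump * A powr (- (real n / real p)) / (real n + 1)"
    have "cmod (ray_weight j i n v) \<le> K_jump * gevrey_bound A p n (B / v ^ p) / v"
      using v R by (intro ray_weight_le i) auto
    also have "\<dots> = ?a * uGamma (real n / real p) (B / v ^ p) / v" by (simp add: gevrey_bound_def)
    also have "\<dots> \<le> ?a * (K' * v ^ (M + 2)) / v"
      using v K'(2)[OF v] K_jump by (intro divide_right_mono mult_left_mono) auto
    finally have 1: "cmod (ray_weight j i n v) \<le> ?a * K' * v ^ (M + 1)" using v by simp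
    have "cmod (ray_weight j i n v * \<phi> v) \<le> (?a * K' * v ^ (M + 1)) * (K / v ^ M)"
      unfolding norm_mult by (intro mult_mono 1 le v) (use K_jump K' v in auto)
    also have "\<dots> = (?a * K' * K) * v" using v by simp
    finally show "cmod (ray_weight j i n v * \<phi> v) \<le> (?a * K' * K) * v" .
  qed (simp add: ray_weight_0)
qed

definition K_int :: real where
  "K_int = (SOME K. K \<ge> 1 \<and> (\<forall>n M \<epsilon> R. 0 < \<epsilon> \<longrightarrow> \<epsilon> \<le> R \<longrightarrow> R \<le> 1 / \<rho> \<longrightarrow>
     integral {\<epsilon>..R} (\<lambda>v. gevrey_bound A p n (B / v ^ p) / v ^ (M + 1)) \<le> K * double_size A B p n M))"

lemma K_int: "1 \<le> K_int" "0 < \<epsilon> \<Longrightarrow> \<epsilon> \<le> R \<Longrightarrow> R \<le> 1 / \<rho> \<Longrightarrow>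
     integral {\<epsilon>..R} (\<lambda>v. gevrey_bound A p n (B / v ^ p) / v ^ (M + 1)) \<le> K_int * double_size A B p n M"
proof -
  have "1 / \<rho> > 0" using \<rho> by simp
  from someI_ex[OF gevrey_bound_int_ex[OF A B p this], folded K_int_def]
  show "1 \<le> K_int" "0 < \<epsilon> \<Longrightarrow> \<epsilon> \<le> R \<Longrightarrow> R \<le> 1 / \<rho> \<Longrightarrow>
     integral {\<epsilon>..R} (\<lambda>v. gevrey_bound A p n (B / v ^ p) / v ^ (M + 1)) \<le> K_int * double_size A B p n M" by auto
qed

lemma ray_weight_integral_le:
  assumes i: "i < J" and R: "0 < R" "R \<le> 1 / \<rho>" and \<phi>: "continuous_on {0<..R} \<phi>"
    and le: "\<And>v. 0 < v \<Longrightarrow> v \<le> R \<Longrightarrow> cmod (\<phi> v) \<le> K / v ^ M"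
  shows "cmod (integral {0..R} (\<lambda>v. ray_weight j i n v * \<phi> v)) \<le> K * (K_jump * (K_int * double_size A B p n M))"
proof -
  have "0 \<le> cmod (\<phi> R)" by simp
  also have "\<dots> \<le> K / R ^ M" by (rule le) (use R in auto)
  finally have "0 \<le> K / R ^ M * R ^ M" using R by (intro mult_nonneg_nonneg) auto
  then have K: "K \<ge> 0" using R by simp
  let ?D = "\<lambda>v. gevrey_bound A p n (B / v ^ p) / v ^ (M + 1)"
  show ?thesis
  proof (rule norm_integral_Icc_0_le[OF ray_weight_times_cont[OF i R \<phi> le] R(1)])
    fix v assume v: "0 < v" "v \<le> R"
    have "cmod (ray_weight j i n v * \<phi> v) \<le> (K_jump * gevrey_bound A p n (B / v ^ p) / v) * (K / v ^ M)"
      unfolding norm_mult using v R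
      by (intro mult_mono ray_weight_le i le v) (auto intro!: divide_nonneg_nonneg mult_nonneg_nonneg K_jump bound_nonneg)
    then show "cmod (ray_weight j i n v * \<phi> v) \<le> (K * K_jump) * ?D v" by (simp add: mult_ac)
  next
    fix \<epsilon> assume \<epsilon>: "0 < \<epsilon>" "\<epsilon> \<le> R"
    have int: "?D integrable_on {\<epsilon>..R}" using gevrey_bound_cont[OF B \<epsilon>(1)] by (rule integrable_continuous_interval)
    have "integral {\<epsilon>..R} (\<lambda>s. (K * K_jump) * ?D s) = (K * K_jump) * integral {\<epsilon>..R} ?D" by (rule integral_mult_right)
    also have "\<dots> \<le> (K * K_jump) * (K_int * double_size A B p n M)"
      by (intro mult_left_mono K_int \<epsilon> R) (use K K_jump in auto)
    also have "\<dots> = K * (K_jump * (K_int * double_size A B p n M))" by (rule mult.assoc)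
    finally show "(\<lambda>s. (K * K_jump) * ?D s) integrable_on {\<epsilon>..R} \<and>
      integral {\<epsilon>..R} (\<lambda>s. (K * K_jump) * ?D s) \<le> K * (K_jump * (K_int * double_size A B p n M))"
      using integrable_on_mult_right[OF int, of "K * K_jump"] by blast
  qed
qed

lemma ray_point_norm: "0 < v \<Longrightarrow> cmod (ray_point j i v) = 1 / v" by (simp add: ray_point_def norm_mult norm_divide)

lemma ray_point_away:
  assumes X: "X \<in> Vsec j" and i: "i < J" and v: "0 < v" "v \<le> 1 / \<rho>"
  shows "separation * (1 / v) \<le> cmod (ray_point j i v - X)" "separation * cmod X \<le> cmod (ray_point j i v - X)" "ray_point j i v \<noteq> X"
    "cmod (ray_point j i v / (ray_point j i v - X)) \<le> 1 / separation"
proof -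
  have a: "node j 1 \<le> node j (Suc i)" "node j (Suc i) \<le> node j J" using i by (auto intro!: node_mono)
  show 1: "separation * (1 / v) \<le> cmod (ray_point j i v - X)" "separation * cmod X \<le> cmod (ray_point j i v - X)"
    unfolding ray_point_def by (rule away_ray[OF X a inv_\<rho>[OF v]])+
  have p1: "0 < separation * (1 / v)" using separation v by simp
  then show "ray_point j i v \<noteq> X" using 1 by force
  have d: "0 < cmod (ray_point j i v - X)" using p1 1 by linarith
  have "(1 / v) / cmod (ray_point j i v - X) \<le> (1 / v) / (separation * (1 / v))"
    using v by (intro divide_left_mono[OF 1(1) _ mult_pos_pos[OF d p1]]) simp
  then show "cmod (ray_point j i v / (ray_point j i v - X)) \<le> 1 / separation" using v separation by (simp add: norm_divide ray_point_norm)
qed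

lemma ray_point_cont: "continuous_on {0<..R} (ray_point j i)" unfolding ray_point_def by (intro continuous_intros) auto

lemma arc_away:
  assumes X: "X \<in> Vsec j" and i: "i < J" and \<theta>: "\<theta> \<in> {node j i..node j (Suc i)}" and "\<not> (E \<and> i = 0)"
  shows "separation * \<rho> \<le> cmod (of_real \<rho> * cis \<theta> - X)" "separation * cmod X \<le> cmod (of_real \<rho> * cis \<theta> - X)" "of_real \<rho> * cis \<theta> \<noteq> X"
    "cmod (of_real \<rho> * cis \<theta> / (of_real \<rho> * cis \<theta> - X)) \<le> 1 / separation"
proof -
  have "separation * \<rho> \<le> cmod (of_real \<rho> * cis \<theta> - X) \<and> separation * cmod X \<le> cmod (of_real \<rho> * cis \<theta> - X)"
  proof (cases E)
    case True
    then have "i \<ge> 1" using assms(4) by auto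
    then have "node j 1 \<le> \<theta>" "\<theta> \<le> node j J" using \<theta> i node_mono[of 1 i j] node_mono[of "Suc i" J j] by auto
    then show ?thesis using away_ray[OF X] by auto
  next
    case False then show ?thesis using away_arc[OF X False] by auto
  qed
  then show 1: "separation * \<rho> \<le> cmod (of_real \<rho> * cis \<theta> - X)" "separation * cmod X \<le> cmod (of_real \<rho> * cis \<theta> - X)" by auto
  have p1: "0 < separation * \<rho>" using separation \<rho> by simp
  then show "of_real \<rho> * cis \<theta> \<noteq> X" using 1 by force
  have d: "0 < cmod (of_real \<rho> * cis \<theta> - X)" using p1 1 by linarith
  have "\<rho> / cmod (of_real \<rho> * cis \<theta> - X) \<le> \<rho> / (separation * \<rho>)"
    using \<rho>(1) by (intro divide_left_mono[OF 1(1) _ mult_pos_pos[OF d p1]]) simp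
  then show "cmod (of_real \<rho> * cis \<theta> / (of_real \<rho> * cis \<theta> - X)) \<le> 1 / separation" using \<rho> by (simp add: norm_divide norm_mult)
qed

lemma arc_W:
  assumes i: "i < J" and \<theta>: "\<theta> \<in> {node j i..node j (Suc i)}"
  shows "of_real \<rho> * cis \<theta> \<in> W (j + int i) \<inter> cball 0 \<rho>" "E \<Longrightarrow> of_real \<rho> * cis \<theta> \<in> W j \<inter> cball 0 \<rho>"
  using node_W[OF i order_refl, of j \<theta>] \<theta> \<rho> by (auto simp: norm_mult W_def)

lemma arc_weight_0: "E \<Longrightarrow> arc_weight j 0 n \<theta> = 0" unfolding arc_weight_def by simp

lemma arc_weight_cont: "i < J \<Longrightarrow> continuous_on {node j i..node j (Suc i)} (arc_weight j i n)"
proof -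
  assume i: "i < J"
  have 1: "continuous_on {node j i..node j (Suc i)} (\<lambda>\<theta>. inner_coef (j + int i) (of_real \<rho> * cis \<theta>) n)"
    by (rule continuous_on_compose2[OF inner_coef_cont]) (use arc_W(1)[OF i] in \<open>auto intro!: continuous_intros\<close>)
  have 2: "E \<Longrightarrow> continuous_on {node j i..node j (Suc i)} (\<lambda>\<theta>. inner_coef j (of_real \<rho> * cis \<theta>) n)"
    by (rule continuous_on_compose2[OF inner_coef_cont]) (use arc_W(2)[OF i] in \<open>auto intro!: continuous_intros\<close>)
  show ?thesis unfolding arc_weight_def using 1 2 by (cases E) (auto intro!: continuous_intros)
qed

lemma inner_coef_le_size: "U \<in> W k \<inter> cball 0 \<rho> \<Longrightarrow> cmod (inner_coef k U n) \<le> K_outer * gevrey_size A p n"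
proof -
  assume U: "U \<in> W k \<inter> cball 0 \<rho>"
  have "cmod (inner_coef k U n) \<le> K_family * C * gevrey_bound A p n 0" using U by (intro inner_coef) auto
  also have "\<dots> \<le> K_family * C * gevrey_size A p n"
    using K_family(1) C gevrey_bound_le_size[OF A] by (intro mult_left_mono) auto
  also have "\<dots> \<le> K_outer * gevrey_size A p n" using K_family(1) C size_nonneg by (intro mult_right_mono) (auto simp: K_outer_def)
  finally show ?thesis .
qed

lemma arc_weight_le: "i < J \<Longrightarrow> \<theta> \<in> {node j i..node j (Suc i)} \<Longrightarrow> cmod (arc_weight j i n \<theta>) \<le> 2 * K_outer * gevrey_size A p n"
proof -
  assume i: "i < J" and \<theta>: "\<theta> \<in> {node j i..node j (Suc i)}"
  have 1: "cmod (inner_coef (j + int i) (of_real \<rho> * cis \<theta>) n) \<le> K_outer * gevrey_size A p n"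
    by (rule inner_coef_le_size[OF arc_W(1)[OF i \<theta>]])
  have n: "0 \<le> K_outer * gevrey_size A p n" using K_outer size_nonneg by simp
  show ?thesis
  proof (cases E)
    case True
    have "cmod (inner_coef j (of_real \<rho> * cis \<theta>) n) \<le> K_outer * gevrey_size A p n"
      by (rule inner_coef_le_size[OF arc_W(2)[OF i \<theta> True]])
    from norm_triangle_le_diff[OF add_mono[OF this 1]] show ?thesis unfolding arc_weight_def using True by (simp add: mult_ac)
  next
    case False then show ?thesis unfolding arc_weight_def using 1 n by simp
  qed
qed

text \<open>For \<open>\<eta> = r cis t\<close>, the functions of \<open>U = x / \<eta>\<close> on the sector number \<open>i\<close> of the decomposition.\<close>

definition chart :: "int \<Rightarrow> real \<Rightarrow> real \<Rightarrow> nat \<Rightarrow> complex \<Rightarrow> complex" where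
  "chart j r t i U = Y (j + int i) (lam t) (U * (of_real r * cis t)) (of_real r * cis t)"

definition chart_diff :: "int \<Rightarrow> real \<Rightarrow> real \<Rightarrow> nat \<Rightarrow> complex \<Rightarrow> complex" where
  "chart_diff j r t i U = (if E then chart j r t 0 U - chart j r t i U else - chart j r t i U)"

lemma chart_hol:
  assumes "0 < r" "r \<le> \<epsilon>1" "Z \<subseteq> W (j + int i)" "\<And>U. U \<in> Z \<Longrightarrow> cmod U * r < r0'"
  shows "chart j r t i holomorphic_on Z"
  unfolding chart_def by (rule hol_x[OF r_S[OF assms(1,2)] assms(3)]) (use assms in \<open>auto simp: norm_mult\<close>)

lemma chart_hol_sector:
  assumes r': "0 < r" "r \<le> \<epsilon>1" and i: "i < J"
  shows "chart j r t i holomorphic_on annular_sector \<rho> (r1 / r) (node j i) (node j (Suc i))"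
proof (rule chart_hol[OF r'])
  show "annular_sector \<rho> (r1 / r) (node j i) (node j (Suc i)) \<subseteq> W (j + int i)"
    unfolding annular_sector_def using node_W[OF i] by auto
  fix U assume "U \<in> annular_sector \<rho> (r1 / r) (node j i) (node j (Suc i))"
  then have "cmod U \<le> r1 / r" using \<rho> by (auto simp: annular_sector_def norm_mult)
  then have "cmod U * r \<le> (r1 / r) * r" using r' by (intro mult_right_mono) auto
  then show "cmod U * r < r0'" using r r' by simp
qed

lemma chart_hol_disc:
  assumes r': "0 < r" "r \<le> \<epsilon>1" and E
  shows "chart j r t 0 holomorphic_on cball 0 \<rho>"
proof (rule chart_hol[OF r'])
  show "cball 0 \<rho> \<subseteq> W (j + int 0)" using \<open>E\<close> by (auto simp: W_def)
  fix U :: complex assume "U \<in> cball 0 \<rho>"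
  then have "cmod U * r \<le> \<rho> * r" using r' by (intro mult_right_mono) auto
  then show "cmod U * r < r0'" using r inner_small[OF r'] by linarith
qed

lemma chart_J: "chart j r t J = chart j r t 0" unfolding chart_def using period(3) by simp

definition cauchy_rhs :: "int \<Rightarrow> real \<Rightarrow> real \<Rightarrow> complex \<Rightarrow> complex" where
  "cauchy_rhs j r t X = (\<Sum>i<J. \<i> * integral {node j i..node j (Suc i)} (\<lambda>s. cauchy_kernel (chart j r t i) X (of_real (r1 / r) * cis s)))
    + (\<Sum>i<J. \<i> * integral {node j i..node j (Suc i)} (\<lambda>s. cauchy_kernel (chart_diff j r t i) X (of_real \<rho> * cis s)))
    + (\<Sum>i<J. integral {\<rho>..r1 / r} (\<lambda>s. cauchy_kernel (\<lambda>U. chart j r t (Suc i) U - chart j r t i U) X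
                                    (of_real s * cis (node j (Suc i))) / of_real s))"

lemma Vsec_polar:
  assumes "X \<in> Vsec j" "if E then \<rho>1 \<le> cmod X else True"
  shows "\<exists>\<tau>. X = of_real (cmod X) * cis \<tau> \<and> \<alpha> j < \<tau> \<and> \<tau> < \<beta> j \<and> 0 < cmod X \<and> (\<not> E \<longrightarrow> \<rho>1 < cmod X)"
proof -
  obtain s \<tau> where s: "X = of_real s * cis \<tau>" "if E then 0 < s else \<rho>1 < s" "\<alpha> j < \<tau>" "\<tau> < \<beta> j"
    using assms unfolding Vsec_def by (auto split: if_splits)
  then have "0 < s" using \<rho> by (auto split: if_splits)
  then have "cmod X = s" using s by (simp add: norm_mult)
  then show ?thesis using s \<open>0 < s\<close> by (intro exI[of _ \<tau>]) (auto split: if_splits)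
qed

lemma arc_cont:
  assumes r': "0 < r" "r \<le> \<epsilon>1" and i: "i < J" and s: "\<rho> \<le> s" "s \<le> r1 / r"
  shows "continuous_on {node j i..node j (Suc i)} (\<lambda>\<theta>. chart j r t i (of_real s * cis \<theta>))"
  by (rule continuous_on_compose2[OF holomorphic_on_imp_continuous_on[OF chart_hol_sector[OF r' i]]])
     (use s in \<open>auto intro!: continuous_intros in_annular_sectorI\<close>)

lemma \<rho>_lt_T: "0 < r \<Longrightarrow> r \<le> \<epsilon>1 \<Longrightarrow> \<rho> < r1 / r"
  using inner_small[of r] by (simp add: field_simps)

lemma chart_diff_cont:
  assumes r': "0 < r" "r \<le> \<epsilon>1" and i: "i < J"
  shows "continuous_on {node j i..node j (Suc i)} (\<lambda>\<theta>. chart_diff j r t i (of_real \<rho> * cis \<theta>))"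
proof -
  have 1: "continuous_on {node j i..node j (Suc i)} (\<lambda>\<theta>. chart j r t i (of_real \<rho> * cis \<theta>))"
    using \<rho>_lt_T[OF r'] by (intro arc_cont r' i) auto
  have 2: "E \<Longrightarrow> continuous_on {node j i..node j (Suc i)} (\<lambda>\<theta>. chart j r t 0 (of_real \<rho> * cis \<theta>))"
    by (rule continuous_on_compose2[OF holomorphic_on_imp_continuous_on[OF chart_hol_disc[OF r']]])
       (use \<rho> in \<open>auto intro!: continuous_intros simp: norm_mult\<close>)
  show ?thesis unfolding chart_diff_def using 1 2 by (cases E) (auto intro!: continuous_intros)
qed

lemma ray_cont:
  assumes r': "0 < r" "r \<le> \<epsilon>1" and i: "i < J"
  shows "continuous_on {\<rho>..r1 / r} (\<lambda>s. chart j r t (Suc i) (of_real s * cis (node j (Suc i))) - chart j r t i (of_real s * cis (node j (Suc i))))"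
proof (intro continuous_on_diff)
  have sub: "(\<lambda>s. of_real s * cis (node j (Suc i))) ` {\<rho>..r1 / r} \<subseteq> W (j + int i')" if "i' = i \<or> i' = Suc i" for i'
  proof -
    have "\<alpha> (j + int i') - \<kappa> \<le> node j (Suc i) \<and> node j (Suc i) \<le> \<beta> (j + int i') + \<kappa>"
      using node_ray[OF i, of j] \<alpha>_less[of "j + int i"] \<beta>_less[of "j + int i"] that by (auto simp: add_ac)
    then show ?thesis by (auto intro!: W_polar)
  qed
  have h: "chart j r t i' holomorphic_on (\<lambda>s. of_real s * cis (node j (Suc i))) ` {\<rho>..r1 / r}" if "i' = i \<or> i' = Suc i" for i'
  proof (rule chart_hol[OF r' sub[OF that]])
    fix U assume "U \<in> (\<lambda>s. of_real s * cis (node j (Suc i))) ` {\<rho>..r1 / r}"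
    then have "cmod U \<le> r1 / r" using \<rho> by (auto simp: norm_mult)
    then have "cmod U * r \<le> (r1 / r) * r" using r' by (intro mult_right_mono) auto
    then show "cmod U * r < r0'" using r r' by simp
  qed
  have c: "continuous_on {\<rho>..r1 / r} (\<lambda>s. of_real s * cis (node j (Suc i)))" by (intro continuous_intros)
  show "continuous_on {\<rho>..r1 / r} (\<lambda>s. chart j r t (Suc i) (of_real s * cis (node j (Suc i))))"
    by (rule continuous_on_compose2[OF holomorphic_on_imp_continuous_on[OF h[of "Suc i"]] c]) auto
  show "continuous_on {\<rho>..r1 / r} (\<lambda>s. chart j r t i (of_real s * cis (node j (Suc i))))"
    by (rule continuous_on_compose2[OF holomorphic_on_imp_continuous_on[OF h[of i]] c]) auto
qed

text \<open>Outside the circle \<open>\<bar>X\<bar> = \<rho>\<close> the formula is \<open>decomposition_sum_inside\<close> or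
\<open>decomposition_sum_inner_disc\<close>, combined with Cauchy's formula for the disc if the quasi-sectors contain one.\<close>

lemma cauchy_formula_off_arc:
  assumes X: "X \<in> Vsec j" and r': "0 < r" "r \<le> \<epsilon>1" and Xr: "cmod X * r < r0" and nE: "E \<Longrightarrow> cmod X \<noteq> \<rho>"
  shows "cauchy_rhs j r t X = 2 * pi * \<i> * chart j r t 0 X"
proof -
  let ?F = "chart j r t" and ?T = "r1 / r"
  define Out where "Out = (\<Sum>i<J. \<i> * integral {node j i..node j (Suc i)} (\<lambda>s. cauchy_kernel (?F i) X (of_real ?T * cis s)))"
  define In where "In = (\<Sum>i<J. \<i> * integral {node j i..node j (Suc i)} (\<lambda>s. cauchy_kernel (?F i) X (of_real \<rho> * cis s)))"
  define In' where "In' = (\<Sum>i<J. \<i> * integral {node j i..node j (Suc i)} (\<lambda>s. cauchy_kernel (?F 0) X (of_real \<rho> * cis s)))"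
  define Q where "Q = (\<Sum>i<J. \<i> * integral {node j i..node j (Suc i)} (\<lambda>s. cauchy_kernel (chart_diff j r t i) X (of_real \<rho> * cis s)))"
  define Ray where "Ray = (\<Sum>i<J. integral {\<rho>..r1 / r} (\<lambda>s. cauchy_kernel (\<lambda>U. ?F (Suc i) U - ?F i U) X
                                    (of_real s * cis (node j (Suc i))) / of_real s))"
  have T: "\<rho> < ?T" by (rule \<rho>_lt_T[OF r'])
  have XT: "cmod X < ?T" using Xr r r' by (simp add: field_simps)
  have ds: "decomposition_sum \<rho> ?T J (node j) ?F X = Out - In + Ray"
    unfolding decomposition_sum_def Out_def In_def Ray_def by simp
  have inside: "decomposition_sum \<rho> ?T J (node j) ?F X = 2 * pi * \<i> * ?F 0 X" if gt: "\<rho> < cmod X"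
  proof -
    obtain \<tau> where \<tau>: "X = of_real (cmod X) * cis \<tau>" "\<alpha> j < \<tau>" "\<tau> < \<beta> j"
    proof -
      have "if E then \<rho>1 \<le> cmod X else True"
      proof (cases E)
        case True then show ?thesis using gt \<rho>(3) by simp
      qed simp
      then show thesis using Vsec_polar[OF X] that by blast
    qed
    show ?thesis
      by (rule decomposition_sum_inside[OF \<rho>(1) gt XT _ node_less node_J chart_J chart_hol_sector[OF r'] \<tau>(1)])
         (use J \<tau> node_0[of j] node_1[of j] \<kappa> in auto)
  qed
  have ne: "cmod X \<noteq> \<rho>"
  proof (cases E)
    case False
    then show ?thesis using Vsec_polar[OF X] \<rho>(4) by auto
  qed (use nE in auto)
  have ne': "of_real \<rho> * cis s - X \<noteq> 0" for s using ne \<rho> by (auto simp: norm_mult)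
  show ?thesis
  proof (cases E)
    case False
    have "Q = - In" unfolding Q_def In_def chart_diff_def cauchy_kernel_def using False by (simp add: sum_negf)
    moreover have "\<rho> < cmod X" using Vsec_polar[OF X] \<rho>(4) False by auto
    moreover have "cauchy_rhs j r t X = Out + Q + Ray" unfolding cauchy_rhs_def Out_def Q_def Ray_def by (rule refl)
    ultimately show ?thesis using inside ds by simp
  next
    case True
    have "integral {node j i..node j (Suc i)} (\<lambda>s. cauchy_kernel (chart_diff j r t i) X (of_real \<rho> * cis s))
      = integral {node j i..node j (Suc i)} (\<lambda>s. cauchy_kernel (?F 0) X (of_real \<rho> * cis s))
      - integral {node j i..node j (Suc i)} (\<lambda>s. cauchy_kernel (?F i) X (of_real \<rho> * cis s))" if i: "i < J" for i
    proof -
      have "continuous_on {node j i..node j (Suc i)} (\<lambda>\<theta>. ?F 0 (of_real \<rho> * cis \<theta>))"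
        by (rule continuous_on_compose2[OF holomorphic_on_imp_continuous_on[OF chart_hol_disc[OF r' True]]])
           (use \<rho> in \<open>auto intro!: continuous_intros simp: norm_mult\<close>)
      then have 1: "(\<lambda>s. cauchy_kernel (?F 0) X (of_real \<rho> * cis s)) integrable_on {node j i..node j (Suc i)}"
        unfolding cauchy_kernel_def by (intro integrable_continuous_interval continuous_intros) (use ne' in auto)
      have 2: "(\<lambda>s. cauchy_kernel (?F i) X (of_real \<rho> * cis s)) integrable_on {node j i..node j (Suc i)}"
        unfolding cauchy_kernel_def using T
        by (intro integrable_continuous_interval continuous_intros arc_cont r' i) (use ne' in auto)
      show ?thesis unfolding integral_diff[OF 1 2, symmetric]
        unfolding chart_diff_def cauchy_kernel_def using True by (simp add: left_diff_distrib diff_divide_distrib)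
    qed
    then have Q: "Q = In' - In" unfolding Q_def In'_def In_def by (simp add: right_diff_distrib sum_subtractf)
    have In': "In' = (if cmod X < \<rho> then 2 * pi * \<i> * ?F 0 X else 0)"
      unfolding In'_def using node_less node_J \<rho> ne by (intro circle_cauchy chart_hol_disc r' True) (auto intro: less_imp_le)
    have eq: "Out + Q + Ray = (Out - In + Ray) + In'" using Q by simp
    have "Out + Q + Ray = 2 * pi * \<i> * ?F 0 X"
    proof (cases "cmod X < \<rho>")
      case True
      have "decomposition_sum \<rho> ?T J (node j) ?F X = 0"
        by (rule decomposition_sum_inner_disc[OF \<rho>(1) T node_less node_J chart_J chart_hol_sector[OF r'] True])
      then show ?thesis unfolding eq ds[symmetric] using In' True by simp
    next
      case False
      then have "\<rho> < cmod X" using ne by simp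
      then show ?thesis unfolding eq ds[symmetric] using inside In' False by simp
    qed
    moreover have "cauchy_rhs j r t X = Out + Q + Ray" unfolding cauchy_rhs_def Out_def Q_def Ray_def by (rule refl)
    ultimately show ?thesis by simp
  qed
qed

lemma cauchy_rhs_cont:
  assumes r': "0 < r" "r \<le> \<epsilon>1" and Z: "\<And>s. s \<in> Z \<Longrightarrow> Xs s \<in> Vsec j \<and> cmod (Xs s) * r < r0" and c: "continuous_on Z Xs" and E
  shows "continuous_on Z (\<lambda>s. cauchy_rhs j r t (Xs s))"
proof -
  have T: "\<rho> < r1 / r" by (rule \<rho>_lt_T[OF r'])
  have Tne: "of_real (r1 / r) * cis \<theta> \<noteq> Xs s" if "s \<in> Z" for s \<theta>
  proof -
    have "cmod (Xs s) < r1 / r" using Z[OF that] r r' by (simp add: field_simps)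
    moreover have "cmod (of_real (r1 / r) * cis \<theta>) = r1 / r"
      using T \<rho> r r' by (simp add: norm_mult norm_divide)
    ultimately show ?thesis by auto
  qed
  have 1: "continuous_on Z (\<lambda>s. integral {node j i..node j (Suc i)} (\<lambda>\<theta>. cauchy_kernel (chart j r t i) (Xs s) (of_real (r1 / r) * cis \<theta>)))" if i: "i < J" for i
    unfolding cauchy_kernel_def
  proof (rule continuous_on_kernel_param[OF arc_cont[OF r' i less_imp_le[OF T] order_refl] _ c])
    show "continuous_on {node j i..node j (Suc i)} (\<lambda>\<theta>. of_real (r1 / r) * cis \<theta>)" by (intro continuous_intros)
  qed (rule Tne)
  have 2: "continuous_on Z (\<lambda>s. integral {node j i..node j (Suc i)} (\<lambda>\<theta>. cauchy_kernel (chart_diff j r t i) (Xs s) (of_real \<rho> * cis \<theta>)))" if i: "i < J" for i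
  proof (cases "i = 0")
    case True then show ?thesis unfolding chart_diff_def cauchy_kernel_def using \<open>E\<close> by simp
  next
    case False
    show ?thesis unfolding cauchy_kernel_def
    proof (rule continuous_on_kernel_param[OF chart_diff_cont[OF r' i] _ c])
      show "continuous_on {node j i..node j (Suc i)} (\<lambda>\<theta>. of_real \<rho> * cis \<theta>)" by (intro continuous_intros)
    qed (use arc_away(3)[OF _ i] Z False in blast)
  qed
  have 3: "continuous_on Z (\<lambda>s. integral {\<rho>..r1 / r} (\<lambda>x. cauchy_kernel (\<lambda>U. chart j r t (Suc i) U - chart j r t i U) (Xs s)
                                    (of_real x * cis (node j (Suc i))) / of_real x))" if i: "i < J" for i
  proof -
    have ne: "of_real x * cis (node j (Suc i)) \<noteq> Xs s" if "s \<in> Z" "x \<in> {\<rho>..r1 / r}" for s x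
    proof -
      have "separation * x \<le> cmod (of_real x * cis (node j (Suc i)) - Xs s)"
      proof -
        have "node j 1 \<le> node j (Suc i)" "node j (Suc i) \<le> node j J" using i by (auto intro!: node_mono)
        then show ?thesis using Z[OF that(1)] that(2) by (intro away_ray) auto
      qed
      moreover have "0 < separation * x" using separation that \<rho> by auto
      ultimately show ?thesis by force
    qed
    have "continuous_on Z (\<lambda>s. integral {\<rho>..r1 / r} (\<lambda>x. ((chart j r t (Suc i) (of_real x * cis (node j (Suc i))) - chart j r t i (of_real x * cis (node j (Suc i)))) / of_real x)
         * (of_real x * cis (node j (Suc i))) / (of_real x * cis (node j (Suc i)) - Xs s)))"
    proof (rule continuous_on_kernel_param[OF _ _ c])
      show "continuous_on {\<rho>..r1 / r} (\<lambda>x. (chart j r t (Suc i) (of_real x * cis (node j (Suc i))) - chart j r t i (of_real x * cis (node j (Suc i)))) / of_real x)"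
        by (intro continuous_on_divide ray_cont r' i continuous_intros) (use \<rho> in auto)
      show "continuous_on {\<rho>..r1 / r} (\<lambda>x. of_real x * cis (node j (Suc i)))" by (intro continuous_intros)
    qed (rule ne)
    moreover have "a * b / c / x = a / x * b / c" for a b c x :: complex by simp
    ultimately show ?thesis by (simp only: cauchy_kernel_def)
  qed
  show ?thesis unfolding cauchy_rhs_def using 1 2 3 by (intro continuous_intros) auto
qed

text \<open>Points of the circle \<open>\<bar>X\<bar> = \<rho>\<close> are reached by continuity: no arc with nonzero density is close to them.\<close>

lemma cauchy_formula:
  assumes X: "X \<in> Vsec j" and r': "0 < r" "r \<le> \<epsilon>1" and Xr: "cmod X * r < r0"
  shows "cauchy_rhs j r t X = 2 * pi * \<i> * chart j r t 0 X"
proof (cases "E \<and> cmod X = \<rho>")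
  case False
  then show ?thesis by (intro cauchy_formula_off_arc[OF X r' Xr]) auto
next
  case True
  obtain \<tau> where \<tau>: "X = of_real \<rho> * cis \<tau>" "\<alpha> j < \<tau>" "\<tau> < \<beta> j"
    using Vsec_polar[OF X] True \<rho> by auto
  define x where "x = r0 / r"
  define s1 where "s1 = (\<rho> + x) / 2"
  have "\<rho> < x" using True Xr r' by (simp add: x_def field_simps)
  then have "\<rho> < s1" "s1 < x" by (simp_all add: s1_def field_simps)
  then have s1: "\<rho> < s1" "s1 < r0 / r" by (auto simp: x_def)
  let ?X = "\<lambda>s. of_real s * cis \<tau>"
  have XV: "?X s \<in> Vsec j \<and> cmod (?X s) * r < r0" if "s \<in> {\<rho>..s1}" for s
  proof -
    have s0: "0 < s" using that \<rho> by auto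
    have "?X s \<in> Vsec j" unfolding Vsec_def using True s0 \<tau> by auto
    moreover have "cmod (?X s) = s" using s0 by (simp add: norm_mult)
    moreover have "s < r0 / r" using that s1 by auto
    ultimately show ?thesis using r' by (simp add: field_simps)
  qed
  have c1: "continuous_on {\<rho>..s1} (\<lambda>s. cauchy_rhs j r t (?X s))"
    by (rule cauchy_rhs_cont[OF r' XV]) (use True in \<open>auto intro!: continuous_intros\<close>)
  have c2: "continuous_on {\<rho>..s1} (\<lambda>s. chart j r t 0 (?X s))"
  proof (rule continuous_on_compose2[OF holomorphic_on_imp_continuous_on[OF chart_hol[OF r', of "?X ` {\<rho>..s1}" j 0]]])
    show "?X ` {\<rho>..s1} \<subseteq> W (j + int 0)" using \<tau> \<kappa> by (auto intro!: W_polar)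
    show "cmod U * r < r0'" if "U \<in> ?X ` {\<rho>..s1}" for U using that XV r by fastforce
  qed (auto intro!: continuous_intros)
  have cl: "closure {\<rho><..s1} = {\<rho>..s1}" using s1 by simp
  let ?f = "\<lambda>s. cauchy_rhs j r t (?X s) - 2 * pi * \<i> * chart j r t 0 (?X s)"
  have "continuous_on (closure {\<rho><..s1}) ?f"
    unfolding cl by (intro continuous_intros c1 c2)
  moreover have "?f s = 0" if s: "s \<in> {\<rho><..s1}" for s
  proof -
    have "cmod (?X s) = s" using \<rho> s by (simp add: norm_mult)
    then have "cauchy_rhs j r t (?X s) = 2 * pi * \<i> * chart j r t 0 (?X s)"
      using XV[of s] s by (intro cauchy_formula_off_arc r') auto
    then show ?thesis by simp
  qed
  moreover have "\<rho> \<in> closure {\<rho><..s1}" unfolding cl using s1 by simp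
  ultimately have "?f \<rho> = 0"
    by (rule continuous_constant_on_closure)
  then show ?thesis using \<tau>(1) by simp
qed

end

section \<open>The combined expansion for small \<open>\<eta>\<close>\<close>

lemma sum_power_le:
  assumes "0 < q" "q < (1::real)"
  shows "(\<Sum>n<N. q ^ (N - n)) \<le> 1 / (1 - q)"
proof -
  have "(\<Sum>n<N. q ^ (N - n)) \<le> (\<Sum>n<N. q ^ (N - Suc n))"
    using assms by (intro sum_mono power_decreasing) auto
  also have "\<dots> = (\<Sum>n<N. q ^ n)" by (rule sum.nat_diff_reindex)
  also have "\<dots> = (1 - q ^ N) / (1 - q)" using assms sum_gp_strict[of q N] by simp
  also have "\<dots> \<le> 1 / (1 - q)" using assms by (intro divide_right_mono) auto
  finally show ?thesis .
qed

lemma kernel_expansion_infinity: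
  fixes U X :: complex
  assumes "X \<noteq> 0" "U \<noteq> X" "M > 0"
  shows "X ^ M * (U / (U - X) + (\<Sum>m = 1..<M. U ^ m / X ^ m)) = X * U ^ M / (U - X)"
  using assms(3)
proof (induction M rule: nat_induct_non_zero)
  case 1 then show ?case by simp
next
  case (Suc M)
  have "X ^ Suc M * (U / (U - X) + (\<Sum>m = 1..<Suc M. U ^ m / X ^ m))
      = X * (X ^ M * (U / (U - X) + (\<Sum>m = 1..<M. U ^ m / X ^ m))) + X ^ Suc M * (U ^ M / X ^ M)"
    using Suc.hyps by (simp add: algebra_simps)
  also have "\<dots> = X * (X * U ^ M / (U - X)) + X * U ^ M"
    unfolding Suc.IH using assms(1) by simp
  also have "\<dots> = X * U ^ Suc M / (U - X)"
    using assms by (simp add: field_simps)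
  finally show ?case .
qed

context sectorial_data
begin

text \<open>The functions \<open>a\<^sub>n\<close> and \<open>g\<^sub>n\<^sup>j\<close>: the same Cauchy integrals as for \<open>y\<^sub>l\<^sup>j\<close>, with the densities replaced by their
coefficients and the rays extended to infinity, that is, to \<open>v = 0\<close>.\<close>

definition slow :: "nat \<Rightarrow> complex \<Rightarrow> complex" where
  "slow n x = integral {0..2 * pi} (\<lambda>\<phi>. outer_coef \<phi> n * (of_real r1 * cis \<phi> / (of_real r1 * cis \<phi> - x))) / (2 * pi)"

definition fast :: "int \<Rightarrow> nat \<Rightarrow> complex \<Rightarrow> complex" where
  "fast j n X = ((\<Sum>i<J. \<i> * integral {node j i..node j (Suc i)} (\<lambda>\<theta>. arc_weight j i n \<theta> * (of_real \<rho> * cis \<theta> / (of_real \<rho> * cis \<theta> - X))))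
    + (\<Sum>i<J. integral {0..1 / \<rho>} (\<lambda>v. ray_weight j i n v * (ray_point j i v / (ray_point j i v - X))))) / (2 * pi * \<i>)"

lemma outer_ne: "cmod x < r1 \<Longrightarrow> of_real r1 * cis \<phi> \<noteq> x"
  using r by (auto simp: norm_mult)

text \<open>With \<open>x = U \<eta>\<close> the arcs between the directions \<open>node j i\<close> in the variable \<open>U\<close> appear rotated by the argument \<open>t\<close> of
\<open>\<eta>\<close> in the variable \<open>x\<close>; by periodicity of the coefficients the rotation does not matter.\<close>

lemma slow_arcs:
  assumes "cmod x < r1"
  defines "f \<equiv> \<lambda>n \<phi>. outer_coef \<phi> n * (of_real r1 * cis \<phi> / (of_real r1 * cis \<phi> - x))"
  shows "2 * pi * \<i> * slow n x = (\<Sum>i<J. \<i> * integral {node j i..node j (Suc i)} (\<lambda>\<theta>. f n (\<theta> + t)))"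
proof -
  have c: "continuous_on UNIV (f n)"
    unfolding f_def by (intro continuous_intros outer_coef_cont) (use outer_ne[OF assms(1)] in auto)
  have cs: "continuous_on S (f n)" for S by (rule continuous_on_subset[OF c]) simp
  have ct: "continuous_on UNIV (\<lambda>\<theta>. f n (\<theta> + t))"
    by (rule continuous_on_compose2[OF c]) (auto intro!: continuous_intros)
  have per: "f n (\<phi> + 2 * pi) = f n \<phi>" for \<phi>
  proof -
    have "cis (\<phi> + 2 * pi) = cis \<phi>" by (simp flip: cis_mult)
    then show ?thesis unfolding f_def outer_coef_periodic by simp
  qed
  have "(\<Sum>i<J. integral {node j i..node j (Suc i)} (\<lambda>\<theta>. f n (\<theta> + t))) = integral {node j 0..node j J} (\<lambda>\<theta>. f n (\<theta> + t))"
    using sum_integral_combine[of J "node j" "\<lambda>\<theta>. f n (\<theta> + t)"] ct node_less by (auto intro: less_imp_le)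
  also have "\<dots> = integral {node j 0 + t..node j J + t} (f n)"
    using integral_shift[OF cs, where a = "node j 0" and b = "node j J" and c = t] by (simp add: o_def)
  also have "node j J + t = (node j 0 + t) + 2 * pi" by (simp add: node_J)
  also have "integral {node j 0 + t..(node j 0 + t) + 2 * pi} (f n) = integral {0..2 * pi} (f n)"
    by (rule integral_periodic[OF c per])
  finally show ?thesis by (simp add: slow_def f_def sum_distrib_left[symmetric])
qed

definition K_main :: real where
  "K_main = K_outer * (r1 / (r1 - r0)) + 2 * K_outer / separation + J * (K_jump * K_int / separation) + J * (K_jump * K_int / separation / (1 - r0 / r1))"

lemma K_main: "0 \<le> K_main"
  unfolding K_main_def using K_outer K_jump K_int(1) separation r
  by (intro add_nonneg_nonneg mult_nonneg_nonneg divide_nonneg_nonneg) auto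

lemma K_jump_int: "0 \<le> K_jump * K_int / separation" using K_jump K_int(1) separation by simp

lemma chart_diff_remainder:
  assumes r': "0 < r" "r \<le> \<epsilon>1" and i: "i < J" and \<theta>: "\<theta> \<in> {node j i..node j (Suc i)}"
  shows "cmod (chart_diff j r t i (of_real \<rho> * cis \<theta>) - (\<Sum>n<N. arc_weight j i n \<theta> * (of_real r * cis t) ^ n)) \<le> 2 * K_outer * gevrey_size A p N * r ^ N"
proof -
  let ?U = "of_real \<rho> * cis \<theta>" and ?\<eta> = "of_real r * cis t"
  have b: "K_family * C * gevrey_bound A p N 0 * r ^ N \<le> K_outer * gevrey_size A p N * r ^ N"
  proof (intro mult_right_mono)
    have "K_family * C * gevrey_bound A p N 0 \<le> K_family * C * gevrey_size A p N"
      using K_family(1) C gevrey_bound_le_size[OF A] by (intro mult_left_mono) auto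
    also have "\<dots> \<le> K_outer * gevrey_size A p N" using K_family(1) C size_nonneg by (intro mult_right_mono) (auto simp: K_outer_def)
    finally show "K_family * C * gevrey_bound A p N 0 \<le> K_outer * gevrey_size A p N" .
  qed (use r' in auto)
  have 1: "cmod (chart j r t i ?U - (\<Sum>n<N. inner_coef (j + int i) ?U n * ?\<eta> ^ n)) \<le> K_outer * gevrey_size A p N * r ^ N"
    unfolding chart_def using arc_W(1)[OF i \<theta>] by (intro order_trans[OF inner_coef(2) b] r') auto
  have n: "0 \<le> K_outer * gevrey_size A p N * r ^ N" using K_outer size_nonneg r' by simp
  show ?thesis
  proof (cases E)
    case True
    have 2: "cmod (chart j r t 0 ?U - (\<Sum>n<N. inner_coef j ?U n * ?\<eta> ^ n)) \<le> K_outer * gevrey_size A p N * r ^ N"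
      unfolding chart_def using arc_W(2)[OF i \<theta> True] by (simp, intro order_trans[OF inner_coef(2) b] r') auto
    have "chart_diff j r t i ?U - (\<Sum>n<N. arc_weight j i n \<theta> * ?\<eta> ^ n)
       = (chart j r t 0 ?U - (\<Sum>n<N. inner_coef j ?U n * ?\<eta> ^ n)) - (chart j r t i ?U - (\<Sum>n<N. inner_coef (j + int i) ?U n * ?\<eta> ^ n))"
      unfolding chart_diff_def arc_weight_def using True by (simp add: left_diff_distrib sum_subtractf)
    also have "cmod \<dots> \<le> K_outer * gevrey_size A p N * r ^ N + K_outer * gevrey_size A p N * r ^ N"
      by (intro norm_triangle_le_diff add_mono 1 2)
    finally show ?thesis by (simp add: mult_ac)
  next
    case False
    have "chart_diff j r t i ?U - (\<Sum>n<N. arc_weight j i n \<theta> * ?\<eta> ^ n) = - (chart j r t i ?U - (\<Sum>n<N. inner_coef (j + int i) ?U n * ?\<eta> ^ n))"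
      unfolding chart_diff_def arc_weight_def using False by (simp add: sum_negf)
    then show ?thesis using 1 n by (simp only: norm_minus_cancel)
  qed
qed

lemma ray_weight_kernel_integrable:
  assumes X: "X \<in> Vsec j" and i: "i < J" and R: "0 < R" "R \<le> 1 / \<rho>"
  shows "(\<lambda>v. ray_weight j i n v * (ray_point j i v / (ray_point j i v - X))) integrable_on {0..R}"
proof (rule integrable_continuous_interval, rule ray_weight_times_cont[OF i R, where K = "1 / separation" and M = 0])
  show "continuous_on {0<..R} (\<lambda>v. ray_point j i v / (ray_point j i v - X))"
    using ray_point_away(3)[OF X i] R by (intro continuous_intros ray_point_cont) auto
  show "cmod (ray_point j i v / (ray_point j i v - X)) \<le> 1 / separation / v ^ 0" if "0 < v" "v \<le> R" for v
    using ray_point_away(4)[OF X i, of v] that R by simp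
qed

text \<open>The difference between Cauchy's formula and its termwise expansion consists of the remainders of the densities
on the outer arcs (\<open>S1\<close>), the inner arcs (\<open>S2\<close>) and the segments \<open>\<rho> \<le> \<bar>U\<bar> \<le> r1 / r\<close> (\<open>S3\<close>), and of the
integrals of the first \<open>N\<close> coefficients over the parts \<open>\<bar>U\<bar> \<ge> r1 / r\<close> of the rays (\<open>S4\<close>).\<close>

lemma main_remainder:
  assumes X: "X \<in> Vsec j" and r': "0 < r" "r \<le> \<epsilon>1" and Xr: "cmod X * r < r0"
  shows "cmod (chart j r t 0 X - (\<Sum>n<N. (slow n (X * (of_real r * cis t)) + fast j n X) * (of_real r * cis t) ^ n))
     \<le> K_main * gevrey_size A p N * r ^ N"
proof -
  define T where "T = r1 / r"
  define \<eta> where "\<eta> = of_real r * cis t"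
  have \<eta>: "\<eta> \<noteq> 0" "cmod \<eta> = r" using r' by (auto simp: \<eta>_def norm_mult)
  have T: "\<rho> < T" "0 < T" using \<rho>_lt_T[OF r'] \<rho> by (auto simp: T_def)
  have XT: "cmod X < T" using Xr r r' by (simp add: T_def field_simps)
  have xr1: "cmod (X * \<eta>) < r1" using Xr r by (simp add: norm_mult \<eta>)
  have iT: "0 < 1 / T" "1 / T < 1 / \<rho>" "1 / T \<le> 1 / \<rho>" using T \<rho> by (auto simp: frac_less2 frac_le)
  let ?gs = "gevrey_size A p N"
  let ?k = "\<lambda>U. U / (U - X)"
  let ?oT = "\<lambda>\<theta>. of_real T * cis \<theta>" and ?o\<rho> = "\<lambda>\<theta>. of_real \<rho> * cis \<theta>"
  have grs: "0 \<le> ?gs * r ^ N" using size_nonneg r' by simp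
  define S1 where "S1 = (\<lambda>i. integral {node j i..node j (Suc i)} (\<lambda>\<theta>. (chart j r t i (?oT \<theta>) - (\<Sum>n<N. outer_coef (\<theta> + t) n * \<eta> ^ n)) * ?k (?oT \<theta>)))"
  define S2 where "S2 = (\<lambda>i. integral {node j i..node j (Suc i)} (\<lambda>\<theta>. (chart_diff j r t i (?o\<rho> \<theta>) - (\<Sum>n<N. arc_weight j i n \<theta> * \<eta> ^ n)) * ?k (?o\<rho> \<theta>)))"
  define \<Delta> where "\<Delta> = (\<lambda>i v. (chart j r t (Suc i) (ray_point j i v) - chart j r t i (ray_point j i v)) / of_real v)"
  define S3 where "S3 = (\<lambda>i. integral {1 / T..1 / \<rho>} (\<lambda>v. (\<Delta> i v - (\<Sum>n<N. ray_weight j i n v * \<eta> ^ n)) * ?k (ray_point j i v)))"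
  define S4 where "S4 = (\<lambda>i. (\<Sum>n<N. integral {0..1 / T} (\<lambda>v. ray_weight j i n v * ?k (ray_point j i v)) * \<eta> ^ n))"
  \<comment> \<open>the kernel in the variable \<open>x\<close> equals the kernel in the variable \<open>U\<close>, which turns the integrals over
    the outer arcs into \<open>slow\<close>\<close>
  have neT: "?oT \<theta> - X \<noteq> 0" for \<theta> using XT T by (auto simp: norm_mult)
  have cT: "continuous_on I (\<lambda>\<theta>. ?k (?oT \<theta>))" for I by (intro continuous_intros) (use neT in auto)
  have cFT: "continuous_on {node j i..node j (Suc i)} (\<lambda>\<theta>. chart j r t i (?oT \<theta>))" if "i < J" for i
    using arc_cont[OF r' that, of T j t] T by (simp add: T_def)
  have cb: "continuous_on I (\<lambda>\<theta>. outer_coef (\<theta> + t) n)" for I n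
    by (rule continuous_on_compose2[OF outer_coef_cont]) (auto intro!: continuous_intros)
  have kT: "of_real r1 * cis (\<theta> + t) / (of_real r1 * cis (\<theta> + t) - X * \<eta>) = ?k (?oT \<theta>)" for \<theta>
  proof -
    have "of_real r1 * cis (\<theta> + t) = ?oT \<theta> * \<eta>" using r' by (simp add: T_def \<eta>_def mult_ac cis_mult)
    moreover have "?oT \<theta> * \<eta> - X * \<eta> = (?oT \<theta> - X) * \<eta>" by (simp add: left_diff_distrib)
    ultimately show ?thesis using \<eta> by simp
  qed
  have O: "(\<Sum>i<J. \<i> * integral {node j i..node j (Suc i)} (\<lambda>s. cauchy_kernel (chart j r t i) X (?oT s)))
     - (\<Sum>n<N. (2 * pi * \<i>) * slow n (X * \<eta>) * \<eta> ^ n) = (\<Sum>i<J. \<i> * S1 i)"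
  proof -
    have "S1 i = integral {node j i..node j (Suc i)} (\<lambda>s. cauchy_kernel (chart j r t i) X (?oT s))
       - (\<Sum>n<N. integral {node j i..node j (Suc i)} (\<lambda>\<theta>. outer_coef (\<theta> + t) n * ?k (?oT \<theta>)) * \<eta> ^ n)" if i: "i < J" for i
    proof -
      have "integral {node j i..node j (Suc i)} (\<lambda>s. chart j r t i (?oT s) * ?k (?oT s))
       - (\<Sum>n<N. integral {node j i..node j (Suc i)} (\<lambda>\<theta>. outer_coef (\<theta> + t) n * ?k (?oT \<theta>)) * \<eta> ^ n) = S1 i"
        unfolding S1_def
        by (rule integral_expansion_diff) (intro integrable_continuous_interval continuous_on_mult cFT cT cb i)+
      then show ?thesis by (simp add: cauchy_kernel_def)
    qed
    moreover have "(2 * pi * \<i>) * slow n (X * \<eta>) * \<eta> ^ n = (\<Sum>i<J. \<i> * integral {node j i..node j (Suc i)} (\<lambda>\<theta>. outer_coef (\<theta> + t) n * ?k (?oT \<theta>)) * \<eta> ^ n)" for n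
      unfolding slow_arcs[OF xr1, of n j t] kT by (simp add: sum_distrib_right)
    ultimately show ?thesis
      by (simp add: right_diff_distrib sum_subtractf sum_distrib_left mult_ac)
         (rule sum.swap)
  qed
  have S1_le: "cmod (S1 i) \<le> (K_outer * ?gs * r ^ N * (r1 / (r1 - r0))) * (node j (Suc i) - node j i)" if i: "i < J" for i
    unfolding S1_def
  proof (rule integral_bound)
    show "node j i \<le> node j (Suc i)" using node_less[OF i] by (rule less_imp_le)
    show "continuous_on {node j i..node j (Suc i)} (\<lambda>\<theta>. (chart j r t i (?oT \<theta>) - (\<Sum>n<N. outer_coef (\<theta> + t) n * \<eta> ^ n)) * ?k (?oT \<theta>))"
      by (intro continuous_on_mult cT continuous_on_diff cFT i continuous_on_sum cb continuous_on_const)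
    fix \<theta> assume \<theta>: "\<theta> \<in> {node j i..node j (Suc i)}"
    have "chart j r t i (?oT \<theta>) = Y (j + int i) (lam t) (of_real r1 * cis (\<theta> + t)) (of_real r * cis t)"
    proof -
      have "?oT \<theta> * (of_real r * cis t) = of_real r1 * cis (\<theta> + t)" using r' by (simp add: T_def mult_ac cis_mult)
      then show ?thesis by (simp add: chart_def)
    qed
    then have 1: "cmod (chart j r t i (?oT \<theta>) - (\<Sum>n<N. outer_coef (\<theta> + t) n * \<eta> ^ n)) \<le> K_outer * ?gs * r ^ N"
      using outer_coef(2)[OF r', of "j + int i" "\<theta> + t" t N] \<theta> node_lower[of i j] node_upper[OF i, of j] i by (simp add: \<eta>_def)
    have 2: "cmod (?k (?oT \<theta>)) \<le> r1 / (r1 - r0)"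
    proof -
      have "T - cmod X \<le> cmod (?oT \<theta> - X)" using norm_triangle_ineq2[of "?oT \<theta>" X] T by (simp add: norm_mult)
      moreover have p: "0 < T - cmod X" using XT by simp
      ultimately have "T / cmod (?oT \<theta> - X) \<le> T / (T - cmod X)" using T by (intro divide_left_mono mult_pos_pos) auto
      also have "\<dots> = r1 / (r1 - cmod X * r)" using r' p by (simp add: T_def field_simps)
      also have "\<dots> \<le> r1 / (r1 - r0)" using Xr r by (intro divide_left_mono mult_pos_pos) auto
      finally show ?thesis using T by (simp add: norm_divide norm_mult)
    qed
    show "cmod ((chart j r t i (?oT \<theta>) - (\<Sum>n<N. outer_coef (\<theta> + t) n * \<eta> ^ n)) * ?k (?oT \<theta>)) \<le> K_outer * ?gs * r ^ N * (r1 / (r1 - r0))"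
      unfolding norm_mult using 1 2 K_outer size_nonneg r' by (intro mult_mono) auto
  qed
  \<comment> \<open>if \<open>E\<close> holds, the kernel may be singular on the arc number 0, but there the density vanishes\<close>
  have c\<rho>: "continuous_on {node j i..node j (Suc i)} (\<lambda>\<theta>. f \<theta> * ?k (?o\<rho> \<theta>))"
    if i: "i < J" and f: "continuous_on {node j i..node j (Suc i)} f" "E \<and> i = 0 \<Longrightarrow> f = (\<lambda>_. 0)" for f i
  proof (cases "E \<and> i = 0")
    case True then show ?thesis using f by simp
  next
    case False
    show ?thesis by (intro continuous_intros f(1)) (use arc_away(3)[OF X i _ False] in auto)
  qed
  have QY0: "E \<and> i = 0 \<Longrightarrow> (\<lambda>\<theta>. chart_diff j r t i (?o\<rho> \<theta>)) = (\<lambda>_. 0)" for i unfolding chart_diff_def by auto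
  have qc0: "E \<and> i = 0 \<Longrightarrow> arc_weight j i n = (\<lambda>_. 0)" for i n using arc_weight_0 by auto
  have I: "(\<Sum>i<J. \<i> * integral {node j i..node j (Suc i)} (\<lambda>s. cauchy_kernel (chart_diff j r t i) X (?o\<rho> s)))
     - (\<Sum>n<N. (\<Sum>i<J. \<i> * integral {node j i..node j (Suc i)} (\<lambda>\<theta>. arc_weight j i n \<theta> * ?k (?o\<rho> \<theta>))) * \<eta> ^ n) = (\<Sum>i<J. \<i> * S2 i)"
  proof -
    have "S2 i = integral {node j i..node j (Suc i)} (\<lambda>s. cauchy_kernel (chart_diff j r t i) X (?o\<rho> s))
       - (\<Sum>n<N. integral {node j i..node j (Suc i)} (\<lambda>\<theta>. arc_weight j i n \<theta> * ?k (?o\<rho> \<theta>)) * \<eta> ^ n)" if i: "i < J" for i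
    proof -
      have "integral {node j i..node j (Suc i)} (\<lambda>s. chart_diff j r t i (?o\<rho> s) * ?k (?o\<rho> s))
       - (\<Sum>n<N. integral {node j i..node j (Suc i)} (\<lambda>\<theta>. arc_weight j i n \<theta> * ?k (?o\<rho> \<theta>)) * \<eta> ^ n) = S2 i"
        unfolding S2_def
        by (rule integral_expansion_diff)
           (intro integrable_continuous_interval c\<rho> i chart_diff_cont r' arc_weight_cont; use QY0 qc0 in auto)+
      then show ?thesis by (simp add: cauchy_kernel_def)
    qed
    then show ?thesis
      by (simp add: right_diff_distrib sum_subtractf sum_distrib_left sum_distrib_right mult_ac)
         (rule sum.swap)
  qed
  have S2_le: "cmod (S2 i) \<le> (2 * K_outer * ?gs * r ^ N * (1 / separation)) * (node j (Suc i) - node j i)" if i: "i < J" for i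
    unfolding S2_def
  proof (rule integral_bound)
    show "node j i \<le> node j (Suc i)" using node_less[OF i] by (rule less_imp_le)
    have e0: "E \<and> i = 0 \<Longrightarrow> (\<lambda>\<theta>. chart_diff j r t i (?o\<rho> \<theta>) - (\<Sum>n<N. arc_weight j i n \<theta> * \<eta> ^ n)) = (\<lambda>_. 0)"
      using QY0[of i] qc0[of i] by (auto simp: fun_eq_iff)
    show "continuous_on {node j i..node j (Suc i)} (\<lambda>\<theta>. (chart_diff j r t i (?o\<rho> \<theta>) - (\<Sum>n<N. arc_weight j i n \<theta> * \<eta> ^ n)) * ?k (?o\<rho> \<theta>))"
      by (intro c\<rho> i e0 continuous_on_diff chart_diff_cont r' continuous_on_sum continuous_on_mult arc_weight_cont continuous_on_const)
    fix \<theta> assume \<theta>: "\<theta> \<in> {node j i..node j (Suc i)}"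
    show "cmod ((chart_diff j r t i (?o\<rho> \<theta>) - (\<Sum>n<N. arc_weight j i n \<theta> * \<eta> ^ n)) * ?k (?o\<rho> \<theta>)) \<le> 2 * K_outer * ?gs * r ^ N * (1 / separation)"
    proof (cases "E \<and> i = 0")
      case True
      have "chart_diff j r t i (?o\<rho> \<theta>) - (\<Sum>n<N. arc_weight j i n \<theta> * \<eta> ^ n) = 0" using fun_cong[OF e0[OF True]] .
      then show ?thesis using K_outer size_nonneg r' separation by simp
    next
      case False
      show ?thesis unfolding norm_mult \<eta>_def
        using K_outer size_nonneg r' by (intro mult_mono chart_diff_remainder i \<theta> arc_away(4)[OF X i \<theta> False] r') auto
    qed
  qed
  \<comment> \<open>the coefficients are defined on the whole ray, the function only up to \<open>1 / v = T\<close>\<close>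
  have cw0: "0 < separation" using separation by simp
  have Uc: "continuous_on {1 / T..1 / \<rho>} (ray_point j i)" for i
    by (rule continuous_on_subset[OF ray_point_cont[of "1 / \<rho>"]]) (auto intro: less_le_trans[OF iT(1)])
  have vpos: "0 < v" if "v \<in> {1 / T..1 / \<rho>}" for v
    using that by (auto intro: less_le_trans[OF iT(1)])
  have vne: "\<forall>v\<in>{1 / T..1 / \<rho>}. v \<noteq> 0"
  proof
    fix v assume "v \<in> {1 / T..1 / \<rho>}"
    from vpos[OF this] show "v \<noteq> 0" by simp
  qed
  have kc: "continuous_on {1 / T..1 / \<rho>} (\<lambda>v. ?k (ray_point j i v))" if i: "i < J" for i
    using ray_point_away(3)[OF X i vpos] by (intro continuous_intros Uc) auto
  have \<Delta>c: "continuous_on {1 / T..1 / \<rho>} (\<Delta> i)" if i: "i < J" for i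
    unfolding \<Delta>_def ray_point_def
  proof (intro continuous_on_divide)
    show "continuous_on {1 / T..1 / \<rho>} (\<lambda>v. chart j r t (Suc i) (of_real (1 / v) * cis (node j (Suc i))) - chart j r t i (of_real (1 / v) * cis (node j (Suc i))))"
    proof (rule continuous_on_compose2[OF ray_cont[OF r' i]])
      show "continuous_on {1 / T..1 / \<rho>} (\<lambda>v. 1 / v)" using vne by (intro continuous_intros)
      show "(\<lambda>v. 1 / v) ` {1 / T..1 / \<rho>} \<subseteq> {\<rho>..r1 / r}"
      proof
        fix s assume "s \<in> (\<lambda>v. 1 / v) ` {1 / T..1 / \<rho>}"
        then obtain v where v: "s = 1 / v" "1 / T \<le> v" "v \<le> 1 / \<rho>" by auto
        have "0 < v" using v iT by linarith
        then show "s \<in> {\<rho>..r1 / r}" unfolding v(1) T_def[symmetric] using v(2,3) T \<rho> by (auto simp: field_simps)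
      qed
    qed
  qed (use vne in \<open>auto intro!: continuous_intros\<close>)
  have wc: "continuous_on {1 / T..1 / \<rho>} (ray_weight j i n)" if i: "i < J" for i n
    by (rule continuous_on_subset[OF ray_weight_cont[OF i]]) (auto intro: less_le_trans[OF iT(1)])
  have Rv: "integral {\<rho>..r1 / r} (\<lambda>s. cauchy_kernel (\<lambda>U. chart j r t (Suc i) U - chart j r t i U) X (of_real s * cis (node j (Suc i))) / of_real s)
      = integral {1 / T..1 / \<rho>} (\<lambda>v. \<Delta> i v * ?k (ray_point j i v))" if i: "i < J" for i
  proof -
    have "continuous_on {\<rho>..r1 / r} (\<lambda>s. cauchy_kernel (\<lambda>U. chart j r t (Suc i) U - chart j r t i U) X (of_real s * cis (node j (Suc i))))"
      unfolding cauchy_kernel_def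
    proof (intro continuous_on_divide continuous_on_mult ray_cont r' i)
      have a: "node j 1 \<le> node j (Suc i)" "node j (Suc i) \<le> node j J" using i by (auto intro!: node_mono)
      show "\<forall>s\<in>{\<rho>..r1 / r}. of_real s * cis (node j (Suc i)) - X \<noteq> 0"
      proof
        fix s assume s: "s \<in> {\<rho>..r1 / r}"
        have "separation * s \<le> cmod (of_real s * cis (node j (Suc i)) - X)" using s by (intro away_ray[OF X a]) auto
        moreover have "0 < separation * s" using cw0 s \<rho> by auto
        ultimately show "of_real s * cis (node j (Suc i)) - X \<noteq> 0" by force
      qed
    qed (auto intro!: continuous_intros)
    from integral_inverse_substitution[OF \<rho>(1) less_imp_le[OF T(1)[unfolded T_def]] this]
    show ?thesis by (simp add: T_def \<Delta>_def ray_point_def cauchy_kernel_def mult_ac)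
  qed
  have Ry: "integral {1 / T..1 / \<rho>} (\<lambda>v. \<Delta> i v * ?k (ray_point j i v)) - (\<Sum>n<N. integral {0..1 / \<rho>} (\<lambda>v. ray_weight j i n v * ?k (ray_point j i v)) * \<eta> ^ n) = S3 i - S4 i" if i: "i < J" for i
  proof -
    have 1: "integral {1 / T..1 / \<rho>} (\<lambda>v. \<Delta> i v * ?k (ray_point j i v)) - (\<Sum>n<N. integral {1 / T..1 / \<rho>} (\<lambda>v. ray_weight j i n v * ?k (ray_point j i v)) * \<eta> ^ n) = S3 i"
      unfolding S3_def by (rule integral_expansion_diff) (intro integrable_continuous_interval continuous_on_mult \<Delta>c kc wc i)+
    have "integral {0..1 / T} (\<lambda>v. ray_weight j i n v * ?k (ray_point j i v)) + integral {1 / T..1 / \<rho>} (\<lambda>v. ray_weight j i n v * ?k (ray_point j i v))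
        = integral {0..1 / \<rho>} (\<lambda>v. ray_weight j i n v * ?k (ray_point j i v))" for n
      using iT \<rho> by (intro Henstock_Kurzweil_Integration.integral_combine ray_weight_kernel_integrable X i) auto
    then have "(\<Sum>n<N. integral {0..1 / \<rho>} (\<lambda>v. ray_weight j i n v * ?k (ray_point j i v)) * \<eta> ^ n)
       = S4 i + (\<Sum>n<N. integral {1 / T..1 / \<rho>} (\<lambda>v. ray_weight j i n v * ?k (ray_point j i v)) * \<eta> ^ n)"
      unfolding S4_def sum.distrib[symmetric] distrib_right[symmetric] by simp
    then show ?thesis using 1 by simp
  qed
  have S3_le: "cmod (S3 i) \<le> K_jump * K_int / separation * ?gs * r ^ N" if i: "i < J" for i
  proof -
    let ?D = "\<lambda>v. gevrey_bound A p N (B / v ^ p) / v ^ (0 + 1)"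
    have int: "?D integrable_on {1 / T..1 / \<rho>}" using gevrey_bound_cont[OF B iT(1)] by (rule integrable_continuous_interval)
    have "cmod (S3 i) \<le> integral {1 / T..1 / \<rho>} (\<lambda>v. (K_jump * r ^ N * (1 / separation)) * ?D v)"
      unfolding S3_def
    proof (rule integral_norm_bound_integral)
      show "(\<lambda>v. (\<Delta> i v - (\<Sum>n<N. ray_weight j i n v * \<eta> ^ n)) * ?k (ray_point j i v)) integrable_on {1 / T..1 / \<rho>}"
        by (intro integrable_continuous_interval continuous_on_mult continuous_on_diff continuous_on_sum continuous_on_const \<Delta>c kc wc i)
      show "(\<lambda>v. (K_jump * r ^ N * (1 / separation)) * ?D v) integrable_on {1 / T..1 / \<rho>}" by (rule integrable_on_mult_right[OF int])
      fix v assume v: "v \<in> {1 / T..1 / \<rho>}"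
      have v0: "0 < v" by (rule vpos[OF v])
      have vr: "\<rho> \<le> 1 / v" using inv_\<rho>[OF v0] v by simp
      have "1 / v \<le> T" using v v0 T by (auto simp: field_simps)
      then have sr: "1 / v * r \<le> r1" using r' by (simp add: T_def pos_le_divide_eq)
      have "\<Delta> i v - (\<Sum>n<N. ray_weight j i n v * \<eta> ^ n) = (chart j r t (Suc i) (ray_point j i v) - chart j r t i (ray_point j i v) - (\<Sum>n<N. jump_coef (j + int i) (node j (Suc i)) (1 / v) n * \<eta> ^ n)) / of_real v"
        by (simp add: \<Delta>_def ray_weight_def diff_divide_distrib sum_divide_distrib)
      moreover have "cmod (chart j r t (Suc i) (ray_point j i v) - chart j r t i (ray_point j i v) - (\<Sum>n<N. jump_coef (j + int i) (node j (Suc i)) (1 / v) n * \<eta> ^ n))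
          \<le> K_jump * gevrey_bound A p N (B * (1 / v) ^ p) * r ^ N"
        using jump_coef(2)[OF vr node_ray[OF i, of j] r' sr, of t N] by (simp add: chart_def ray_point_def \<eta>_def K_jump_def add_ac)
      ultimately have "cmod (\<Delta> i v - (\<Sum>n<N. ray_weight j i n v * \<eta> ^ n)) \<le> K_jump * gevrey_bound A p N (B / v ^ p) * r ^ N / v"
        using v0 by (simp add: norm_divide power_divide divide_right_mono)
      then have "cmod ((\<Delta> i v - (\<Sum>n<N. ray_weight j i n v * \<eta> ^ n)) * ?k (ray_point j i v)) \<le> (K_jump * gevrey_bound A p N (B / v ^ p) * r ^ N / v) * (1 / separation)"
        unfolding norm_mult using v v0 K_jump bound_nonneg[OF v0] r' by (intro mult_mono ray_point_away(4)[OF X i]) auto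
      then show "cmod ((\<Delta> i v - (\<Sum>n<N. ray_weight j i n v * \<eta> ^ n)) * ?k (ray_point j i v)) \<le> (K_jump * r ^ N * (1 / separation)) * ?D v"
        by (simp add: mult_ac)
    qed
    also have "\<dots> = (K_jump * r ^ N * (1 / separation)) * integral {1 / T..1 / \<rho>} ?D" by (rule integral_mult_right)
    also have "\<dots> \<le> (K_jump * r ^ N * (1 / separation)) * (K_int * double_size A B p N 0)"
      using K_jump r' cw0 by (intro mult_left_mono K_int iT) auto
    also have "\<dots> = K_jump * K_int / separation * ?gs * r ^ N" by (simp add: double_size_0[OF B])
    finally show ?thesis .
  qed
  have S4_le: "cmod (S4 i) \<le> K_jump * K_int / separation / (1 - r0 / r1) * ?gs * r ^ N" if i: "i < J" for i
  proof -
    let ?q = "r0 / r1"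
    have q1: "0 < ?q" "?q < 1" using r by auto
    have one: "cmod (integral {0..1 / T} (\<lambda>v. ray_weight j i n v * ?k (ray_point j i v)) * \<eta> ^ n) \<le> K_jump * K_int / separation * ?gs * r ^ N * ?q ^ (N - n)" if n: "n < N" for n
    proof -
      \<comment> \<open>On the tail \<open>v \<le> 1 / T\<close> the moment of order \<open>N - n\<close> converts the missing powers of \<open>\<eta>\<close>: the weight
        \<open>(1 / (T v))^(N - n)\<close> is at least 1, and \<open>A \<le> B r0^p\<close> turns \<open>B^(- M/p) r1^(- M)\<close> into
        \<open>A^(- M/p) (r0 / r1)^M\<close>, which can be summed over \<open>n\<close>.\<close>
      let ?M = "N - n"
      have "cmod (integral {0..1 / T} (\<lambda>v. ray_weight j i n v * ?k (ray_point j i v))) \<le> (1 / separation * (1 / T) ^ ?M) * (K_jump * (K_int * double_size A B p n ?M))"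
      proof (rule ray_weight_integral_le[OF i iT(1,3)])
        show "continuous_on {0<..1 / T} (\<lambda>v. ?k (ray_point j i v))"
          using ray_point_away(3)[OF X i] iT by (intro continuous_intros ray_point_cont) auto
        fix v assume v: "0 < v" "v \<le> 1 / T"
        have "cmod (?k (ray_point j i v)) \<le> 1 / separation * 1" using ray_point_away(4)[OF X i, of v] v iT by simp
        also have "\<dots> \<le> 1 / separation * ((1 / T) ^ ?M / v ^ ?M)"
          using v cw0 power_mono[of v "1 / T" ?M] by (intro mult_left_mono) auto
        finally show "cmod (?k (ray_point j i v)) \<le> 1 / separation * (1 / T) ^ ?M / v ^ ?M" by simp
      qed
      then have "cmod (integral {0..1 / T} (\<lambda>v. ray_weight j i n v * ?k (ray_point j i v)) * \<eta> ^ n) \<le> (1 / separation * (1 / T) ^ ?M) * (K_jump * (K_int * double_size A B p n ?M)) * r ^ n"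
        unfolding norm_mult norm_power \<eta>(2) using r' by (intro mult_right_mono) auto
      also have "\<dots> = K_jump * K_int / separation * ((1 / T) ^ ?M * r ^ n * double_size A B p n ?M)" by simp
      also have "\<dots> \<le> K_jump * K_int / separation * (?gs * r ^ N * ?q ^ ?M)"
      proof (rule mult_left_mono[OF _ K_jump_int])
        have "(1 / T) ^ ?M * r ^ n = (1 / r1) ^ ?M * r ^ N"
          using n by (simp add: T_def power_divide power_add[symmetric])
        moreover have "(1 / r1) ^ ?M * double_size A B p n ?M \<le> ?gs * ?q ^ ?M"
        proof -
          let ?x = "real ?M / real p"
          have "A powr ?x \<le> (B * r0 ^ p) powr ?x" using A AB by (intro powr_mono2) auto
          also have "\<dots> = B powr ?x * r0 ^ ?M" using B r p by (simp add: powr_mult powr_realpow[symmetric] powr_powr)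
          finally have "A powr ?x \<le> B powr ?x * r0 ^ ?M" .
          then have "A powr ?x * (A powr (- ?x) * B powr (- ?x)) \<le> (B powr ?x * r0 ^ ?M) * (A powr (- ?x) * B powr (- ?x))"
            by (rule mult_right_mono) simp
          moreover have "A powr ?x * (A powr (- ?x) * B powr (- ?x)) = (A powr ?x * A powr (- ?x)) * B powr (- ?x)" by simp
          moreover have "(B powr ?x * r0 ^ ?M) * (A powr (- ?x) * B powr (- ?x)) = (B powr ?x * B powr (- ?x)) * (A powr (- ?x) * r0 ^ ?M)" by simp
          moreover have "A powr ?x * A powr (- ?x) = 1" "B powr ?x * B powr (- ?x) = 1" using A B by (simp_all add: powr_add[symmetric])
          ultimately have Bx: "B powr (- ?x) \<le> A powr (- ?x) * r0 ^ ?M" by simp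
          have G: "0 \<le> Gamma (real N / real p + 1)" by (intro Gamma_real_nonneg add_nonneg_pos) auto
          have "(1 / r1) ^ ?M * double_size A B p n ?M = (1 / r1) ^ ?M * (A powr (- (real n / real p)) * B powr (- ?x) * Gamma (real N / real p + 1))"
            using n by (simp add: double_size_def)
          also have "\<dots> \<le> (1 / r1) ^ ?M * (A powr (- (real n / real p)) * (A powr (- ?x) * r0 ^ ?M) * Gamma (real N / real p + 1))"
            using Bx r G by (intro mult_left_mono mult_right_mono) auto
          also have "\<dots> = (A powr (- (real n / real p)) * A powr (- ?x)) * Gamma (real N / real p + 1) * ?q ^ ?M"
            by (simp add: power_divide)
          also have "A powr (- (real n / real p)) * A powr (- ?x) = A powr (- (real N / real p))"
          proof -
            have "- (real n / real p) + (- ?x) = - (real N / real p)" using n p by (simp add: of_nat_diff field_simps)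
            then show ?thesis by (simp only: powr_add[symmetric])
          qed
          finally show ?thesis by (simp add: gevrey_size_def)
        qed
        then have "(1 / r1) ^ ?M * double_size A B p n ?M * r ^ N \<le> ?gs * ?q ^ ?M * r ^ N" using r' by (intro mult_right_mono) auto
        ultimately show "(1 / T) ^ ?M * r ^ n * double_size A B p n ?M \<le> ?gs * r ^ N * ?q ^ ?M" by (simp add: mult_ac)
      qed
      finally show ?thesis by (simp add: mult_ac)
    qed
    have "cmod (S4 i) \<le> (\<Sum>n<N. K_jump * K_int / separation * ?gs * r ^ N * ?q ^ (N - n))"
      unfolding S4_def using one by (intro sum_norm_le) auto
    also have "\<dots> = K_jump * K_int / separation * ?gs * r ^ N * (\<Sum>n<N. ?q ^ (N - n))" by (simp add: sum_distrib_left)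
    also have "\<dots> \<le> K_jump * K_int / separation * ?gs * r ^ N * (1 / (1 - ?q))"
      using K_jump_int size_nonneg r' by (intro mult_left_mono sum_power_le q1 mult_nonneg_nonneg) auto
    finally show ?thesis by simp
  qed
  have fm: "cauchy_rhs j r t X = 2 * pi * \<i> * chart j r t 0 X" by (rule cauchy_formula[OF X r' Xr])
  have "2 * pi * \<i> * (chart j r t 0 X - (\<Sum>n<N. (slow n (X * \<eta>) + fast j n X) * \<eta> ^ n))
     = cauchy_rhs j r t X - (\<Sum>n<N. (2 * pi * \<i>) * slow n (X * \<eta>) * \<eta> ^ n) - (\<Sum>n<N. (2 * pi * \<i>) * fast j n X * \<eta> ^ n)"
    unfolding fm by (simp add: algebra_simps sum.distrib sum_distrib_left)
  also have "(\<Sum>n<N. (2 * pi * \<i>) * fast j n X * \<eta> ^ n) =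
      (\<Sum>n<N. (\<Sum>i<J. \<i> * integral {node j i..node j (Suc i)} (\<lambda>\<theta>. arc_weight j i n \<theta> * ?k (?o\<rho> \<theta>))) * \<eta> ^ n)
      + (\<Sum>i<J. \<Sum>n<N. integral {0..1 / \<rho>} (\<lambda>v. ray_weight j i n v * ?k (ray_point j i v)) * \<eta> ^ n)"
  proof -
    have "(\<Sum>n<N. (2 * pi * \<i>) * fast j n X * \<eta> ^ n) =
      (\<Sum>n<N. (\<Sum>i<J. \<i> * integral {node j i..node j (Suc i)} (\<lambda>\<theta>. arc_weight j i n \<theta> * ?k (?o\<rho> \<theta>))) * \<eta> ^ n
          + (\<Sum>i<J. integral {0..1 / \<rho>} (\<lambda>v. ray_weight j i n v * ?k (ray_point j i v)) * \<eta> ^ n))"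
      by (intro sum.cong refl) (simp add: fast_def distrib_right sum_distrib_right)
    also have "\<dots> = (\<Sum>n<N. (\<Sum>i<J. \<i> * integral {node j i..node j (Suc i)} (\<lambda>\<theta>. arc_weight j i n \<theta> * ?k (?o\<rho> \<theta>))) * \<eta> ^ n)
      + (\<Sum>n<N. \<Sum>i<J. integral {0..1 / \<rho>} (\<lambda>v. ray_weight j i n v * ?k (ray_point j i v)) * \<eta> ^ n)" by (rule sum.distrib)
    also have "(\<Sum>n<N. \<Sum>i<J. integral {0..1 / \<rho>} (\<lambda>v. ray_weight j i n v * ?k (ray_point j i v)) * \<eta> ^ n)
       = (\<Sum>i<J. \<Sum>n<N. integral {0..1 / \<rho>} (\<lambda>v. ray_weight j i n v * ?k (ray_point j i v)) * \<eta> ^ n)" by (rule sum.swap)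
    finally show ?thesis .
  qed
  also have "cauchy_rhs j r t X - (\<Sum>n<N. (2 * pi * \<i>) * slow n (X * \<eta>) * \<eta> ^ n) -
      ((\<Sum>n<N. (\<Sum>i<J. \<i> * integral {node j i..node j (Suc i)} (\<lambda>\<theta>. arc_weight j i n \<theta> * ?k (?o\<rho> \<theta>))) * \<eta> ^ n)
      + (\<Sum>i<J. \<Sum>n<N. integral {0..1 / \<rho>} (\<lambda>v. ray_weight j i n v * ?k (ray_point j i v)) * \<eta> ^ n))
     = (\<Sum>i<J. \<i> * S1 i) + (\<Sum>i<J. \<i> * S2 i) + (\<Sum>i<J. S3 i - S4 i)"
  proof -
    have "(\<Sum>i<J. S3 i - S4 i) = (\<Sum>i<J. integral {\<rho>..r1 / r} (\<lambda>s. cauchy_kernel (\<lambda>U. chart j r t (Suc i) U - chart j r t i U) X (of_real s * cis (node j (Suc i))) / of_real s))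
       - (\<Sum>i<J. \<Sum>n<N. integral {0..1 / \<rho>} (\<lambda>v. ray_weight j i n v * ?k (ray_point j i v)) * \<eta> ^ n)"
      unfolding sum_subtractf[symmetric] by (intro sum.cong refl) (use Rv Ry in simp)
    then show ?thesis unfolding cauchy_rhs_def O[symmetric] I[symmetric] T_def by simp
  qed
  finally have eq: "2 * pi * \<i> * (chart j r t 0 X - (\<Sum>n<N. (slow n (X * \<eta>) + fast j n X) * \<eta> ^ n))
     = (\<Sum>i<J. \<i> * S1 i) + (\<Sum>i<J. \<i> * S2 i) + (\<Sum>i<J. S3 i - S4 i)" .
  have len: "(\<Sum>i<J. node j (Suc i) - node j i) = 2 * pi"
    using sum_lessThan_telescope[of "node j" J] node_J[of j] by simp
  have b1: "cmod (\<Sum>i<J. \<i> * S1 i) \<le> (K_outer * ?gs * r ^ N * (r1 / (r1 - r0))) * (2 * pi)"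
    unfolding len[symmetric] sum_distrib_left by (rule sum_norm_le) (use S1_le in \<open>simp add: norm_mult\<close>)
  have b2: "cmod (\<Sum>i<J. \<i> * S2 i) \<le> (2 * K_outer * ?gs * r ^ N * (1 / separation)) * (2 * pi)"
    unfolding len[symmetric] sum_distrib_left by (rule sum_norm_le) (use S2_le in \<open>simp add: norm_mult\<close>)
  have b3: "cmod (\<Sum>i<J. S3 i - S4 i) \<le> (\<Sum>i<J. K_jump * K_int / separation * ?gs * r ^ N + K_jump * K_int / separation / (1 - r0 / r1) * ?gs * r ^ N)"
    by (intro sum_norm_le norm_triangle_le_diff add_mono S3_le S4_le) auto
  have b3': "0 \<le> (\<Sum>i<J. K_jump * K_int / separation * ?gs * r ^ N + K_jump * K_int / separation / (1 - r0 / r1) * ?gs * r ^ N)" (is "0 \<le> ?s3")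
    by (rule order_trans[OF norm_ge_zero b3])
  have "cmod (chart j r t 0 X - (\<Sum>n<N. (slow n (X * \<eta>) + fast j n X) * \<eta> ^ n)) * (2 * pi)
      = cmod (2 * pi * \<i> * (chart j r t 0 X - (\<Sum>n<N. (slow n (X * \<eta>) + fast j n X) * \<eta> ^ n)))"
    unfolding norm_mult by simp
  also have "\<dots> \<le> (K_outer * ?gs * r ^ N * (r1 / (r1 - r0))) * (2 * pi) + (2 * K_outer * ?gs * r ^ N * (1 / separation)) * (2 * pi) + ?s3"
    unfolding eq by (intro norm_triangle_le add_mono b1 b2 b3)
  also have "\<dots> \<le> (K_outer * ?gs * r ^ N * (r1 / (r1 - r0))) * (2 * pi) + (2 * K_outer * ?gs * r ^ N * (1 / separation)) * (2 * pi) + ?s3 * (2 * pi)"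
    using mult_left_mono[of 1 "2 * pi" ?s3] b3' pi_ge_two by simp
  also have "\<dots> = (K_main * ?gs * r ^ N) * (2 * pi)" by (simp add: K_main_def algebra_simps)
  finally show ?thesis by (simp add: \<eta>_def)
qed

end

section \<open>Expansions at infinity\<close>

lemma integral_expansion_infinity:
  fixes w U :: "real \<Rightarrow> complex"
  assumes nz: "\<And>s. s \<in> {a..b} \<Longrightarrow> w s = 0 \<or> U s \<noteq> X" and X: "X \<noteq> 0" and M: "M > 0"
    and int: "(\<lambda>s. w s * (U s / (U s - X))) integrable_on {a..b}"
      "\<And>m. (\<lambda>s. w s * U s ^ m) integrable_on {a..b}"
  shows "X ^ M * (integral {a..b} (\<lambda>s. w s * (U s / (U s - X))) + (\<Sum>m = 1..<M. integral {a..b} (\<lambda>s. w s * U s ^ m) / X ^ m))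
    = integral {a..b} (\<lambda>s. w s * (X * U s ^ M / (U s - X)))"
proof -
  have "(\<Sum>m = 1..<M. integral {a..b} (\<lambda>s. w s * U s ^ m) / X ^ m) = (\<Sum>m = 1..<M. integral {a..b} (\<lambda>s. w s * U s ^ m / X ^ m))"
    by simp
  also have "\<dots> = integral {a..b} (\<lambda>s. \<Sum>m = 1..<M. w s * U s ^ m / X ^ m)"
    by (intro integral_sum[symmetric] integrable_on_divide int) auto
  finally have "X ^ M * (integral {a..b} (\<lambda>s. w s * (U s / (U s - X))) + (\<Sum>m = 1..<M. integral {a..b} (\<lambda>s. w s * U s ^ m) / X ^ m))
    = X ^ M * integral {a..b} (\<lambda>s. w s * (U s / (U s - X)) + (\<Sum>m = 1..<M. w s * U s ^ m / X ^ m))"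
    by (subst integral_add[OF int(1)]) (intro integrable_sum integrable_on_divide int finite_atLeastLessThan, simp)
  also have "\<dots> = integral {a..b} (\<lambda>s. X ^ M * (w s * (U s / (U s - X)) + (\<Sum>m = 1..<M. w s * U s ^ m / X ^ m)))"
    by simp
  also have "\<dots> = integral {a..b} (\<lambda>s. w s * (X * U s ^ M / (U s - X)))"
  proof (rule integral_cong)
    fix s assume "s \<in> {a..b}"
    from nz[OF this] show "X ^ M * (w s * (U s / (U s - X)) + (\<Sum>m = 1..<M. w s * U s ^ m / X ^ m)) = w s * (X * U s ^ M / (U s - X))"
    proof
      assume "U s \<noteq> X"
      have "X ^ M * (w s * (U s / (U s - X)) + (\<Sum>m = 1..<M. w s * U s ^ m / X ^ m))
         = w s * (X ^ M * (U s / (U s - X) + (\<Sum>m = 1..<M. U s ^ m / X ^ m)))"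
        by (simp add: sum_distrib_left distrib_left mult_ac)
      then show ?thesis unfolding kernel_expansion_infinity[OF X \<open>U s \<noteq> X\<close> M] .
    qed simp
  qed
  finally show ?thesis .
qed

lemma norm_diff_chain:
  fixes y :: "'a::real_normed_vector"
  assumes "norm (y - (a + g)) \<le> u" "norm (y' - (a + g')) \<le> v" "norm (y' - y - d) \<le> w"
  shows "norm (g' - g - d) \<le> u + v + w"
proof -
  have "g' - g - d = ((y - (a + g)) - (y' - (a + g'))) + (y' - y - d)" by simp
  also have "norm \<dots> \<le> u + v + w"
    by (rule norm_triangle_le[OF add_mono[OF norm_triangle_le_diff[OF add_mono[OF assms(1,2)]] assms(3)]])
  finally show ?thesis .
qed

context sectorial_data
begin

text \<open>The coefficients of \<open>X^(- m)\<close> that result from expanding the kernel \<open>U / (U - X)\<close> in powers of \<open>U / X\<close>.\<close>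

definition asym_coef :: "int \<Rightarrow> nat \<Rightarrow> nat \<Rightarrow> complex" where
  "asym_coef j n mm = - ((\<Sum>i<J. \<i> * integral {node j i..node j (Suc i)} (\<lambda>\<theta>. arc_weight j i n \<theta> * (of_real \<rho> * cis \<theta>) ^ mm))
    + (\<Sum>i<J. integral {0..1 / \<rho>} (\<lambda>v. ray_weight j i n v * ray_point j i v ^ mm))) / (2 * pi * \<i>)"

definition K_fast :: real where "K_fast = 2 * K_outer * exp (B * \<rho> ^ p) / separation + J * (1 / separation * (K_jump * K_int))"

lemma K_fast: "0 \<le> K_fast" unfolding K_fast_def using K_outer K_jump K_int(1) separation
  by (intro add_nonneg_nonneg mult_nonneg_nonneg divide_nonneg_nonneg) auto

lemma size_times_power_le: "gevrey_size A p n * \<rho> ^ M \<le> exp (B * \<rho> ^ p) * double_size A B p n M"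
proof -
  let ?k = "real n / real p" and ?x = "real M / real p"
  have "(B * \<rho> ^ p) powr ?x * Gamma (?k + 1) \<le> exp (B * \<rho> ^ p) * Gamma (?k + ?x + 1)"
    using B \<rho> by (intro Gamma_shift_le) auto
  moreover have "(B * \<rho> ^ p) powr ?x = B powr ?x * \<rho> ^ M"
    using B \<rho> p by (simp add: powr_mult powr_realpow[symmetric] powr_powr)
  ultimately have "B powr (- ?x) * (B powr ?x * \<rho> ^ M * Gamma (?k + 1)) \<le> B powr (- ?x) * (exp (B * \<rho> ^ p) * Gamma (?k + ?x + 1))"
    by (intro mult_left_mono) auto
  moreover have "B powr (- ?x) * (B powr ?x * \<rho> ^ M * Gamma (?k + 1)) = (B powr (- ?x) * B powr ?x) * (\<rho> ^ M * Gamma (?k + 1))" by simp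
  moreover have "B powr (- ?x) * B powr ?x = 1" using B by (simp add: powr_add[symmetric])
  ultimately have "\<rho> ^ M * Gamma (?k + 1) \<le> B powr (- ?x) * (exp (B * \<rho> ^ p) * Gamma (?k + ?x + 1))" by simp
  then have "A powr (- ?k) * (\<rho> ^ M * Gamma (?k + 1)) \<le> A powr (- ?k) * (B powr (- ?x) * (exp (B * \<rho> ^ p) * Gamma (?k + ?x + 1)))"
    by (rule mult_left_mono) simp
  then show ?thesis by (simp add: gevrey_size_def double_size_def add_divide_distrib mult_ac add_ac)
qed

text \<open>After multiplication by \<open>X^M\<close> the remainder has the kernel \<open>X U^M / (U - X)\<close>, which is bounded by
\<open>\<bar>U\<bar>^M / separation\<close>. So the claim reduces to the moments of the densities. For \<open>M = 0\<close>
nothing is subtracted and the original kernel satisfies the same bound.\<close>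

lemma fast_expansion:
  assumes X: "X \<in> Vsec j"
  shows "cmod X ^ M * cmod (fast j n X - (\<Sum>mm = 1..<M. asym_coef j n mm / X ^ mm)) \<le> K_fast * double_size A B p n M"
proof -
  let ?U = "\<lambda>\<theta>. of_real \<rho> * cis \<theta>"
  define \<Phi> where "\<Phi> = (\<lambda>U. if M = 0 then U / (U - X) else X * U ^ M / (U - X))"
  have \<Phi>_le: "cmod (\<Phi> U) \<le> cmod U ^ M / separation" if u: "0 < cmod U" "separation * cmod U \<le> cmod (U - X)" "separation * cmod X \<le> cmod (U - X)" for U
  proof -
    have p1: "0 < separation * cmod U" using separation u by (intro mult_pos_pos) auto
    then have d: "0 < cmod (U - X)" using u by linarith
    show ?thesis
    proof (cases "M = 0")
      case True
      have "cmod U / cmod (U - X) \<le> cmod U / (separation * cmod U)" using u d p1 separation by (intro divide_left_mono mult_pos_pos) auto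
      then show ?thesis using True u separation by (simp add: \<Phi>_def norm_divide)
    next
      case False
      have "cmod X \<le> cmod (U - X) / separation" using u(3) separation by (simp add: pos_le_divide_eq mult.commute)
      then have "cmod X * cmod U ^ M / cmod (U - X) \<le> (cmod (U - X) / separation) * cmod U ^ M / cmod (U - X)"
        by (intro divide_right_mono mult_right_mono) auto
      then show ?thesis using False d by (simp add: \<Phi>_def norm_divide norm_mult norm_power)
    qed
  qed
  have wphi: "continuous_on {0<..1 / \<rho>} (\<lambda>v. \<Phi> (ray_point j i v))" if i: "i < J" for i
    unfolding \<Phi>_def using ray_point_away(3)[OF X i] by (cases "M = 0") (auto intro!: continuous_intros ray_point_cont)
  have wphile: "cmod (\<Phi> (ray_point j i v)) \<le> 1 / separation / v ^ M" if i: "i < J" and v: "0 < v" "v \<le> 1 / \<rho>" for i v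
  proof -
    have "cmod (\<Phi> (ray_point j i v)) \<le> cmod (ray_point j i v) ^ M / separation"
      using ray_point_away(1,2)[OF X i v] v by (intro \<Phi>_le) (auto simp: ray_point_norm)
    then show ?thesis using v by (simp add: ray_point_norm power_divide mult.commute)
  qed
  have R\<rho>: "0 < 1 / \<rho>" "1 / \<rho> \<le> 1 / \<rho>" using \<rho> by auto
  have aphi: "cmod (integral {node j i..node j (Suc i)} (\<lambda>\<theta>. arc_weight j i n \<theta> * \<Phi> (?U \<theta>))) \<le> (2 * K_outer * gevrey_size A p n * (\<rho> ^ M / separation)) * (node j (Suc i) - node j i)"
    if i: "i < J" for i
  proof (rule integral_bound)
    show "node j i \<le> node j (Suc i)" using node_less[OF i] by (rule less_imp_le)
    show "continuous_on {node j i..node j (Suc i)} (\<lambda>\<theta>. arc_weight j i n \<theta> * \<Phi> (?U \<theta>))"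
    proof (cases "E \<and> i = 0")
      case True then show ?thesis using arc_weight_0 by auto
    next
      case False
      then show ?thesis unfolding \<Phi>_def using arc_away(3)[OF X i _ False]
        by (cases "M = 0") (auto intro!: continuous_intros arc_weight_cont i)
    qed
    fix \<theta> assume \<theta>: "\<theta> \<in> {node j i..node j (Suc i)}"
    show "cmod (arc_weight j i n \<theta> * \<Phi> (?U \<theta>)) \<le> 2 * K_outer * gevrey_size A p n * (\<rho> ^ M / separation)"
    proof (cases "E \<and> i = 0")
      case True then show ?thesis using arc_weight_0 K_outer size_nonneg \<rho> separation by auto
    next
      case False
      have nU: "cmod (?U \<theta>) = \<rho>" using \<rho> by (simp add: norm_mult)
      have "cmod (\<Phi> (?U \<theta>)) \<le> \<rho> ^ M / separation"
        using \<Phi>_le[of "?U \<theta>"] arc_away(1,2)[OF X i \<theta> False] \<rho> unfolding nU by auto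
      then show ?thesis unfolding norm_mult using K_outer size_nonneg by (intro mult_mono arc_weight_le i \<theta>) auto
    qed
  qed
  have lin: "X ^ M * (fast j n X - (\<Sum>mm = 1..<M. asym_coef j n mm / X ^ mm)) * (2 * pi * \<i>) =
      (\<Sum>i<J. \<i> * integral {node j i..node j (Suc i)} (\<lambda>\<theta>. arc_weight j i n \<theta> * \<Phi> (?U \<theta>)))
      + (\<Sum>i<J. integral {0..1 / \<rho>} (\<lambda>v. ray_weight j i n v * \<Phi> (ray_point j i v)))" if XM: "X \<noteq> 0 \<or> M = 0"
  proof (cases "M = 0")
    case True then show ?thesis by (simp add: fast_def \<Phi>_def)
  next
    case False
    then have M: "M > 0" and X0: "X \<noteq> 0" using XM by auto
    define a where "a = (\<lambda>i. integral {node j i..node j (Suc i)} (\<lambda>\<theta>. arc_weight j i n \<theta> * (?U \<theta> / (?U \<theta> - X))))"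
    define am where "am = (\<lambda>i mm. integral {node j i..node j (Suc i)} (\<lambda>\<theta>. arc_weight j i n \<theta> * ?U \<theta> ^ mm))"
    define w where "w = (\<lambda>i. integral {0..1 / \<rho>} (\<lambda>v. ray_weight j i n v * (ray_point j i v / (ray_point j i v - X))))"
    define wm where "wm = (\<lambda>i mm. integral {0..1 / \<rho>} (\<lambda>v. ray_weight j i n v * ray_point j i v ^ mm))"
    have 1: "X ^ M * (a i + (\<Sum>mm = 1..<M. am i mm / X ^ mm)) = integral {node j i..node j (Suc i)} (\<lambda>\<theta>. arc_weight j i n \<theta> * \<Phi> (?U \<theta>))" if i: "i < J" for i
    proof -
      have "X ^ M * (a i + (\<Sum>mm = 1..<M. am i mm / X ^ mm)) = integral {node j i..node j (Suc i)} (\<lambda>\<theta>. arc_weight j i n \<theta> * (X * ?U \<theta> ^ M / (?U \<theta> - X)))"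
        unfolding a_def am_def
      proof (rule integral_expansion_infinity[OF _ X0 M])
        show "arc_weight j i n s = 0 \<or> ?U s \<noteq> X" if "s \<in> {node j i..node j (Suc i)}" for s
          using arc_away(3)[OF X i that] arc_weight_0 by blast
        show "(\<lambda>s. arc_weight j i n s * (?U s / (?U s - X))) integrable_on {node j i..node j (Suc i)}"
        proof (cases "E \<and> i = 0")
          case True then show ?thesis using arc_weight_0 by (auto intro: integrable_eq[OF integrable_0])
        next
          case False
          show ?thesis
            by (intro integrable_continuous_interval continuous_intros arc_weight_cont i) (use arc_away(3)[OF X i _ False] in auto)
        qed
        show "(\<lambda>s. arc_weight j i n s * ?U s ^ mm) integrable_on {node j i..node j (Suc i)}" for mm
          by (intro integrable_continuous_interval continuous_intros arc_weight_cont i)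
      qed
      then show ?thesis using M by (simp add: \<Phi>_def)
    qed
    have 2: "X ^ M * (w i + (\<Sum>mm = 1..<M. wm i mm / X ^ mm)) = integral {0..1 / \<rho>} (\<lambda>v. ray_weight j i n v * \<Phi> (ray_point j i v))" if i: "i < J" for i
    proof -
      have "X ^ M * (w i + (\<Sum>mm = 1..<M. wm i mm / X ^ mm)) = integral {0..1 / \<rho>} (\<lambda>v. ray_weight j i n v * (X * ray_point j i v ^ M / (ray_point j i v - X)))"
        unfolding w_def wm_def
      proof (rule integral_expansion_infinity[OF _ X0 M])
        show "ray_weight j i n v = 0 \<or> ray_point j i v \<noteq> X" if "v \<in> {0..1 / \<rho>}" for v
          using ray_point_away(3)[OF X i, of v] that ray_weight_0[of j i n] by (cases "v = 0") auto
        show "(\<lambda>v. ray_weight j i n v * (ray_point j i v / (ray_point j i v - X))) integrable_on {0..1 / \<rho>}"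
          by (rule ray_weight_kernel_integrable[OF X i R\<rho>])
        show "(\<lambda>v. ray_weight j i n v * ray_point j i v ^ mm) integrable_on {0..1 / \<rho>}" for mm
          by (rule integrable_continuous_interval, rule ray_weight_times_cont[OF i R\<rho>, where K = 1 and M = mm])
             (auto intro!: continuous_intros ray_point_cont simp: norm_power ray_point_norm power_divide)
      qed
      then show ?thesis using M by (simp add: \<Phi>_def)
    qed
    have g: "fast j n X * (2 * pi * \<i>) = (\<Sum>i<J. \<i> * a i) + (\<Sum>i<J. w i)"
      by (simp add: fast_def a_def w_def)
    have c: "asym_coef j n mm * (2 * pi * \<i>) = - ((\<Sum>i<J. \<i> * am i mm) + (\<Sum>i<J. wm i mm))" for mm
      by (simp add: asym_coef_def am_def wm_def)
    have "X ^ M * (fast j n X - (\<Sum>mm = 1..<M. asym_coef j n mm / X ^ mm)) * (2 * pi * \<i>)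
       = X ^ M * (fast j n X * (2 * pi * \<i>) - (\<Sum>mm = 1..<M. (asym_coef j n mm * (2 * pi * \<i>)) / X ^ mm))"
      unfolding sum_distrib_right[symmetric] times_divide_eq_left[symmetric] by (simp only: left_diff_distrib mult.assoc)
    also have "\<dots> = X ^ M * ((\<Sum>i<J. \<i> * a i) + (\<Sum>i<J. w i) + (\<Sum>mm = 1..<M. ((\<Sum>i<J. \<i> * am i mm) + (\<Sum>i<J. wm i mm)) / X ^ mm))"
      unfolding g c divide_minus_left sum_negf diff_minus_eq_add ..
    also have "(\<Sum>mm = 1..<M. ((\<Sum>i<J. \<i> * am i mm) + (\<Sum>i<J. wm i mm)) / X ^ mm)
       = (\<Sum>i<J. \<Sum>mm = 1..<M. \<i> * am i mm / X ^ mm) + (\<Sum>i<J. \<Sum>mm = 1..<M. wm i mm / X ^ mm)"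
      unfolding add_divide_distrib sum.distrib sum_divide_distrib by (intro arg_cong2[of _ _ _ _ "(+)"] sum.swap)
    also have "X ^ M * ((\<Sum>i<J. \<i> * a i) + (\<Sum>i<J. w i) + ((\<Sum>i<J. \<Sum>mm = 1..<M. \<i> * am i mm / X ^ mm) + (\<Sum>i<J. \<Sum>mm = 1..<M. wm i mm / X ^ mm)))
       = (\<Sum>i<J. \<i> * (X ^ M * (a i + (\<Sum>mm = 1..<M. am i mm / X ^ mm)))) + (\<Sum>i<J. X ^ M * (w i + (\<Sum>mm = 1..<M. wm i mm / X ^ mm)))"
      by (simp add: distrib_left sum.distrib sum_distrib_left mult_ac)
    also have "\<dots> = (\<Sum>i<J. \<i> * integral {node j i..node j (Suc i)} (\<lambda>\<theta>. arc_weight j i n \<theta> * \<Phi> (?U \<theta>)))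
      + (\<Sum>i<J. integral {0..1 / \<rho>} (\<lambda>v. ray_weight j i n v * \<Phi> (ray_point j i v)))"
      using 1 2 by simp
    finally show ?thesis .
  qed
  have ds: "0 < double_size A B p n M" by (rule double_size_pos[OF A B])
  show ?thesis
  proof (cases "X \<noteq> 0 \<or> M = 0")
    case False
    then have "cmod X ^ M = 0" by simp
    then show ?thesis using mult_nonneg_nonneg[OF K_fast less_imp_le[OF ds]] by (simp only: mult_zero_left)
  next
    case True
    have len: "(\<Sum>i<J. node j (Suc i) - node j i) = 2 * pi"
      using sum_lessThan_telescope[of "node j" J] node_J[of j] by simp
    have b1: "cmod (\<Sum>i<J. \<i> * integral {node j i..node j (Suc i)} (\<lambda>\<theta>. arc_weight j i n \<theta> * \<Phi> (?U \<theta>))) \<le> (2 * K_outer * gevrey_size A p n * (\<rho> ^ M / separation)) * (2 * pi)"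
      unfolding len[symmetric] sum_distrib_left by (rule sum_norm_le) (use aphi in \<open>simp add: norm_mult\<close>)
    have b2: "cmod (\<Sum>i<J. integral {0..1 / \<rho>} (\<lambda>v. ray_weight j i n v * \<Phi> (ray_point j i v))) \<le> (\<Sum>i<J. 1 / separation * (K_jump * (K_int * double_size A B p n M)))"
      by (intro sum_norm_le ray_weight_integral_le R\<rho> wphi wphile) auto
    have b2': "0 \<le> J * (1 / separation * (K_jump * K_int)) * double_size A B p n M"
      using K_jump K_int(1) separation ds by (intro mult_nonneg_nonneg) auto
    have "cmod X ^ M * cmod (fast j n X - (\<Sum>mm = 1..<M. asym_coef j n mm / X ^ mm)) * (2 * pi)
       = cmod (X ^ M * (fast j n X - (\<Sum>mm = 1..<M. asym_coef j n mm / X ^ mm)) * (2 * pi * \<i>))"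
      unfolding norm_mult norm_power by simp
    also have "\<dots> \<le> (2 * K_outer * gevrey_size A p n * (\<rho> ^ M / separation)) * (2 * pi) + (\<Sum>i<J. 1 / separation * (K_jump * (K_int * double_size A B p n M)))"
      unfolding lin[OF True] by (intro norm_triangle_le add_mono b1 b2)
    also have "\<dots> = (2 * K_outer / separation * (gevrey_size A p n * \<rho> ^ M)) * (2 * pi) + J * (1 / separation * (K_jump * K_int)) * double_size A B p n M" by simp
    also have "\<dots> \<le> (2 * K_outer / separation * (exp (B * \<rho> ^ p) * double_size A B p n M)) * (2 * pi) + J * (1 / separation * (K_jump * K_int)) * double_size A B p n M * (2 * pi)"
    proof (intro add_mono mult_right_mono mult_left_mono size_times_power_le)
      show "J * (1 / separation * (K_jump * K_int)) * double_size A B p n M \<le> J * (1 / separation * (K_jump * K_int)) * double_size A B p n M * (2 * pi)"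
        using mult_left_mono[of 1 "2 * pi", OF _ b2'] pi_ge_two by simp
    qed (use K_outer separation in auto)
    also have "\<dots> = (K_fast * double_size A B p n M) * (2 * pi)" by (simp add: K_fast_def algebra_simps)
    finally show ?thesis by simp
  qed
qed

lemma fast_le: "X \<in> Vsec j \<Longrightarrow> cmod (fast j n X) \<le> K_fast * gevrey_size A p n"
  using fast_expansion[of X j 0 n] by (simp add: double_size_0[OF B])

lemma slow_holomorphic: "slow n holomorphic_on ball 0 r1"
proof -
  have ne: "of_real r1 * cis t - x \<noteq> 0" if "x \<in> ball 0 r1" for x :: complex and t using that r by (auto simp: norm_mult)
  have "(\<lambda>x. integral (cbox 0 (2 * pi)) (\<lambda>\<phi>. outer_coef \<phi> n * (of_real r1 * cis \<phi> / (of_real r1 * cis \<phi> - x)))) holomorphic_on ball 0 r1"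
  proof (rule leibniz_rule_holomorphic)
    fix x :: complex and t :: real assume x: "x \<in> ball 0 r1"
    show "((\<lambda>x. outer_coef t n * (of_real r1 * cis t / (of_real r1 * cis t - x))) has_field_derivative
       outer_coef t n * (of_real r1 * cis t / ((of_real r1 * cis t - x) * (of_real r1 * cis t - x)))) (at x within ball 0 r1)"
      using ne[OF x] by (auto intro!: derivative_eq_intros)
  next
    fix x :: complex assume x: "x \<in> ball 0 r1"
    have "continuous_on {0..2 * pi} (\<lambda>\<phi>. outer_coef \<phi> n)" by (rule continuous_on_subset[OF outer_coef_cont]) simp
    then show "(\<lambda>\<phi>. outer_coef \<phi> n * (of_real r1 * cis \<phi> / (of_real r1 * cis \<phi> - x))) integrable_on cbox 0 (2 * pi)"
      unfolding cbox_interval by (intro integrable_continuous_interval continuous_intros) (use ne[OF x] in auto)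
  next
    have b: "continuous_on (ball 0 r1 \<times> cbox 0 (2 * pi)) (\<lambda>z. outer_coef (snd z) n)"
      by (rule continuous_on_compose2[OF outer_coef_cont continuous_on_snd[OF continuous_on_id]]) simp
    show "continuous_on (ball 0 r1 \<times> cbox 0 (2 * pi)) (\<lambda>(x, t). outer_coef t n * (of_real r1 * cis t / ((of_real r1 * cis t - x) * (of_real r1 * cis t - x))))"
      unfolding split_beta by (intro continuous_intros b) (use ne in \<open>auto simp: mem_Times_iff\<close>)
  qed simp
  then show ?thesis unfolding slow_def[abs_def] cbox_interval by (intro holomorphic_intros) auto
qed

lemma slow_le:
  assumes "cmod x < r0"
  shows "cmod (slow n x) \<le> K_outer * (r1 / (r1 - r0)) * gevrey_size A p n"
proof -
  have x1: "cmod x < r1" using assms r by simp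
  have ne: "of_real r1 * cis t - x \<noteq> 0" for t using outer_ne[OF x1] by simp
  have "cmod (integral {0..2 * pi} (\<lambda>\<phi>. outer_coef \<phi> n * (of_real r1 * cis \<phi> / (of_real r1 * cis \<phi> - x)))) \<le> (K_outer * gevrey_size A p n * (r1 / (r1 - r0))) * (2 * pi - 0)"
  proof (rule integral_bound)
    have "continuous_on {0..2 * pi} (\<lambda>\<phi>. outer_coef \<phi> n)" by (rule continuous_on_subset[OF outer_coef_cont]) simp
    then show "continuous_on {0..2 * pi} (\<lambda>\<phi>. outer_coef \<phi> n * (of_real r1 * cis \<phi> / (of_real r1 * cis \<phi> - x)))"
      by (intro continuous_intros) (use ne in auto)
    fix t :: real
    have "r1 - r0 \<le> cmod (of_real r1 * cis t - x)"
      using norm_triangle_ineq2[of "of_real r1 * cis t" x] assms r by (simp add: norm_mult)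
    then have "r1 / cmod (of_real r1 * cis t - x) \<le> r1 / (r1 - r0)" using r by (intro divide_left_mono mult_pos_pos) auto
    then have "cmod (of_real r1 * cis t / (of_real r1 * cis t - x)) \<le> r1 / (r1 - r0)" using r by (simp add: norm_divide norm_mult)
    then show "cmod (outer_coef t n * (of_real r1 * cis t / (of_real r1 * cis t - x))) \<le> K_outer * gevrey_size A p n * (r1 / (r1 - r0))"
      unfolding norm_mult[of "outer_coef t n"] using K_outer size_nonneg by (intro mult_mono outer_coef(1)) auto
  qed simp
  from divide_right_mono[OF this, of "2 * pi"]
  have "cmod (slow n x) \<le> (K_outer * gevrey_size A p n * (r1 / (r1 - r0))) * (2 * pi - 0) / (2 * pi)"
    by (simp add: slow_def norm_divide)
  also have "\<dots> = K_outer * (r1 / (r1 - r0)) * gevrey_size A p n" by simp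
  finally show ?thesis .
qed

lemma Vsec_W: "X \<in> Vsec j \<Longrightarrow> X \<in> W j"
proof -
  assume X: "X \<in> Vsec j"
  show ?thesis
  proof (cases "E \<and> cmod X \<le> \<rho>")
    case True then show ?thesis by (simp add: W_def)
  next
    case False
    have "if E then \<rho>1 \<le> cmod X else True" using False \<rho>(3) by (cases E) auto
    from Vsec_polar[OF X this] obtain \<tau> where \<tau>: "X = of_real (cmod X) * cis \<tau>" "\<alpha> j < \<tau>" "\<tau> < \<beta> j" "\<not> E \<longrightarrow> \<rho>1 < cmod X" by blast
    have "\<rho> \<le> cmod X" using False \<tau>(4) \<rho>(4) by (cases E) auto
    then have "of_real (cmod X) * cis \<tau> \<in> W j" using \<tau> \<kappa> by (intro W_polar) auto
    then show ?thesis using \<tau>(1) by simp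
  qed
qed

text \<open>The functions \<open>slow\<close> are holomorphic by their integral representation. The functions \<open>fast\<close> are recovered
successively as locally uniform limits of difference quotients of holomorphic functions.\<close>

lemma fast_holomorphic:
  assumes op: "open (Vsec j)"
  shows "fast j n holomorphic_on Vsec j"
proof (induction n rule: less_induct)
  case (less n)
  have "\<exists>d>0. fast j n holomorphic_on ball X d" if X: "X \<in> Vsec j" for X
  proof -
    obtain d where d: "d > 0" "cball X d \<subseteq> Vsec j" using op X open_contains_cball by blast
    let ?e = "\<lambda>i. of_real (eta_seq i) * cis 0"
    define F where "F = (\<lambda>i X. chart j (eta_seq i) 0 0 X - (\<Sum>k<Suc n. slow k (X * ?e i) * ?e i ^ k))"
    have bnd: "cmod z \<le> cmod X + d" if "z \<in> cball X d" for z
      using that norm_triangle_ineq2[of z X] by (simp add: dist_norm norm_minus_commute)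
    have "(\<lambda>i. eta_seq i * (cmod X + d)) \<longlonglongrightarrow> 0 * (cmod X + d)" by (intro tendsto_mult_right eta_seq)
    then have "\<forall>\<^sub>F i in sequentially. eta_seq i * (cmod X + d) < r0" using r by (intro order_tendstoD(2)[of _ 0]) auto
    then have ev: "\<forall>\<^sub>F i in sequentially. \<forall>z\<in>cball X d. cmod z * eta_seq i < r0"
    proof eventually_elim
      case (elim i)
      show ?case
      proof
        fix z assume "z \<in> cball X d"
        from mult_left_mono[OF bnd[OF this] less_imp_le[OF eta_seq(1)[of i]]]
        show "cmod z * eta_seq i < r0" using elim by (simp add: mult.commute)
      qed
    qed
    have ul: "uniform_limit (cball X d) (\<lambda>i z. (F i z - (\<Sum>k<n. fast j k z * ?e i ^ k)) / ?e i ^ n) (fast j n) sequentially"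
    proof (rule coeff_uniform_limit[OF eta_seq_cis(1,2)])
      show "\<forall>\<^sub>F i in sequentially. \<forall>z\<in>cball X d. cmod (F i z - (\<Sum>k<Suc n. fast j k z * ?e i ^ k)) \<le> (K_main * gevrey_size A p (Suc n)) * cmod (?e i) ^ Suc n"
        using ev
      proof eventually_elim
        case (elim i)
        show ?case
        proof
          fix z assume z: "z \<in> cball X d"
          have "F i z - (\<Sum>k<Suc n. fast j k z * ?e i ^ k) = chart j (eta_seq i) 0 0 z - (\<Sum>k<Suc n. (slow k (z * ?e i) + fast j k z) * ?e i ^ k)"
            unfolding F_def distrib_right sum.distrib by simp
          then show "cmod (F i z - (\<Sum>k<Suc n. fast j k z * ?e i ^ k)) \<le> (K_main * gevrey_size A p (Suc n)) * cmod (?e i) ^ Suc n"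
            unfolding eta_seq_cis(3) using main_remainder[of z j "eta_seq i" 0 "Suc n"] eta_seq(1,2)[of i] elim z d by auto
        qed
      qed
    qed
    have "\<forall>\<^sub>F i in sequentially. continuous_on (cball X d) (\<lambda>z. (F i z - (\<Sum>k<n. fast j k z * ?e i ^ k)) / ?e i ^ n)
         \<and> (\<lambda>z. (F i z - (\<Sum>k<n. fast j k z * ?e i ^ k)) / ?e i ^ n) holomorphic_on ball X d"
      using ev
    proof eventually_elim
      case (elim i)
      have 1: "chart j (eta_seq i) 0 0 holomorphic_on cball X d"
        by (rule chart_hol[OF eta_seq(1,2)]) (use Vsec_W d elim r in force)+
      have 2: "(\<lambda>z. slow k (z * ?e i)) holomorphic_on cball X d" for k
      proof -
        have "(\<lambda>z. z * ?e i) ` cball X d \<subseteq> ball 0 r1"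
          using elim r eta_seq(1)[of i] by (force simp: norm_mult)
        from holomorphic_on_compose_gen[OF _ slow_holomorphic this] show ?thesis
          by (simp add: o_def holomorphic_intros)
      qed
      have 3: "fast j k holomorphic_on cball X d" if "k < n" for k
        by (rule holomorphic_on_subset[OF less[OF that] d(2)])
      have h: "(\<lambda>z. (F i z - (\<Sum>k<n. fast j k z * ?e i ^ k)) / ?e i ^ n) holomorphic_on cball X d"
        unfolding F_def by (intro holomorphic_intros 1 2 3) (use eta_seq_cis(2)[of i 0] in auto)
      then show ?case using holomorphic_on_imp_continuous_on[OF h] holomorphic_on_subset[OF h ball_subset_cball] by blast
    qed
    from holomorphic_uniform_limit[OF this ul] have "fast j n holomorphic_on ball X d" by auto
    then show ?thesis using d by blast
  qed
  then have "fast j n field_differentiable (at X within Vsec j)" if "X \<in> Vsec j" for X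
    using that by (metis centre_in_ball holomorphic_on_imp_differentiable_at open_ball field_differentiable_at_within)
  then show ?case by (simp add: holomorphic_on_def)
qed

text \<open>On the ray in the middle of the overlap both \<open>fast (j + 1) n X - fast j n X\<close> and the coefficients of the jump
expand the same function of \<open>\<eta>\<close>; the parts \<open>slow\<close> cancel.\<close>

lemma fast_diff:
  fixes j :: int
  assumes s: "\<rho> \<le> s" "\<rho>1 < s"
  defines "X \<equiv> of_real s * cis (mid j)"
  shows "X \<in> Vsec j" "X \<in> Vsec (j + 1)" "cmod (fast (j + 1) n X - fast j n X) \<le> K_jump * gevrey_bound A p n (B * s ^ p)"
proof -
  have s0: "0 < s" using s \<rho> by simp
  have ml: "\<alpha> (j + 1) < mid j" "mid j < \<beta> j" using mid[of j] \<kappa> by auto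
  show XV: "X \<in> Vsec j" "X \<in> Vsec (j + 1)"
    unfolding Vsec_def X_def using s s0 ml \<alpha>_less[of j] \<beta>_less[of j] by (auto split: if_splits) force+
  have nX: "cmod X = s" using s0 by (simp add: X_def norm_mult)
  have ray: "\<alpha> (j + 1) - \<kappa> \<le> mid j" "mid j \<le> \<beta> j + \<kappa>" using ml \<kappa> by auto
  let ?e = "\<lambda>i. of_real (eta_seq i) * cis 0"
  have "fast (j + 1) n X - fast j n X - jump_coef j (mid j) s n = 0"
  proof (rule expansion_unique[OF eta_seq_cis(1)[of 0] eta_seq_cis(2), of "\<lambda>n. fast (j + 1) n X - fast j n X - jump_coef j (mid j) s n"])
    fix N
    have "(\<lambda>i. eta_seq i * s) \<longlonglongrightarrow> 0 * s" by (intro tendsto_mult_right eta_seq)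
    then have ev: "\<forall>\<^sub>F i in sequentially. eta_seq i * s < r0" using r by (intro order_tendstoD(2)[of _ 0]) auto
    let ?K = "K_main * gevrey_size A p (Suc N) + K_main * gevrey_size A p (Suc N) + K_jump * gevrey_bound A p (Suc N) (B * s ^ p)"
    show "\<exists>K. \<forall>\<^sub>F i in sequentially. cmod (\<Sum>n<Suc N. (fast (j + 1) n X - fast j n X - jump_coef j (mid j) s n) * ?e i ^ n) \<le> K * cmod (?e i) ^ Suc N"
    proof (intro exI[of _ ?K], use ev in eventually_elim)
      fix i assume i: "eta_seq i * s < r0"
      let ?y = "chart j (eta_seq i) 0 0 X" and ?y' = "chart (j + 1) (eta_seq i) 0 0 X"
      let ?a = "\<Sum>n<Suc N. slow n (X * ?e i) * ?e i ^ n"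
      let ?g = "\<lambda>j. \<Sum>n<Suc N. fast j n X * ?e i ^ n" and ?d = "\<Sum>n<Suc N. jump_coef j (mid j) s n * ?e i ^ n"
      have 1: "cmod (chart k (eta_seq i) 0 0 X - (?a + ?g k)) \<le> K_main * gevrey_size A p (Suc N) * eta_seq i ^ Suc N" if "X \<in> Vsec k" for k
        unfolding sum.distrib[symmetric] distrib_right[symmetric]
        by (rule main_remainder[OF that eta_seq(1,2)]) (use i nX in \<open>simp add: mult.commute\<close>)
      have 2: "cmod (?y' - ?y - ?d) \<le> K_jump * gevrey_bound A p (Suc N) (B * s ^ p) * eta_seq i ^ Suc N"
        using jump_coef(2)[OF s(1) ray eta_seq(1,2), of i 0 "Suc N"] i r by (simp add: chart_def X_def K_jump_def mult.commute)
      have "(\<Sum>n<Suc N. (fast (j + 1) n X - fast j n X - jump_coef j (mid j) s n) * ?e i ^ n) = ?g (j + 1) - ?g j - ?d"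
        unfolding left_diff_distrib sum_subtractf by simp
      also have "cmod \<dots> \<le> K_main * gevrey_size A p (Suc N) * eta_seq i ^ Suc N + K_main * gevrey_size A p (Suc N) * eta_seq i ^ Suc N + K_jump * gevrey_bound A p (Suc N) (B * s ^ p) * eta_seq i ^ Suc N"
        by (rule norm_diff_chain[OF 1[OF XV(1)] 1[OF XV(2)] 2])
      also have "\<dots> = ?K * cmod (?e i) ^ Suc N" unfolding eta_seq_cis(3) by (simp only: distrib_right)
      finally show "cmod (\<Sum>n<Suc N. (fast (j + 1) n X - fast j n X - jump_coef j (mid j) s n) * ?e i ^ n) \<le> ?K * cmod (?e i) ^ Suc N" .
    qed
  qed
  then have "fast (j + 1) n X - fast j n X = jump_coef j (mid j) s n" by simp
  then show "cmod (fast (j + 1) n X - fast j n X) \<le> K_jump * gevrey_bound A p n (B * s ^ p)"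
    using jump_coef(1)[OF s(1) ray, of n] by (simp add: K_jump_def)
qed

text \<open>A difference that is smaller than every power of \<open>1 / X\<close> along a ray has vanishing expansion at infinity.\<close>

lemma asym_coef_step:
  assumes "mm > 0"
  shows "asym_coef (j + 1) n mm = asym_coef j n mm"
proof -
  define ss where "ss = (\<lambda>i. \<rho> + \<rho>1 + real (Suc i))"
  have ss: "\<rho> \<le> ss i" "\<rho>1 < ss i" "0 < ss i" for i using \<rho> by (auto simp: ss_def)
  define \<zeta> where "\<zeta> = (\<lambda>i. 1 / (of_real (ss i) * cis (mid j)))"
  have n\<zeta>: "cmod (\<zeta> i) = 1 / ss i" for i using ss(3)[of i] by (simp add: \<zeta>_def norm_divide norm_mult)
  define e where "e = (\<lambda>mm. if mm = 0 then 0 else asym_coef (j + 1) n mm - asym_coef j n mm)"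
  have "e mm = 0"
  proof (rule expansion_unique)
    show "\<zeta> \<longlonglongrightarrow> 0"
    proof (rule tendsto_norm_zero_cancel, rule Lim_null_comparison)
      show "\<forall>\<^sub>F i in sequentially. norm (norm (\<zeta> i)) \<le> inverse (real (Suc i))"
      proof (intro always_eventually allI)
        fix i
        have "1 / ss i \<le> 1 / real (Suc i)" using \<rho> by (intro divide_left_mono mult_pos_pos ss) (auto simp: ss_def)
        then show "norm (norm (\<zeta> i)) \<le> inverse (real (Suc i))" unfolding n\<zeta> using ss(3)[of i] by (simp add: inverse_eq_divide)
      qed
    qed (rule LIMSEQ_inverse_real_of_nat)
    show "\<zeta> i \<noteq> 0" for i using ss(3)[of i] by (simp add: \<zeta>_def)
    fix N
    obtain K' where K': "K' \<ge> 0" "\<And>v. 0 < v \<Longrightarrow> v \<le> 1 / \<rho> \<Longrightarrow> uGamma (real n / real p) (B / v ^ p) \<le> K' * v ^ Suc N"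
      using uGamma_flat[of "real n / real p" B p "1 / \<rho>" "Suc N"] B p \<rho> by auto
    let ?a = "K_jump * (A powr (- (real n / real p)) / (real n + 1)) * K'"
    let ?K = "K_fast * double_size A B p n (Suc N) + K_fast * double_size A B p n (Suc N) + ?a"
    show "\<exists>K. \<forall>\<^sub>F i in sequentially. cmod (\<Sum>mm<Suc N. e mm * \<zeta> i ^ mm) \<le> K * cmod (\<zeta> i) ^ Suc N"
    proof (intro exI[of _ ?K] always_eventually allI)
      fix i
      let ?X = "of_real (ss i) * cis (mid j)"
      have nX: "cmod ?X = ss i" using ss(3)[of i] by (simp add: norm_mult)
      let ?S = "\<lambda>j. \<Sum>mm = 1..<Suc N. asym_coef j n mm / ?X ^ mm"
      have V: "?X \<in> Vsec j" "?X \<in> Vsec (j + 1)" by (rule fast_diff[OF ss(1,2)])+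
      have 1: "cmod (fast k n ?X - ?S k) \<le> K_fast * double_size A B p n (Suc N) * cmod (\<zeta> i) ^ Suc N" if "?X \<in> Vsec k" for k
        using fast_expansion[OF that, of "Suc N" n] ss(3)[of i] unfolding nX n\<zeta>
        by (simp add: power_divide pos_le_divide_eq mult.commute del: power_Suc)
      have 2: "cmod (fast (j + 1) n ?X - fast j n ?X) \<le> ?a * cmod (\<zeta> i) ^ Suc N"
      proof -
        have v: "0 < 1 / ss i" "1 / ss i \<le> 1 / \<rho>" using ss[of i] \<rho> by (auto intro: divide_left_mono)
        have "cmod (fast (j + 1) n ?X - fast j n ?X) \<le> K_jump * gevrey_bound A p n (B * ss i ^ p)" by (rule fast_diff(3)[OF ss(1,2)])
        also have "B * ss i ^ p = B / (1 / ss i) ^ p" by (simp add: power_divide)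
        also have "K_jump * gevrey_bound A p n (B / (1 / ss i) ^ p) = K_jump * (A powr (- (real n / real p)) / (real n + 1)) * uGamma (real n / real p) (B / (1 / ss i) ^ p)"
          by (simp add: gevrey_bound_def)
        also have "\<dots> \<le> K_jump * (A powr (- (real n / real p)) / (real n + 1)) * (K' * (1 / ss i) ^ Suc N)"
          using K_jump by (intro mult_left_mono K' v) auto
        finally show ?thesis unfolding n\<zeta> by simp
      qed
      have "(\<Sum>mm<Suc N. e mm * \<zeta> i ^ mm) = (\<Sum>mm = 1..<Suc N. e mm * \<zeta> i ^ mm)"
        by (rule sum.mono_neutral_right) (auto simp: e_def)
      also have "\<dots> = (\<Sum>mm = 1..<Suc N. asym_coef (j + 1) n mm / ?X ^ mm - asym_coef j n mm / ?X ^ mm)"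
        by (intro sum.cong refl) (auto simp: e_def \<zeta>_def power_divide diff_divide_distrib)
      also have "\<dots> = ?S (j + 1) - ?S j" by (rule sum_subtractf)
      also have "\<dots> = ((fast j n ?X - ?S j) - (fast (j + 1) n ?X - ?S (j + 1))) + (fast (j + 1) n ?X - fast j n ?X)" by simp
      also have "cmod \<dots> \<le> K_fast * double_size A B p n (Suc N) * cmod (\<zeta> i) ^ Suc N + K_fast * double_size A B p n (Suc N) * cmod (\<zeta> i) ^ Suc N + ?a * cmod (\<zeta> i) ^ Suc N"
        by (rule norm_triangle_le[OF add_mono[OF norm_triangle_le_diff[OF add_mono[OF 1[OF V(1)] 1[OF V(2)]]] 2]])
      also have "\<dots> = ?K * cmod (\<zeta> i) ^ Suc N" by (simp only: distrib_right)
      finally show "cmod (\<Sum>mm<Suc N. e mm * \<zeta> i ^ mm) \<le> ?K * cmod (\<zeta> i) ^ Suc N" .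
    qed
  qed
  then show ?thesis using assms by (simp add: e_def)
qed

lemma asym_coef_eq: "mm > 0 \<Longrightarrow> asym_coef (int j) n mm = asym_coef 0 n mm"
proof (induction j)
  case (Suc j)
  then show ?case using asym_coef_step[of mm "int j" n] by (simp add: add.commute)
qed simp

lemma fast_expansion_common:
  assumes X: "X \<in> Vsec (int j)"
  shows "cmod X ^ M * cmod (fast (int j) n X - (\<Sum>mm = 1..<M. asym_coef 0 n mm / X ^ mm)) \<le> K_fast * double_size A B p n M"
proof -
  have "(\<Sum>mm = 1..<M. asym_coef 0 n mm / X ^ mm) = (\<Sum>mm = 1..<M. asym_coef (int j) n mm / X ^ mm)"
    using asym_coef_eq by (intro sum.cong refl) auto
  then show ?thesis using fast_expansion[OF X, of M n] by simp
qed

lemma remainder_at_S: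
  assumes X: "X \<in> Vsec j" and \<eta>: "\<eta> \<in> S l" "cmod \<eta> \<le> \<epsilon>1" and X\<eta>: "cmod X * cmod \<eta> < r0"
  shows "cmod (Y j l (X * \<eta>) \<eta> - (\<Sum>n<N. (slow n (X * \<eta>) + fast j n X) * \<eta> ^ n)) \<le> (K_main + C) * gevrey_size A p N * cmod \<eta> ^ N"
proof -
  define r where "r = cmod \<eta>"
  define t where "t = Arg \<eta>"
  have "\<eta> \<noteq> 0" using S_nz \<eta> by auto
  then have r': "0 < r" "r \<le> \<epsilon>1" and e: "\<eta> = of_real r * cis t"
    using \<eta> Arg_eq[of \<eta>] by (auto simp: r_def t_def cis_conv_exp)
  have 1: "cmod (chart j r t 0 X - (\<Sum>n<N. (slow n (X * \<eta>) + fast j n X) * \<eta> ^ n)) \<le> K_main * gevrey_size A p N * r ^ N"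
    using main_remainder[OF X r', of t N] X\<eta> unfolding e[symmetric] by (simp add: r_def)
  have m0: "cmod X * cmod \<eta> < r0'" using X\<eta> r by simp
  have S': "\<eta> \<in> S (lam t)" using r_S[OF r', of t] e by simp
  have "cmod (Y j l (X * \<eta>) \<eta> - Y j (lam t) (X * \<eta>) \<eta>) \<le> C * exp (- (A / cmod \<eta> ^ p))"
    by (intro Y_A dom Vsec_W X \<eta> S' m0)
  also have "\<dots> \<le> C * (gevrey_size A p N * r ^ N)"
    unfolding r_def[symmetric] using C by (intro mult_left_mono exp_le_gevrey_size A p r')
  finally have 2: "cmod (Y j l (X * \<eta>) \<eta> - chart j r t 0 X) \<le> C * (gevrey_size A p N * r ^ N)"
    by (simp add: chart_def e[symmetric])
  have "cmod ((Y j l (X * \<eta>) \<eta> - chart j r t 0 X) + (chart j r t 0 X - (\<Sum>n<N. (slow n (X * \<eta>) + fast j n X) * \<eta> ^ n)))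
    \<le> C * (gevrey_size A p N * r ^ N) + K_main * gevrey_size A p N * r ^ N"
    by (rule norm_triangle_le[OF add_mono[OF 2 1]])
  then show ?thesis by (simp add: r_def algebra_simps)
qed

end

section \<open>The expansion on the whole domain\<close>

lemma gevrey_size_shift:
  assumes A: "A > 0" and p: "p > 0" and e: "0 < e" "e \<le> r" and n: "n \<le> N"
  shows "gevrey_size A p n * r ^ n * 2 ^ (N - n) \<le> exp (A * (2 / e) ^ p) * (gevrey_size A p N * r ^ N)"
proof -
  let ?b = "A * (2 / e) ^ p" and ?k = "real n / real p" and ?d = "real (N - n) / real p"
  have kd: "?k + ?d = real N / real p" using n p by (simp add: add_divide_distrib[symmetric])
  have "?b powr ?d * Gamma (?k + 1) \<le> exp ?b * Gamma (?k + ?d + 1)"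
    using A e by (intro Gamma_shift_le) auto
  moreover have "?b powr ?d = A powr ?d * (2 / e) ^ (N - n)"
    using A e p by (simp add: powr_mult powr_realpow[symmetric] powr_powr)
  ultimately have g: "A powr ?d * (2 / e) ^ (N - n) * Gamma (?k + 1) \<le> exp ?b * Gamma (real N / real p + 1)"
    unfolding kd by simp
  have Ad: "A powr (- (real N / real p)) * A powr ?d = A powr (- ?k)"
    unfolding powr_add[symmetric] kd[symmetric] by simp
  have "r ^ n * 2 ^ (N - n) \<le> r ^ N * (2 / e) ^ (N - n)"
  proof -
    have "r ^ n * e ^ (N - n) \<le> r ^ n * r ^ (N - n)" using e by (intro mult_left_mono power_mono) auto
    also have "\<dots> = r ^ N" using n by (simp add: power_add[symmetric])
    finally show ?thesis using e by (simp add: power_divide pos_le_divide_eq mult_ac mult_left_mono)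
  qed
  then have "(A powr (- ?k) * Gamma (?k + 1)) * (r ^ n * 2 ^ (N - n)) \<le> (A powr (- ?k) * Gamma (?k + 1)) * (r ^ N * (2 / e) ^ (N - n))"
    by (intro mult_left_mono mult_nonneg_nonneg Gamma_real_nonneg add_nonneg_pos) auto
  also have "\<dots> = (A powr (- (real N / real p)) * r ^ N) * (A powr ?d * (2 / e) ^ (N - n) * Gamma (?k + 1))"
    unfolding Ad[symmetric] by simp
  also have "\<dots> \<le> (A powr (- (real N / real p)) * r ^ N) * (exp ?b * Gamma (real N / real p + 1))"
    using e by (intro mult_left_mono g) auto
  finally show ?thesis by (simp add: gevrey_size_def mult_ac)
qed

text \<open>For \<open>\<bar>\<eta>\<bar> \<ge> e\<close> the terms \<open>gevrey_size A p n * \<bar>\<eta>\<bar>^n\<close> grow, up to a constant factor, at least like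
  \<open>2^n\<close>. Therefore the bounds for the function and for the coefficients already imply the bound for the
  remainder.\<close>

lemma gevrey_remainder_away:
  fixes b :: "nat \<Rightarrow> complex"
  assumes A: "A > 0" and p: "p > 0" and e: "0 < e" "e \<le> cmod \<eta>"
    and y: "cmod y \<le> K" and b: "\<And>n. cmod (b n) \<le> K * gevrey_size A p n"
  shows "cmod (y - (\<Sum>n<N. b n * \<eta> ^ n)) \<le> 2 * K * exp (A * (2 / e) ^ p) * gevrey_size A p N * cmod \<eta> ^ N"
proof -
  define T where "T = exp (A * (2 / e) ^ p) * (gevrey_size A p N * cmod \<eta> ^ N)"
  have K: "0 \<le> K" using y norm_ge_zero order_trans by blast
  have T0: "0 \<le> T" unfolding T_def using gevrey_size_pos[OF A, of p N] by (intro mult_nonneg_nonneg) auto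
  have s: "gevrey_size A p n * cmod \<eta> ^ n \<le> T / 2 ^ (N - n)" if "n \<le> N" for n
    using gevrey_size_shift[OF A p e that] unfolding T_def by (simp add: pos_le_divide_eq)
  have "gevrey_size A p 0 * cmod \<eta> ^ 0 \<le> T / 2 ^ N" using s[of 0] by simp
  also have "\<dots> \<le> T / 1" using T0 by (intro divide_left_mono) auto
  finally have "1 \<le> T" using A by (simp add: gevrey_size_def)
  then have 0: "cmod y \<le> K * T" using y K mult_left_mono[of 1 T K] by simp
  have "cmod (\<Sum>n<N. b n * \<eta> ^ n) \<le> (\<Sum>n<N. K * (T / 2 ^ (N - n)))"
  proof (rule sum_norm_le)
    fix n assume n: "n \<in> {..<N}"
    have "cmod (b n * \<eta> ^ n) \<le> (K * gevrey_size A p n) * cmod \<eta> ^ n"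
      unfolding norm_mult norm_power by (intro mult_right_mono b) auto
    also have "\<dots> \<le> K * (T / 2 ^ (N - n))" using mult_left_mono[OF s[of n] K] n by (simp add: mult.assoc)
    finally show "cmod (b n * \<eta> ^ n) \<le> K * (T / 2 ^ (N - n))" .
  qed
  also have "\<dots> = K * T * (\<Sum>n<N. (1 / 2) ^ (N - n))" by (simp add: sum_distrib_left power_divide)
  also have "(\<Sum>n<N. (1 / 2) ^ (N - n)) = (\<Sum>n<N. (1 / 2 :: real) ^ Suc n)"
    by (rule sum.reindex_bij_witness[of _ "\<lambda>n. N - Suc n" "\<lambda>n. N - Suc n"]) (auto simp: Suc_diff_Suc)
  also have "\<dots> = 1 - (1 / 2) ^ N" by (induction N) (auto simp: field_simps)
  also have "K * T * (1 - (1 / 2) ^ N) \<le> K * T * 1" using K T0 by (intro mult_left_mono) auto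
  finally have "cmod (y - (\<Sum>n<N. b n * \<eta> ^ n)) \<le> K * T + K * T * 1" by (rule norm_triangle_le_diff[OF add_mono[OF 0]])
  then show ?thesis by (simp add: T_def mult_ac)
qed

context sectorial_data
begin

text \<open>If the quasi-sectors contain a disc and \<open>\<bar>\<eta>\<bar>\<close> is large, then \<open>x\<close> may lie outside the disc of
radius \<open>r0\<close>. There the functions \<open>a n\<close> are given the value 0, which \<open>gevrey_remainder_away\<close> allows.\<close>

theorem sectorial_expansion:
  obtains a :: "nat \<Rightarrow> complex \<Rightarrow> complex" and g :: "int \<Rightarrow> nat \<Rightarrow> complex \<Rightarrow> complex" and c :: "nat \<Rightarrow> nat \<Rightarrow> complex" and K :: real
  where "0 \<le> K" "\<And>n. a n holomorphic_on ball 0 r0" "\<And>n x. cmod x < r0 \<Longrightarrow> cmod (a n x) \<le> K * gevrey_size A p n"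
    "\<And>j n. open (Vsec j) \<Longrightarrow> g j n holomorphic_on Vsec j"
    "\<And>j n M X. X \<in> Vsec (int j) \<Longrightarrow> cmod X ^ M * cmod (g (int j) n X - (\<Sum>m = 1..<M. c n m / X ^ m)) \<le> K * double_size A B p n M"
    "\<And>j l X \<eta> N. X \<in> Vsec j \<Longrightarrow> \<eta> \<in> S l \<Longrightarrow> (X * \<eta>, \<eta>) \<in> D j l \<Longrightarrow> cmod X * cmod \<eta> < r0 \<or> cmod X < \<rho>1 \<Longrightarrow>
      cmod (Y j l (X * \<eta>) \<eta> - (\<Sum>n<N. (a n (X * \<eta>) + g j n X) * \<eta> ^ n)) \<le> K * gevrey_size A p N * cmod \<eta> ^ N"
proof -
  define a where "a n x = (if cmod x < r0 then slow n x else 0)" for n x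
  define Ka where "Ka = K_outer * (r1 / (r1 - r0))"
  define e where "e = min \<epsilon>1 (r0 / \<rho>1)"
  define Ky where "Ky = C + Ka + K_fast"
  define Ke where "Ke = 2 * Ky * exp (A * (2 / e) ^ p)"
  define K where "K = Ka + K_fast + Ke + (K_main + C)"
  have e: "0 < e" "e \<le> \<epsilon>1" "e * \<rho>1 \<le> r0" unfolding e_def using \<epsilon>1 r \<rho> by (auto simp: min_def field_simps)
  have Ka: "0 \<le> Ka" unfolding Ka_def using K_outer r by simp
  have Ky: "0 \<le> Ky" unfolding Ky_def using Ka K_fast C by simp
  have Ke: "0 \<le> Ke" unfolding Ke_def using Ky by simp
  have K: "0 \<le> K" "Ka \<le> K" "K_fast \<le> K" "Ke \<le> K" "K_main + C \<le> K" unfolding K_def using Ka K_fast Ke K_main C by auto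
  have gs': "0 \<le> gevrey_size A p n" for n by (rule less_imp_le[OF gevrey_size_pos[OF A]])
  have a_le: "cmod (a n x) \<le> Ka * gevrey_size A p n" for n x
    using slow_le[of x n, folded Ka_def] mult_nonneg_nonneg[OF Ka gs'[of n]] by (simp add: a_def)
  show ?thesis
  proof (rule that[of K a fast "asym_coef 0"])
    show "0 \<le> K" by (rule K)
    show "a n holomorphic_on ball 0 r0" for n
      by (rule holomorphic_transform[OF holomorphic_on_subset[OF slow_holomorphic[of n]]]) (use r in \<open>auto simp: a_def\<close>)
    show "cmod (a n x) \<le> K * gevrey_size A p n" for n x
      by (rule order_trans[OF a_le mult_right_mono[OF K(2) gs']])
    show "open (Vsec j) \<Longrightarrow> fast j n holomorphic_on Vsec j" for j n by (rule fast_holomorphic)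
    show "cmod X ^ M * cmod (fast (int j) n X - (\<Sum>m = 1..<M. asym_coef 0 n m / X ^ m)) \<le> K * double_size A B p n M"
      if "X \<in> Vsec (int j)" for j n M X
      by (rule order_trans[OF fast_expansion_common[OF that] mult_right_mono[OF K(3)]]) (rule less_imp_le[OF double_size_pos[OF A B]])
    fix j l X \<eta> N
    assume X: "X \<in> Vsec j" and \<eta>: "\<eta> \<in> S l" and D: "(X * \<eta>, \<eta>) \<in> D j l" and small: "cmod X * cmod \<eta> < r0 \<or> cmod X < \<rho>1"
    have lift: "T \<le> K * gevrey_size A p N * cmod \<eta> ^ N" if "T \<le> k * gevrey_size A p N * cmod \<eta> ^ N" "k \<le> K" for T k
      by (rule order_trans[OF that(1)]) (intro mult_right_mono that(2) gs' zero_le_power norm_ge_zero)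
    show "cmod (Y j l (X * \<eta>) \<eta> - (\<Sum>n<N. (a n (X * \<eta>) + fast j n X) * \<eta> ^ n)) \<le> K * gevrey_size A p N * cmod \<eta> ^ N"
    proof (cases "cmod \<eta> < e")
      case True
      have m: "cmod X * cmod \<eta> < r0" using small
      proof
        assume "cmod X < \<rho>1"
        then have "cmod X * cmod \<eta> \<le> \<rho>1 * cmod \<eta>" by (intro mult_right_mono) auto
        also have "\<dots> < \<rho>1 * e" using True \<rho> by simp
        finally show ?thesis using e(3) by (simp add: mult.commute)
      qed
      then have "a n (X * \<eta>) = slow n (X * \<eta>)" for n by (simp add: a_def norm_mult)
      then show ?thesis using remainder_at_S[OF X \<eta> _ m, of N] True e by (intro lift[OF _ K(5)]) simp
    next
      case False
      show ?thesis
      proof (rule lift[OF _ K(4)], unfold Ke_def, rule gevrey_remainder_away[OF A p e(1)])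
        show "e \<le> cmod \<eta>" using False by simp
        show "cmod (Y j l (X * \<eta>) \<eta>) \<le> Ky" using Y_bnd[OF D] Ka K_fast unfolding Ky_def by linarith
        fix n
        have "cmod (a n (X * \<eta>) + fast j n X) \<le> Ka * gevrey_size A p n + K_fast * gevrey_size A p n"
          by (intro norm_triangle_le add_mono a_le fast_le X)
        also have "\<dots> \<le> Ky * gevrey_size A p n" unfolding Ky_def using C gs'[of n] by (simp add: distrib_right)
        finally show "cmod (a n (X * \<eta>) + fast j n X) \<le> Ky * gevrey_size A p n" .
      qed
    qed
  qed
qed

end

section \<open>Sectors, quasi-sectors and coverings\<close>

lemma arg_between_polar: "0 < s \<Longrightarrow> a < t \<Longrightarrow> t < b \<Longrightarrow> arg_between a b (of_real s * cis t)"
  unfolding arg_between_def by (auto simp: norm_mult)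

lemma arg_betweenE:
  assumes "arg_between a b x"
  obtains t where "a < t" "t < b" "x = of_real (cmod x) * cis t" "x \<noteq> 0"
  using assms unfolding arg_between_def by blast

lemma arg_between_mono: "arg_between a b x \<Longrightarrow> a' \<le> a \<Longrightarrow> b \<le> b' \<Longrightarrow> arg_between a' b' x"
  unfolding arg_between_def by force

lemma arg_between_divide:
  assumes "arg_between a b x" "arg_between c d y"
  shows "arg_between (a - d) (b - c) (x / y)"
proof -
  obtain t where t: "a < t" "t < b" "x = of_real (cmod x) * cis t" "x \<noteq> 0" using assms(1) by (rule arg_betweenE)
  obtain u where u: "c < u" "u < d" "y = of_real (cmod y) * cis u" "y \<noteq> 0" using assms(2) by (rule arg_betweenE)
  have "x / y = of_real (cmod x / cmod y) * cis (t - u)"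
    by (subst t(3), subst u(3)) (simp add: cis_divide[symmetric])
  moreover have "arg_between (a - d) (b - c) \<dots>" using t u by (intro arg_between_polar) auto
  ultimately show ?thesis by (simp only:)
qed

lemma cis_add_period: "cis (t + 2 * pi * of_int q) = cis t"
  by (simp add: cis_mult[symmetric] cis_multiple_2pi)

lemma open_arg_between: "open {x. arg_between a b x}"
proof -
  have "\<forall>\<^sub>F y in nhds x. arg_between a b y" if x: "arg_between a b x" for x
  proof -
    obtain t where t: "a < t" "t < b" "x = of_real (cmod x) * cis t" "x \<noteq> 0" using x by (rule arg_betweenE)
    have "isCont (\<lambda>y. t + Arg (y / x)) x"
      by (intro continuous_intros isCont_o2[OF _ continuous_at_Arg]) (use t in auto)
    then have "((\<lambda>y. t + Arg (y / x)) \<longlongrightarrow> t + Arg (x / x)) (nhds x)"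
      unfolding isCont_def by (rule tendsto_at_iff_tendsto_nhds[of "\<lambda>y. t + Arg (y / x)", THEN iffD1])
    then have lim: "((\<lambda>y. t + Arg (y / x)) \<longlongrightarrow> t) (nhds x)" using t by simp
    have "\<forall>\<^sub>F y in nhds x. y \<noteq> 0" using t by (auto intro!: t1_space_nhds)
    then show ?thesis using order_tendstoD(1)[OF lim t(1)] order_tendstoD(2)[OF lim t(2)]
    proof eventually_elim
      case (elim y)
      have "y / x = of_real (cmod (y / x)) * cis (Arg (y / x))"
        using Arg_eq[of "y / x"] elim t(4) by (simp add: cis_conv_exp mult.commute)
      then have "y = of_real (cmod (y / x)) * cis (Arg (y / x)) * (of_real (cmod x) * cis t)"
        using t(3,4) by (metis nonzero_eq_divide_eq)
      also have "\<dots> = of_real (cmod y) * cis (t + Arg (y / x))"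
        using t(4) by (simp add: cis_mult[symmetric] norm_divide)
      finally show ?case using elim unfolding arg_between_def by blast
    qed
  qed
  then show ?thesis by (subst open_subopen) (auto simp: eventually_nhds subset_eq)
qed

lemma open_sector: "open (sector a b (ereal r))"
proof -
  have "sector a b (ereal r) = ball 0 r \<inter> {x. arg_between a b x}"
    by (auto simp: sector_def arg_between_def)
  then show ?thesis by (simp add: open_Int open_arg_between)
qed

lemma mem_quasi_sector:
  "x \<in> quasi_sector a b (ereal r) \<mu> \<longleftrightarrow>
     (if \<mu> > 0 then cmod x < r \<and> arg_between a b x \<or> cmod x < \<mu> else - \<mu> < cmod x \<and> cmod x < r \<and> arg_between a b x)"
  by (simp add: quasi_sector_def)

lemma quasi_sector_infinite:
  assumes "b < a + 2 * pi"
  shows "quasi_sector a b \<infinity> \<mu> = (if \<mu> > 0 then {x. arg_between a b x} \<union> ball 0 \<mu> else {x. arg_between a b x} \<inter> - cball 0 (- \<mu>))"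
  using assms by (auto simp: quasi_sector_def)

lemma norm_cis_diff_le: "cmod (cis s - cis t) \<le> \<bar>s - t\<bar>"
proof -
  have "(cmod (cis s - cis t))\<^sup>2 = (cos s - cos t)\<^sup>2 + (sin s - sin t)\<^sup>2" by (simp add: cmod_power2)
  also have "\<dots> = 2 - 2 * cos (s - t)"
    using sin_cos_squared_add[of s] sin_cos_squared_add[of t] by (simp only: power2_diff cos_diff) algebra
  also have "\<dots> = (2 * sin ((s - t) / 2))\<^sup>2"
  proof -
    have "2 * ((s - t) / 2) = s - t" by simp
    with cos_double_sin[of "(s - t) / 2"] have "cos (s - t) = 1 - 2 * (sin ((s - t) / 2))\<^sup>2" by (simp only:)
    then show ?thesis by (simp add: power_mult_distrib)
  qed
  also have "\<dots> \<le> (s - t)\<^sup>2"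
    using abs_sin_x_le_abs_x[of "(s - t) / 2"] by (subst abs_le_square_iff[symmetric]) simp
  finally show ?thesis by (simp add: abs_le_square_iff[symmetric])
qed

text \<open>Sectors are invariant under dilations, so a Lebesgue number of the covering of one circle serves for all
  radii.\<close>

lemma sector_covering_lebesgue:
  fixes I :: "'l set"
  assumes r: "0 < r" and cov: "(\<Union>l\<in>I. sector (a l) (b l) (ereal r)) = ball 0 r - {0}" and \<kappa>: "0 < \<kappa>"
  obtains m :: nat and lam where "m > 0" "pi / m \<le> \<kappa>" "\<And>t. lam t \<in> I"
    "\<And>s t \<tau>. 0 < s \<Longrightarrow> s < r \<Longrightarrow> \<bar>\<tau> - t\<bar> \<le> pi / m \<Longrightarrow> of_real s * cis \<tau> \<in> sector (a (lam t)) (b (lam t)) (ereal r)"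
proof -
  let ?G = "(\<lambda>l. sector (a l) (b l) (ereal r)) ` I"
  have "sphere 0 (r / 2) \<subseteq> \<Union>?G" using r by (auto simp: cov)
  from Heine_Borel_lemma[OF compact_sphere this]
  obtain e where e: "e > 0" "\<And>x. x \<in> sphere 0 (r / 2) \<Longrightarrow> \<exists>T\<in>?G. ball x e \<subseteq> T" using open_sector by blast
  have "\<exists>l\<in>I. ball (of_real (r / 2) * cis t) e \<subseteq> sector (a l) (b l) (ereal r)" for t
    using e(2)[of "of_real (r / 2) * cis t"] r by (simp add: norm_mult)
  then obtain lam where lam: "\<And>t. lam t \<in> I" "\<And>t. ball (of_real (r / 2) * cis t) e \<subseteq> sector (a (lam t)) (b (lam t)) (ereal r)"
    by metis
  define d where "d = min \<kappa> (e / r)"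
  have d: "0 < d" using e r \<kappa> by (simp add: d_def)
  obtain m :: nat where m: "pi / d < real m" using reals_Archimedean2 by blast
  have m0: "0 < real m" by (rule less_trans[OF _ m]) (use d in simp)
  then have md: "pi / m \<le> d" using m d by (simp add: field_simps)
  show thesis
  proof (rule that[of m lam])
    show "m > 0" using m0 by simp
    show "pi / m \<le> \<kappa>" using md by (simp add: d_def)
    show "lam t \<in> I" for t by (rule lam)
    fix s t \<tau> assume s: "0 < s" "s < r" and \<tau>: "\<bar>\<tau> - t\<bar> \<le> pi / m"
    have "dist (of_real (r / 2) * cis t) (of_real (r / 2) * cis \<tau>) = cmod (of_real (r / 2) * (cis t - cis \<tau>))"
      unfolding dist_norm by (simp only: right_diff_distrib)
    also have "\<dots> = r / 2 * cmod (cis t - cis \<tau>)" using r by (simp add: norm_mult)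
    also have "\<dots> \<le> r / 2 * d" using norm_cis_diff_le[of t \<tau>] \<tau> md r by (intro mult_left_mono) auto
    also have "\<dots> \<le> r / 2 * (e / r)" using r by (intro mult_left_mono) (auto simp: d_def)
    also have "\<dots> < e" using r e by simp
    finally have "of_real (r / 2) * cis \<tau> \<in> sector (a (lam t)) (b (lam t)) (ereal r)" using lam(2)[of t] by auto
    then have "arg_between (a (lam t)) (b (lam t)) (of_real (r / 2) * cis \<tau>)" by (simp add: sector_def)
    then obtain u where u: "a (lam t) < u" "u < b (lam t)" "of_real (r / 2) * cis \<tau> = of_real (cmod (of_real (r / 2) * cis \<tau>)) * cis u"
      by (rule arg_betweenE)
    then have "cis \<tau> = cis u" using r by (simp add: norm_mult)
    then show "of_real s * cis \<tau> \<in> sector (a (lam t)) (b (lam t)) (ereal r)"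
      using s u by (auto simp: sector_def norm_mult intro: arg_between_polar)
  qed
qed

text \<open>The cyclic index set \<open>{1..J}\<close> is unrolled to the integers, \<open>j\<close> corresponding to \<open>j - 1\<close>. The angles
  \<open>unrolled J f\<close> continue those of \<open>angle_ext\<close> to negative indices.\<close>

definition wrap :: "nat \<Rightarrow> int \<Rightarrow> nat" where
  "wrap J k = nat (k mod int J) + 1"

definition unrolled :: "nat \<Rightarrow> (nat \<Rightarrow> real) \<Rightarrow> int \<Rightarrow> real" where
  "unrolled J f k = f (wrap J k) + 2 * pi * of_int (k div int J)"

lemma wrap_mem: "J > 0 \<Longrightarrow> wrap J k \<in> {1..J}"
  by (simp add: wrap_def Suc_le_eq nat_less_iff)

lemma wrap_period: "wrap J (k + int J) = wrap J k"
  by (simp add: wrap_def)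

lemma wrap_Suc: "J > 0 \<Longrightarrow> wrap J (k + 1) = cyc_suc J (wrap J k)"
proof -
  assume J: "J > 0"
  have "int ((nat (k mod int J) + 1) mod J) = (k + 1) mod int J"
    using J by (simp add: zmod_int mod_simps add.commute)
  then show ?thesis by (simp add: wrap_def cyc_suc_def)
qed

lemma unrolled_period: "J > 0 \<Longrightarrow> unrolled J f (k + int J) = unrolled J f k + 2 * pi"
  by (simp add: unrolled_def wrap_period algebra_simps)

lemma unrolled_eq_angle_ext:
  assumes "J > 0" "j > 0"
  shows "unrolled J f (int (j - 1) + int J * q) = angle_ext J f j + 2 * pi * of_int q"
proof -
  have "(int (j - 1) + int J * q) mod int J = int ((j - 1) mod J)" "(int (j - 1) + int J * q) div int J = int ((j - 1) div J) + q"
    using assms by (simp_all add: zdiv_int zmod_int)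
  then show ?thesis by (simp add: unrolled_def angle_ext_def wrap_def algebra_simps)
qed

lemma unrolled_index: "J > 0 \<Longrightarrow> k = int (wrap J k - 1) + int J * (k div int J)"
  by (simp add: wrap_def)

lemma wrap_of_index: "j \<in> {1..J} \<Longrightarrow> wrap J (int (j - 1)) = j"
  by (auto simp: wrap_def nat_mod_as_int)

lemma unrolled_of_index: "j \<in> {1..J} \<Longrightarrow> unrolled J f (int (j - 1)) = f j"
  unfolding unrolled_def wrap_of_index by auto

text \<open>For \<open>J = 1\<close> the overlap condition would force an opening larger than \<open>2 * pi\<close>, so there are at least two
quasi-sectors. As the angles increase with the index, this makes every opening smaller than \<open>2 * pi\<close>, and the full
annulus of the convention never occurs.\<close>

lemma covering_angles:
  assumes J: "J > 0" and cov: "good_consistent_covering J L \<mu> \<eta>0 \<alpha>V \<beta>V \<alpha>S \<beta>S \<delta>"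
  obtains \<kappa> where "0 < \<kappa>" "\<kappa> \<le> 1" "2 * \<kappa> \<le> \<delta>"
    "\<And>k. unrolled J \<alpha>V (k + 1) + 2 * \<kappa> < unrolled J \<beta>V k" "\<And>k. unrolled J \<beta>V k + 2 * \<kappa> < unrolled J \<alpha>V (k + 2)"
    "2 \<le> J" "\<And>j. j \<in> {1..J} \<Longrightarrow> \<alpha>V j + 2 * \<delta> < \<beta>V j" "\<And>j. j \<in> {1..J} \<Longrightarrow> \<beta>V j < \<alpha>V j + 2 * pi"
proof -
  have "\<delta> > 0 \<and> (\<forall>j\<in>{1..J}. \<alpha>V j < \<beta>V j \<and> \<beta>V j \<le> \<alpha>V j + 2 * pi)
      \<and> (\<forall>j\<in>{1..J}. angle_ext J \<alpha>V (j + 1) < \<beta>V j \<and> \<beta>V j < angle_ext J \<alpha>V (j + 2))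
      \<and> (\<forall>j\<in>{1..<J}. \<delta> < (\<beta>V j - \<alpha>V (j + 1)) / 2) \<and> \<delta> < (\<beta>V J - \<alpha>V 1 - 2 * pi) / 2"
    using cov unfolding good_consistent_covering_def by (elim conjE) (intro conjI; assumption)
  then have \<delta>: "\<delta> > 0" and len: "\<And>j. j \<in> {1..J} \<Longrightarrow> \<beta>V j \<le> \<alpha>V j + 2 * pi"
    and i: "\<And>j. j \<in> {1..J} \<Longrightarrow> angle_ext J \<alpha>V (j + 1) < \<beta>V j" "\<And>j. j \<in> {1..J} \<Longrightarrow> \<beta>V j < angle_ext J \<alpha>V (j + 2)"
    and iii: "\<And>j. j \<in> {1..<J} \<Longrightarrow> \<delta> < (\<beta>V j - \<alpha>V (j + 1)) / 2" "\<delta> < (\<beta>V J - \<alpha>V 1 - 2 * pi) / 2"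
    by blast+
  have overlap: "angle_ext J \<alpha>V (j + 1) + 2 * \<delta> < \<beta>V j" if j: "j \<in> {1..J}" for j
  proof (cases "j = J")
    case True then show ?thesis using iii(2) J by (simp add: angle_ext_def)
  next
    case False then show ?thesis using iii(1)[of j] j by (simp add: angle_ext_def)
  qed
  have J2: "2 \<le> J"
  proof (rule ccontr)
    assume "\<not> 2 \<le> J"
    then have "J = 1" using J by simp
    then show False using i(1)[of 1] len[of 1] by (simp add: angle_ext_def)
  qed
  define G where "G = Min ((\<lambda>j. angle_ext J \<alpha>V (j + 2) - \<beta>V j) ` {1..J})"
  have G: "0 < G" "\<And>j. j \<in> {1..J} \<Longrightarrow> \<beta>V j + G \<le> angle_ext J \<alpha>V (j + 2)"
  proof -
    show "0 < G" unfolding G_def using J i(2) by (subst Min_gr_iff) auto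
    fix j assume "j \<in> {1..J}"
    then have "G \<le> angle_ext J \<alpha>V (j + 2) - \<beta>V j" unfolding G_def by (intro Min_le) auto
    then show "\<beta>V j + G \<le> angle_ext J \<alpha>V (j + 2)" by simp
  qed
  define \<kappa> where "\<kappa> = min 1 (min (\<delta> / 2) (G / 4))"
  have \<kappa>: "0 < \<kappa>" "\<kappa> \<le> 1" "2 * \<kappa> \<le> \<delta>" "2 * \<kappa> < G" unfolding \<kappa>_def using \<delta> G by auto
  have next1: "unrolled J \<alpha>V (k + 1) + 2 * \<delta> < unrolled J \<beta>V k"
    and next2: "unrolled J \<beta>V k + G \<le> unrolled J \<alpha>V (k + 2)" for k
  proof -
    let ?j = "wrap J k" and ?q = "k div int J"
    have j: "?j \<in> {1..J}" by (rule wrap_mem[OF J])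
    have k: "k = int (?j - 1) + int J * ?q" by (rule unrolled_index[OF J])
    have k1: "k + 1 = int ((?j + 1) - 1) + int J * ?q" and k2: "k + 2 = int ((?j + 2) - 1) + int J * ?q"
      by (subst k; use j in simp)+
    have b: "unrolled J \<beta>V k = \<beta>V ?j + 2 * pi * of_int ?q" by (simp add: unrolled_def)
    have a: "unrolled J \<alpha>V (k + 1) = angle_ext J \<alpha>V (?j + 1) + 2 * pi * of_int ?q"
      by (subst k1, subst unrolled_eq_angle_ext[OF J]) simp_all
    have a2: "unrolled J \<alpha>V (k + 2) = angle_ext J \<alpha>V (?j + 2) + 2 * pi * of_int ?q"
      by (subst k2, subst unrolled_eq_angle_ext[OF J]) simp_all
    show "unrolled J \<alpha>V (k + 1) + 2 * \<delta> < unrolled J \<beta>V k" unfolding a b using overlap[OF j] by simp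
    show "unrolled J \<beta>V k + G \<le> unrolled J \<alpha>V (k + 2)" unfolding a2 b using G(2)[OF j] by simp
  qed
  have step: "unrolled J \<alpha>V k < unrolled J \<alpha>V (k + 1)" for k
    using next1[of "k - 1"] next2[of "k - 1"] G(1) \<delta> by (simp add: algebra_simps)
  have mono: "unrolled J \<alpha>V k \<le> unrolled J \<alpha>V (k + int d)" for k d
  proof (induction d)
    case (Suc d)
    then show ?case using step[of "k + int d"] by (simp add: algebra_simps)
  qed simp
  show thesis
  proof (rule that[OF \<kappa>(1-3) _ _ J2])
    show "unrolled J \<alpha>V (k + 1) + 2 * \<kappa> < unrolled J \<beta>V k" for k using next1[of k] \<kappa> \<delta> by simp
    show "unrolled J \<beta>V k + 2 * \<kappa> < unrolled J \<alpha>V (k + 2)" for k using next2[of k] \<kappa> by simp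
    fix j assume j: "j \<in> {1..J}"
    let ?k = "int (j - 1)"
    show "\<alpha>V j + 2 * \<delta> < \<beta>V j"
      using step[of ?k] next1[of ?k] unfolding unrolled_of_index[OF j] by simp
    have "unrolled J \<alpha>V (?k + 2) \<le> unrolled J \<alpha>V (?k + 2 + int (J - 2))" by (rule mono)
    also have "\<dots> = \<alpha>V j + 2 * pi" using J2 unrolled_period[OF J, of \<alpha>V ?k] unrolled_of_index[OF j, of \<alpha>V] by (simp add: algebra_simps)
    finally show "\<beta>V j < \<alpha>V j + 2 * pi" using next2[of ?k] G(1) unfolding unrolled_of_index[OF j] by simp
  qed
qed

section \<open>The expansion of a consistent family\<close>

lemma holomorphic2_on_subset: "holomorphic2_on f U \<Longrightarrow> U' \<subseteq> U \<Longrightarrow> holomorphic2_on f U'"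
  unfolding holomorphic2_on_def by (meson has_derivative_subset subsetD)

lemma quasi_sector_mono:
  assumes "x \<in> quasi_sector a b (ereal r) \<mu>" "a' \<le> a" "b \<le> b'" "r \<le> r'" "\<mu> \<le> \<mu>'"
  shows "x \<in> quasi_sector a' b' (ereal r') \<mu>'"
  using assms by (auto simp: mem_quasi_sector intro: arg_between_mono split: if_splits)

lemma quasi_sector_divide:
  assumes x: "x \<in> quasi_sector a1 b1 (ereal r) (\<mu> * cmod \<eta>)" and \<eta>: "arg_between a2 b2 \<eta>"
    and ab: "a \<le> a1 - b2" "b1 - a2 \<le> b" "b < a + 2 * pi"
  shows "x / \<eta> \<in> quasi_sector a b \<infinity> \<mu>"
proof -
  have \<eta>0: "0 < cmod \<eta>" using \<eta> by (auto simp: arg_between_def)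
  have arg: "arg_between a b (x / \<eta>)" if "arg_between a1 b1 x"
    by (rule arg_between_mono[OF arg_between_divide[OF that \<eta>]]) (use ab in auto)
  show ?thesis
    using x arg \<eta>0 unfolding quasi_sector_infinite[OF ab(3)] mem_quasi_sector
    by (auto simp: zero_less_mult_iff norm_divide field_simps split: if_splits)
qed

lemma quasi_sector_infinite_polar:
  assumes "b < a + 2 * pi" "\<mu> \<noteq> 0"
  shows "{of_real s * cis \<tau> |s \<tau>. (if \<mu> > 0 then 0 < s else \<bar>\<mu>\<bar> < s) \<and> a < \<tau> \<and> \<tau> < b} \<union> (if \<mu> > 0 then ball 0 \<bar>\<mu>\<bar> else {})
    = quasi_sector a b \<infinity> \<mu>" (is "?P \<union> _ = _")
proof -
  have "?P = {x. arg_between a b x} \<inter> (if \<mu> > 0 then UNIV else - cball 0 (- \<mu>))"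
  proof (intro equalityI subsetI)
    fix x assume "x \<in> ?P"
    then show "x \<in> {x. arg_between a b x} \<inter> (if \<mu> > 0 then UNIV else - cball 0 (- \<mu>))"
      using assms(2) by (auto simp: norm_mult intro!: arg_between_polar split: if_splits)
  next
    fix x assume x: "x \<in> {x. arg_between a b x} \<inter> (if \<mu> > 0 then UNIV else - cball 0 (- \<mu>))"
    then obtain t where "a < t" "t < b" "x = of_real (cmod x) * cis t" "x \<noteq> 0" by (auto elim: arg_betweenE)
    then show "x \<in> ?P" using x assms(2) by (intro CollectI exI[of _ "cmod x"] exI[of _ t]) (auto split: if_splits)
  qed
  then show ?thesis unfolding quasi_sector_infinite[OF assms(1)] using assms(2) by auto
qed

lemma open_quasi_sector_infinite: "b < a + 2 * pi \<Longrightarrow> open (quasi_sector a b \<infinity> \<mu>)"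
  unfolding quasi_sector_infinite by (auto intro!: open_Un open_Int open_arg_between simp: open_Compl)

lemma poincare_expansion_of_bounds:
  assumes "\<And>M X. X \<in> V \<Longrightarrow> cmod X ^ M * cmod (g X - (\<Sum>m = 1..<M. c m / X ^ m)) \<le> K M"
  shows "poincare_expansion V g c"
  unfolding poincare_expansion_def
proof
  fix M
  have "\<forall>\<^sub>F X in at_infinity. X \<in> V \<longrightarrow> norm (g X - (\<Sum>m = 1..<M. c m / X ^ m)) \<le> K M * norm (1 / X ^ M)"
    unfolding eventually_at_infinity
  proof (intro exI[of _ 1] allI impI)
    fix X :: complex assume X: "1 \<le> norm X" "X \<in> V"
    then have "X \<noteq> 0" by auto
    then show "norm (g X - (\<Sum>m = 1..<M. c m / X ^ m)) \<le> K M * norm (1 / X ^ M)"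
      using assms[OF X(2), of M] by (simp add: norm_divide norm_power pos_le_divide_eq mult.commute)
  qed
  then show "(\<lambda>X. g X - (\<Sum>m = 1..<M. c m / X ^ m)) \<in> O[inf at_infinity (principal V)](\<lambda>X. 1 / X ^ M)"
    by (intro bigoI[of _ "K M"]) (simp add: eventually_inf_principal)
qed

text \<open>The angles of the enlarged quasi-sectors are those of \<open>V j\<close>, rotated by the bisector of \<open>S l\<close> and enlarged by
\<open>\<delta>\<close>, while the half-opening of \<open>S l\<close> is at most \<open>\<delta> / 2\<close>. So \<open>U \<eta>\<close> belongs to them whenever \<open>U\<close> is in a quasi-sector enlarged by the angle
\<open>\<kappa> \<le> \<delta> / 2\<close> and \<open>\<eta> \<in> S l\<close>, and the hypotheses of \<open>sectorial_data\<close> hold with radii between \<open>r0\<close> and \<open>r0'\<close> and with \<open>\<rho>\<close>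
between \<open>\<bar>\<mu>\<bar>\<close> and its counterpart for \<open>\<mu>'\<close>.\<close>

lemma consistent_family_expansion:
  fixes p J L :: nat
    and \<mu> \<mu>' r0 r0' \<eta>0 \<delta> A B C :: real
    and \<alpha>V \<beta>V \<alpha>S \<beta>S :: "nat \<Rightarrow> real"
    and y :: "nat \<Rightarrow> nat \<Rightarrow> complex \<Rightarrow> complex \<Rightarrow> complex"
  defines "S \<equiv> \<lambda>l. sector (\<alpha>S l) (\<beta>S l) (ereal \<eta>0)"
    and "V \<equiv> \<lambda>j. quasi_sector (\<alpha>V j) (\<beta>V j) \<infinity> \<mu>"
    and "lo \<equiv> lower_angle \<alpha>V \<alpha>S \<beta>S \<delta>"
    and "up \<equiv> upper_angle \<beta>V \<alpha>S \<beta>S \<delta>"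
  defines "Dt \<equiv> \<lambda>j l. pair_domain (lo j l - 2 * \<delta>) (up j l + 2 * \<delta>) r0' \<mu>' (\<alpha>S l) (\<beta>S l) \<eta>0"
    and "Dl \<equiv> \<lambda>j l. pair_domain (lo j l) (up j l) r0 \<mu> (\<alpha>S l) (\<beta>S l) \<eta>0"
    and "At \<equiv> min A (B * r0 ^ p)"
  assumes p: "p > 0" and J: "J > 0" and \<mu>: "\<mu> \<noteq> 0" and r0: "r0 > 0" and \<eta>0: "\<eta>0 > 0"
    and cov: "good_consistent_covering J L \<mu> \<eta>0 \<alpha>V \<beta>V \<alpha>S \<beta>S \<delta>"
    and r0': "r0' > r0" and \<mu>': "\<mu>' > \<mu>" and A: "A > 0" and B: "B > 0" and C: "C > 0"
    and hol: "\<And>j l. j \<in> {1..J} \<Longrightarrow> l \<in> {1..L} \<Longrightarrow> holomorphic2_on (\<lambda>(x, \<eta>). y j l x \<eta>) (Dt j l)"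
    and bnd: "\<And>j l. j \<in> {1..J} \<Longrightarrow> l \<in> {1..L} \<Longrightarrow> bounded ((\<lambda>(x, \<eta>). y j l x \<eta>) ` Dt j l)"
    and stepS: "\<And>j l x \<eta>. j \<in> {1..J} \<Longrightarrow> l \<in> {1..L} \<Longrightarrow> (x, \<eta>) \<in> Dt j l \<Longrightarrow> (x, \<eta>) \<in> Dt j (cyc_suc L l) \<Longrightarrow>
        cmod (y j (cyc_suc L l) x \<eta> - y j l x \<eta>) \<le> C * exp (- (A / cmod \<eta> ^ p))"
    and stepV: "\<And>j l x \<eta>. j \<in> {1..J} \<Longrightarrow> l \<in> {1..L} \<Longrightarrow> (x, \<eta>) \<in> Dt j l \<Longrightarrow> (x, \<eta>) \<in> Dt (cyc_suc J j) l \<Longrightarrow>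
        cmod (y (cyc_suc J j) l x \<eta> - y j l x \<eta>) \<le> C * exp (- (B * cmod (x / \<eta>) ^ p))"
  obtains a :: "nat \<Rightarrow> complex \<Rightarrow> complex" and g :: "nat \<Rightarrow> nat \<Rightarrow> complex \<Rightarrow> complex" and c :: "nat \<Rightarrow> nat \<Rightarrow> complex" and K :: real
  where "0 < K" "\<And>n. a n holomorphic_on ball 0 r0" "\<And>n x. cmod x < r0 \<Longrightarrow> cmod (a n x) \<le> K * gevrey_size At p n"
    "\<And>j n. j \<in> {1..J} \<Longrightarrow> g j n holomorphic_on V j"
    "\<And>j n M X. j \<in> {1..J} \<Longrightarrow> X \<in> V j \<Longrightarrow> cmod X ^ M * cmod (g j n X - (\<Sum>m = 1..<M. c n m / X ^ m)) \<le> K * double_size At B p n M"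
    "\<And>j l x \<eta> N. j \<in> {1..J} \<Longrightarrow> l \<in> {1..L} \<Longrightarrow> (x, \<eta>) \<in> Dl j l \<Longrightarrow>
      cmod (y j l x \<eta> - (\<Sum>n<N. (a n x + g j n (x / \<eta>)) * \<eta> ^ n)) \<le> K * gevrey_size At p N * cmod \<eta> ^ N"
    "\<And>j l. j \<in> {1..J} \<Longrightarrow> l \<in> {1..L} \<Longrightarrow> Dl j l \<subseteq> Dt j l"
    "\<And>j l. j \<in> {1..J} \<Longrightarrow> l \<in> {1..L} \<Longrightarrow> lo j l < up j l \<and> \<alpha>V j \<le> lo j l - \<beta>S l \<and> lo j l - \<beta>S l < up j l - \<alpha>S l \<and> up j l - \<alpha>S l \<le> \<beta>V j"
proof -
  obtain \<kappa> where \<kappa>: "0 < \<kappa>" "\<kappa> \<le> 1" "2 * \<kappa> \<le> \<delta>"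
      and angles: "\<And>k. unrolled J \<alpha>V (k + 1) + 2 * \<kappa> < unrolled J \<beta>V k" "\<And>k. unrolled J \<beta>V k + 2 * \<kappa> < unrolled J \<alpha>V (k + 2)"
      and J2: "2 \<le> J" and width: "\<And>j. j \<in> {1..J} \<Longrightarrow> \<alpha>V j + 2 * \<delta> < \<beta>V j" "\<And>j. j \<in> {1..J} \<Longrightarrow> \<beta>V j < \<alpha>V j + 2 * pi"
    by (rule covering_angles[OF J cov]) blast
  have "(\<forall>l\<in>{1..L}. \<alpha>S l < \<beta>S l \<and> \<beta>S l \<le> \<alpha>S l + 2 * pi) \<and> (\<Union>l\<in>{1..L}. S l) = ball 0 \<eta>0 - {0} \<and>
     (\<forall>l\<in>{1..L}. \<forall>m\<in>{1..L}. \<not> cyc_adjacent L l m \<longrightarrow> S l \<inter> S m = {}) \<and> (\<forall>l\<in>{1..L}. \<beta>S l - \<alpha>S l \<le> \<delta>)"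
    using cov unfolding good_consistent_covering_def S_def by (elim conjE) (intro conjI; assumption)
  then have \<alpha>\<beta>S: "\<And>l. l \<in> {1..L} \<Longrightarrow> \<alpha>S l < \<beta>S l" and covS: "(\<Union>l\<in>{1..L}. S l) = ball 0 \<eta>0 - {0}"
    and adj: "\<And>l l'. l \<in> {1..L} \<Longrightarrow> l' \<in> {1..L} \<Longrightarrow> S l \<inter> S l' \<noteq> {} \<Longrightarrow> cyc_adjacent L l l'"
    and lenS: "\<And>l. l \<in> {1..L} \<Longrightarrow> \<beta>S l - \<alpha>S l \<le> \<delta>" by blast+
  have mem_Dt: "(x, \<eta>) \<in> Dt j l \<longleftrightarrow> \<eta> \<in> S l \<and> x \<in> quasi_sector (lo j l - 2 * \<delta>) (up j l + 2 * \<delta>) (ereal r0') (\<mu>' * cmod \<eta>)" for x \<eta> j l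
    by (simp add: Dt_def pair_domain_def S_def)
  have mem_Dl: "(x, \<eta>) \<in> Dl j l \<longleftrightarrow> \<eta> \<in> S l \<and> x \<in> quasi_sector (lo j l) (up j l) (ereal r0) (\<mu> * cmod \<eta>)" for x \<eta> j l
    by (simp add: Dl_def pair_domain_def S_def)
  have S_nz: "cmod \<eta> > 0" if "\<eta> \<in> S l" for \<eta> l using that by (simp add: S_def sector_def)
  have \<delta>: "\<delta> > 0" using \<kappa> by simp
  have sub: "Dl j l \<subseteq> Dt j l" for j l
  proof
    fix z assume z: "z \<in> Dl j l"
    obtain x \<eta> where [simp]: "z = (x, \<eta>)" by (cases z)
    have "\<mu> * cmod \<eta> \<le> \<mu>' * cmod \<eta>" using \<mu>' by (intro mult_right_mono) auto
    then show "z \<in> Dt j l" using z \<delta> r0' by (auto simp: mem_Dt mem_Dl intro: quasi_sector_mono)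
  qed
  have "bounded (\<Union>(j, l)\<in>{1..J} \<times> {1..L}. (\<lambda>(x, \<eta>). y j l x \<eta>) ` Dt j l)"
    by (rule bounded_UN) (use bnd in auto)
  then obtain K0 where K0: "\<And>j l x \<eta>. j \<in> {1..J} \<Longrightarrow> l \<in> {1..L} \<Longrightarrow> (x, \<eta>) \<in> Dt j l \<Longrightarrow> cmod (y j l x \<eta>) \<le> K0"
    unfolding bounded_iff by fastforce
  obtain m :: nat and lam where m: "m > 0" "pi / m \<le> \<kappa>" and lam: "\<And>t. lam t \<in> {1..L}"
      "\<And>s t \<tau>. 0 < s \<Longrightarrow> s < \<eta>0 \<Longrightarrow> \<bar>\<tau> - t\<bar> \<le> pi / m \<Longrightarrow> of_real s * cis \<tau> \<in> S (lam t)"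
    unfolding S_def by (rule sector_covering_lebesgue[OF \<eta>0 covS[unfolded S_def] \<kappa>(1)]) blast
  define D where "D k l = (if l \<in> {1..L} then Dt (wrap J k) l else {})" for k l
  define T where "T l = (if l \<in> {1..L} then S l else {})" for l
  define \<rho> where "\<rho> = (if \<mu> > 0 then (\<mu> + \<mu>') / 2 else (max 0 (- \<mu>') - \<mu>) / 2)"
  define r1 where "r1 = r0 + (r0' - r0) / 3"
  define r2 where "r2 = r0 + 2 * (r0' - r0) / 3"
  define \<eta>1 where "\<eta>1 = min (\<eta>0 / 2) (r1 / (2 * \<rho>))"
  define C' where "C' = max C K0"
  have \<rho>: "0 < \<rho>" "- \<mu>' < \<rho>" "\<mu> > 0 \<Longrightarrow> \<bar>\<mu>\<bar> < \<rho>" "\<mu> > 0 \<Longrightarrow> \<rho> < \<mu>'" "\<not> \<mu> > 0 \<Longrightarrow> \<rho> < \<bar>\<mu>\<bar>"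
    unfolding \<rho>_def using \<mu> \<mu>' by (auto simp: max_def)
  have r: "r0 < r1" "r1 < r2" "r2 < r0'" unfolding r1_def r2_def using r0' by (simp_all add: field_simps)
  have \<eta>1: "0 < \<eta>1" "\<eta>1 < \<eta>0" "\<eta>1 * \<rho> < r1"
  proof -
    show "0 < \<eta>1" "\<eta>1 < \<eta>0" unfolding \<eta>1_def using \<eta>0 r r0 \<rho>(1) by auto
    have "\<eta>1 * \<rho> \<le> r1 / (2 * \<rho>) * \<rho>" unfolding \<eta>1_def using \<rho>(1) by (intro mult_right_mono) auto
    also have "\<dots> < r1" using \<rho>(1) r r0 by simp
    finally show "\<eta>1 * \<rho> < r1" .
  qed
  have At: "0 < At" "At \<le> B * r0 ^ p" "At \<le> A" unfolding At_def using A B r0 by auto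
  have C': "0 \<le> C'" "C \<le> C'" "K0 \<le> C'" unfolding C'_def using C by auto
  have wj: "wrap J k \<in> {1..J}" for k by (rule wrap_mem[OF J])
  have sd: "sectorial_data p J m At B C' r0 r1 r2 r0' \<rho> \<bar>\<mu>\<bar> \<kappa> \<eta>1 (\<mu> > 0) (unrolled J \<alpha>V) (unrolled J \<beta>V) (\<lambda>k. y (wrap J k)) D T lam"
  proof (rule sectorial_data.intro)
    show "of_real s * cis \<tau> \<in> T (lam t)" if "0 < s" "s \<le> \<eta>1" "\<bar>\<tau> - t\<bar> \<le> pi / m" for s \<tau> t
      using lam that \<eta>1 by (simp add: T_def)
    show "0 \<notin> T l" for l using S_nz[of 0 l] by (auto simp: T_def)
    show "holomorphic2_on (\<lambda>(x, \<eta>). y (wrap J k) l x \<eta>) (D k l)" for k l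
      using hol[OF wj] by (simp add: D_def holomorphic2_on_def)
    show "cmod (y (wrap J k) l x \<eta>) \<le> C'" if "(x, \<eta>) \<in> D k l" for x \<eta> k l
      using K0[OF wj, of l x \<eta> k] that C' by (auto simp: D_def split: if_splits)
    show "cmod (y (wrap J k) l x \<eta> - y (wrap J k) l' x \<eta>) \<le> C' * exp (- (At / cmod \<eta> ^ p))"
      if mem: "(x, \<eta>) \<in> D k l" "(x, \<eta>) \<in> D k l'" for x \<eta> k l l'
    proof -
      have l: "l \<in> {1..L}" "l' \<in> {1..L}" "(x, \<eta>) \<in> Dt (wrap J k) l" "(x, \<eta>) \<in> Dt (wrap J k) l'"
        using mem by (auto simp: D_def split: if_splits)
      have "cyc_adjacent L l l'" by (rule adj[OF l(1,2)]) (use l in \<open>auto simp: mem_Dt\<close>)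
      then have "cmod (y (wrap J k) l x \<eta> - y (wrap J k) l' x \<eta>) \<le> C * exp (- (A / cmod \<eta> ^ p))"
        unfolding cyc_adjacent_def
      proof (elim disjE)
        assume "l = l'" then show ?thesis using C by simp
      next
        assume "l = cyc_suc L l'" then show ?thesis using stepS[OF wj l(2,4)] l(3) by simp
      next
        assume "l' = cyc_suc L l" then show ?thesis using stepS[OF wj l(1,3)] l(4) by (simp add: norm_minus_commute)
      qed
      also have "\<dots> \<le> C' * exp (- (At / cmod \<eta> ^ p))"
        using C C' At by (intro mult_mono) (auto intro: divide_right_mono)
      finally show ?thesis .
    qed
    show "cmod (y (wrap J (k + 1)) l x \<eta> - y (wrap J k) l x \<eta>) \<le> C' * exp (- (B * cmod (x / \<eta>) ^ p))"
      if mem: "(x, \<eta>) \<in> D k l" "(x, \<eta>) \<in> D (k + 1) l" for x \<eta> k l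
    proof -
      have l: "l \<in> {1..L}" "(x, \<eta>) \<in> Dt (wrap J k) l" "(x, \<eta>) \<in> Dt (cyc_suc J (wrap J k)) l"
        using mem wrap_Suc[OF J, of k] by (auto simp: D_def split: if_splits)
      have "cmod (y (wrap J (k + 1)) l x \<eta> - y (wrap J k) l x \<eta>) \<le> C * exp (- (B * cmod (x / \<eta>) ^ p))"
        unfolding wrap_Suc[OF J] by (rule stepV[OF wj l])
      also have "\<dots> \<le> C' * exp (- (B * cmod (x / \<eta>) ^ p))" using C' by (intro mult_right_mono) auto
      finally show ?thesis .
    qed
    show "(U * \<eta>, \<eta>) \<in> D k l"
      if U: "U \<in> {of_real s * cis \<tau> |s \<tau>. \<rho> \<le> s \<and> unrolled J \<alpha>V k - \<kappa> \<le> \<tau> \<and> \<tau> \<le> unrolled J \<beta>V k + \<kappa>} \<union> (if \<mu> > 0 then cball 0 \<rho> else {})"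
        and \<eta>: "\<eta> \<in> T l" and small: "cmod U * cmod \<eta> < r0'" for U k \<eta> l
    proof -
      have l: "l \<in> {1..L}" and \<eta>S: "\<eta> \<in> S l" using \<eta> by (auto simp: T_def split: if_splits)
      note e0 = S_nz[OF \<eta>S]
      let ?j = "wrap J k" and ?q = "k div int J"
      from U have "U * \<eta> \<in> quasi_sector (lo ?j l - 2 * \<delta>) (up ?j l + 2 * \<delta>) (ereal r0') (\<mu>' * cmod \<eta>)"
      proof
        assume "U \<in> {of_real s * cis \<tau> |s \<tau>. \<rho> \<le> s \<and> unrolled J \<alpha>V k - \<kappa> \<le> \<tau> \<and> \<tau> \<le> unrolled J \<beta>V k + \<kappa>}"
        then obtain s \<tau> where s: "U = of_real s * cis \<tau>" "\<rho> \<le> s" "unrolled J \<alpha>V k - \<kappa> \<le> \<tau>" "\<tau> \<le> unrolled J \<beta>V k + \<kappa>" by blast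
        have "arg_between (\<alpha>S l) (\<beta>S l) \<eta>" using \<eta>S by (simp add: S_def sector_def)
        then obtain t where t: "\<alpha>S l < t" "t < \<beta>S l" "\<eta> = of_real (cmod \<eta>) * cis t" "\<eta> \<noteq> 0" by (rule arg_betweenE)
        have s0: "0 < s" using s(2) \<rho>(1) by simp
        have "U * \<eta> = of_real (s * cmod \<eta>) * cis (\<tau> + t)"
          by (subst t(3)) (simp add: s(1) cis_mult[symmetric])
        also have "cis (\<tau> + t) = cis (\<tau> + t - 2 * pi * of_int ?q)"
          using cis_add_period[of "\<tau> + t - 2 * pi * of_int ?q" ?q] by simp
        finally have U\<eta>: "U * \<eta> = of_real (s * cmod \<eta>) * cis (\<tau> + t - 2 * pi * of_int ?q)" .
        have "arg_between (lo ?j l - 2 * \<delta>) (up ?j l + 2 * \<delta>) (U * \<eta>)"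
          unfolding U\<eta> lo_def up_def lower_angle_def upper_angle_def
          using s t \<kappa> lenS[OF l] e0 s0 unfolding unrolled_def by (intro arg_between_polar mult_pos_pos) argo+
        moreover have nU: "cmod U = s" using s0 by (simp add: s(1) norm_mult)
        moreover have "- \<mu>' * cmod \<eta> < s * cmod \<eta>" using e0 s(2) \<rho>(2) by (intro mult_strict_right_mono) auto
        ultimately show ?thesis using small by (simp add: mem_quasi_sector norm_mult)
      next
        assume "U \<in> (if \<mu> > 0 then cball 0 \<rho> else {})"
        then have "\<mu> > 0" "cmod U \<le> \<rho>" by (auto split: if_splits)
        then have "cmod U * cmod \<eta> < \<mu>' * cmod \<eta>" "0 < \<mu>' * cmod \<eta>" using \<rho>(1,4) e0 by auto
        then show ?thesis by (simp add: mem_quasi_sector norm_mult)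
      qed
      then show ?thesis using l \<eta>S by (simp add: D_def mem_Dt)
    qed
  qed (use p m J2 At B C' r0 r \<rho> \<mu> \<kappa> \<eta>1 angles in \<open>auto simp: unrolled_period[OF J] wrap_period\<close>)
  have Vsec: "sectorial_data.Vsec \<bar>\<mu>\<bar> (\<mu> > 0) (unrolled J \<alpha>V) (unrolled J \<beta>V) (int (j - 1)) = V j" if j: "j \<in> {1..J}" for j
    unfolding sectorial_data.Vsec_def[OF sd] unrolled_of_index[OF j] V_def
    by (rule quasi_sector_infinite_polar[OF width(2)[OF j] \<mu>])
  have opV: "open (V j)" if "j \<in> {1..J}" for j
    unfolding V_def by (rule open_quasi_sector_infinite[OF width(2)[OF that]])
  have incl: "lo j l < up j l \<and> \<alpha>V j \<le> lo j l - \<beta>S l \<and> lo j l - \<beta>S l < up j l - \<alpha>S l \<and> up j l - \<alpha>S l \<le> \<beta>V j"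
    if "j \<in> {1..J}" "l \<in> {1..L}" for j l
    using width(1)[OF that(1)] \<alpha>\<beta>S[OF that(2)] lenS[OF that(2)]
    unfolding lo_def up_def lower_angle_def upper_angle_def by (simp add: field_simps)
  show ?thesis
  proof (rule sectorial_data.sectorial_expansion[OF sd])
    fix a :: "nat \<Rightarrow> complex \<Rightarrow> complex" and g :: "int \<Rightarrow> nat \<Rightarrow> complex \<Rightarrow> complex" and c :: "nat \<Rightarrow> nat \<Rightarrow> complex" and K :: real
    let ?VV = "sectorial_data.Vsec \<bar>\<mu>\<bar> (\<mu> > 0) (unrolled J \<alpha>V) (unrolled J \<beta>V)"
    assume K: "0 \<le> K" and a: "\<And>n. a n holomorphic_on ball 0 r0" "\<And>n x. cmod x < r0 \<Longrightarrow> cmod (a n x) \<le> K * gevrey_size At p n"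
      and g: "\<And>j n. open (?VV j) \<Longrightarrow> g j n holomorphic_on ?VV j"
        "\<And>j n M X. X \<in> ?VV (int j) \<Longrightarrow> cmod X ^ M * cmod (g (int j) n X - (\<Sum>m = 1..<M. c n m / X ^ m)) \<le> K * double_size At B p n M"
      and rem: "\<And>j l X \<eta> N. X \<in> ?VV j \<Longrightarrow> \<eta> \<in> T l \<Longrightarrow> (X * \<eta>, \<eta>) \<in> D j l \<Longrightarrow> cmod X * cmod \<eta> < r0 \<or> cmod X < \<bar>\<mu>\<bar> \<Longrightarrow>
        cmod (y (wrap J j) l (X * \<eta>) \<eta> - (\<Sum>n<N. (a n (X * \<eta>) + g j n X) * \<eta> ^ n)) \<le> K * gevrey_size At p N * cmod \<eta> ^ N"
    have gs: "K * gevrey_size At p n \<le> (K + 1) * gevrey_size At p n" for n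
      using gevrey_size_pos[OF At(1), of p n] by (intro mult_right_mono) auto
    have ds: "K * double_size At B p n M \<le> (K + 1) * double_size At B p n M" for n M
      using double_size_pos[OF At(1) B, of p n M] by (intro mult_right_mono) auto
    show ?thesis
    proof (rule that[of "K + 1" a "\<lambda>j. g (int (j - 1))" c])
      show "0 < K + 1" using K by simp
      show "a n holomorphic_on ball 0 r0" for n by (rule a)
      show "cmod (a n x) \<le> (K + 1) * gevrey_size At p n" if "cmod x < r0" for n x
        by (rule order_trans[OF a(2)[OF that] gs])
      show "g (int (j - 1)) n holomorphic_on V j" if "j \<in> {1..J}" for j n
        using g(1)[of "int (j - 1)" n] opV[OF that] unfolding Vsec[OF that] .
      show "cmod X ^ M * cmod (g (int (j - 1)) n X - (\<Sum>m = 1..<M. c n m / X ^ m)) \<le> (K + 1) * double_size At B p n M"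
        if "j \<in> {1..J}" "X \<in> V j" for j n M X
        by (rule order_trans[OF g(2) ds]) (use that Vsec in simp)
      show "Dl j l \<subseteq> Dt j l" for j l by (rule sub)
      show "lo j l < up j l \<and> \<alpha>V j \<le> lo j l - \<beta>S l \<and> lo j l - \<beta>S l < up j l - \<alpha>S l \<and> up j l - \<alpha>S l \<le> \<beta>V j"
        if "j \<in> {1..J}" "l \<in> {1..L}" for j l using that by (rule incl)
      fix j l x \<eta> N assume j: "j \<in> {1..J}" and l: "l \<in> {1..L}" and x: "(x, \<eta>) \<in> Dl j l"
      have \<eta>S: "\<eta> \<in> S l" and xq: "x \<in> quasi_sector (lo j l) (up j l) (ereal r0) (\<mu> * cmod \<eta>)" using x by (auto simp: mem_Dl)
      note e0 = S_nz[OF \<eta>S]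
      have X: "x / \<eta> \<in> V j" unfolding V_def
        by (rule quasi_sector_divide[OF xq]) (use \<eta>S incl[OF j l] width(2)[OF j] in \<open>auto simp: S_def sector_def\<close>)
      have x\<eta>: "x / \<eta> * \<eta> = x" using e0 by auto
      have small: "cmod (x / \<eta>) * cmod \<eta> < r0 \<or> cmod (x / \<eta>) < \<bar>\<mu>\<bar>"
        using xq e0 unfolding mem_quasi_sector norm_divide
        by (auto simp: zero_less_mult_iff field_simps split: if_splits)
      have "cmod (y (wrap J (int (j - 1))) l (x / \<eta> * \<eta>) \<eta> - (\<Sum>n<N. (a n (x / \<eta> * \<eta>) + g (int (j - 1)) n (x / \<eta>)) * \<eta> ^ n)) \<le> K * gevrey_size At p N * cmod \<eta> ^ N"
      proof (rule rem)
        show "x / \<eta> \<in> ?VV (int (j - 1))" unfolding Vsec[OF j] by (rule X)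
        show "\<eta> \<in> T l" using \<eta>S l by (simp add: T_def)
        show "(x / \<eta> * \<eta>, \<eta>) \<in> D (int (j - 1)) l"
          unfolding x\<eta> D_def wrap_of_index[OF j] using subsetD[OF sub x] l by simp
      qed (rule small)
      also have "\<dots> \<le> (K + 1) * gevrey_size At p N * cmod \<eta> ^ N" by (intro mult_right_mono gs) auto
      finally show "cmod (y j l x \<eta> - (\<Sum>n<N. (a n x + g (int (j - 1)) n (x / \<eta>)) * \<eta> ^ n)) \<le> (K + 1) * gevrey_size At p N * cmod \<eta> ^ N"
        unfolding x\<eta> wrap_of_index[OF j] .
    qed
  qed
qed

theorem mainTheorem1:
  fixes p J L :: nat
    and \<mu> \<mu>' r0 r0' \<eta>0 \<delta> A B C :: real
    and \<alpha>V \<beta>V \<alpha>S \<beta>S :: "nat \<Rightarrow> real"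
    and y :: "nat \<Rightarrow> nat \<Rightarrow> complex \<Rightarrow> complex \<Rightarrow> complex"
  defines "S \<equiv> \<lambda>l. sector (\<alpha>S l) (\<beta>S l) (ereal \<eta>0)"
    and "V \<equiv> \<lambda>j. quasi_sector (\<alpha>V j) (\<beta>V j) \<infinity> \<mu>"
    and "lo \<equiv> lower_angle \<alpha>V \<alpha>S \<beta>S \<delta>"
    and "up \<equiv> upper_angle \<beta>V \<alpha>S \<beta>S \<delta>"
  defines "Vl \<equiv> \<lambda>j l \<eta>. quasi_sector (lo j l) (up j l) (ereal r0) (\<mu> * cmod \<eta>)"
    and "Vt \<equiv> \<lambda>j l \<eta>. quasi_sector (lo j l - 2 * \<delta>) (up j l + 2 * \<delta>) (ereal r0') (\<mu>' * cmod \<eta>)"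
    and "Dt \<equiv> \<lambda>j l. pair_domain (lo j l - 2 * \<delta>) (up j l + 2 * \<delta>) r0' \<mu>' (\<alpha>S l) (\<beta>S l) \<eta>0"
    and "At \<equiv> min A (B * r0 ^ p)"
  assumes "p > 0" "J > 0" "L > 0" "\<mu> \<noteq> 0" "r0 > 0" "\<eta>0 > 0"
    and "good_consistent_covering J L \<mu> \<eta>0 \<alpha>V \<beta>V \<alpha>S \<beta>S \<delta>"
    and "r0' > r0" "\<mu>' > \<mu>"
    and "A > 0" "B > 0" "C > 0"
    and "\<forall>j\<in>{1..J}. \<forall>l\<in>{1..L}.
           holomorphic2_on (\<lambda>(x, \<eta>). y j l x \<eta>) (Dt j l) \<and>
           bounded ((\<lambda>(x, \<eta>). y j l x \<eta>) ` Dt j l)"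
    and "\<forall>j\<in>{1..J}. \<forall>l\<in>{1..L}. \<forall>\<eta>\<in>S l \<inter> S (cyc_suc L l).
           \<forall>x\<in>Vt j l \<eta> \<inter> Vt j (cyc_suc L l) \<eta>.
             cmod (y j (cyc_suc L l) x \<eta> - y j l x \<eta>) \<le> C * exp (- (A / cmod \<eta> ^ p))"
    and "\<forall>j\<in>{1..J}. \<forall>l\<in>{1..L}. \<forall>\<eta>\<in>S l.
           \<forall>x\<in>Vt j l \<eta> \<inter> Vt (cyc_suc J j) l \<eta>.
             cmod (y (cyc_suc J j) l x \<eta> - y j l x \<eta>) \<le> C * exp (- (B * cmod (x / \<eta>) ^ p))"
  shows "\<exists>(a :: nat \<Rightarrow> complex \<Rightarrow> complex) (g :: nat \<Rightarrow> nat \<Rightarrow> complex \<Rightarrow> complex)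
            (c :: nat \<Rightarrow> nat \<Rightarrow> complex).
           (\<forall>n. a n \<in> H_space r0) \<and>
           (\<forall>j\<in>{1..J}. \<forall>n. g j n \<in> G_space (V j)) \<and>
           (\<forall>j\<in>{1..J}. \<forall>l\<in>{1..L}.
              gevrey_DAC p (\<alpha>V j) (\<beta>V j) \<mu> (lo j l) (up j l) r0 (\<alpha>S l) (\<beta>S l) \<eta>0
                (y j l) a (g j) c) \<and>
           (\<exists>K. \<forall>j\<in>{1..J}. \<forall>l\<in>{1..L}. \<forall>\<eta>\<in>S l. \<forall>x\<in>Vl j l \<eta>. \<forall>N>0.
              cmod (y j l x \<eta> - (\<Sum>n<N. (a n x + g j n (x / \<eta>)) * \<eta> ^ n))
                \<le> K * At powr (- (real N / real p)) * Gamma (real N / real p + 1) * cmod \<eta> ^ N) \<and>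
           (\<exists>K. \<forall>M n. \<forall>j\<in>{1..J}. \<forall>X\<in>V j.
              cmod X ^ M * cmod (g j n X - (\<Sum>m = 1..<M. c n m / X ^ m))
                \<le> K * At powr (- (real n / real p)) * B powr (- (real M / real p)) *
                  Gamma (real (M + n) / real p + 1))"
  proof -
  have params: "p > 0" "J > 0" "\<mu> \<noteq> 0" "r0 > 0" "\<eta>0 > 0" "good_consistent_covering J L \<mu> \<eta>0 \<alpha>V \<beta>V \<alpha>S \<beta>S \<delta>"
      "r0' > r0" "\<mu>' > \<mu>" "A > 0" "B > 0" "C > 0"
    and y: "\<And>j l. j \<in> {1..J} \<Longrightarrow> l \<in> {1..L} \<Longrightarrow> holomorphic2_on (\<lambda>(x, \<eta>). y j l x \<eta>) (Dt j l)"
      "\<And>j l. j \<in> {1..J} \<Longrightarrow> l \<in> {1..L} \<Longrightarrow> bounded ((\<lambda>(x, \<eta>). y j l x \<eta>) ` Dt j l)"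
    and steps: "\<And>j l x \<eta>. j \<in> {1..J} \<Longrightarrow> l \<in> {1..L} \<Longrightarrow> \<eta> \<in> S l \<inter> S (cyc_suc L l) \<Longrightarrow> x \<in> Vt j l \<eta> \<inter> Vt j (cyc_suc L l) \<eta> \<Longrightarrow>
        cmod (y j (cyc_suc L l) x \<eta> - y j l x \<eta>) \<le> C * exp (- (A / cmod \<eta> ^ p))"
      "\<And>j l x \<eta>. j \<in> {1..J} \<Longrightarrow> l \<in> {1..L} \<Longrightarrow> \<eta> \<in> S l \<Longrightarrow> x \<in> Vt j l \<eta> \<inter> Vt (cyc_suc J j) l \<eta> \<Longrightarrow>
        cmod (y (cyc_suc J j) l x \<eta> - y j l x \<eta>) \<le> C * exp (- (B * cmod (x / \<eta>) ^ p))"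
    using assms(9-) by blast+
  define Dl where "Dl j l = pair_domain (lo j l) (up j l) r0 \<mu> (\<alpha>S l) (\<beta>S l) \<eta>0" for j l
  have mem_Dt: "(x, \<eta>) \<in> Dt j l \<longleftrightarrow> \<eta> \<in> S l \<and> x \<in> Vt j l \<eta>" for x \<eta> j l
    by (simp add: Dt_def Vt_def S_def pair_domain_def)
  have mem_Dl: "(x, \<eta>) \<in> Dl j l \<longleftrightarrow> \<eta> \<in> S l \<and> x \<in> Vl j l \<eta>" for x \<eta> j l
    by (simp add: Dl_def Vl_def S_def pair_domain_def)
  have step1: "cmod (y j (cyc_suc L l) x \<eta> - y j l x \<eta>) \<le> C * exp (- (A / cmod \<eta> ^ p))"
    if "j \<in> {1..J}" "l \<in> {1..L}" "(x, \<eta>) \<in> Dt j l" "(x, \<eta>) \<in> Dt j (cyc_suc L l)" for j l x \<eta>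
    using steps(1)[OF that(1,2)] that(3,4) by (simp add: mem_Dt)
  have step2: "cmod (y (cyc_suc J j) l x \<eta> - y j l x \<eta>) \<le> C * exp (- (B * cmod (x / \<eta>) ^ p))"
    if "j \<in> {1..J}" "l \<in> {1..L}" "(x, \<eta>) \<in> Dt j l" "(x, \<eta>) \<in> Dt (cyc_suc J j) l" for j l x \<eta>
    using steps(2)[OF that(1,2)] that(3,4) by (simp add: mem_Dt)
  obtain a g c K where K: "0 < K"
    and a: "\<And>n. a n holomorphic_on ball 0 r0" "\<And>n x. cmod x < r0 \<Longrightarrow> cmod (a n x) \<le> K * gevrey_size At p n"
    and g: "\<And>j n. j \<in> {1..J} \<Longrightarrow> g j n holomorphic_on V j"
      "\<And>j n M X. j \<in> {1..J} \<Longrightarrow> X \<in> V j \<Longrightarrow> cmod X ^ M * cmod (g j n X - (\<Sum>m = 1..<M. c n m / X ^ m)) \<le> K * double_size At B p n M"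
    and rem: "\<And>j l x \<eta> N. j \<in> {1..J} \<Longrightarrow> l \<in> {1..L} \<Longrightarrow> (x, \<eta>) \<in> Dl j l \<Longrightarrow>
      cmod (y j l x \<eta> - (\<Sum>n<N. (a n x + g j n (x / \<eta>)) * \<eta> ^ n)) \<le> K * gevrey_size At p N * cmod \<eta> ^ N"
    and sub: "\<And>j l. j \<in> {1..J} \<Longrightarrow> l \<in> {1..L} \<Longrightarrow> Dl j l \<subseteq> Dt j l"
    and incl: "\<And>j l. j \<in> {1..J} \<Longrightarrow> l \<in> {1..L} \<Longrightarrow> lo j l < up j l \<and> \<alpha>V j \<le> lo j l - \<beta>S l \<and> lo j l - \<beta>S l < up j l - \<alpha>S l \<and> up j l - \<alpha>S l \<le> \<beta>V j"
    by (rule consistent_family_expansion[OF params y[unfolded Dt_def lo_def up_def] step1[unfolded Dt_def lo_def up_def] step2[unfolded Dt_def lo_def up_def]])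
      (assumption | (rule that[unfolded V_def Dl_def At_def Dt_def lo_def up_def]; assumption))+
  have At: "At > 0" using params by (simp add: At_def)
  define L1 where "L1 = At powr (- (1 / real p))"
  define L2 where "L2 = B powr (- (1 / real p))"
  have L: "0 < L1" "0 < L2" using At params(10) by (auto simp: L1_def L2_def)
  have pow: "L1 ^ n = At powr (- (real n / real p))" "L2 ^ n = B powr (- (real n / real p))" for n
    using At params(10) by (simp_all add: L1_def L2_def powr_realpow[symmetric] powr_powr)
  have gs: "K * gevrey_size At p n = K * L1 ^ n * Gamma (real n / real p + 1)" for n
    by (simp add: gevrey_size_def pow)
  have ds: "K * double_size At B p n M = K * L1 ^ n * L2 ^ M * Gamma (real (M + n) / real p + 1)" for n M
    by (simp add: double_size_def pow)
  have aH: "a n \<in> H_space r0" for n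
    unfolding H_space_def bounded_iff using a by (auto intro!: exI[of _ "K * gevrey_size At p n"])
  have gP: "poincare_expansion (V j) (g j n) (c n)" if "j \<in> {1..J}" for j n
    by (rule poincare_expansion_of_bounds[OF g(2)[OF that]])
  have gG: "g j n \<in> G_space (V j)" if j: "j \<in> {1..J}" for j n
  proof -
    have "bounded (g j n ` V j)"
      unfolding bounded_iff using g(2)[OF j, of _ 0 n] by (auto intro!: exI[of _ "K * double_size At B p n 0"])
    then show ?thesis unfolding G_space_def using g(1)[OF j] gP[OF j] by blast
  qed
  have dac: "gevrey_DAC p (\<alpha>V j) (\<beta>V j) \<mu> (lo j l) (up j l) r0 (\<alpha>S l) (\<beta>S l) \<eta>0 (y j l) a (g j) c"
    if j: "j \<in> {1..J}" and l: "l \<in> {1..L}" for j l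
    unfolding gevrey_DAC_def
  proof (intro conjI)
    show "holomorphic2_on (\<lambda>(x, \<eta>). y j l x \<eta>) (pair_domain (lo j l) (up j l) r0 \<mu> (\<alpha>S l) (\<beta>S l) \<eta>0)"
      using holomorphic2_on_subset[OF y(1)[OF j l] sub[OF j l]] by (simp add: Dl_def)
    show "\<forall>n. g j n \<in> G_space (quasi_sector (\<alpha>V j) (\<beta>V j) \<infinity> \<mu>) \<and> poincare_expansion (quasi_sector (\<alpha>V j) (\<beta>V j) \<infinity> \<mu>) (g j n) (c n)"
      using gG[OF j] gP[OF j] by (simp add: V_def)
    show "\<exists>C>0. \<exists>L1>0. \<exists>L2>0.
        (\<forall>n. \<forall>x\<in>ball 0 r0. cmod (a n x) \<le> C * L1 ^ n * Gamma (real n / real p + 1)) \<and>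
        (\<forall>n M. \<forall>X\<in>quasi_sector (\<alpha>V j) (\<beta>V j) \<infinity> \<mu>.
           cmod X ^ M * cmod (g j n X - (\<Sum>m = 1..<M. c n m / X ^ m)) \<le> C * L1 ^ n * L2 ^ M * Gamma (real (M + n) / real p + 1)) \<and>
        (\<forall>N. \<forall>(x, \<eta>)\<in>pair_domain (lo j l) (up j l) r0 \<mu> (\<alpha>S l) (\<beta>S l) \<eta>0.
           cmod (y j l x \<eta> - (\<Sum>n<N. (a n x + g j n (x / \<eta>)) * \<eta> ^ n)) \<le> C * L1 ^ N * Gamma (real N / real p + 1) * cmod \<eta> ^ N)"
    proof (rule exI[of _ K], rule conjI[OF K], rule exI[of _ L1], rule conjI[OF L(1)], rule exI[of _ L2], rule conjI[OF L(2)], intro conjI allI ballI)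
      fix n x assume "x \<in> ball (0::complex) r0"
      then show "cmod (a n x) \<le> K * L1 ^ n * Gamma (real n / real p + 1)" using a(2)[of x n] by (simp add: gs)
    next
      fix n M X assume "X \<in> quasi_sector (\<alpha>V j) (\<beta>V j) \<infinity> \<mu>"
      then show "cmod X ^ M * cmod (g j n X - (\<Sum>m = 1..<M. c n m / X ^ m)) \<le> K * L1 ^ n * L2 ^ M * Gamma (real (M + n) / real p + 1)"
        using g(2)[OF j, of X M n] unfolding V_def ds by blast
    next
      fix N z assume "z \<in> pair_domain (lo j l) (up j l) r0 \<mu> (\<alpha>S l) (\<beta>S l) \<eta>0"
      then show "case z of (x, \<eta>) \<Rightarrow> cmod (y j l x \<eta> - (\<Sum>n<N. (a n x + g j n (x / \<eta>)) * \<eta> ^ n)) \<le> K * L1 ^ N * Gamma (real N / real p + 1) * cmod \<eta> ^ N"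
        using rem[OF j l, of "fst z" "snd z" N] by (simp add: gs Dl_def split_beta)
    qed
  qed (use incl[OF j l] aH in auto)
  show ?thesis
  proof (intro exI[of _ a] exI[of _ g] exI[of _ c] conjI)
    show "\<exists>K. \<forall>j\<in>{1..J}. \<forall>l\<in>{1..L}. \<forall>\<eta>\<in>S l. \<forall>x\<in>Vl j l \<eta>. \<forall>N>0.
        cmod (y j l x \<eta> - (\<Sum>n<N. (a n x + g j n (x / \<eta>)) * \<eta> ^ n))
          \<le> K * At powr (- (real N / real p)) * Gamma (real N / real p + 1) * cmod \<eta> ^ N"
      using rem unfolding mem_Dl gevrey_size_def mult.assoc by (intro exI[of _ K]) blast
    show "\<exists>K. \<forall>M n. \<forall>j\<in>{1..J}. \<forall>X\<in>V j.
        cmod X ^ M * cmod (g j n X - (\<Sum>m = 1..<M. c n m / X ^ m))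
          \<le> K * At powr (- (real n / real p)) * B powr (- (real M / real p)) * Gamma (real (M + n) / real p + 1)"
      using g(2) unfolding double_size_def mult.assoc by (intro exI[of _ K]) blast
  qed (use aH gG dac in auto)
qed

end
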